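(* Let $\mathfrak C=(n,\Lambda,L,P)$ be a stabilizer code with $R=\mathbb Z_n[\Lambda]$ and $D=\mathrm{rk}(\Lambda)$, and let $Q(\mathfrak C)$ be its module of local excitations modulo those created by local operators. All local excitations of $\mathfrak C$ are mobile, i.e. there exists a subgroup $\Gamma\subset\Lambda$ of finite index such that $(x^\gamma-1)Q(\mathfrak C)=0$ for every $\gamma\in\Gamma$, if and only if $\dim(Q(\mathfrak C))\le 0$ (i.e. $Q(\mathfrak C)$ is zero or has Krull dimension $0$). In particular, all local excitations of $\mathfrak C$ are mobile if $D=1$, or if $\mathfrak C$ is saturated and $D=2$.
   Context: Let $n$ be a positive integer, $\mathbb Z_n=\mathbb Z/n\mathbb Z$, $\Lambda$ a finitely generated abelian group, $R=\mathbb Z_n[\Lambda]$ its group ring, $x^\lambda\in R$ the element corresponding to $\lambda\in\Lambda$. For $r=\sum_\lambda r_\lambda x^\lambda$ the antipode is $\overline r=\sum_\lambda r_\lambda x^{-\lambda}$. For an $R$-module $M$, $\overline M$ is the same abelian group with $R$-action twisted by the antipode, and $M^*=\mathrm{Hom}_R(\overline M,R)$, identified with the module of $\mathbb Z_n$-linear maps $f:M\to R$ with $f(rm)=\overline r f(m)$. A stabilizer code $\mathfrak C=(n,\Lambda,L,P)$ consists of: $P=P_0[\Lambda]=P_0\otimes_{\mathbb Z_n}R$, where $P_0$ is a finitely generated $\mathbb Z_n$-module with a bilinear form $\omega_0:P_0\times P_0\to\mathbb Z_n$ that is alternating ($\omega_0(a,a)=0$ for all $a$) and nondegenerate ($\omega_0(\cdot,a)=0\Rightarrow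 a=0$), equipped with the $\mathbb Z_n$-bilinear form $\omega:P\times P\to R$, $\omega(a x^\lambda,b x^\mu)=\omega_0(a,b)x^{\mu-\lambda}$; and an $R$-submodule $L\subset P$ which is isotropic, i.e. $\omega|_{L\times L}=0$. For a submodule $N\subset P$, $N^\omega=\{p\in P:\omega(m,p)=0\ \forall m\in N\}$. The code is saturated if $L^{\omega\omega}=L$ (equivalently, $P/L$ is torsion-free, meaning no nonzero element is annihilated by a non-zero-divisor of $R$). $Q(\mathfrak C)=L^*/(P/L^\omega)$ is the cokernel of $P\to L^*$, $p\mapsto\omega(\cdot,p)|_L$. $D=\mathrm{rk}(\Lambda)$ is the free rank of $\Lambda$. The dimension $\dim(M)$ of an $R$-module $M$ is the Krull dimension of $R/\mathrm{Ann}(M)$, with $\dim(0)=-\infty$. *)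

theory Defs
  imports "HOL-Algebra.Algebra" "HOL-Library.Extended_Real"
begin

definition fin_gen_group :: "('g, 'm) monoid_scheme \<Rightarrow> bool" where
  "fin_gen_group G \<longleftrightarrow> (\<exists>S. finite S \<and> S \<subseteq> carrier G \<and> generate G S = carrier G)"

definition int_independent :: "('g, 'm) monoid_scheme \<Rightarrow> 'g set \<Rightarrow> bool" where
  "int_independent G B \<longleftrightarrow> finite B \<and> B \<subseteq> carrier G \<and>
     (\<forall>c :: 'g \<Rightarrow> int. (\<Otimes>\<^bsub>G\<^esub>b\<in>B. b [^]\<^bsub>G\<^esub> c b) = \<one>\<^bsub>G\<^esub> \<longrightarrow> (\<forall>b\<in>B. c b = 0))"

text \<open>
  For a finitely generated abelian group the largest size of a \<open>\<int>\<close>-independent subset is the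
  \<open>D\<close> in \<open>\<int>\<^sup>D \<oplus> (finite)\<close>.
\<close>

definition free_rank :: "('g, 'm) monoid_scheme \<Rightarrow> enat" where
  "free_rank G = (SUP B\<in>{B. int_independent G B}. enat (card B))"

definition finite_index :: "'g set \<Rightarrow> ('g, 'm) monoid_scheme \<Rightarrow> bool" where
  "finite_index H G \<longleftrightarrow> subgroup H G \<and> finite (rcosets\<^bsub>G\<^esub> H)"

text \<open>
  The record type of modules extends that of rings; the fields \<open>mult\<close> and \<open>one\<close> play no role
  in the locale \<^locale>\<open>module\<close> and are left undefined in the constructions below.
\<close>

definition fin_gen_module :: "('r, 'k) ring_scheme \<Rightarrow> ('r, 'm, 'n) module_scheme \<Rightarrow> bool" where
  "fin_gen_module R M \<longleftrightarrow>
     (\<exists>S. finite S \<and> S \<subseteq> carrier M \<and> (\<forall>N. submodule N R M \<and> S \<subseteq> N \<longrightarrow> N = carrier M))"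

definition regular_module :: "('r, 'k) ring_scheme \<Rightarrow> ('r, 'r) module" where
  "regular_module R =
     \<lparr>carrier = carrier R, monoid.mult = undefined, monoid.one = undefined,
      ring.zero = \<zero>\<^bsub>R\<^esub>, ring.add = (\<lambda>x y. x \<oplus>\<^bsub>R\<^esub> y), smult = (\<lambda>r x. r \<otimes>\<^bsub>R\<^esub> x)\<rparr>"

definition twist_module ::
  "('r \<Rightarrow> 'r) \<Rightarrow> ('r, 'm, 'n) module_scheme \<Rightarrow> ('r, 'm, 'n) module_scheme" where
  "twist_module \<sigma> M = M\<lparr>smult := (\<lambda>r x. \<sigma> r \<odot>\<^bsub>M\<^esub> x)\<rparr>"

definition hom_module ::
  "('r, 'k) ring_scheme \<Rightarrow> ('r, 'm, 'p) module_scheme \<Rightarrow> ('r, 'n, 'q) module_scheme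
     \<Rightarrow> ('r, 'm \<Rightarrow> 'n) module" where
  "hom_module R M N =
     \<lparr>carrier = {f \<in> carrier M \<rightarrow>\<^sub>E carrier N.
        (\<forall>x\<in>carrier M. \<forall>y\<in>carrier M. f (x \<oplus>\<^bsub>M\<^esub> y) = f x \<oplus>\<^bsub>N\<^esub> f y) \<and>
        (\<forall>r\<in>carrier R. \<forall>x\<in>carrier M. f (r \<odot>\<^bsub>M\<^esub> x) = r \<odot>\<^bsub>N\<^esub> f x)},
      monoid.mult = undefined, monoid.one = undefined,
      ring.zero = (\<lambda>x\<in>carrier M. \<zero>\<^bsub>N\<^esub>),
      ring.add = (\<lambda>f g. \<lambda>x\<in>carrier M. f x \<oplus>\<^bsub>N\<^esub> g x),
      smult = (\<lambda>r f. \<lambda>x\<in>carrier M. r \<odot>\<^bsub>N\<^esub> f x)\<rparr>"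

text \<open>The scalar action on cosets is written in the style of \<^const>\<open>rcoset_mult\<close>.\<close>

definition quot_module ::
  "('r, 'm, 'n) module_scheme \<Rightarrow> 'm set \<Rightarrow> ('r, 'm set) module" where
  "quot_module M N =
     \<lparr>carrier = a_rcosets\<^bsub>M\<^esub> N, monoid.mult = undefined, monoid.one = undefined,
      ring.zero = N, ring.add = set_add M, smult = (\<lambda>r A. \<Union>x\<in>A. N +>\<^bsub>M\<^esub> (r \<odot>\<^bsub>M\<^esub> x))\<rparr>"

definition annihilator :: "('r, 'k) ring_scheme \<Rightarrow> ('r, 'm, 'n) module_scheme \<Rightarrow> 'r set" where
  "annihilator R M = {r \<in> carrier R. \<forall>x\<in>carrier M. r \<odot>\<^bsub>M\<^esub> x = \<zero>\<^bsub>M\<^esub>}"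

text \<open>The supremum is taken in \<^typ>\<open>ereal\<close>, so that the zero ring has dimension \<open>-\<infinity>\<close>.\<close>

definition krull_dim :: "('r, 'k) ring_scheme \<Rightarrow> ereal" where
  "krull_dim R = Sup {ereal (real k) | k.
     \<exists>p :: nat \<Rightarrow> 'r set. (\<forall>i\<le>k. primeideal (p i) R) \<and> (\<forall>i<k. p i \<subset> p (Suc i))}"

definition module_dim :: "('r, 'k) ring_scheme \<Rightarrow> ('r, 'm, 'n) module_scheme \<Rightarrow> ereal" where
  "module_dim R M = krull_dim (R Quot annihilator R M)"

text \<open>
  An element \<open>\<Sum>\<^sub>\<lambda> f\<^sub>\<lambda> x\<^sup>\<lambda>\<close> is the finitely supported function \<open>\<lambda> \<mapsto> f\<^sub>\<lambda>\<close> on the carrier of the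
  group, extended by \<^const>\<open>undefined\<close> outside. Groups are written multiplicatively, so
  \<open>x\<^bsup>\<mu> - \<lambda>\<^esup>\<close> has exponent \<open>inv \<lambda> \<otimes> \<mu>\<close>.
\<close>

definition gsupp :: "('g, 'm) monoid_scheme \<Rightarrow> ('a, 'k) ring_scheme \<Rightarrow> ('g \<Rightarrow> 'a) \<Rightarrow> 'g set" where
  "gsupp G M f = {g \<in> carrier G. f g \<noteq> \<zero>\<^bsub>M\<^esub>}"

definition finsupp_funs ::
  "('g, 'm) monoid_scheme \<Rightarrow> ('a, 'k) ring_scheme \<Rightarrow> ('g \<Rightarrow> 'a) set" where
  "finsupp_funs G M = {f \<in> carrier G \<rightarrow>\<^sub>E carrier M. finite (gsupp G M f)}"

text \<open>\<open>a x\<^sup>g\<close>\<close>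

definition gmonom ::
  "('g, 'm) monoid_scheme \<Rightarrow> ('a, 'k) ring_scheme \<Rightarrow> 'a \<Rightarrow> 'g \<Rightarrow> 'g \<Rightarrow> 'a" where
  "gmonom G M a g = (\<lambda>h\<in>carrier G. if h = g then a else \<zero>\<^bsub>M\<^esub>)"

definition group_ring ::
  "('k, 'r) ring_scheme \<Rightarrow> ('g, 'm) monoid_scheme \<Rightarrow> ('g \<Rightarrow> 'k) ring" where
  "group_ring K G =
     \<lparr>carrier = finsupp_funs G K,
      monoid.mult = (\<lambda>r s. \<lambda>g\<in>carrier G.
        \<Oplus>\<^bsub>K\<^esub>h\<in>gsupp G K r. r h \<otimes>\<^bsub>K\<^esub> s (inv\<^bsub>G\<^esub> h \<otimes>\<^bsub>G\<^esub> g)),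
      monoid.one = gmonom G K \<one>\<^bsub>K\<^esub> \<one>\<^bsub>G\<^esub>,
      ring.zero = (\<lambda>g\<in>carrier G. \<zero>\<^bsub>K\<^esub>),
      ring.add = (\<lambda>r s. \<lambda>g\<in>carrier G. r g \<oplus>\<^bsub>K\<^esub> s g)\<rparr>"

definition antipode :: "('g, 'm) monoid_scheme \<Rightarrow> ('g \<Rightarrow> 'k) \<Rightarrow> 'g \<Rightarrow> 'k" where
  "antipode G r = (\<lambda>g\<in>carrier G. r (inv\<^bsub>G\<^esub> g))"

text \<open>The module \<open>M[G] = M \<otimes>\<^sub>K K[G]\<close> over the group ring \<open>K[G]\<close>.\<close>

definition group_module ::
  "('k, 'r) ring_scheme \<Rightarrow> ('g, 'm) monoid_scheme \<Rightarrow> ('k, 'a, 'n) module_scheme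
     \<Rightarrow> ('g \<Rightarrow> 'k, 'g \<Rightarrow> 'a) module" where
  "group_module K G M =
     \<lparr>carrier = finsupp_funs G M, monoid.mult = undefined, monoid.one = undefined,
      ring.zero = (\<lambda>g\<in>carrier G. \<zero>\<^bsub>M\<^esub>),
      ring.add = (\<lambda>p q. \<lambda>g\<in>carrier G. p g \<oplus>\<^bsub>M\<^esub> q g),
      smult = (\<lambda>r p. \<lambda>g\<in>carrier G.
        \<Oplus>\<^bsub>M\<^esub>h\<in>gsupp G K r. r h \<odot>\<^bsub>M\<^esub> p (inv\<^bsub>G\<^esub> h \<otimes>\<^bsub>G\<^esub> g))\<rparr>"

text \<open>
  The biadditive extension of \<open>\<omega>(a x\<^sup>\<lambda>, b x\<^sup>\<mu>) = \<omega>\<^sub>0(a, b) x\<^bsup>\<mu> - \<lambda>\<^esup>\<close>: the coefficient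
  at \<open>\<nu>\<close> collects the pairs of exponents \<open>\<kappa>\<close> and \<open>\<kappa> + \<nu>\<close>.
\<close>

definition form_ext ::
  "('k, 'r) ring_scheme \<Rightarrow> ('g, 'm) monoid_scheme \<Rightarrow> ('k, 'a, 'n) module_scheme
     \<Rightarrow> ('a \<Rightarrow> 'a \<Rightarrow> 'k) \<Rightarrow> ('g \<Rightarrow> 'a) \<Rightarrow> ('g \<Rightarrow> 'a) \<Rightarrow> 'g \<Rightarrow> 'k" where
  "form_ext K G M \<omega>\<^sub>0 p q = (\<lambda>\<nu>\<in>carrier G.
     \<Oplus>\<^bsub>K\<^esub>\<kappa>\<in>gsupp G M p. \<omega>\<^sub>0 (p \<kappa>) (q (\<kappa> \<otimes>\<^bsub>G\<^esub> \<nu>)))"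

abbreviation pauli_ring :: "nat \<Rightarrow> ('l, 'm) monoid_scheme \<Rightarrow> ('l \<Rightarrow> int set) ring" where
  "pauli_ring n \<Lambda> \<equiv> group_ring (ZFact (int n)) \<Lambda>"

abbreviation pauli_module ::
  "nat \<Rightarrow> ('l, 'm) monoid_scheme \<Rightarrow> (int set, 'p, 'q) module_scheme
     \<Rightarrow> ('l \<Rightarrow> int set, 'l \<Rightarrow> 'p) module" where
  "pauli_module n \<Lambda> P\<^sub>0 \<equiv> group_module (ZFact (int n)) \<Lambda> P\<^sub>0"

abbreviation pauli_form ::
  "nat \<Rightarrow> ('l, 'm) monoid_scheme \<Rightarrow> (int set, 'p, 'q) module_scheme
     \<Rightarrow> ('p \<Rightarrow> 'p \<Rightarrow> int set) \<Rightarrow> ('l \<Rightarrow> 'p) \<Rightarrow> ('l \<Rightarrow> 'p) \<Rightarrow> 'l \<Rightarrow> int set" where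
  "pauli_form n \<Lambda> P\<^sub>0 \<omega>\<^sub>0 \<equiv> form_ext (ZFact (int n)) \<Lambda> P\<^sub>0 \<omega>\<^sub>0"

locale stabilizer_code =
  \<Lambda>: comm_group \<Lambda> + P\<^sub>0: module "ZFact (int n)" P\<^sub>0
  for n :: nat
    and \<Lambda> :: "('l, 'm) monoid_scheme"
    and P\<^sub>0 :: "(int set, 'p, 'q) module_scheme"
    and \<omega>\<^sub>0 :: "'p \<Rightarrow> 'p \<Rightarrow> int set"
    and L :: "('l \<Rightarrow> 'p) set" +
  assumes n_pos: "n > 0"
    and fin_gen_lattice: "fin_gen_group \<Lambda>"
    and fin_gen_P0: "fin_gen_module (ZFact (int n)) P\<^sub>0"
    and form_closed:
      "\<lbrakk>a \<in> carrier P\<^sub>0; b \<in> carrier P\<^sub>0\<rbrakk> \<Longrightarrow> \<omega>\<^sub>0 a b \<in> carrier (ZFact (int n))"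
    and form_add_left:
      "\<lbrakk>a \<in> carrier P\<^sub>0; b \<in> carrier P\<^sub>0; c \<in> carrier P\<^sub>0\<rbrakk>
        \<Longrightarrow> \<omega>\<^sub>0 (a \<oplus>\<^bsub>P\<^sub>0\<^esub> b) c = \<omega>\<^sub>0 a c \<oplus>\<^bsub>ZFact (int n)\<^esub> \<omega>\<^sub>0 b c"
    and form_add_right:
      "\<lbrakk>a \<in> carrier P\<^sub>0; b \<in> carrier P\<^sub>0; c \<in> carrier P\<^sub>0\<rbrakk>
        \<Longrightarrow> \<omega>\<^sub>0 a (b \<oplus>\<^bsub>P\<^sub>0\<^esub> c) = \<omega>\<^sub>0 a b \<oplus>\<^bsub>ZFact (int n)\<^esub> \<omega>\<^sub>0 a c"
    and form_smult_left:
      "\<lbrakk>k \<in> carrier (ZFact (int n)); a \<in> carrier P\<^sub>0; b \<in> carrier P\<^sub>0\<rbrakk>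
        \<Longrightarrow> \<omega>\<^sub>0 (k \<odot>\<^bsub>P\<^sub>0\<^esub> a) b = k \<otimes>\<^bsub>ZFact (int n)\<^esub> \<omega>\<^sub>0 a b"
    and form_smult_right:
      "\<lbrakk>k \<in> carrier (ZFact (int n)); a \<in> carrier P\<^sub>0; b \<in> carrier P\<^sub>0\<rbrakk>
        \<Longrightarrow> \<omega>\<^sub>0 a (k \<odot>\<^bsub>P\<^sub>0\<^esub> b) = k \<otimes>\<^bsub>ZFact (int n)\<^esub> \<omega>\<^sub>0 a b"
    and form_alternating: "a \<in> carrier P\<^sub>0 \<Longrightarrow> \<omega>\<^sub>0 a a = \<zero>\<^bsub>ZFact (int n)\<^esub>"
    and form_nondegenerate:
      "\<lbrakk>a \<in> carrier P\<^sub>0; \<forall>b\<in>carrier P\<^sub>0. \<omega>\<^sub>0 b a = \<zero>\<^bsub>ZFact (int n)\<^esub>\<rbrakk> \<Longrightarrow> a = \<zero>\<^bsub>P\<^sub>0\<^esub>"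
    and submodule_L: "submodule L (pauli_ring n \<Lambda>) (pauli_module n \<Lambda> P\<^sub>0)"
    and isotropic:
      "\<lbrakk>u \<in> L; v \<in> L\<rbrakk> \<Longrightarrow> pauli_form n \<Lambda> P\<^sub>0 \<omega>\<^sub>0 u v = \<zero>\<^bsub>pauli_ring n \<Lambda>\<^esub>"

definition orth ::
  "nat \<Rightarrow> ('l, 'm) monoid_scheme \<Rightarrow> (int set, 'p, 'q) module_scheme
     \<Rightarrow> ('p \<Rightarrow> 'p \<Rightarrow> int set) \<Rightarrow> ('l \<Rightarrow> 'p) set \<Rightarrow> ('l \<Rightarrow> 'p) set" where
  "orth n \<Lambda> P\<^sub>0 \<omega>\<^sub>0 N = {p \<in> carrier (pauli_module n \<Lambda> P\<^sub>0).
     \<forall>m\<in>N. pauli_form n \<Lambda> P\<^sub>0 \<omega>\<^sub>0 m p = \<zero>\<^bsub>pauli_ring n \<Lambda>\<^esub>}"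

definition saturated ::
  "nat \<Rightarrow> ('l, 'm) monoid_scheme \<Rightarrow> (int set, 'p, 'q) module_scheme
     \<Rightarrow> ('p \<Rightarrow> 'p \<Rightarrow> int set) \<Rightarrow> ('l \<Rightarrow> 'p) set \<Rightarrow> bool" where
  "saturated n \<Lambda> P\<^sub>0 \<omega>\<^sub>0 L \<longleftrightarrow> orth n \<Lambda> P\<^sub>0 \<omega>\<^sub>0 (orth n \<Lambda> P\<^sub>0 \<omega>\<^sub>0 L) = L"

text \<open>\<open>L\<^sup>* = Hom\<^sub>R(L', R)\<close>, where \<open>L'\<close> is \<open>L\<close> with the action twisted by the antipode.\<close>

definition pauli_dual ::
  "nat \<Rightarrow> ('l, 'm) monoid_scheme \<Rightarrow> (int set, 'p, 'q) module_scheme \<Rightarrow> ('l \<Rightarrow> 'p) set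
     \<Rightarrow> ('l \<Rightarrow> int set, ('l \<Rightarrow> 'p) \<Rightarrow> ('l \<Rightarrow> int set)) module" where
  "pauli_dual n \<Lambda> P\<^sub>0 L = hom_module (pauli_ring n \<Lambda>)
     (twist_module (antipode \<Lambda>) ((pauli_module n \<Lambda> P\<^sub>0)\<lparr>carrier := L\<rparr>))
     (regular_module (pauli_ring n \<Lambda>))"

text \<open>The cokernel of \<open>P \<rightarrow> L\<^sup>*\<close>, \<open>p \<mapsto> \<omega>(\<cdot>, p)\<close>; the kernel of this map is \<open>L\<^sup>\<omega>\<close>.\<close>

definition excitations ::
  "nat \<Rightarrow> ('l, 'm) monoid_scheme \<Rightarrow> (int set, 'p, 'q) module_scheme
     \<Rightarrow> ('p \<Rightarrow> 'p \<Rightarrow> int set) \<Rightarrow> ('l \<Rightarrow> 'p) set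
     \<Rightarrow> ('l \<Rightarrow> int set, (('l \<Rightarrow> 'p) \<Rightarrow> ('l \<Rightarrow> int set)) set) module" where
  "excitations n \<Lambda> P\<^sub>0 \<omega>\<^sub>0 L = quot_module (pauli_dual n \<Lambda> P\<^sub>0 L)
     ((\<lambda>p. \<lambda>m\<in>L. pauli_form n \<Lambda> P\<^sub>0 \<omega>\<^sub>0 m p) ` carrier (pauli_module n \<Lambda> P\<^sub>0))"

definition all_mobile ::
  "nat \<Rightarrow> ('l, 'm) monoid_scheme \<Rightarrow> (int set, 'p, 'q) module_scheme
     \<Rightarrow> ('p \<Rightarrow> 'p \<Rightarrow> int set) \<Rightarrow> ('l \<Rightarrow> 'p) set \<Rightarrow> bool" where
  "all_mobile n \<Lambda> P\<^sub>0 \<omega>\<^sub>0 L \<longleftrightarrow>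
     (let R = pauli_ring n \<Lambda>; Q = excitations n \<Lambda> P\<^sub>0 \<omega>\<^sub>0 L in
      \<exists>\<Gamma>. finite_index \<Gamma> \<Lambda> \<and>
        (\<forall>\<gamma>\<in>\<Gamma>. \<forall>e\<in>carrier Q.
           (gmonom \<Lambda> (ZFact (int n)) \<one>\<^bsub>ZFact (int n)\<^esub> \<gamma> \<ominus>\<^bsub>R\<^esub> \<one>\<^bsub>R\<^esub>) \<odot>\<^bsub>Q\<^esub> e = \<zero>\<^bsub>Q\<^esub>))"

end

theory Submission
  imports Defs "HOL.Complex" "HOL-Library.Poly_Mapping" "HOL-Library.Product_Plus"
    "HOL-Computational_Algebra.Polynomial"
begin

text \<open>
  A monomial is torsion in a ring of positive characteristic as soon as it is torsion modulo every
  prime ideal. Hence mobility can be tested on the residue rings of the primes above the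
  annihilator of the excitation module: in dimension \<open>0\<close> these are finitely generated fields of
  positive characteristic, so finite fields, and conversely mobility makes the quotient by the
  annihilator finite.

  For small rank, a functional on \<open>L\<close> is pulled back to a submodule of a free module over
  \<open>\<int>[x]\<close> or \<open>\<int>[x][y]\<close>, the monomials of which span a subgroup of finite index in the lattice.
  After multiplication by an element \<open>s\<close> divisible by no prime factor of \<open>n\<close>, it extends to the
  whole free module, and an extension is of the form \<open>\<omega>(\<cdot>, p)\<close> because \<open>\<omega>\<^sub>0\<close> is a perfect pairing. So
  \<open>s\<close> annihilates the excitations. In rank one the generator \<open>x\<close> is thus a root of \<open>s\<close>, hence torsion,
  modulo every prime above the annihilator. In rank two saturation makes \<open>L\<close> the solution set of linear
  congruences, and then \<open>s\<close> can be chosen to involve only one of the two variables.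
\<close>

hide_const (open) Divisibility.prime

section \<open>Ideals of commutative rings as sets\<close>

text \<open>Over a field, a functional on a submodule extends once a single nonzero element is
  inverted. Here \<open>n\<close> is composite and the group ring has zero divisors, so the work is
  lifted to polynomial rings over the integers, with functionals that are linear only modulo
  \<open>n\<close>. What replaces the field is the self-injectivity of the integers modulo
  \<open>n\<close>: if \<open>n = d * d'\<close>, a class killed by \<open>d'\<close> is a multiple
  of \<open>d\<close>. This supplies a value at each new vector as soon as the ideal of scalars
  carrying that vector into the submodule is known up to a content-free factor. In rank two such a
  factor can involve both variables and then shows neither to be torsion. A submodule cut out by
  congruences can instead be enlarged by dropping one congruence and one prime factor
  \<open>q\<close> of \<open>n\<close> at a time; the obstruction is an ideal of polynomials in
  \<open>x\<close> and \<open>y\<close> over the field with \<open>q\<close> elements, and it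
  becomes principal over rational functions in \<open>x\<close>, so denominators in \<open>x\<close>
  alone suffice. Exchanging the variables treats \<open>y\<close>. Torsion of the lattice is never
  split off; it disappears into the finitely many cosets of the subgroup of monomials.\<close>

definition is_ideal :: "'a::comm_ring_1 set \<Rightarrow> bool" where
  "is_ideal I \<longleftrightarrow> 0 \<in> I \<and> (\<forall>x\<in>I. \<forall>y\<in>I. x + y \<in> I) \<and> (\<forall>r. \<forall>x\<in>I. r * x \<in> I)"

definition is_prime :: "'a::comm_ring_1 set \<Rightarrow> bool" where
  "is_prime p \<longleftrightarrow> is_ideal p \<and> 1 \<notin> p \<and> (\<forall>x y. x * y \<in> p \<longrightarrow> x \<in> p \<or> y \<in> p)"

lemma is_idealI:
  assumes "0 \<in> I" "\<And>x y. x \<in> I \<Longrightarrow> y \<in> I \<Longrightarrow> x + y \<in> I" "\<And>r x. x \<in> I \<Longrightarrow> r * x \<in> I"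
  shows "is_ideal I"
  using assms by (auto simp: is_ideal_def)

lemma is_ideal_0: "is_ideal I \<Longrightarrow> 0 \<in> I"
  and is_ideal_add: "is_ideal I \<Longrightarrow> x \<in> I \<Longrightarrow> y \<in> I \<Longrightarrow> x + y \<in> I"
  and is_ideal_mult: "is_ideal I \<Longrightarrow> x \<in> I \<Longrightarrow> r * x \<in> I"
  by (auto simp: is_ideal_def)

lemma is_ideal_mult_right: "is_ideal I \<Longrightarrow> x \<in> I \<Longrightarrow> x * r \<in> I"
  by (metis is_ideal_mult mult.commute)

lemma is_ideal_uminus: "is_ideal I \<Longrightarrow> x \<in> I \<Longrightarrow> - x \<in> I"
  using is_ideal_mult[of I x "-1"] by simp

lemma is_ideal_diff: "is_ideal I \<Longrightarrow> x \<in> I \<Longrightarrow> y \<in> I \<Longrightarrow> x - y \<in> I"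
  using is_ideal_add[of I x "-y"] is_ideal_uminus[of I y] by simp

lemma is_ideal_add_cancel: "is_ideal I \<Longrightarrow> x \<in> I \<Longrightarrow> x + y \<in> I \<longleftrightarrow> y \<in> I"
  by (metis is_ideal_diff add_diff_cancel_left' is_ideal_add)

lemma is_ideal_diff_cancel: "is_ideal I \<Longrightarrow> x - y \<in> I \<Longrightarrow> x \<in> I \<longleftrightarrow> y \<in> I"
  by (metis is_ideal_add_cancel diff_add_cancel)

lemma is_ideal_sum: "is_ideal I \<Longrightarrow> (\<And>x. x \<in> A \<Longrightarrow> f x \<in> I) \<Longrightarrow> sum f A \<in> I"
  by (induction A rule: infinite_finite_induct) (auto simp: is_ideal_0 is_ideal_add)

lemma is_prime_ideal: "is_prime p \<Longrightarrow> is_ideal p"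
  and is_prime_1: "is_prime p \<Longrightarrow> 1 \<notin> p"
  by (auto simp: is_prime_def)

lemma is_prime_mult_iff: "is_prime p \<Longrightarrow> x * y \<in> p \<longleftrightarrow> x \<in> p \<or> y \<in> p"
  by (metis is_prime_def is_ideal_mult is_ideal_mult_right)

lemma is_prime_power: "is_prime p \<Longrightarrow> x ^ k \<in> p \<Longrightarrow> x \<in> p"
  by (induction k) (auto simp: is_prime_mult_iff is_prime_1)

lemma is_prime_prime_elem:
  assumes "prime_elem (q::'a::comm_ring_1)"
  shows "is_prime {x. q dvd x}"
  using assms unfolding is_prime_def
  by (auto intro!: is_idealI simp: prime_elem_dvd_mult_iff dest: prime_elem_not_unit)

text \<open>Krull's argument: an ideal maximal among those disjoint from the multiplicative set
  \<open>S\<close> is prime. If \<open>x\<close> and \<open>y\<close> lie outside it, the ideals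
  obtained by adding \<open>x\<close> and \<open>y\<close> both meet \<open>S\<close>, and the
  product of two such elements lies in \<open>S\<close> and, if \<open>x * y\<close> were in the
  ideal, in the ideal as well.\<close>

lemma prime_ideal_avoiding:
  assumes I: "is_ideal (I::'a::comm_ring_1 set)" and S1: "1 \<in> S"
    and Sm: "\<And>x y. x \<in> S \<Longrightarrow> y \<in> S \<Longrightarrow> x * y \<in> S" and IS: "I \<inter> S = {}"
  obtains p where "is_prime p" "I \<subseteq> p" "p \<inter> S = {}"
proof -
  let ?A = "{J. is_ideal J \<and> I \<subseteq> J \<and> J \<inter> S = {}}"
  have "\<exists>M\<in>?A. \<forall>J\<in>?A. M \<subseteq> J \<longrightarrow> J = M"
  proof (rule subset_Zorn_nonempty)
    show "?A \<noteq> {}" using I IS by blast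
    fix C assume ne: "C \<noteq> {}" and ch: "subset.chain ?A C"
    have mem: "\<And>J. J \<in> C \<Longrightarrow> is_ideal J \<and> I \<subseteq> J \<and> J \<inter> S = {}"
      using ch unfolding subset.chain_def by blast
    have "is_ideal (\<Union>C)"
    proof (rule is_idealI)
      show "0 \<in> \<Union>C" using ne mem is_ideal_0 by blast
      fix x y assume "x \<in> \<Union>C" "y \<in> \<Union>C"
      then obtain J K where JK: "J \<in> C" "x \<in> J" "K \<in> C" "y \<in> K" by blast
      have "J \<subseteq> K \<or> K \<subseteq> J" using ch JK unfolding subset.chain_def by blast
      then show "x + y \<in> \<Union>C" using JK mem is_ideal_add by blast
    next
      fix r x assume "x \<in> \<Union>C" then show "r * x \<in> \<Union>C" using mem is_ideal_mult by blast
    qed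
    then show "\<Union>C \<in> ?A" using ne mem by blast
  qed
  then obtain p where pA: "p \<in> ?A" and pmax: "\<forall>J\<in>?A. p \<subseteq> J \<longrightarrow> J = p" ..
  have p: "is_ideal p" "I \<subseteq> p" "p \<inter> S = {}" using pA by auto
  have max: "J = p" if "is_ideal J" "J \<inter> S = {}" "p \<subseteq> J" for J
  proof -
    have "J \<in> ?A" using that p(2) by auto
    then show ?thesis using pmax that(3) by blast
  qed
  have ext: "\<exists>s\<in>S. \<exists>a\<in>p. \<exists>r. s = a + r * x" if "x \<notin> p" for x
  proof -
    let ?X = "{y. \<exists>a\<in>p. \<exists>r. y = a + r * x}"
    have "is_ideal ?X"
    proof (rule is_idealI)
      show "0 \<in> ?X" using is_ideal_0[OF p(1)] by (intro CollectI bexI[of _ 0] exI[of _ 0]) simp_all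
    next
      fix y z assume "y \<in> ?X" "z \<in> ?X"
      then obtain a r b t where "a \<in> p" "b \<in> p" "y = a + r * x" "z = b + t * x" by blast
      then have "a + b \<in> p" "y + z = (a + b) + (r + t) * x"
        using is_ideal_add[OF p(1)] by (auto simp: algebra_simps)
      then show "y + z \<in> ?X" by blast
    next
      fix s y assume "y \<in> ?X"
      then obtain a r where "a \<in> p" "y = a + r * x" by blast
      then have "s * a \<in> p" "s * y = s * a + (s * r) * x"
        using is_ideal_mult[OF p(1)] by (auto simp: algebra_simps)
      then show "s * y \<in> ?X" by blast
    qed
    moreover have "p \<subseteq> ?X"
    proof
      fix y assume "y \<in> p"
      then show "y \<in> ?X" by (intro CollectI bexI[of _ y] exI[of _ 0]) simp_all
    qed
    moreover have "x \<in> ?X" using is_ideal_0[OF p(1)] by (intro CollectI bexI[of _ 0] exI[of _ 1]) simp_all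
    ultimately have "?X \<inter> S \<noteq> {}" using max[of ?X] that by blast
    then show ?thesis by blast
  qed
  have "is_prime p"
    unfolding is_prime_def
  proof (intro conjI allI impI p(1))
    show "1 \<notin> p" using p(3) S1 by blast
    fix x y assume xy: "x * y \<in> p"
    show "x \<in> p \<or> y \<in> p"
    proof (rule ccontr)
      assume "\<not> (x \<in> p \<or> y \<in> p)"
      then obtain s a r s' a' r' where *: "s \<in> S" "a \<in> p" "s = a + r * x" "s' \<in> S" "a' \<in> p" "s' = a' + r' * y"
        using ext[of x] ext[of y] by blast
      have "s * s' = a * s' + (r * x) * a' + (r * r') * (x * y)" using * by (simp add: algebra_simps)
      then have "s * s' \<in> p"
        using * xy p(1) by (simp add: is_ideal_add is_ideal_mult is_ideal_mult_right)
      then show False using p(3) Sm * by blast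
    qed
  qed
  then show ?thesis using that p by blast
qed

lemma power_diff_one_dvd: "(t ^ N - 1 :: 'a::comm_ring_1) dvd t ^ (N * M) - 1"
  by (metis power_mult dvd_def power_diff_1_eq)

text \<open>Each \<open>n\<close>-th power raises the order of vanishing at \<open>1\<close>, because
  \<open>1 + v + \<dots> + v\<^sup>n\<^sup>-\<^sup>1 \<equiv> n\<close> modulo \<open>v - 1\<close>.\<close>

lemma unipotent_torsion:
  assumes I: "is_ideal (I::'a::comm_ring_1 set)" and n: "of_nat n \<in> I" "n > 0" and k: "(u - 1) ^ k \<in> I"
  obtains M where "M > 0" "u ^ M - 1 \<in> I"
proof -
  have "\<exists>w. u ^ (n ^ j) - 1 - (u - 1) ^ Suc j * w \<in> I" for j
  proof (induction j)
    case 0 then show ?case by (auto intro!: exI[of _ 1] simp: is_ideal_0[OF I])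
  next
    case (Suc j)
    let ?v = "u ^ (n ^ j)"
    from Suc obtain w where w: "?v - 1 - (u - 1) ^ Suc j * w \<in> I" by blast
    have "(\<Sum>i<n. ?v ^ i) - of_nat n = (\<Sum>i<n. ?v ^ i - 1)" by (simp add: sum_subtractf)
    also have "\<dots> = (\<Sum>i<n. (?v - 1) * (\<Sum>l<i. ?v ^ l))" by (simp add: power_diff_1_eq)
    also have "\<dots> = (?v - 1) * (\<Sum>i<n. \<Sum>l<i. ?v ^ l)" by (simp add: sum_distrib_left)
    finally obtain w' where w': "(\<Sum>i<n. ?v ^ i) = of_nat n + (?v - 1) * w'" by (metis add.commute diff_eq_eq)
    have e1: "u ^ (n ^ Suc j) - 1 = (?v - 1) * (\<Sum>i<n. ?v ^ i)"
      unfolding power_Suc2 power_mult by (rule power_diff_1_eq)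
    define a where "a = ?v - 1"
    define b where "b = (u - 1) ^ Suc j * w"
    have ab: "a - b \<in> I" using w by (simp add: a_def b_def)
    \<comment> \<open>The product \<open>a * (of_nat n + a * w')\<close> is
      \<open>a * a * w'\<close> up to a multiple of \<open>n\<close>, and \<open>a\<close> may be
      replaced by \<open>b\<close> modulo \<open>I\<close>. The square doubles the order
      \<open>Suc j\<close>, which is at least one more.\<close>
    have dvd: "(u - 1) ^ Suc (Suc j) dvd b * b * w'"
    proof -
      have "(u - 1) ^ Suc (Suc j) dvd (u - 1) ^ (Suc j + Suc j)" by (rule le_imp_power_dvd) simp
      then show ?thesis unfolding b_def power_add
        by (metis (no_types, opaque_lifting) dvd_mult2 mult.assoc mult.left_commute)
    qed
    then obtain w2 where w2: "b * b * w' = (u - 1) ^ Suc (Suc j) * w2" by (auto simp: dvd_def)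
    have "u ^ (n ^ Suc j) - 1 - (u - 1) ^ Suc (Suc j) * w2 = a * of_nat n + (a - b) * ((a + b) * w')"
      unfolding w2[symmetric] e1 w' a_def[symmetric] by (simp add: algebra_simps)
    also have "\<dots> \<in> I" using n ab by (intro is_ideal_add[OF I] is_ideal_mult[OF I] is_ideal_mult_right[OF I])
    finally show ?case by blast
  qed
  from this[of k] obtain w where "u ^ (n ^ k) - 1 - (u - 1) ^ Suc k * w \<in> I" by blast
  moreover have "(u - 1) ^ Suc k * w \<in> I" using k
    by (simp add: is_ideal_mult[OF I] is_ideal_mult_right[OF I] mult.assoc)
  ultimately have "u ^ (n ^ k) - 1 \<in> I" using is_ideal_diff_cancel[OF I] by blast
  then show ?thesis using that[of "n ^ k"] n(2) by simp
qed

text \<open>The divisors of powers of the elements \<open>t ^ N - 1\<close> form a multiplicative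
  set, since \<open>t ^ N - 1\<close> and \<open>t ^ M - 1\<close> both divide
  \<open>t ^ (N * M) - 1\<close>. A prime above \<open>I\<close> avoiding it is excluded by
  hypothesis, so some power of some \<open>t ^ N - 1\<close> lies in \<open>I\<close>, and
  \<open>unipotent_torsion\<close> removes that power.\<close>

lemma torsion_of_prime_torsion:
  assumes I: "is_ideal (I::'a::comm_ring_1 set)" and n: "of_nat n \<in> I" "n > 0"
    and pr: "\<And>p. is_prime p \<Longrightarrow> I \<subseteq> p \<Longrightarrow> \<exists>N>0. t ^ N - 1 \<in> p"
  obtains N where "N > 0" "t ^ N - 1 \<in> I"
proof -
  let ?S = "{x. \<exists>N>0. \<exists>k. x dvd (t ^ N - 1) ^ k}"
  have "I \<inter> ?S \<noteq> {}"
  proof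
    assume "I \<inter> ?S = {}"
    moreover have "1 \<in> ?S" by auto
    moreover have "x * y \<in> ?S" if xS: "x \<in> ?S" and yS: "y \<in> ?S" for x y
    proof -
      obtain N k M j where *: "N > 0" "x dvd (t ^ N - 1) ^ k" "M > 0" "y dvd (t ^ M - 1) ^ j"
        using xS yS by blast
      have "x dvd (t ^ (N * M) - 1) ^ k" "y dvd (t ^ (N * M) - 1) ^ j"
        using * power_diff_one_dvd[of t N M] power_diff_one_dvd[of t M N]
        by (metis dvd_trans dvd_power_same mult.commute)+
      then have "x * y dvd (t ^ (N * M) - 1) ^ (k + j)" by (simp add: power_add mult_dvd_mono)
      then show ?thesis using * by (metis (mono_tags, lifting) mem_Collect_eq nat_0_less_mult_iff)
    qed
    ultimately obtain p where p: "is_prime p" "I \<subseteq> p" "p \<inter> ?S = {}"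
      using prime_ideal_avoiding[OF I, of ?S thesis] by blast
    then obtain N where "N > 0" "t ^ N - 1 \<in> p" using pr by blast
    moreover have "t ^ N - 1 \<in> ?S" using \<open>N > 0\<close> by (intro CollectI exI[of _ N] conjI exI[of _ 1]) simp_all
    ultimately show False using p by blast
  qed
  then obtain x N k where "x \<in> I" "N > 0" "x dvd (t ^ N - 1) ^ k" by blast
  then have "(t ^ N - 1) ^ k \<in> I" by (metis dvd_def I is_ideal_mult_right)
  then obtain M where "M > 0" "(t ^ N) ^ M - 1 \<in> I" by (rule unipotent_torsion[OF I n])
  then show ?thesis using that[of "N * M"] \<open>N > 0\<close> by (simp add: power_mult)
qed

text \<open>The residue characteristic: primality of \<open>p\<close> puts a prime factor of
  \<open>n\<close> into \<open>p\<close>, and by Bezout an integer of \<open>p\<close> coprime to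
  that factor would put \<open>1\<close> into \<open>p\<close>.\<close>

lemma is_prime_nat:
  assumes p: "is_prime (p::'a::comm_ring_1 set)" and n: "of_nat n \<in> p" "n > 0"
  obtains q :: nat where "prime q" "q dvd n" "\<And>z. of_int z \<in> p \<longleftrightarrow> int q dvd z"
proof -
  have "\<exists>q. prime q \<and> q dvd n \<and> of_nat q \<in> p"
    using n
  proof (induction n rule: less_induct)
    case (less n)
    have "n \<noteq> 1" using less.prems is_prime_1[OF p] by auto
    then obtain q where q: "prime q" "q dvd n" using prime_factor_nat by blast
    then obtain m where m: "n = q * m" by (auto simp: dvd_def)
    have "of_nat q \<in> p \<or> of_nat m \<in> p" using less.prems(1) p unfolding m by (simp add: is_prime_mult_iff)
    moreover have "m < n" "m > 0" using q(1) less.prems(2) prime_gt_1_nat[OF q(1)] unfolding m by auto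
    ultimately show ?case using less.IH[of m] q unfolding m by (metis dvd_mult)
  qed
  then obtain q where q: "prime q" "q dvd n" "of_nat q \<in> p" by blast
  have I: "is_ideal p" using p by (rule is_prime_ideal)
  have "of_int z \<in> p \<longleftrightarrow> int q dvd z" for z
  proof
    assume "int q dvd z"
    then obtain k where "z = int q * k" by (auto simp: dvd_def)
    then show "of_int z \<in> p" using q(3) by (simp add: is_ideal_mult_right[OF I])
  next
    assume z: "of_int z \<in> p"
    show "int q dvd z"
    proof (rule ccontr)
      assume "\<not> int q dvd z"
      then have "coprime (int q) z" using q(1) by (simp add: prime_imp_coprime)
      then obtain u v where "u * int q + v * z = 1" by (metis coprime_iff_gcd_eq_1 bezout_int)
      then have "(of_int u * of_nat q + of_int v * of_int z :: 'a) = 1"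
        by (metis of_int_1 of_int_add of_int_mult of_int_of_nat_eq)
      moreover have "(of_int u * of_nat q + of_int v * of_int z :: 'a) \<in> p"
        using q(3) z by (intro is_ideal_add[OF I] is_ideal_mult[OF I])
      ultimately show False using is_prime_1[OF p] by simp
    qed
  qed
  then show ?thesis using that q by blast
qed

text \<open>Modulo \<open>p\<close>, the element \<open>t\<close> is algebraic over the field with
  \<open>q\<close> elements, so its powers lie in the finite span of
  \<open>t ^ 0, ..., t ^ (e - 1)\<close>. Two powers coincide, and \<open>t\<close> can be cancelled
  because it is outside the prime.\<close>

lemma power_torsion_of_root:
  assumes p: "is_prime (p::'a::comm_ring_1 set)" and q: "prime (q::nat)"
    and pq: "\<And>z. of_int z \<in> p \<longleftrightarrow> int q dvd z"
    and s: "\<exists>i. \<not> int q dvd coeff s i" and st: "poly (map_poly of_int s) t \<in> p" and tp: "t \<notin> p"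
  obtains N where "N > 0" "t ^ N - 1 \<in> p"
proof -
  have I: "is_ideal p" using p by (rule is_prime_ideal)
  let ?P = "\<lambda>i. \<not> int q dvd coeff s i"
  \<comment> \<open>The degree of \<open>s\<close> modulo \<open>q\<close>; the coefficients of
    \<open>s\<close> above it may be nonzero multiples of \<open>q\<close>. Its leading coefficient
    is inverted modulo \<open>q\<close> by the Bezout factor \<open>l\<close> below, which makes the
    relation \<open>red\<close> monic.\<close>
  define e where "e = (GREATEST i. ?P i)"
  have bnd: "\<And>i. ?P i \<Longrightarrow> i \<le> degree s" by (metis dvd_0_right le_degree)
  have e: "?P e" unfolding e_def using s bnd by (metis (mono_tags, lifting) GreatestI_nat)
  have above: "int q dvd coeff s i" if "i > e" for i
    using that bnd Greatest_le_nat[of ?P i "degree s"] unfolding e_def by fastforce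
  have "coprime (coeff s e) (int q)" using q e by (simp add: prime_imp_coprime coprime_commute)
  then obtain l m where lm: "l * coeff s e + m * int q = 1" by (metis coprime_iff_gcd_eq_1 bezout_int)
  have qp: "of_int (int q) \<in> p" using pq[of "int q"] by simp
  have red: "t ^ e - (\<Sum>i<e. of_int (- l * coeff s i) * t ^ i) \<in> p"
  proof -
    have deg: "e \<le> degree s" using bnd e by blast
    have "poly (map_poly of_int s) t = (\<Sum>i\<le>degree s. of_int (coeff s i) * t ^ i)"
      unfolding poly_altdef
    proof (rule sum.mono_neutral_cong_left)
      show "{..degree (map_poly (of_int :: int \<Rightarrow> 'a) s)} \<subseteq> {..degree s}" by (simp add: map_poly_degree_leq)
      have "(of_int (coeff s i) :: 'a) = 0" if "i > degree (map_poly (of_int :: int \<Rightarrow> 'a) s)" for i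
        using coeff_eq_0[OF that] by (simp add: coeff_map_poly)
      then show "\<forall>i\<in>{..degree s} - {..degree (map_poly (of_int :: int \<Rightarrow> 'a) s)}.
        of_int (coeff s i) * t ^ i = 0" by auto
    qed (auto simp: coeff_map_poly)
    also have "{..degree s} = {..<e} \<union> {e} \<union> {e<..degree s}" using deg by auto
    also have "(\<Sum>i\<in>{..<e} \<union> {e} \<union> {e<..degree s}. of_int (coeff s i) * t ^ i)
        = (\<Sum>i<e. of_int (coeff s i) * t ^ i) + of_int (coeff s e) * t ^ e
          + (\<Sum>i\<in>{e<..degree s}. of_int (coeff s i) * t ^ i)"
      by (subst sum.union_disjoint; (subst sum.union_disjoint)?) auto
    finally have *: "poly (map_poly of_int s) t = \<dots>" .
    have "(\<Sum>i\<in>{e<..degree s}. of_int (coeff s i) * t ^ i) \<in> p"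
      using above pq by (intro is_ideal_sum[OF I] is_ideal_mult_right[OF I]) auto
    then have "(\<Sum>i<e. of_int (coeff s i) * t ^ i) + of_int (coeff s e) * t ^ e \<in> p"
      using st * is_ideal_diff[OF I] by (metis add_diff_cancel_right')
    then have "of_int l * ((\<Sum>i<e. of_int (coeff s i) * t ^ i) + of_int (coeff s e) * t ^ e)
        + of_int m * t ^ e * of_int (int q) \<in> p"
      by (intro is_ideal_add[OF I is_ideal_mult[OF I] is_ideal_mult[OF I qp]])
    also have "of_int l * ((\<Sum>i<e. of_int (coeff s i) * t ^ i) + of_int (coeff s e) * t ^ e)
        + of_int m * t ^ e * of_int (int q)
        = (\<Sum>i<e. of_int (l * coeff s i) * t ^ i) + of_int (l * coeff s e + m * int q) * t ^ e"
      by (simp add: algebra_simps sum_distrib_left)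
    also have "\<dots> = t ^ e - (\<Sum>i<e. of_int (- l * coeff s i) * t ^ i)"
      unfolding lm by (simp add: sum_negf)
    finally show ?thesis .
  qed
  have step: "\<exists>c. t ^ k - (\<Sum>i<e. of_int (c i) * t ^ i) \<in> p" for k
  proof (induction k)
    case 0
    show ?case
    proof (cases "e = 0")
      case True
      then show ?thesis using red by (auto simp: is_ideal_0[OF I])
    next
      case False
      then have "(\<Sum>i<e. of_int ((\<lambda>i. if i = 0 then 1 else 0) i) * t ^ i) = 1"
        by (simp add: if_distrib if_distribR sum.delta cong: if_cong)
      then show ?thesis by (intro exI[of _ "\<lambda>i. if i = 0 then 1 else 0"]) (simp add: is_ideal_0[OF I])
    qed
  next
    case (Suc k)
    then obtain c where c: "t ^ k - (\<Sum>i<e. of_int (c i) * t ^ i) \<in> p" by blast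
    \<comment> \<open>Multiplication by \<open>t\<close> shifts the coefficients, and the term
      \<open>t ^ e\<close> that overflows is rewritten by the monic relation \<open>red\<close>. For
      \<open>e = 0\<close> there is no last coefficient \<open>c (e - 1)\<close>, hence the
      guard.\<close>
    define c' where "c' i = (if i = 0 then 0 else c (i - 1)) + (if e = 0 then 0 else c (e - 1) * (- l * coeff s i))" for i
    have "t * (\<Sum>i<e. of_int (c i) * t ^ i) - (\<Sum>i<e. of_int (c' i) * t ^ i)
      = (if e = 0 then 0 else of_int (c (e - 1)) * (t ^ e - (\<Sum>i<e. of_int (- l * coeff s i) * t ^ i)))"
    proof (cases e)
      case (Suc d)
      have "t * (\<Sum>i<e. of_int (c i) * t ^ i) = (\<Sum>i<d. of_int (c i) * t ^ Suc i) + of_int (c d) * t ^ e"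
        unfolding Suc by (simp add: algebra_simps sum_distrib_left)
      also have "(\<Sum>i<d. of_int (c i) * t ^ Suc i) = (\<Sum>i<e. of_int (if i = 0 then 0 else c (i - 1)) * t ^ i)"
        unfolding Suc by (subst sum.lessThan_Suc_shift) simp
      finally show ?thesis unfolding c'_def using Suc
        by (simp add: algebra_simps sum.distrib sum_distrib_left sum_negf sum_subtractf)
    qed simp
    then have "t * (\<Sum>i<e. of_int (c i) * t ^ i) - (\<Sum>i<e. of_int (c' i) * t ^ i) \<in> p"
      using red by (simp add: is_ideal_mult[OF I] is_ideal_0[OF I] split: if_splits)
    moreover have "t * (t ^ k - (\<Sum>i<e. of_int (c i) * t ^ i)) \<in> p" using c by (rule is_ideal_mult[OF I])
    ultimately have "t * (t ^ k - (\<Sum>i<e. of_int (c i) * t ^ i)) +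
      (t * (\<Sum>i<e. of_int (c i) * t ^ i) - (\<Sum>i<e. of_int (c' i) * t ^ i)) \<in> p"
      using is_ideal_add[OF I] by blast
    then show ?case by (intro exI[of _ c']) (simp add: algebra_simps)
  qed
  \<comment> \<open>The coefficients matter only modulo \<open>q\<close>, so residues in
    \<open>{0..<int q}\<close> suffice and the span becomes a finite set.\<close>
  define F where "F = (\<lambda>c. \<Sum>i<e. of_int (c i) * t ^ i) ` ({..<e} \<rightarrow>\<^sub>E {0..<int q})"
  have fin: "finite F" unfolding F_def by (intro finite_imageI finite_PiE) auto
  have "\<exists>y\<in>F. t ^ k - y \<in> p" for k
  proof -
    obtain c where c: "t ^ k - (\<Sum>i<e. of_int (c i) * t ^ i) \<in> p" using step by blast
    define d where "d = (\<lambda>i\<in>{..<e}. c i mod int q)"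
    have "(\<Sum>i<e. of_int (c i) * t ^ i) - (\<Sum>i<e. of_int (d i) * t ^ i) = (\<Sum>i<e. of_int (c i - d i) * t ^ i)"
      by (simp add: algebra_simps sum_subtractf)
    also have "\<dots> \<in> p"
    proof (intro is_ideal_sum[OF I] is_ideal_mult_right[OF I])
      fix i assume "i \<in> {..<e}"
      then show "of_int (c i - d i) \<in> p" unfolding pq d_def by (simp add: dvd_minus_mod)
    qed
    finally have "t ^ k - (\<Sum>i<e. of_int (d i) * t ^ i) \<in> p" using is_ideal_add[OF I c] by fastforce
    moreover have "d \<in> {..<e} \<rightarrow>\<^sub>E {0..<int q}" unfolding d_def using prime_gt_0_nat[OF q] by auto
    ultimately show ?thesis unfolding F_def by blast
  qed
  then obtain y where y: "\<And>k. y k \<in> F" "\<And>k. t ^ k - y k \<in> p" by metis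
  have "finite (range y)" by (rule finite_subset[OF _ fin], rule image_subsetI, rule y(1))
  then have "\<not> inj y" using finite_imageD infinite_UNIV_nat by blast
  then obtain a b where ab: "a < b" "y a = y b" unfolding inj_def by (metis linorder_neqE_nat)
  have "t ^ a * (t ^ (b - a) - 1) = (t ^ b - y b) - (t ^ a - y a)"
    using ab by (simp add: algebra_simps power_add[symmetric])
  also have "\<dots> \<in> p" using y(2) is_ideal_diff[OF I] by blast
  finally have "t ^ (b - a) - 1 \<in> p" using tp is_prime_power[OF p] is_prime_mult_iff[OF p] by blast
  then show ?thesis using that[of "b - a"] ab by simp
qed

section \<open>Finitely generated domains\<close>

definition is_subring :: "'a::comm_ring_1 set \<Rightarrow> bool" where
  "is_subring A \<longleftrightarrow> 1 \<in> A \<and> (\<forall>x\<in>A. \<forall>y\<in>A. x + y \<in> A \<and> x * y \<in> A) \<and> (\<forall>x\<in>A. - x \<in> A)"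

definition polys_over :: "'a::comm_ring_1 set \<Rightarrow> 'a poly set" where
  "polys_over A = {f. \<forall>i. coeff f i \<in> A}"

definition adjoin :: "'a::comm_ring_1 set \<Rightarrow> 'a \<Rightarrow> 'a set" where
  "adjoin A b = (\<lambda>f. poly f b) ` polys_over A"

text \<open>The degree of the reduction modulo \<open>p\<close>. It is a relation because a
  polynomial with all coefficients in \<open>p\<close> has no such degree, and because it may lie
  below \<open>degree f\<close>.\<close>

definition deg_mod :: "'a::comm_ring_1 set \<Rightarrow> 'a poly \<Rightarrow> nat \<Rightarrow> bool" where
  "deg_mod p f e \<longleftrightarrow> coeff f e \<notin> p \<and> (\<forall>i>e. coeff f i \<in> p)"

text \<open>The localisation of \<open>A / (A \<inter> p)\<close> at a single element is a field.\<close>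

definition G_domain :: "'a::comm_ring_1 set \<Rightarrow> 'a set \<Rightarrow> bool" where
  "G_domain p A \<longleftrightarrow> (\<exists>u\<in>A. u \<notin> p \<and> (\<forall>a\<in>A. a \<notin> p \<longrightarrow> (\<exists>k. \<exists>c\<in>A. a * c - u ^ k \<in> p)))"

lemma is_subring_1: "is_subring A \<Longrightarrow> 1 \<in> A"
  and is_subring_add: "is_subring A \<Longrightarrow> x \<in> A \<Longrightarrow> y \<in> A \<Longrightarrow> x + y \<in> A"
  and is_subring_mult: "is_subring A \<Longrightarrow> x \<in> A \<Longrightarrow> y \<in> A \<Longrightarrow> x * y \<in> A"
  and is_subring_uminus: "is_subring A \<Longrightarrow> x \<in> A \<Longrightarrow> - x \<in> A"
  by (auto simp: is_subring_def)

lemma is_subring_0: "is_subring A \<Longrightarrow> 0 \<in> A"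
  by (metis is_subring_1 is_subring_add is_subring_uminus add.right_inverse)

lemma is_subring_diff: "is_subring A \<Longrightarrow> x \<in> A \<Longrightarrow> y \<in> A \<Longrightarrow> x - y \<in> A"
  by (metis is_subring_add is_subring_uminus diff_conv_add_uminus)

lemma is_subring_sum: "is_subring A \<Longrightarrow> (\<And>x. x \<in> S \<Longrightarrow> f x \<in> A) \<Longrightarrow> sum f S \<in> A"
  by (induction S rule: infinite_finite_induct) (auto simp: is_subring_0 is_subring_add)

lemma is_subring_power: "is_subring A \<Longrightarrow> x \<in> A \<Longrightarrow> x ^ k \<in> A"
  by (induction k) (auto simp: is_subring_1 is_subring_mult)

lemma is_subring_UNIV: "is_subring UNIV"
  by (simp add: is_subring_def)

lemma is_subring_polys_over:
  assumes A: "is_subring A"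
  shows "is_subring (polys_over A)"
proof -
  have "1 \<in> polys_over A" by (auto simp: polys_over_def coeff_1 is_subring_0[OF A] is_subring_1[OF A])
  moreover have "f * g \<in> polys_over A" if "f \<in> polys_over A" "g \<in> polys_over A" for f g
    using that by (auto simp: polys_over_def coeff_mult intro!: is_subring_sum[OF A] is_subring_mult[OF A])
  ultimately show ?thesis
    unfolding is_subring_def[of "polys_over A"]
    by (auto simp: polys_over_def is_subring_add[OF A] is_subring_uminus[OF A])
qed

lemma polys_over_monom: "is_subring A \<Longrightarrow> a \<in> A \<Longrightarrow> monom a k \<in> polys_over A"
  by (auto simp: polys_over_def is_subring_0)

lemma polys_over_const: "is_subring A \<Longrightarrow> a \<in> A \<Longrightarrow> [:a:] \<in> polys_over A"
  using polys_over_monom[of A a 0] by (simp add: monom_0)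

lemma polys_over_pCons: "a \<in> A \<Longrightarrow> f \<in> polys_over A \<Longrightarrow> pCons a f \<in> polys_over A"
  by (auto simp: polys_over_def coeff_pCons split: nat.split)

lemma polys_over_smult: "is_subring A \<Longrightarrow> a \<in> A \<Longrightarrow> f \<in> polys_over A \<Longrightarrow> smult a f \<in> polys_over A"
  by (auto simp: polys_over_def is_subring_mult)

lemma is_subring_adjoin: "is_subring A \<Longrightarrow> is_subring (adjoin A b)"
  unfolding is_subring_def[of "adjoin A b"]
proof (intro conjI ballI)
  assume A: "is_subring A"
  note P = is_subring_polys_over[OF A]
  show "1 \<in> adjoin A b" unfolding adjoin_def by (rule image_eqI[of _ _ 1]) (auto simp: is_subring_1[OF P])
  fix x assume "x \<in> adjoin A b"
  then obtain f where f: "f \<in> polys_over A" "x = poly f b" by (auto simp: adjoin_def)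
  then have "- x = poly (- f) b" "- f \<in> polys_over A" by (simp_all add: is_subring_uminus[OF P])
  then show "- x \<in> adjoin A b" unfolding adjoin_def by blast
  fix y assume "y \<in> adjoin A b"
  then obtain g where g: "g \<in> polys_over A" "y = poly g b" by (auto simp: adjoin_def)
  have "x + y = poly (f + g) b" "f + g \<in> polys_over A" using f g by (simp_all add: is_subring_add[OF P])
  then show "x + y \<in> adjoin A b" unfolding adjoin_def by blast
  have "x * y = poly (f * g) b" "f * g \<in> polys_over A" using f g by (simp_all add: is_subring_mult[OF P])
  then show "x * y \<in> adjoin A b" unfolding adjoin_def by blast
qed

lemma subset_adjoin: "is_subring A \<Longrightarrow> A \<subseteq> adjoin A b"
proof
  fix a assume A: "is_subring A" and a: "a \<in> A"
  have "a = poly [:a:] b" by simp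
  then show "a \<in> adjoin A b" unfolding adjoin_def using polys_over_const[OF A a] by blast
qed

lemma adjoin_self:
  assumes A: "is_subring A"
  shows "b \<in> adjoin A b"
proof -
  have "b = poly (monom 1 1) b" by (simp add: poly_monom)
  then show ?thesis unfolding adjoin_def using polys_over_monom[OF A is_subring_1[OF A]] by blast
qed

lemma adjoin_least: "is_subring B \<Longrightarrow> A \<subseteq> B \<Longrightarrow> b \<in> B \<Longrightarrow> adjoin A b \<subseteq> B"
  by (auto simp: adjoin_def poly_altdef polys_over_def intro!: is_subring_sum is_subring_mult is_subring_power)

lemma deg_mod_exists:
  assumes "is_ideal p" "coeff f j \<notin> p"
  obtains e where "deg_mod p f e"
proof -
  let ?P = "\<lambda>i. coeff f i \<notin> p"
  have bnd: "?P i \<Longrightarrow> i \<le> degree f" for i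
    using assms(1) is_ideal_0 by (metis coeff_eq_0 not_le)
  have "?P (GREATEST i. ?P i)" using assms(2) bnd by (metis (mono_tags, lifting) GreatestI_nat)
  moreover have "coeff f i \<in> p" if "i > (GREATEST i. ?P i)" for i
    using that bnd Greatest_le_nat[of ?P i "degree f"] by fastforce
  ultimately show ?thesis using that[of "GREATEST i. ?P i"] by (simp add: deg_mod_def)
qed

lemma coeff_mult_mem:
  assumes I: "is_ideal I" and "\<And>i. coeff f i \<in> I"
  shows "coeff (f * g) k \<in> I"
  unfolding coeff_mult using assms by (intro is_ideal_sum[OF I] is_ideal_mult_right[OF I])

lemma deg_mod_mult:
  assumes p: "is_prime p" and f: "deg_mod p f d" and g: "deg_mod p g e"
  shows "deg_mod p (f * g) (d + e)"
  unfolding deg_mod_def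
proof (intro conjI allI impI)
  have I: "is_ideal p" using p by (rule is_prime_ideal)
  have "coeff (f * g) (d + e) = coeff f d * coeff g e + (\<Sum>i\<in>{..d + e} - {d}. coeff f i * coeff g (d + e - i))"
    unfolding coeff_mult using sum.remove[of "{..d + e}" d "\<lambda>i. coeff f i * coeff g (d + e - i)"] by simp
  moreover have "(\<Sum>i\<in>{..d + e} - {d}. coeff f i * coeff g (d + e - i)) \<in> p"
  proof (intro is_ideal_sum[OF I])
    fix i assume "i \<in> {..d + e} - {d}"
    then have "i > d \<or> d + e - i > e" by auto
    then show "coeff f i * coeff g (d + e - i) \<in> p" using f g
      by (auto simp: deg_mod_def intro: is_ideal_mult[OF I] is_ideal_mult_right[OF I])
  qed
  moreover have "coeff f d * coeff g e \<notin> p" using f g by (simp add: deg_mod_def is_prime_mult_iff[OF p])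
  ultimately show "coeff (f * g) (d + e) \<notin> p" using is_ideal_add_cancel[OF I] by (metis add.commute)
  fix k assume k: "k > d + e"
  show "coeff (f * g) k \<in> p"
    unfolding coeff_mult
  proof (intro is_ideal_sum[OF I])
    fix i assume "i \<in> {..k}"
    then have "i > d \<or> k - i > e" using k by auto
    then show "coeff f i * coeff g (k - i) \<in> p" using f g
      by (auto simp: deg_mod_def intro: is_ideal_mult[OF I] is_ideal_mult_right[OF I])
  qed
qed

text \<open>The leading coefficient of \<open>g\<close> is not invertible, so each division step
  multiplies the dividend by it. The exponent is the degree bound \<open>k\<close> itself rather
  than the number of steps taken, which makes the induction uniform; degrees are measured modulo
  \<open>p\<close> throughout, while quotient and remainder keep coefficients in
  \<open>A\<close>.\<close>

lemma pseudo_division_mod: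
  assumes p: "is_ideal p" and A: "is_subring A" and g: "g \<in> polys_over A" "\<And>i. i > e \<Longrightarrow> coeff g i \<in> p"
  shows "f \<in> polys_over A \<Longrightarrow> (\<And>i. i \<ge> k \<Longrightarrow> coeff f i \<in> p) \<Longrightarrow>
    \<exists>Q\<in>polys_over A. \<exists>r\<in>polys_over A. smult (coeff g e ^ k) f = Q * g + r \<and> (\<forall>i\<ge>e. coeff r i \<in> p)"
proof (induction k arbitrary: f)
  note P = is_subring_polys_over[OF A]
  case 0
  show ?case
    by (rule bexI[where x = 0], rule bexI[where x = f]) (use 0 in \<open>auto simp: is_subring_0[OF P]\<close>)
next
  note P = is_subring_polys_over[OF A]
  case (Suc k)
  let ?l = "coeff g e"
  have lA: "?l \<in> A" using g by (simp add: polys_over_def)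
  show ?case
  proof (cases "k < e")
    case True
    show ?thesis
      by (rule bexI[where x = 0], rule bexI[where x = "smult (?l ^ Suc k) f"])
        (use True Suc.prems lA in \<open>auto simp: is_subring_0[OF P] intro!: is_ideal_mult[OF p] polys_over_smult[OF A] is_subring_power[OF A] is_subring_mult[OF A]\<close>)
  next
    case False
    let ?h = "monom (coeff f k) (k - e)"
    let ?f = "smult ?l f - ?h * g"
    have h: "?h \<in> polys_over A" using Suc.prems(1) by (intro polys_over_monom[OF A]) (simp add: polys_over_def)
    have fA: "?f \<in> polys_over A"
      using Suc.prems(1) h g lA by (intro is_subring_diff[OF P] is_subring_mult[OF P] polys_over_smult[OF A])
    have "coeff ?f i \<in> p" if i: "i \<ge> k" for i
    proof (cases "i = k")
      case True
      have "coeff (?h * g) k = coeff f k * ?l" using False by (auto simp: coeff_monom_mult)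
      then show ?thesis using True by (simp add: is_ideal_0[OF p])
    next
      case F: False
      then have "coeff f i \<in> p" "coeff g (i - (k - e)) \<in> p" using i Suc.prems(2)[of i] g(2) False by auto
      then show ?thesis by (auto simp: coeff_monom_mult intro!: is_ideal_diff[OF p] is_ideal_mult[OF p] is_ideal_0[OF p])
    qed
    from Suc.IH[OF fA this] obtain Q r where Qr: "Q \<in> polys_over A" "r \<in> polys_over A"
      "smult (?l ^ k) ?f = Q * g + r" "\<forall>i\<ge>e. coeff r i \<in> p" by blast
    let ?Q = "Q + smult (?l ^ k) ?h"
    have "smult (?l ^ Suc k) f = ?Q * g + r"
      using Qr(3) by (simp add: smult_diff_right algebra_simps)
    moreover have "?Q \<in> polys_over A"
      using Qr h lA by (intro is_subring_add[OF P] polys_over_smult[OF A] is_subring_power[OF A])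
    ultimately show ?thesis using Qr by blast
  qed
qed

lemma poly_mem_ideal:
  assumes "is_ideal p" "\<And>i. coeff f i \<in> p" shows "poly f b \<in> p"
  unfolding poly_altdef using assms by (intro is_ideal_sum is_ideal_mult_right) auto

text \<open>If \<open>A[b][1/u]\<close> is a field with \<open>u = h(b)\<close> and \<open>b\<close> transcendental, then \<open>1 + X h\<close> divides a
  power of \<open>h\<close>; as it is coprime to \<open>h\<close>, it would be a unit.\<close>

lemma G_domain_adjoin_algebraic:
  assumes p: "is_prime p" and A: "is_subring A" and G: "G_domain p (adjoin A b)"
  obtains f where "f \<in> polys_over A" "poly f b \<in> p" "\<exists>i. coeff f i \<notin> p"
proof (rule ccontr)
  assume "\<not> thesis"
  then have trans: "\<And>f i. f \<in> polys_over A \<Longrightarrow> poly f b \<in> p \<Longrightarrow> coeff f i \<in> p" using that by blast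
  note I = is_prime_ideal[OF p] and P = is_subring_polys_over[OF A]
  obtain h where h: "h \<in> polys_over A" "poly h b \<notin> p" and
    u: "\<And>a. a \<in> adjoin A b \<Longrightarrow> a \<notin> p \<Longrightarrow> \<exists>k. \<exists>c\<in>adjoin A b. a * c - poly h b ^ k \<in> p"
    using G unfolding G_domain_def by (auto simp: adjoin_def)
  define H where "H = pCons 1 h"
  have H: "H \<in> polys_over A" unfolding H_def using h A by (simp add: polys_over_pCons is_subring_1)
  have "poly H b \<notin> p" using trans[OF H, of 0] is_prime_1[OF p] by (auto simp: H_def)
  then obtain k c where "c \<in> adjoin A b" "poly H b * c - poly h b ^ k \<in> p"
    using u[of "poly H b"] H by (auto simp: adjoin_def)
  then obtain C where C: "C \<in> polys_over A" "poly (H * C - h ^ k) b \<in> p" by (auto simp: adjoin_def)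
  then have z: "coeff (H * C - h ^ k) i \<in> p" for i
    using trans H h by (metis is_subring_diff is_subring_mult is_subring_power P)
  obtain j where "coeff h j \<notin> p" using h(2) poly_mem_ideal[OF I] by blast
  then obtain e where e: "deg_mod p h e" using deg_mod_exists[OF I] by blast
  have He: "deg_mod p H (Suc e)" using e by (auto simp: deg_mod_def H_def coeff_pCons split: nat.split)
  define T :: "'a poly" where "T = [:0, 1:]"
  have HT: "H = T * h - (-1)" by (simp add: H_def T_def one_pCons)
  have "H dvd (T * h) ^ k - (-1) ^ k" unfolding HT by (rule dvdI[OF power_diff_sumr2])
  then obtain E where E: "T ^ k * h ^ k - (-1) ^ k = H * E" by (auto simp: dvd_def power_mult_distrib)
  \<comment> \<open>Modulo \<open>p\<close> one has \<open>H * C = h ^ k\<close>. Multiplying by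
    \<open>T ^ k\<close> and subtracting \<open>H * E = T ^ k * h ^ k - (-1) ^ k\<close> shows
    \<open>H * F = (-1) ^ k\<close>, so \<open>H\<close> would be a unit although its degree modulo
    \<open>p\<close> is the positive number \<open>Suc e\<close>.\<close>
  define F where "F = T ^ k * C - E"
  have "H * F = T ^ k * (H * C) - H * E" unfolding F_def by (simp add: algebra_simps)
  then have "H * F - (-1) ^ k = (H * C - h ^ k) * T ^ k"
    unfolding E[symmetric] by (simp add: algebra_simps)
  then have HF: "coeff (H * F - (-1) ^ k) i \<in> p" for i
    using coeff_mult_mem[OF I, of "H * C - h ^ k", OF z] by simp
  have m1: "(-1) ^ k \<notin> p"
    using is_prime_power[OF p, of "-1" k] is_ideal_uminus[OF I, of "-1"] is_prime_1[OF p] by auto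
  have c1: "coeff ((-1) ^ k) i = (if i = 0 then (-1) ^ k else (0::'a))" for i
    by (cases "even k") (auto simp: coeff_1)
  show False
  proof (cases "\<exists>i. coeff F i \<notin> p")
    case True
    then obtain e' where "deg_mod p F e'" using deg_mod_exists[OF I] by blast
    then have "coeff (H * F) (Suc e + e') \<notin> p" using deg_mod_mult[OF p He] by (auto simp: deg_mod_def)
    then show False using HF[of "Suc e + e'"] c1 by simp
  next
    case False
    then have "coeff (F * H) 0 \<in> p" using coeff_mult_mem[OF I] by blast
    then have "coeff ((-1) ^ k) 0 \<in> p" using HF[of 0] is_ideal_diff_cancel[OF I]
      by (metis coeff_diff mult.commute)
    then show False using m1 c1 by simp
  qed
qed

text \<open>Minimality of \<open>e\<close> is stated in the form in which division consumes it: a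
  remainder that stays in \<open>S\<close> and has degree below \<open>e\<close> modulo
  \<open>p\<close> vanishes modulo \<open>p\<close>.\<close>

lemma deg_mod_minimal:
  assumes "is_ideal p" "F \<in> S" "coeff F j \<notin> p"
  obtains f e where "f \<in> S" "deg_mod p f e" "\<forall>g\<in>S. (\<forall>i\<ge>e. coeff g i \<in> p) \<longrightarrow> (\<forall>i. coeff g i \<in> p)"
proof -
  let ?P = "\<lambda>e. \<exists>f\<in>S. deg_mod p f e"
  have "\<exists>e. ?P e" using assms deg_mod_exists by metis
  then obtain f where f: "f \<in> S" "deg_mod p f (LEAST e. ?P e)" using LeastI_ex[of ?P] by blast
  show ?thesis
  proof (rule that[OF f], intro ballI impI allI)
    fix g i assume g: "g \<in> S" "\<forall>i\<ge>(LEAST e. ?P e). coeff g i \<in> p"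
    show "coeff g i \<in> p"
    proof (rule ccontr)
      assume "coeff g i \<notin> p"
      then obtain e where e: "deg_mod p g e" using deg_mod_exists assms(1) by blast
      then have "(LEAST e. ?P e) \<le> e" using g(1) by (intro Least_le) blast
      then show False using g(2) e by (auto simp: deg_mod_def)
    qed
  qed
qed

text \<open>The descent step of Zariski's lemma. Modulo \<open>p\<close>, \<open>b\<close> is a root
  of some \<open>g\<close> over \<open>A\<close> of least degree \<open>d\<close> with leading
  coefficient \<open>l\<close>, and the denominator \<open>u\<close> of \<open>adjoin A b\<close>
  divides a nonzero \<open>w\<close> from \<open>A\<close>. Then \<open>l * w\<close> is a
  denominator for \<open>A\<close>: if \<open>a\<close> has an inverse in the localisation of
  \<open>adjoin A b\<close>, clearing \<open>u\<close> with \<open>w\<close> and reducing by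
  \<open>g\<close> with \<open>l\<close> gives \<open>a * r = l ^ j * w ^ k\<close> for a polynomial
  \<open>r\<close> in \<open>b\<close> of degree below \<open>d\<close>, and comparing constant
  coefficients gives an inverse over \<open>A\<close>.\<close>

lemma G_domain_adjoin:
  assumes p: "is_prime p" and A: "is_subring A" and G: "G_domain p (adjoin A b)"
  shows "G_domain p A"
proof -
  note I = is_prime_ideal[OF p] and P = is_subring_polys_over[OF A] and B = is_subring_adjoin[OF A, of b]
  let ?Z = "{f \<in> polys_over A. poly f b \<in> p}"
  obtain g d where g: "g \<in> polys_over A" "poly g b \<in> p" "deg_mod p g d"
    and gmin: "\<And>f i. f \<in> polys_over A \<Longrightarrow> poly f b \<in> p \<Longrightarrow> (\<And>i. i \<ge> d \<Longrightarrow> coeff f i \<in> p) \<Longrightarrow> coeff f i \<in> p"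
  proof -
    obtain f j where f: "f \<in> ?Z" "coeff f j \<notin> p" using G_domain_adjoin_algebraic[OF p A G] by blast
    show ?thesis
    proof (rule deg_mod_minimal[OF I f])
      fix g e assume "g \<in> ?Z" "deg_mod p g e"
        and min: "\<forall>f\<in>?Z. (\<forall>i\<ge>e. coeff f i \<in> p) \<longrightarrow> (\<forall>i. coeff f i \<in> p)"
      moreover have "coeff f i \<in> p"
        if "f \<in> polys_over A" "poly f b \<in> p" "\<And>i. i \<ge> e \<Longrightarrow> coeff f i \<in> p" for f i
        using min that by blast
      ultimately show thesis using that[of g e] by blast
    qed
  qed
  define l where "l = coeff g d"
  have l: "l \<in> A" "l \<notin> p" using g by (auto simp: l_def deg_mod_def polys_over_def)
  have d: "d > 0"
  proof (rule ccontr)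
    assume "\<not> d > 0"
    then have hi: "\<And>i. i > 0 \<Longrightarrow> coeff g i \<in> p" using g(3) by (auto simp: deg_mod_def)
    have "poly g b = coeff g 0 + b * poly (poly_shift 1 g) b"
      by (cases g) (simp add: poly_shift_def coeff_pCons coeff_inverse)
    moreover have "poly (poly_shift 1 g) b \<in> p" by (rule poly_mem_ideal[OF I]) (simp add: coeff_poly_shift hi)
    ultimately have "coeff g 0 \<in> p" using g(2) is_ideal_mult[OF I] is_ideal_diff[OF I] by (metis add_diff_cancel_right')
    then show False using g(3) \<open>\<not> d > 0\<close> by (auto simp: deg_mod_def)
  qed
  obtain u where u: "u \<in> adjoin A b" "u \<notin> p"
    and uG: "\<And>a. a \<in> adjoin A b \<Longrightarrow> a \<notin> p \<Longrightarrow> \<exists>k. \<exists>c\<in>adjoin A b. a * c - u ^ k \<in> p"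
    using G unfolding G_domain_def by blast
  \<comment> \<open>The polynomials over \<open>A\<close> whose value at \<open>b\<close> is a
    multiple of \<open>u\<close> modulo \<open>p\<close>. A member of least degree will turn out to
    be constant, which yields the multiple \<open>w\<close> of \<open>u\<close> in
    \<open>A\<close>.\<close>
  let ?S = "{f \<in> polys_over A. \<exists>c\<in>adjoin A b. poly f b - u * c \<in> p}"
  obtain h0 where h0: "h0 \<in> polys_over A" "u = poly h0 b" using u(1) by (auto simp: adjoin_def)
  have h0S: "h0 \<in> ?S" using h0 is_subring_1[OF B] is_ideal_0[OF I] by (intro CollectI conjI bexI[of _ 1]) auto
  have gS: "g \<in> ?S" using g is_subring_0[OF B] by (intro CollectI conjI bexI[of _ 0]) auto
  obtain j where "coeff h0 j \<notin> p" using u(2) h0(2) poly_mem_ideal[OF I] by blast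
  obtain h e where hS: "h \<in> ?S" and he: "deg_mod p h e"
    and hmin: "\<forall>f\<in>?S. (\<forall>i\<ge>e. coeff f i \<in> p) \<longrightarrow> (\<forall>i. coeff f i \<in> p)"
    by (rule deg_mod_minimal[OF I h0S \<open>coeff h0 j \<notin> p\<close>])
  have hA: "h \<in> polys_over A" using hS by simp
  have hl: "coeff h e \<in> A" using hA by (simp add: polys_over_def)
  have div: "\<exists>k. \<exists>Q\<in>polys_over A. \<forall>i. coeff (smult (coeff h e ^ k) f - Q * h) i \<in> p" if f: "f \<in> ?S" for f
  proof -
    have fA: "f \<in> polys_over A" using f by simp
    have "coeff f i \<in> p" if "i \<ge> Suc (degree f)" for i using that by (simp add: coeff_eq_0 is_ideal_0[OF I])
    from pseudo_division_mod[OF I A hA, of e f "Suc (degree f)", OF _ fA this] he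
    obtain Q r where Q: "Q \<in> polys_over A" "r \<in> polys_over A"
      "smult (coeff h e ^ Suc (degree f)) f = Q * h + r" "\<forall>i\<ge>e. coeff r i \<in> p"
      by (auto simp: deg_mod_def)
    let ?k = "Suc (degree f)"
    have r: "r = smult (coeff h e ^ ?k) f - Q * h" using Q(3) by simp
    obtain c1 c2 where c: "c1 \<in> adjoin A b" "poly f b - u * c1 \<in> p" "c2 \<in> adjoin A b" "poly h b - u * c2 \<in> p"
      using f hS by auto
    have hAB: "coeff h e \<in> adjoin A b" using hl subset_adjoin[OF A] by blast
    have QB: "poly Q b \<in> adjoin A b" using Q(1) by (auto simp: adjoin_def)
    have "poly r b - u * (coeff h e ^ ?k * c1 - poly Q b * c2)
      = coeff h e ^ ?k * (poly f b - u * c1) - poly Q b * (poly h b - u * c2)"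
      unfolding r by (simp add: algebra_simps)
    also have "\<dots> \<in> p" by (rule is_ideal_diff[OF I is_ideal_mult[OF I c(2)] is_ideal_mult[OF I c(4)]])
    finally have "poly r b - u * (coeff h e ^ ?k * c1 - poly Q b * c2) \<in> p" .
    moreover have "coeff h e ^ ?k * c1 - poly Q b * c2 \<in> adjoin A b"
      using c hAB QB by (intro is_subring_diff[OF B] is_subring_mult[OF B] is_subring_power[OF B])
    ultimately have "r \<in> ?S" using Q(2) by blast
    then have "\<forall>i. coeff r i \<in> p" using hmin Q(4) by blast
    then show ?thesis using Q(1) r by blast
  qed
  \<comment> \<open>If \<open>e > 0\<close>, dividing \<open>g\<close> by \<open>h\<close> presents
    a nonzero multiple of \<open>g\<close> as \<open>Q * h\<close> modulo \<open>p\<close>, with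
    \<open>Q\<close> of degree below \<open>d\<close>. As \<open>poly h b\<close> is outside
    \<open>p\<close>, the value of \<open>Q\<close> at \<open>b\<close> lies in \<open>p\<close>, so
    \<open>Q\<close> vanishes by the choice of \<open>g\<close>, and with it \<open>g\<close>, a
    contradiction.\<close>
  have e0: "e = 0"
  proof (rule ccontr)
    assume e: "e \<noteq> 0"
    have hb: "poly h b \<notin> p"
    proof
      assume hb: "poly h b \<in> p"
      obtain k Q where Q: "Q \<in> polys_over A" "\<forall>i. coeff (smult (coeff h e ^ k) h0 - Q * h) i \<in> p"
        using div[OF h0S] by blast
      have "poly (smult (coeff h e ^ k) h0 - Q * h) b \<in> p" using Q(2) by (intro poly_mem_ideal[OF I]) blast
      then have "coeff h e ^ k * u \<in> p" using hb h0(2) is_ideal_diff_cancel[OF I] is_ideal_mult[OF I]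
        by (metis poly_diff poly_mult poly_smult)
      then show False using u(2) he is_prime_mult_iff[OF p] is_prime_power[OF p] by (auto simp: deg_mod_def)
    qed
    obtain k Q where Q: "Q \<in> polys_over A" "\<And>i. coeff (smult (coeff h e ^ k) g - Q * h) i \<in> p"
      using div[OF gS] by blast
    have ck: "coeff h e ^ k \<notin> p" using he is_prime_power[OF p] by (auto simp: deg_mod_def)
    have "poly (smult (coeff h e ^ k) g - Q * h) b \<in> p" using Q(2) by (rule poly_mem_ideal[OF I])
    then have "poly Q b * poly h b \<in> p" using g(2) is_ideal_diff_cancel[OF I] is_ideal_mult[OF I]
      by (metis poly_diff poly_mult poly_smult)
    then have Qb: "poly Q b \<in> p" using hb is_prime_mult_iff[OF p] by blast
    have lk: "coeff (smult (coeff h e ^ k) g) i \<in> p \<longleftrightarrow> coeff (Q * h) i \<in> p" for i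
      using Q(2)[of i] is_ideal_diff_cancel[OF I] by (metis coeff_diff)
    show False
    proof (cases "\<exists>i. coeff Q i \<notin> p")
      case True
      then obtain e' where e': "deg_mod p Q e'" using deg_mod_exists[OF I] by blast
      then have "coeff (Q * h) (e' + e) \<notin> p" using deg_mod_mult[OF p e' he] by (simp add: deg_mod_def)
      then have "coeff h e ^ k * coeff g (e' + e) \<notin> p" using lk by simp
      then have "coeff g (e' + e) \<notin> p" using is_ideal_mult[OF I] by blast
      then have "e' + e \<le> d" using g(3) by (meson deg_mod_def not_le)
      then have "\<And>i. i \<ge> d \<Longrightarrow> coeff Q i \<in> p" using e' e by (auto simp: deg_mod_def)
      then show False using gmin[OF Q(1) Qb] True by blast
    next
      case False
      then have "coeff (Q * h) d \<in> p" using coeff_mult_mem[OF I] by blast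
      then have "coeff h e ^ k * l \<in> p" using lk[of d] by (simp add: l_def)
      then show False using ck l(2) is_prime_mult_iff[OF p] by blast
    qed
  qed
  define w where "w = coeff h 0"
  have w: "w \<in> A" "w \<notin> p" using hl he e0 by (auto simp: w_def deg_mod_def)
  obtain c' where c': "c' \<in> adjoin A b" "w - u * c' \<in> p"
  proof -
    obtain c where c: "c \<in> adjoin A b" "poly h b - u * c \<in> p" using hS by blast
    have "poly h b = coeff h 0 + b * poly (poly_shift 1 h) b"
      by (cases h) (simp add: poly_shift_def coeff_pCons coeff_inverse)
    moreover have "poly (poly_shift 1 h) b \<in> p"
      using he e0 by (intro poly_mem_ideal[OF I]) (simp add: coeff_poly_shift deg_mod_def)
    ultimately have "poly h b - w \<in> p" unfolding w_def by (simp add: is_ideal_mult[OF I])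
    then have "(poly h b - u * c) - (poly h b - w) \<in> p" by (rule is_ideal_diff[OF I c(2)])
    then show ?thesis using that c by (simp add: algebra_simps)
  qed
  have wk: "w ^ k - u ^ k * c' ^ k \<in> p" for k
  proof -
    have "w - u * c' dvd w ^ k - (u * c') ^ k" by (rule dvdI[OF power_diff_sumr2])
    then show ?thesis using c'(2) by (auto simp: dvd_def power_mult_distrib is_ideal_mult_right[OF I])
  qed
  have "\<exists>k. \<exists>c\<in>A. a * c - (l * w) ^ k \<in> p" if a: "a \<in> A" "a \<notin> p" for a
  proof -
    obtain k c where c: "c \<in> adjoin A b" "a * c - u ^ k \<in> p" using uG[of a] a subset_adjoin[OF A] by blast
    have "c * c' ^ k \<in> adjoin A b" using c c' by (intro is_subring_mult[OF B] is_subring_power[OF B])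
    then obtain f where f: "f \<in> polys_over A" "c * c' ^ k = poly f b" by (auto simp: adjoin_def)
    have eq: "a * poly f b - w ^ k = (a * c - u ^ k) * c' ^ k - (w ^ k - u ^ k * c' ^ k)"
      unfolding f(2)[symmetric] by (simp add: algebra_simps)
    have af: "a * poly f b - w ^ k \<in> p"
      unfolding eq by (rule is_ideal_diff[OF I is_ideal_mult_right[OF I c(2)] wk])
    have "coeff f i \<in> p" if "i \<ge> Suc (degree f)" for i using that by (simp add: coeff_eq_0 is_ideal_0[OF I])
    from pseudo_division_mod[OF I A g(1), of d f "Suc (degree f)", OF _ f(1) this] g(3)
    obtain Q r where Q: "Q \<in> polys_over A" "r \<in> polys_over A"
      "smult (l ^ Suc (degree f)) f = Q * g + r" "\<forall>i\<ge>d. coeff r i \<in> p"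
      by (auto simp: deg_mod_def l_def)
    let ?j = "Suc (degree f)"
    \<comment> \<open>This polynomial has degree below \<open>d\<close> modulo \<open>p\<close> and
      takes a value in \<open>p\<close> at \<open>b\<close>, so by minimality of \<open>g\<close>
      all its coefficients lie in \<open>p\<close>. Only the constant one is used.\<close>
    let ?F = "smult a r - [:l ^ ?j * w ^ k:]"
    have rb: "poly r b = l ^ ?j * poly f b - poly Q b * poly g b"
      using arg_cong[OF Q(3), of "\<lambda>x. poly x b"] by simp
    have "poly ?F b = l ^ ?j * (a * poly f b - w ^ k) - a * poly Q b * poly g b"
      by (simp add: rb algebra_simps del: power_Suc)
    also have "\<dots> \<in> p" by (rule is_ideal_diff[OF I is_ideal_mult[OF I af] is_ideal_mult[OF I g(2)]])
    finally have Fb: "poly ?F b \<in> p" .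
    have FA: "?F \<in> polys_over A" using Q(2) a(1) l(1) w(1)
      by (intro is_subring_diff[OF P] polys_over_smult[OF A] polys_over_const[OF A]
          is_subring_mult[OF A] is_subring_power[OF A])
    have Fi: "coeff ?F i \<in> p" if "i \<ge> d" for i
      using that d Q(4) by (auto simp: coeff_pCons is_ideal_mult[OF I] split: nat.split)
    from gmin[OF FA Fb Fi, of 0] have "a * coeff r 0 - l ^ ?j * w ^ k \<in> p" by simp
    \<comment> \<open>The extra factor equalises the exponents of \<open>l\<close> and
      \<open>w\<close>, so that a power of the single element \<open>l * w\<close> appears.\<close>
    then have "(a * coeff r 0 - l ^ ?j * w ^ k) * (l ^ k * w ^ ?j) \<in> p" by (rule is_ideal_mult_right[OF I])
    then have "a * (coeff r 0 * (l ^ k * w ^ ?j)) - (l * w) ^ (?j + k) \<in> p"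
      by (simp add: algebra_simps power_add power_mult_distrib)
    moreover have "coeff r 0 * (l ^ k * w ^ ?j) \<in> A" using Q(2) l(1) w(1)
      by (intro is_subring_mult[OF A] is_subring_power[OF A]) (auto simp: polys_over_def)
    ultimately show ?thesis by blast
  qed
  moreover have "l * w \<in> A" "l * w \<notin> p" using l w by (auto simp: is_subring_mult[OF A] is_prime_mult_iff[OF p])
  ultimately show ?thesis unfolding G_domain_def by blast
qed

definition adjoin_list :: "'a::comm_ring_1 list \<Rightarrow> 'a set" where
  "adjoin_list bs = foldr (\<lambda>b A. adjoin A b) bs (range of_int)"

lemma is_subring_of_int: "is_subring (range (of_int :: int \<Rightarrow> 'a::comm_ring_1))"
  unfolding is_subring_def
proof (intro conjI ballI)
  show "1 \<in> range (of_int :: int \<Rightarrow> 'a)" by (metis of_int_1 rangeI)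
  fix x assume "x \<in> range (of_int :: int \<Rightarrow> 'a)"
  then obtain i where x: "x = of_int i" by blast
  then have "- x = of_int (- i)" by simp
  then show "- x \<in> range of_int" by blast
  fix y assume "y \<in> range (of_int :: int \<Rightarrow> 'a)"
  then obtain j where y: "y = of_int j" by blast
  have "x + y = of_int (i + j)" "x * y = of_int (i * j)" using x y by simp_all
  then show "x + y \<in> range of_int" "x * y \<in> range of_int" by blast+
qed

lemma is_subring_adjoin_list: "is_subring (adjoin_list bs)"
  by (induction bs) (auto simp: adjoin_list_def is_subring_of_int is_subring_adjoin)

lemma set_subset_adjoin_list: "set bs \<subseteq> adjoin_list bs"
proof (induction bs)
  case (Cons b bs)
  have "adjoin_list bs \<subseteq> adjoin_list (b # bs)" "b \<in> adjoin_list (b # bs)"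
    using subset_adjoin[OF is_subring_adjoin_list, of bs b] adjoin_self[OF is_subring_adjoin_list, of b bs]
    by (simp_all add: adjoin_list_def)
  then show ?case using Cons.IH by auto
qed simp

lemma of_int_mem_subring: "is_subring A \<Longrightarrow> of_int z \<in> A"
  by (induction z rule: int_induct[where k=0])
    (auto simp: is_subring_0 is_subring_1 is_subring_add is_subring_diff)

lemma adjoin_list_least: "is_subring B \<Longrightarrow> set bs \<subseteq> B \<Longrightarrow> adjoin_list bs \<subseteq> B"
proof (induction bs)
  case Nil
  then show ?case by (auto simp: adjoin_list_def of_int_mem_subring)
next
  case (Cons b bs)
  then show ?case using adjoin_least[of B "adjoin_list bs" b] by (simp add: adjoin_list_def)
qed

text \<open>\<open>foldr\<close> adjoins the head of the list outermost, so peeling heads off with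
  \<open>G_domain_adjoin\<close> leaves the last generator; for this reason the element of interest
  stands at the end.\<close>

lemma G_domain_adjoin_list:
  "is_prime p \<Longrightarrow> G_domain p (adjoin_list (bs @ [b])) \<Longrightarrow> G_domain p (adjoin (range of_int) b)"
proof (induction bs)
  case (Cons a bs)
  have "G_domain p (adjoin (adjoin_list (bs @ [b])) a)" using Cons.prems(2) by (simp add: adjoin_list_def)
  then have "G_domain p (adjoin_list (bs @ [b]))" by (rule G_domain_adjoin[OF Cons.prems(1) is_subring_adjoin_list])
  then show ?case by (rule Cons.IH[OF Cons.prems(1)])
qed (simp add: adjoin_list_def)

text \<open>The finite-field case of the Nullstellensatz: a finitely generated ring that is a field of
  positive characteristic has only roots of unity as units.\<close>

lemma power_torsion_maximal:
  assumes p: "is_prime (p::'a::comm_ring_1 set)" and n: "of_nat n \<in> p" "n > 0"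
    and gen: "\<And>x. \<exists>y\<in>adjoin_list bs. x - y \<in> p"
    and max: "\<And>x. x \<notin> p \<Longrightarrow> \<exists>y. x * y - 1 \<in> p" and t: "t \<notin> p"
  obtains N where "N > 0" "t ^ N - 1 \<in> p"
proof -
  note I = is_prime_ideal[OF p]
  \<comment> \<open>Modulo \<open>p\<close>, the element \<open>t\<close> is already generated by
    \<open>bs\<close>; it is adjoined once more at the bottom so that it survives the peeling. The
    resulting field needs only the trivial denominator \<open>1\<close>.\<close>
  let ?A = "adjoin_list (bs @ [t])"
  have sub: "adjoin_list bs \<subseteq> ?A"
    using set_subset_adjoin_list[of "bs @ [t]"] by (intro adjoin_list_least is_subring_adjoin_list) auto
  have "\<exists>k. \<exists>c\<in>?A. a * c - 1 ^ k \<in> p" if a: "a \<notin> p" for a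
  proof -
    obtain y where y: "a * y - 1 \<in> p" using max[OF a] by blast
    obtain c where c: "c \<in> adjoin_list bs" "y - c \<in> p" using gen by blast
    have "a * c - 1 = (a * y - 1) - a * (y - c)" by (simp add: algebra_simps)
    also have "\<dots> \<in> p" by (rule is_ideal_diff[OF I y is_ideal_mult[OF I c(2)]])
    finally show ?thesis using c sub by auto
  qed
  then have "G_domain p ?A"
    unfolding G_domain_def using is_subring_1[OF is_subring_adjoin_list] is_prime_1[OF p] by blast
  then have "G_domain p (adjoin (range of_int) t)" by (rule G_domain_adjoin_list[OF p])
  then obtain f where f: "f \<in> polys_over (range of_int)" "poly f t \<in> p" "\<exists>i. coeff f i \<notin> p"
    by (rule G_domain_adjoin_algebraic[OF p is_subring_of_int])
  obtain q where q: "prime q" "\<And>z. of_int z \<in> p \<longleftrightarrow> int q dvd z" using is_prime_nat[OF p n] by metis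
  have "\<forall>i. \<exists>z. coeff f i = of_int z \<and> (i > degree f \<longrightarrow> z = 0)"
    using f(1) by (auto simp: polys_over_def) (metis coeff_eq_0 of_int_0 rangeE)
  then obtain z where z: "\<And>i. coeff f i = of_int (z i)" "\<And>i. i > degree f \<Longrightarrow> z i = 0" by metis
  define s where "s = Abs_poly z"
  have s: "coeff s i = z i" for i unfolding s_def
    using z(2) by (subst coeff_Abs_poly[of "degree f"]) auto
  have "map_poly of_int s = f" by (rule poly_eqI) (simp add: coeff_map_poly s z)
  then have "poly (map_poly of_int s) t \<in> p" using f by simp
  moreover have "\<exists>i. \<not> int q dvd coeff s i" using f(3) q(2) by (simp add: s z)
  ultimately show ?thesis using power_torsion_of_root[OF p q(1,2)] t that by blast
qed

section \<open>Krull dimension zero\<close>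

text \<open>Every prime \<open>p\<close> above \<open>I\<close> is maximal: if \<open>x\<close>
  outside \<open>p\<close> had no inverse modulo \<open>p\<close>, the ideal generated by
  \<open>p\<close> and \<open>x\<close> would be proper and lie in a prime strictly above
  \<open>p\<close>. The residue ring is then a finitely generated field, in which the unit
  \<open>t\<close> is a root of unity.\<close>

lemma torsion_if_primes_maximal:
  assumes I: "is_ideal (I::'a::comm_ring_1 set)" and n: "of_nat n \<in> I" "n > 0"
    and gen: "\<And>x. \<exists>y\<in>adjoin_list bs. x - y \<in> I"
    and nochain: "\<And>p p'. is_prime p \<Longrightarrow> is_prime p' \<Longrightarrow> I \<subseteq> p \<Longrightarrow> p \<subset> p' \<Longrightarrow> False"
    and t: "t * t' - 1 \<in> I"
  obtains N where "N > 0" "t ^ N - 1 \<in> I"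
proof (rule torsion_of_prime_torsion[OF I n])
  fix p assume p: "is_prime p" "I \<subseteq> p"
  note pI = is_prime_ideal[OF p(1)]
  have tp: "t \<notin> p"
  proof
    assume "t \<in> p"
    moreover have "t * t' - 1 \<in> p" using t p(2) by blast
    ultimately have "t * t' - (t * t' - 1) \<in> p" by (rule is_ideal_diff[OF pI is_ideal_mult_right[OF pI]])
    then show False using is_prime_1[OF p(1)] by simp
  qed
  have max: "\<exists>y. x * y - 1 \<in> p" if x: "x \<notin> p" for x
  proof (rule ccontr)
    assume no: "\<not> ?thesis"
    define J where "J = {a + x * r | a r. a \<in> p}"
    have J: "is_ideal J"
    proof (rule is_idealI)
      show "0 \<in> J" unfolding J_def by (intro CollectI exI[of _ 0]) (simp add: is_ideal_0[OF pI])
    next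
      fix y z assume "y \<in> J" "z \<in> J"
      then obtain a r b s where "a \<in> p" "b \<in> p" "y = a + x * r" "z = b + x * s" unfolding J_def by blast
      then have "a + b \<in> p" "y + z = (a + b) + x * (r + s)"
        using is_ideal_add[OF pI] by (auto simp: algebra_simps)
      then show "y + z \<in> J" unfolding J_def by blast
    next
      fix s y assume "y \<in> J"
      then obtain a r where "a \<in> p" "y = a + x * r" unfolding J_def by blast
      then have "s * a \<in> p" "s * y = s * a + x * (s * r)"
        using is_ideal_mult[OF pI] by (auto simp: algebra_simps)
      then show "s * y \<in> J" unfolding J_def by blast
    qed
    have "1 \<notin> J"
    proof
      assume "1 \<in> J"
      then obtain a r where a: "a \<in> p" "1 = a + x * r" unfolding J_def by blast
      then have "x * r - 1 = - a" by (metis add_diff_cancel_right' diff_add_cancel minus_diff_eq)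
      then show False using no is_ideal_uminus[OF pI a(1)] by metis
    qed
    then have "J \<inter> {1} = {}" by simp
    then obtain p' where p': "is_prime p'" "J \<subseteq> p'"
      by (rule prime_ideal_avoiding[OF J, of "{1}", rotated 2]) auto
    have pJ: "a \<in> J" if "a \<in> p" for a unfolding J_def using that by (intro CollectI exI[of _ a] exI[of _ 0]) (simp add: that)
    have "x \<in> J" unfolding J_def by (intro CollectI exI[of _ 0] exI[of _ 1]) (simp add: is_ideal_0[OF pI])
    then have "p \<subset> p'" using pJ p'(2) x by blast
    then show False using nochain[OF p(1) p'(1) p(2)] by blast
  qed
  have nn: "of_nat n \<in> p" and gen': "\<exists>y\<in>adjoin_list bs. x - y \<in> p" for x
    using n(1) gen[of x] p(2) by blast+
  obtain N where "N > 0" "t ^ N - 1 \<in> p" by (rule power_torsion_maximal[OF p(1) nn n(2) gen' max tp])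
  then show "\<exists>N>0. t ^ N - 1 \<in> p" by blast
qed (use that in blast)

text \<open>Modulo \<open>I\<close> the ring is finite, since the coefficients \<open>c y\<close>
  matter only modulo \<open>n\<close>. For \<open>a\<close> in \<open>p'\<close> outside
  \<open>p\<close> two powers of \<open>a\<close> then agree modulo \<open>I\<close>, and cancelling
  in \<open>p\<close> gives \<open>a ^ m - 1\<close> in \<open>p\<close> with \<open>m > 0\<close>,
  which \<open>p'\<close> cannot contain together with \<open>a\<close>.\<close>

lemma no_prime_chain_if_finite:
  assumes I: "is_ideal (I::'a::comm_ring_1 set)" and n: "of_nat n \<in> I" "n > 0"
    and Y: "finite Y" and span: "\<And>u. \<exists>c. u - (\<Sum>y\<in>Y. of_int (c y) * y) \<in> I"
    and p: "is_prime p" and p': "is_prime p'" and sub: "I \<subseteq> p" "p \<subset> p'"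
  shows False
proof -
  define F where "F = (\<lambda>c. \<Sum>y\<in>Y. of_int (c y) * y) ` (Y \<rightarrow>\<^sub>E {0..<int n})"
  have fin: "finite F" unfolding F_def by (intro finite_imageI finite_PiE Y) auto
  have nI: "of_int z \<in> I" if "int n dvd z" for z
  proof -
    from that obtain k where "z = int n * k" by (auto simp: dvd_def)
    then show ?thesis using n by (simp add: is_ideal_mult_right[OF I])
  qed
  have "\<exists>y\<in>F. u - y \<in> I" for u
  proof -
    obtain c where c: "u - (\<Sum>y\<in>Y. of_int (c y) * y) \<in> I" using span by blast
    define d where "d = (\<lambda>y\<in>Y. c y mod int n)"
    have "(\<Sum>y\<in>Y. of_int (c y) * y) - (\<Sum>y\<in>Y. of_int (d y) * y) = (\<Sum>y\<in>Y. of_int (c y - d y) * y)"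
      by (simp add: algebra_simps sum_subtractf)
    also have "\<dots> \<in> I"
    proof (intro is_ideal_sum[OF I] is_ideal_mult_right[OF I])
      fix y assume "y \<in> Y"
      then show "of_int (c y - d y) \<in> I" unfolding d_def by (intro nI) (simp add: dvd_minus_mod)
    qed
    finally have "u - (\<Sum>y\<in>Y. of_int (d y) * y) \<in> I" using is_ideal_add[OF I c] by fastforce
    moreover have "d \<in> Y \<rightarrow>\<^sub>E {0..<int n}" unfolding d_def using n(2) by auto
    ultimately show ?thesis unfolding F_def by blast
  qed
  then obtain r where r: "\<And>u. r u \<in> F" "\<And>u. u - r u \<in> I" by metis
  obtain a where a: "a \<in> p'" "a \<notin> p" using sub by blast
  have "finite (range (\<lambda>k::nat. r (a ^ k)))" by (rule finite_subset[OF _ fin], rule image_subsetI, rule r(1))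
  then have "\<not> inj (\<lambda>k::nat. r (a ^ k))" using finite_imageD infinite_UNIV_nat by blast
  then obtain i j :: nat where ij: "i < j" "r (a ^ i) = r (a ^ j)" unfolding inj_def by (metis linorder_neqE_nat)
  have "a ^ i * (a ^ (j - i) - 1) = (a ^ j - r (a ^ j)) - (a ^ i - r (a ^ i))"
    using ij by (simp add: algebra_simps power_add[symmetric])
  also have "\<dots> \<in> p" using is_ideal_diff[OF I r(2) r(2)] sub(1) by blast
  finally have "a ^ (j - i) - 1 \<in> p" using a(2) is_prime_power[OF p] is_prime_mult_iff[OF p] by blast
  then have "a ^ (j - i) - 1 \<in> p'" using sub(2) by blast
  moreover have "a ^ (j - i) \<in> p'" using a(1) ij(1) is_ideal_mult[OF is_prime_ideal[OF p']]
    by (metis power_minus_mult zero_less_diff)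
  ultimately have "a ^ (j - i) - (a ^ (j - i) - 1) \<in> p'" using is_ideal_diff[OF is_prime_ideal[OF p']] by blast
  then show False using is_prime_1[OF p'] by simp
qed

section \<open>Prime ideals and Krull dimension of a carrier-based image of a ring type\<close>

locale ring_surjection =
  fixes \<psi> :: "'a::comm_ring_1 \<Rightarrow> 'b" and T :: "('b, 'c) ring_scheme"
  assumes surj: "carrier T = range \<psi>"
    and map_add: "\<psi> (x + y) = \<psi> x \<oplus>\<^bsub>T\<^esub> \<psi> y"
    and map_mult: "\<psi> (x * y) = \<psi> x \<otimes>\<^bsub>T\<^esub> \<psi> y"
    and map_0: "\<psi> 0 = \<zero>\<^bsub>T\<^esub>"
    and map_1: "\<psi> 1 = \<one>\<^bsub>T\<^esub>"
begin

lemma is_cring: "cring T"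
proof (rule cringI)
  show "abelian_group T"
  proof (rule abelian_groupI)
    fix x assume "x \<in> carrier T"
    then obtain u where "x = \<psi> u" by (auto simp: surj)
    then have "\<psi> (- u) \<oplus>\<^bsub>T\<^esub> x = \<zero>\<^bsub>T\<^esub>" by (simp flip: map_add map_0)
    then show "\<exists>y\<in>carrier T. y \<oplus>\<^bsub>T\<^esub> x = \<zero>\<^bsub>T\<^esub>" by (auto simp: surj)
  qed (auto simp: surj add_ac simp flip: map_add map_0)
  show "Group.comm_monoid T"
    by (rule comm_monoidI) (auto simp: surj mult_ac simp flip: map_mult map_1)
qed (auto simp: surj algebra_simps simp flip: map_mult map_add)

lemma map_minus: "\<psi> (x - y) = \<psi> x \<ominus>\<^bsub>T\<^esub> \<psi> y"
proof -
  interpret T: cring T by (rule is_cring)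
  have c: "\<psi> u \<in> carrier T" for u by (auto simp: surj)
  have "\<psi> (x - y) \<oplus>\<^bsub>T\<^esub> \<psi> y = \<psi> x" by (simp flip: map_add)
  then show ?thesis using c by (metis T.minus_eq T.a_assoc T.r_neg T.r_zero T.a_inv_closed)
qed

lemma vimage_primeideal:
  assumes P: "primeideal P T"
  shows "is_prime {u. \<psi> u \<in> P}"
proof -
  interpret P: primeideal P T by (rule P)
  have c: "\<psi> u \<in> carrier T" for u by (auto simp: surj)
  have "1 \<notin> {u. \<psi> u \<in> P}" using P.one_imp_carrier P.I_notcarr by (auto simp: map_1)
  then show ?thesis
    unfolding is_prime_def
    using P.I_prime[OF c c] c
    by (auto intro!: is_idealI simp: map_0 map_add map_mult P.I_l_closed)
qed

lemma image_is_prime: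
  assumes p: "is_prime p" and ker: "{u. \<psi> u = \<zero>\<^bsub>T\<^esub>} \<subseteq> p"
  shows "primeideal (\<psi> ` p) T" and "\<psi> u \<in> \<psi> ` p \<longleftrightarrow> u \<in> p"
proof -
  interpret T: cring T by (rule is_cring)
  note I = is_prime_ideal[OF p]
  have mem: "\<psi> u \<in> \<psi> ` p \<longleftrightarrow> u \<in> p" for u
  proof
    assume "\<psi> u \<in> \<psi> ` p"
    then obtain v where v: "v \<in> p" "\<psi> u = \<psi> v" by blast
    have "\<psi> v \<in> carrier T" by (auto simp: surj)
    then have "\<psi> (u - v) = \<zero>\<^bsub>T\<^esub>" by (simp add: map_minus v T.minus_eq T.r_neg)
    then have "u - v \<in> p" using ker by blast
    then show "u \<in> p" using v is_ideal_diff_cancel[OF I] by blast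
  qed blast
  show "\<psi> u \<in> \<psi> ` p \<longleftrightarrow> u \<in> p" by (rule mem)
  have inv: "\<ominus>\<^bsub>T\<^esub> \<psi> u = \<psi> (- u)" for u
    using map_minus[of 0 u] T.a_inv_closed[of "\<psi> u"] by (simp add: map_0 T.minus_eq surj)
  show "primeideal (\<psi> ` p) T"
  proof (rule primeidealI)
    show "ideal (\<psi> ` p) T"
    proof (rule idealI)
      show "subgroup (\<psi> ` p) (add_monoid T)"
      proof (unfold_locales, goal_cases)
        case 1 then show ?case by (auto simp: surj)
      next
        case (2 x y) then show ?case by (auto simp flip: map_add simp: mem is_ideal_add[OF I])
      next
        case 3 then show ?case by (simp flip: map_0 add: mem is_ideal_0[OF I])
      next
        case (4 x)
        then obtain u where "x = \<psi> u" "u \<in> p" by blast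
        then show ?case using inv[of u] by (simp add: a_inv_def[symmetric] mem is_ideal_uminus[OF I])
      qed
    qed (auto simp: surj mem is_ideal_mult[OF I] is_ideal_mult_right[OF I] T.ring_axioms simp flip: map_mult)
    show "carrier T \<noteq> \<psi> ` p" using is_prime_1[OF p] mem surj by (metis rangeI)
    show "cring T" by (rule is_cring)
    fix a b assume "a \<in> carrier T" "b \<in> carrier T" "a \<otimes>\<^bsub>T\<^esub> b \<in> \<psi> ` p"
    moreover from this obtain u v where "a = \<psi> u" "b = \<psi> v" by (auto simp: surj)
    ultimately show "a \<in> \<psi> ` p \<or> b \<in> \<psi> ` p"
      using mem is_prime_mult_iff[OF p] by (metis map_mult)
  qed
qed

text \<open>The first two members of any chain of positive length already form a strict pair, and
  primes of the image correspond to primes of the type above the kernel. A ring without primes has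
  supremum minus infinity, so it also falls under the bound.\<close>

lemma krull_dim_le_0_iff:
  "krull_dim T \<le> 0 \<longleftrightarrow>
     (\<forall>p p'. is_prime p \<longrightarrow> is_prime p' \<longrightarrow> {u. \<psi> u = \<zero>\<^bsub>T\<^esub>} \<subseteq> p \<longrightarrow> \<not> p \<subset> p')"
proof
  assume dim: "krull_dim T \<le> 0"
  show "\<forall>p p'. is_prime p \<longrightarrow> is_prime p' \<longrightarrow> {u. \<psi> u = \<zero>\<^bsub>T\<^esub>} \<subseteq> p \<longrightarrow> \<not> p \<subset> p'"
  proof (intro allI impI notI)
    fix p p' assume *: "is_prime p" "is_prime p'" "{u. \<psi> u = \<zero>\<^bsub>T\<^esub>} \<subseteq> p" "p \<subset> p'"
    then have ker': "{u. \<psi> u = \<zero>\<^bsub>T\<^esub>} \<subseteq> p'" by blast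
    let ?p = "\<lambda>i::nat. if i = 0 then \<psi> ` p else \<psi> ` p'"
    have "\<psi> ` p \<subset> \<psi> ` p'"
      using *(4) image_is_prime(2)[OF *(1,3)] by blast
    then have "(\<forall>i\<le>1. primeideal (?p i) T) \<and> (\<forall>i<1. ?p i \<subset> ?p (Suc i))"
      using image_is_prime(1)[OF *(1,3)] image_is_prime(1)[OF *(2) ker'] by auto
    then have "ereal (real 1) \<in> {ereal (real k) | k. \<exists>p :: nat \<Rightarrow> 'b set. (\<forall>i\<le>k. primeideal (p i) T) \<and> (\<forall>i<k. p i \<subset> p (Suc i))}"
      by (intro CollectI exI[of _ "1::nat"] conjI refl exI[of _ ?p]) auto
    then have "ereal (real 1) \<le> krull_dim T" unfolding krull_dim_def by (rule Sup_upper)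
    then have "ereal (real 1) \<le> 0" using dim by (rule order_trans)
    then show False by simp
  qed
next
  assume no: "\<forall>p p'. is_prime p \<longrightarrow> is_prime p' \<longrightarrow> {u. \<psi> u = \<zero>\<^bsub>T\<^esub>} \<subseteq> p \<longrightarrow> \<not> p \<subset> p'"
  show "krull_dim T \<le> 0"
    unfolding krull_dim_def
  proof (rule Sup_least, clarify)
    fix k and p :: "nat \<Rightarrow> 'b set"
    assume p: "\<forall>i\<le>k. primeideal (p i) T" "\<forall>i<k. p i \<subset> p (Suc i)"
    have "k = 0"
    proof (rule ccontr)
      assume "k \<noteq> 0"
      then have P: "primeideal (p 0) T" "primeideal (p 1) T" "p 0 \<subset> p 1" using p by auto
      interpret P: primeideal "p 0" T by (rule P(1))
      interpret P1: primeideal "p 1" T by (rule P(2))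
      have "{u. \<psi> u = \<zero>\<^bsub>T\<^esub>} \<subseteq> {u. \<psi> u \<in> p 0}" by auto
      moreover have "{u. \<psi> u \<in> p 0} \<subset> {u. \<psi> u \<in> p 1}"
      proof -
        obtain x where "x \<in> p 1" "x \<notin> p 0" using P(3) by blast
        moreover from this obtain u where "x = \<psi> u" using P1.a_subset unfolding surj by blast
        ultimately show ?thesis using P(3) by blast
      qed
      ultimately show False using no vimage_primeideal[OF P(1)] vimage_primeideal[OF P(2)] by blast
    qed
    then show "ereal (real k) \<le> 0" by simp
  qed
qed

end

section \<open>Extending functionals modulo \<open>n\<close>\<close>

text \<open>When the primes dividing \<open>n\<close> stay prime, this says that \<open>s\<close> is not a zero divisor modulo \<open>n\<close>.\<close>

definition content_free :: "nat \<Rightarrow> 'a::comm_ring_1 \<Rightarrow> bool" where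
  "content_free n s \<longleftrightarrow> (\<forall>q::nat. prime q \<longrightarrow> q dvd n \<longrightarrow> \<not> of_nat q dvd s)"

definition primes_stay_prime :: "'a::idom itself \<Rightarrow> bool" where
  "primes_stay_prime _ \<longleftrightarrow> (\<forall>q::nat. prime q \<longrightarrow> prime_elem (of_nat q :: 'a))"

lemma primes_stay_prime_int: "primes_stay_prime TYPE(int)"
  by (simp add: primes_stay_prime_def)

lemma primes_stay_prime_poly:
  "primes_stay_prime TYPE('a::idom) \<Longrightarrow> primes_stay_prime TYPE('a poly)"
  by (simp add: primes_stay_prime_def of_nat_poly lift_prime_elem_poly)

lemma of_nat_prime_dvd_iff:
  assumes "primes_stay_prime TYPE('a::idom)" "prime q"
  shows "(of_nat q :: 'a) dvd of_nat a \<longleftrightarrow> q dvd a"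
proof
  assume dvd: "(of_nat q :: 'a) dvd of_nat a"
  show "q dvd a"
  proof (rule ccontr)
    assume "\<not> q dvd a"
    then have "coprime (int q) (int a)" using assms(2) by (simp add: prime_imp_coprime)
    then obtain u v where "u * int q + v * int a = 1" by (metis coprime_iff_gcd_eq_1 bezout_int)
    then have "(of_int u * of_nat q + of_int v * of_nat a :: 'a) = 1"
      by (metis of_int_1 of_int_add of_int_mult of_int_of_nat_eq)
    moreover have "(of_nat q :: 'a) dvd of_int u * of_nat q + of_int v * of_nat a" using dvd by simp
    ultimately have "(of_nat q :: 'a) dvd 1" by simp
    then show False using assms by (auto simp: primes_stay_prime_def dest: prime_elem_not_unit)
  qed
qed (auto simp: dvd_def)

lemma content_free_1: "primes_stay_prime TYPE('a::idom) \<Longrightarrow> content_free n (1 :: 'a)"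
  by (auto simp: content_free_def primes_stay_prime_def dest: prime_elem_not_unit)

lemma content_free_mult:
  "primes_stay_prime TYPE('a::idom) \<Longrightarrow> content_free n (s :: 'a) \<Longrightarrow> content_free n t \<Longrightarrow> content_free n (s * t)"
  by (auto simp: content_free_def primes_stay_prime_def prime_elem_dvd_mult_iff)

text \<open>\<open>n\<close> itself is not prime, so its prime factors are divided out one by one;
  each divides \<open>u\<close> because it is prime and does not divide \<open>s\<close>.\<close>

lemma content_free_cancel:
  assumes P: "primes_stay_prime TYPE('a::idom)"
  shows "n > 0 \<Longrightarrow> content_free n (s :: 'a) \<Longrightarrow> of_nat n dvd s * u \<Longrightarrow> of_nat n dvd u"
proof (induction n arbitrary: u rule: less_induct)
  case (less n)
  show ?case
  proof (cases "n = 1")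
    case False
    then obtain q where q: "prime q" "q dvd n" using prime_factor_nat by blast
    then obtain m where m: "n = q * m" by (auto simp: dvd_def)
    have pe: "prime_elem (of_nat q :: 'a)" using P q by (simp add: primes_stay_prime_def)
    have "(of_nat q :: 'a) dvd s * u" using less.prems(3) unfolding m by (auto intro: dvd_mult_left)
    moreover have "\<not> of_nat q dvd s" using less.prems(2) q by (simp add: content_free_def)
    ultimately have "of_nat q dvd u" using pe by (simp add: prime_elem_dvd_mult_iff)
    then obtain v where v: "u = of_nat q * v" by (auto simp: dvd_def)
    have "(of_nat q :: 'a) \<noteq> 0" using pe by auto
    then have "of_nat m dvd s * v" using less.prems(3) unfolding m v by (simp add: mult.left_commute)
    moreover have "content_free m s" using less.prems(2) unfolding m by (auto simp: content_free_def)
    moreover have "m < n" "m > 0" using less.prems(1) prime_gt_1_nat[OF q(1)] unfolding m by auto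
    ultimately have "of_nat m dvd v" using less.IH by blast
    then show ?thesis unfolding m v by (simp add: mult_dvd_mono)
  qed simp
qed

text \<open>Adding a high shift of \<open>r\<close> to \<open>d s\<close> yields an element whose content is the gcd of both
  contents, so an element of least content in \<open>J\<close> has content dividing all of \<open>J\<close>.\<close>

lemma ideal_content:
  assumes P: "primes_stay_prime TYPE('a::idom)" and J: "is_ideal (J :: 'a poly set)"
    and n: "of_nat n \<in> J" "n > 0"
  obtains d d' s where "n = d * d'" "content_free n s" "of_nat d * s \<in> J" "\<And>r. r \<in> J \<Longrightarrow> of_nat d dvd r"
proof -
  note PP = primes_stay_prime_poly[OF P]
  \<comment> \<open>\<open>n\<close> qualifies with \<open>s = 1\<close>, so a least
    \<open>d\<close> exists; it is the candidate for the common content of all elements of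
    \<open>J\<close>.\<close>
  let ?P = "\<lambda>d. d dvd n \<and> (\<exists>s. content_free n s \<and> of_nat d * s \<in> J)"
  define d where "d = (LEAST d. ?P d)"
  have "?P n" using n content_free_1[OF PP] by (auto intro: exI[of _ 1])
  then have "?P d" unfolding d_def by (rule LeastI)
  then obtain s where d: "d dvd n" and s: "content_free n s" "of_nat d * s \<in> J" by blast
  have d0: "d > 0" using d n(2) by (auto intro: Nat.gr0I)
  have "of_nat d dvd r" if r: "r \<in> J" for r
  proof (rule ccontr)
    assume nd: "\<not> of_nat d dvd r"
    let ?D = "\<lambda>e. e dvd d \<and> of_nat e dvd r"
    \<comment> \<open>The greatest common divisor of \<open>d\<close> and the content of
      \<open>r\<close>. By maximality no prime divides both cofactors \<open>a\<close> and
      \<open>v\<close>.\<close>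
    define e where "e = (GREATEST e. ?D e)"
    have bnd: "?D x \<Longrightarrow> x \<le> d" for x using d0 by (simp add: dvd_imp_le)
    have e: "?D e" unfolding e_def by (rule GreatestI_nat[of ?D 1 d]) (use bnd in auto)
    then obtain a v where a: "d = e * a" and v: "r = of_nat e * v" by (auto simp: dvd_def)
    have e0: "e > 0" "a > 0" using a d0 by (auto intro: Nat.gr0I)
    have coprime: "\<not> of_nat q dvd v" if q: "prime q" "q dvd a" for q
    proof
      assume "of_nat q dvd v"
      then have "?D (e * q)" using q(2) unfolding a v by (simp add: mult_dvd_mono)
      then have "e * q \<le> e" unfolding e_def using bnd by (rule Greatest_le_nat)
      then show False using e0 prime_gt_1_nat[OF q(1)] by simp
    qed
    have "e \<noteq> d" using e nd by auto
    then have ed: "e < d" using bnd[OF e] by simp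
    \<comment> \<open>The shift exceeds \<open>degree s\<close>, so the coefficients of
      \<open>of_nat a * s\<close> and of \<open>monom 1 K * v\<close> do not overlap: a prime
      dividing their sum divides both. Since \<open>of_nat e * s'\<close> lies in \<open>J\<close>,
      this contradicts the minimality of \<open>d\<close>.\<close>
    define K where "K = Suc (degree s)"
    define s' where "s' = of_nat a * s + monom 1 K * v"
    have "content_free n s'"
      unfolding content_free_def
    proof (intro allI impI notI)
      fix q :: nat assume q: "prime q" "q dvd n" and dvd: "of_nat q dvd s'"
      have pe: "prime_elem (of_nat q :: 'a poly)" using PP q by (simp add: primes_stay_prime_def)
      have c: "of_nat q dvd coeff s' i" for i using dvd by (simp add: of_nat_poly const_poly_dvd_iff)
      show False
      proof (cases "q dvd a")
        case True
        then have "of_nat q dvd of_nat a * s" by (auto simp: dvd_def)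
        then have "of_nat q dvd monom 1 K * v" using dvd unfolding s'_def by (simp add: dvd_add_right_iff)
        then have "of_nat q dvd coeff (monom 1 K * v) (i + K)" for i by (simp add: of_nat_poly const_poly_dvd_iff)
        then have "of_nat q dvd v" by (simp add: of_nat_poly const_poly_dvd_iff coeff_monom_mult)
        then show False using coprime[OF q(1) True] by blast
      next
        case False
        have "of_nat q dvd coeff (of_nat a * s) i" for i
        proof (cases "i < K")
          case True
          then show ?thesis using c[of i] by (simp add: s'_def coeff_monom_mult)
        next
          case False
          then show ?thesis by (simp add: K_def coeff_eq_0 of_nat_poly)
        qed
        then have "of_nat q dvd of_nat a * s" by (simp add: of_nat_poly const_poly_dvd_iff)
        then have "of_nat q dvd (of_nat a :: 'a poly)" using s(1) q pe
          by (auto simp: prime_elem_dvd_mult_iff content_free_def)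
        then show False using of_nat_prime_dvd_iff[OF PP q(1)] False by blast
      qed
    qed
    moreover have "of_nat e * s' = of_nat d * s + monom 1 K * r"
      unfolding s'_def a v by (simp add: algebra_simps)
    then have "of_nat e * s' \<in> J" using s(2) r by (simp add: is_ideal_add[OF J] is_ideal_mult[OF J])
    moreover have "e dvd n" using e d dvd_trans by blast
    ultimately have "d \<le> e" unfolding d_def by (intro Least_le) blast
    then show False using ed by simp
  qed
  then show ?thesis using that[of d "n div d" s] d s by simp
qed

definition submod :: "('i \<Rightarrow> 'u::comm_ring_1) set \<Rightarrow> bool" where
  "submod V \<longleftrightarrow> (\<lambda>i. 0) \<in> V \<and> (\<forall>v\<in>V. \<forall>w\<in>V. (\<lambda>i. v i + w i) \<in> V) \<and> (\<forall>u. \<forall>v\<in>V. (\<lambda>i. u * v i) \<in> V)"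

lemma submod_0: "submod V \<Longrightarrow> (\<lambda>i. 0) \<in> V"
  and submod_add: "submod V \<Longrightarrow> v \<in> V \<Longrightarrow> w \<in> V \<Longrightarrow> (\<lambda>i. v i + w i) \<in> V"
  and submod_mult: "submod V \<Longrightarrow> v \<in> V \<Longrightarrow> (\<lambda>i. u * v i) \<in> V"
  by (auto simp: submod_def)

lemma submod_diff: "submod V \<Longrightarrow> v \<in> V \<Longrightarrow> w \<in> V \<Longrightarrow> (\<lambda>i. v i - w i) \<in> V"
  using submod_add[of V v "\<lambda>i. (-1) * w i"] submod_mult[of V w "-1"] by simp

definition unit_vec :: "'i \<Rightarrow> 'i \<Rightarrow> 'u::comm_ring_1" where
  "unit_vec i = (\<lambda>j. if j = i then 1 else 0)"

text \<open>The sum of \<open>V\<close> and the free module on the coordinates in \<open>Z\<close>.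
  It interpolates between \<open>V\<close> and the whole space, which is reached when
  \<open>Z\<close> covers every coordinate that \<open>V\<close> constrains.\<close>

definition slice :: "('i \<Rightarrow> 'u) set \<Rightarrow> 'i set \<Rightarrow> ('i \<Rightarrow> 'u) set" where
  "slice V Z = {v. \<exists>w\<in>V. \<forall>i. i \<notin> Z \<longrightarrow> v i = w i}"

lemma submod_slice:
  assumes V: "submod V" shows "submod (slice V Z)"
  unfolding submod_def
proof (intro conjI ballI allI)
  show "(\<lambda>i. 0) \<in> slice V Z" unfolding slice_def using submod_0[OF V] by auto
next
  fix v w assume "v \<in> slice V Z" "w \<in> slice V Z"
  then obtain v' w' where *: "v' \<in> V" "w' \<in> V" "\<forall>i. i \<notin> Z \<longrightarrow> v i = v' i" "\<forall>i. i \<notin> Z \<longrightarrow> w i = w' i"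
    unfolding slice_def by blast
  then show "(\<lambda>i. v i + w i) \<in> slice V Z"
    unfolding slice_def using submod_add[OF V *(1,2)] by (intro CollectI bexI[of _ "\<lambda>i. v' i + w' i"]) auto
next
  fix u v assume "v \<in> slice V Z"
  then obtain v' where *: "v' \<in> V" "\<forall>i. i \<notin> Z \<longrightarrow> v i = v' i" unfolding slice_def by blast
  then show "(\<lambda>i. u * v i) \<in> slice V Z"
    unfolding slice_def using submod_mult[OF V *(1)] by (intro CollectI bexI[of _ "\<lambda>i. u * v' i"]) auto
qed

text \<open>The type \<open>'u\<close> stands for a polynomial ring, where degree and content
  arguments are available, and \<open>'n\<close> for the Laurent polynomials, in which functionals
  take their values. The assumption \<open>content\<close> is the conclusion of
  \<open>ideal_content\<close>.\<close>

locale mod_functionals =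
  fixes n :: nat and \<theta> :: "'u::idom \<Rightarrow> 'n::comm_ring_1"
  assumes n_pos: "n > 0"
    and primes: "primes_stay_prime TYPE('u)"
    and content: "\<And>J. is_ideal J \<Longrightarrow> (of_nat n :: 'u) \<in> J \<Longrightarrow>
      \<exists>d d' s. n = d * d' \<and> content_free n s \<and> of_nat d * s \<in> J \<and> (\<forall>r\<in>J. of_nat d dvd r)"
    and hom_add: "\<theta> (a + b) = \<theta> a + \<theta> b"
    and hom_mult: "\<theta> (a * b) = \<theta> a * \<theta> b"
    and hom_1: "\<theta> 1 = 1"
    and torsion_free: "m > 0 \<Longrightarrow> of_nat m * (y :: 'n) = 0 \<Longrightarrow> y = 0"
begin

lemma hom_0: "\<theta> 0 = 0"
  using hom_add[of 0 0] by simp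

lemma hom_of_nat: "\<theta> (of_nat m) = of_nat m"
  by (induction m) (simp_all add: hom_0 hom_add hom_1)

lemma hom_diff: "\<theta> (a - b) = \<theta> a - \<theta> b"
  using hom_add[of "a - b" b] by simp

text \<open>A functional with values in \<open>N / n N\<close> is represented by a lift with values in \<open>N\<close>.\<close>

definition nlin :: "('i \<Rightarrow> 'u) set \<Rightarrow> (('i \<Rightarrow> 'u) \<Rightarrow> 'n) \<Rightarrow> bool" where
  "nlin V f \<longleftrightarrow>
     (\<forall>v\<in>V. \<forall>w\<in>V. of_nat n dvd f (\<lambda>i. v i + w i) - (f v + f w)) \<and>
     (\<forall>u. \<forall>v\<in>V. of_nat n dvd f (\<lambda>i. u * v i) - \<theta> u * f v) \<and>
     (\<forall>v. of_nat n dvd f (\<lambda>i. of_nat n * v i))"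

text \<open>In other words, \<open>s\<close> annihilates the cokernel of the restriction map from
  functionals on \<open>W\<close> to functionals on \<open>V\<close>.\<close>

definition extends :: "('i \<Rightarrow> 'u) set \<Rightarrow> ('i \<Rightarrow> 'u) set \<Rightarrow> 'u \<Rightarrow> bool" where
  "extends V W s \<longleftrightarrow> (\<forall>f. nlin V f \<longrightarrow> (\<exists>F. nlin W F \<and> (\<forall>v\<in>V. of_nat n dvd F v - \<theta> s * f v)))"

lemma nlin_add: "nlin V f \<Longrightarrow> v \<in> V \<Longrightarrow> w \<in> V \<Longrightarrow> of_nat n dvd f (\<lambda>i. v i + w i) - (f v + f w)"
  and nlin_mult: "nlin V f \<Longrightarrow> v \<in> V \<Longrightarrow> of_nat n dvd f (\<lambda>i. u * v i) - \<theta> u * f v"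
  and nlin_n: "nlin V f \<Longrightarrow> of_nat n dvd f (\<lambda>i. of_nat n * v i)"
  by (auto simp: nlin_def)

lemma extends_refl: "extends V V 1"
  by (auto simp: extends_def hom_1 intro: exI)

lemma extends_trans:
  assumes VW: "extends V W s" and WX: "extends W Z t" and sub: "V \<subseteq> W"
  shows "extends V Z (s * t)"
  unfolding extends_def
proof (intro allI impI)
  fix f assume "nlin V f"
  then obtain F where F: "nlin W F" "\<forall>v\<in>V. of_nat n dvd F v - \<theta> s * f v" using VW unfolding extends_def by blast
  then obtain G where G: "nlin Z G" "\<forall>v\<in>W. of_nat n dvd G v - \<theta> t * F v" using WX unfolding extends_def by blast
  have "of_nat n dvd G v - \<theta> (s * t) * f v" if "v \<in> V" for v
  proof -
    have "G v - \<theta> (s * t) * f v = (G v - \<theta> t * F v) + \<theta> t * (F v - \<theta> s * f v)"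
      by (simp add: algebra_simps hom_mult)
    moreover have "of_nat n dvd G v - \<theta> t * F v" "of_nat n dvd F v - \<theta> s * f v" using F G that sub by auto
    ultimately show ?thesis by (metis dvd_add dvd_mult)
  qed
  then show "\<exists>F. nlin Z F \<and> (\<forall>v\<in>V. of_nat n dvd F v - \<theta> (s * t) * f v)" using G by blast
qed

text \<open>Up to the factor \<open>s'\<close>, the module \<open>W\<close> is \<open>V\<close>
  together with one vector \<open>e\<close>. The scalars carrying \<open>e\<close> into
  \<open>V\<close> are multiples of \<open>d\<close> and include \<open>d * s\<close>. The value of
  \<open>f\<close> at \<open>d * s * e\<close> is killed by \<open>d'\<close> modulo
  \<open>n\<close>, hence is \<open>d * y\<close>, and \<open>y\<close> can serve as the value of
  \<open>s * f\<close> at \<open>e\<close>.\<close>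

lemma extends_step:
  assumes V: "submod V" and W: "submod W" and sub: "V \<subseteq> W" and e: "e \<in> W" and d: "n = d * d'"
    and dse: "(\<lambda>i. (of_nat d * s) * e i) \<in> V"
    and ann: "\<And>r. (\<lambda>i. r * e i) \<in> V \<Longrightarrow> of_nat d dvd r"
    and gen: "\<And>w. w \<in> W \<Longrightarrow> \<exists>r. (\<lambda>i. s' * w i - r * e i) \<in> V"
    and nV: "\<And>v. (\<lambda>i. of_nat n * v i) \<in> V"
  shows "extends V W (s * s')"
  unfolding extends_def
proof (intro allI impI)
  fix f assume f: "nlin V f"
  let ?q = "\<lambda>i. (of_nat d * s) * e i"
  \<comment> \<open>The vector \<open>d' * d * s * e\<close> is \<open>n\<close> times
    \<open>s * e\<close>, which itself may lie outside \<open>V\<close>; this is why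
    \<open>nlin\<close> demands that \<open>f\<close> vanish on all multiples of
    \<open>n\<close>.\<close>
  have "of_nat n dvd of_nat d' * f ?q"
  proof -
    have "of_nat n dvd f (\<lambda>i. of_nat d' * ?q i) - \<theta> (of_nat d') * f ?q" by (rule nlin_mult[OF f dse])
    moreover have "(\<lambda>i. of_nat d' * ?q i) = (\<lambda>i. of_nat n * (s * e i))" by (simp add: d mult_ac)
    then have "of_nat n dvd f (\<lambda>i. of_nat d' * ?q i)" using nlin_n[OF f, of "\<lambda>i. s * e i"] by simp
    ultimately show ?thesis by (simp add: hom_of_nat dvd_diff_right_iff)
  qed
  then obtain k where "of_nat d' * f ?q = of_nat n * k" by (auto simp: dvd_def)
  then have 0: "of_nat d' * (f ?q - of_nat d * k) = 0" by (simp add: d algebra_simps)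
  have "d' > 0" using n_pos by (simp add: d)
  then have "f ?q - of_nat d * k = 0" by (rule torsion_free[OF _ 0])
  then obtain y where y: "f ?q = of_nat d * y" by (metis right_minus_eq)
  define \<rho> where "\<rho> w = (SOME r. (\<lambda>i. s' * w i - r * e i) \<in> V)" for w
  have \<rho>: "(\<lambda>i. s' * w i - \<rho> w * e i) \<in> V" if "w \<in> W" for w
    unfolding \<rho>_def using gen[OF that] by (rule someI_ex)
  \<comment> \<open>Formally \<open>s * f w\<close> with \<open>s' * w\<close> split into its part
    in \<open>V\<close> and a multiple of \<open>e\<close>. By \<open>key\<close> the choice of the
    multiple is immaterial: two choices differ by some \<open>d * b\<close>, and \<open>s\<close>
    times the change of the part in \<open>V\<close> is \<open>b * ?q\<close>, at which
    \<open>f\<close> is \<open>b * d * y\<close>. Hence sums and scalar multiples may be computed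
    with any convenient multiple, and on \<open>V\<close> with zero.\<close>
  define F where "F w = \<theta> s * f (\<lambda>i. s' * w i - \<rho> w * e i) + \<theta> (\<rho> w) * y" for w
  have key: "of_nat n dvd F w - (\<theta> s * f (\<lambda>i. s' * w i - r * e i) + \<theta> r * y)"
    if w: "w \<in> W" and r: "(\<lambda>i. s' * w i - r * e i) \<in> V" for w r
  proof -
    let ?t = "\<lambda>i. s' * w i - r * e i" and ?t' = "\<lambda>i. s' * w i - \<rho> w * e i"
    have "(\<lambda>i. ?t i - ?t' i) \<in> V" by (rule submod_diff[OF V r \<rho>[OF w]])
    then have "(\<lambda>i. (\<rho> w - r) * e i) \<in> V" by (simp add: algebra_simps)
    then obtain b where "\<rho> w - r = of_nat d * b" using ann by (meson dvdE)
    then have b: "\<rho> w = r + of_nat d * b" by (metis add.commute diff_eq_eq)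
    have "(\<lambda>i. s * ?t i) = (\<lambda>i. s * ?t' i + b * ?q i)" unfolding b by (simp add: algebra_simps)
    then have 1: "of_nat n dvd f (\<lambda>i. s * ?t i) - (f (\<lambda>i. s * ?t' i) + f (\<lambda>i. b * ?q i))"
      using nlin_add[OF f submod_mult[OF V \<rho>[OF w], of s] submod_mult[OF V dse, of b]] by simp
    have 2: "of_nat n dvd f (\<lambda>i. s * ?t i) - \<theta> s * f ?t" by (rule nlin_mult[OF f r])
    have 3: "of_nat n dvd f (\<lambda>i. s * ?t' i) - \<theta> s * f ?t'" by (rule nlin_mult[OF f \<rho>[OF w]])
    have 4: "of_nat n dvd f (\<lambda>i. b * ?q i) - \<theta> b * f ?q" by (rule nlin_mult[OF f dse])
    have \<theta>\<rho>: "\<theta> (\<rho> w) = \<theta> r + of_nat d * \<theta> b" by (simp only: b hom_add hom_mult hom_of_nat)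
    define A B C D E where "A = f (\<lambda>i. s * ?t i)" and "B = f (\<lambda>i. s * ?t' i)"
      and "C = f (\<lambda>i. b * ?q i)" and "D = f ?t" and "E = f ?t'"
    note defs = this
    have "F w - (\<theta> s * D + \<theta> r * y) = \<theta> s * E + (\<theta> r + of_nat d * \<theta> b) * y - (\<theta> s * D + \<theta> r * y)"
      unfolding F_def \<theta>\<rho> defs ..
    also have "\<dots> = (A - \<theta> s * D) - (B - \<theta> s * E) - (A - (B + C)) - (C - \<theta> b * (of_nat d * y))"
      by (simp add: algebra_simps)
    also have "of_nat n dvd \<dots>"
      by (intro dvd_diff 1[folded defs] 2[folded defs] 3[folded defs] 4[unfolded y, folded defs])
    finally show ?thesis unfolding defs .
  qed
  have "nlin W F"
    unfolding nlin_def
  proof (intro conjI ballI allI)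
    fix v w assume v: "v \<in> W" and w: "w \<in> W"
    let ?v = "\<lambda>i. s' * v i - \<rho> v * e i" and ?w = "\<lambda>i. s' * w i - \<rho> w * e i"
    let ?x = "\<lambda>i. s' * (v i + w i) - (\<rho> v + \<rho> w) * e i"
    have x: "?x = (\<lambda>i. ?v i + ?w i)" by (simp add: algebra_simps)
    have "?x \<in> V" unfolding x by (rule submod_add[OF V \<rho>[OF v] \<rho>[OF w]])
    from key[OF submod_add[OF W v w] this]
    have 1: "of_nat n dvd F (\<lambda>i. v i + w i) - (\<theta> s * f ?x + \<theta> (\<rho> v + \<rho> w) * y)" .
    have 2: "of_nat n dvd f ?x - (f ?v + f ?w)" unfolding x by (rule nlin_add[OF f \<rho>[OF v] \<rho>[OF w]])
    have Fv: "F v = \<theta> s * f ?v + \<theta> (\<rho> v) * y" and Fw: "F w = \<theta> s * f ?w + \<theta> (\<rho> w) * y"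
      by (simp_all only: F_def)
    have alg: "a - (S * p + r1 * y + (S * q + r2 * y)) = (a - (S * x + (r1 + r2) * y)) + S * (x - (p + q))"
      for a S p q r1 r2 x :: 'n by (simp add: algebra_simps)
    have eq: "F (\<lambda>i. v i + w i) - (F v + F w)
      = (F (\<lambda>i. v i + w i) - (\<theta> s * f ?x + \<theta> (\<rho> v + \<rho> w) * y)) + \<theta> s * (f ?x - (f ?v + f ?w))"
      unfolding Fv Fw hom_add by (rule alg)
    show "of_nat n dvd F (\<lambda>i. v i + w i) - (F v + F w)" unfolding eq by (rule dvd_add[OF 1 dvd_mult[OF 2]])
  next
    fix u v assume v: "v \<in> W"
    let ?v = "\<lambda>i. s' * v i - \<rho> v * e i" and ?x = "\<lambda>i. s' * (u * v i) - (u * \<rho> v) * e i"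
    have x: "?x = (\<lambda>i. u * ?v i)" by (simp add: algebra_simps)
    have "?x \<in> V" unfolding x by (rule submod_mult[OF V \<rho>[OF v]])
    from key[OF submod_mult[OF W v] this]
    have 1: "of_nat n dvd F (\<lambda>i. u * v i) - (\<theta> s * f ?x + \<theta> (u * \<rho> v) * y)" .
    have 2: "of_nat n dvd f ?x - \<theta> u * f ?v" unfolding x by (rule nlin_mult[OF f \<rho>[OF v]])
    have Fv: "F v = \<theta> s * f ?v + \<theta> (\<rho> v) * y" by (simp only: F_def)
    have alg: "a - U * (S * p + r * y) = (a - (S * x + U * r * y)) + S * (x - U * p)"
      for a U S p r x :: 'n by (simp add: algebra_simps)
    have eq: "F (\<lambda>i. u * v i) - \<theta> u * F v
      = (F (\<lambda>i. u * v i) - (\<theta> s * f ?x + \<theta> (u * \<rho> v) * y)) + \<theta> s * (f ?x - \<theta> u * f ?v)"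
      unfolding Fv hom_mult by (rule alg)
    show "of_nat n dvd F (\<lambda>i. u * v i) - \<theta> u * F v" unfolding eq by (rule dvd_add[OF 1 dvd_mult[OF 2]])
  next
    fix v :: "'a \<Rightarrow> 'u"
    let ?n = "\<lambda>i. of_nat n * v i"
    have x: "(\<lambda>i. s' * ?n i - 0 * e i) = (\<lambda>i. of_nat n * (s' * v i))" by (simp add: algebra_simps)
    have "?n \<in> W" using nV sub by blast
    moreover have "(\<lambda>i. s' * ?n i - 0 * e i) \<in> V" unfolding x by (rule nV)
    ultimately have "of_nat n dvd F ?n - (\<theta> s * f (\<lambda>i. s' * ?n i - 0 * e i) + \<theta> 0 * y)" by (rule key)
    moreover have "of_nat n dvd \<theta> s * f (\<lambda>i. s' * ?n i - 0 * e i)"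
      unfolding x by (intro dvd_mult nlin_n[OF f])
    ultimately show "of_nat n dvd F ?n" by (simp add: hom_0 dvd_diff_left_iff)
  qed
  moreover have "of_nat n dvd F v - \<theta> (s * s') * f v" if v: "v \<in> V" for v
  proof -
    have x: "(\<lambda>i. s' * v i - 0 * e i) = (\<lambda>i. s' * v i)" by simp
    have "v \<in> W" using v sub by blast
    moreover have "(\<lambda>i. s' * v i - 0 * e i) \<in> V" unfolding x by (rule submod_mult[OF V v])
    ultimately have 1: "of_nat n dvd F v - (\<theta> s * f (\<lambda>i. s' * v i) + \<theta> 0 * y)" using key[of v 0] by (simp add: x)
    have 2: "of_nat n dvd f (\<lambda>i. s' * v i) - \<theta> s' * f v" by (rule nlin_mult[OF f v])
    have eq: "F v - \<theta> (s * s') * f v = (F v - (\<theta> s * f (\<lambda>i. s' * v i) + \<theta> 0 * y))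
      + \<theta> s * (f (\<lambda>i. s' * v i) - \<theta> s' * f v)"
      unfolding hom_mult hom_0 by (simp only: algebra_simps) simp
    show ?thesis unfolding eq by (rule dvd_add[OF 1 dvd_mult[OF 2]])
  qed
  ultimately show "\<exists>F. nlin W F \<and> (\<forall>v\<in>V. of_nat n dvd F v - \<theta> (s * s') * f v)" by blast
qed

text \<open>Coordinates are freed one at a time. The scalars carrying the unit vector at
  \<open>x\<close> into the current submodule form the ideal \<open>?J\<close>, which contains
  \<open>n\<close>; its content provides \<open>d\<close> and the multiplier for
  \<open>extends_step\<close>.\<close>

lemma extends_slice:
  assumes V: "submod V" and nV: "\<And>v. (\<lambda>i. of_nat n * v i) \<in> V" and Z: "finite Z"
  shows "\<exists>s. content_free n s \<and> extends V (slice V Z) s"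
  using Z
proof (induction Z)
  case empty
  have "slice V {} = V" by (auto simp: slice_def fun_eq_iff[symmetric])
  then show ?case using content_free_1[OF primes] extends_refl[of V] by metis
next
  case (insert x Z)
  then obtain s where s: "content_free n s" "extends V (slice V Z) s" by blast
  let ?V = "slice V Z" and ?W = "slice V (insert x Z)"
  have sub: "V \<subseteq> ?V" "?V \<subseteq> ?W" by (auto simp: slice_def)
  note sV = submod_slice[OF V, of Z] and sW = submod_slice[OF V, of "insert x Z"]
  let ?J = "{r. (\<lambda>i. r * unit_vec x i) \<in> ?V}"
  have "is_ideal ?J"
  proof (rule is_idealI)
    show "0 \<in> ?J" using submod_0[OF sV] by simp
    show "a + b \<in> ?J" if "a \<in> ?J" "b \<in> ?J" for a b
      using submod_add[OF sV, of "\<lambda>i. a * unit_vec x i" "\<lambda>i. b * unit_vec x i"] that by (simp add: distrib_right)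
    show "a * b \<in> ?J" if "b \<in> ?J" for a b
      using submod_mult[OF sV, of "\<lambda>i. b * unit_vec x i" a] that by (simp add: mult.assoc)
  qed
  moreover have "of_nat n \<in> ?J" using nV sub by blast
  ultimately obtain d d' s' where d: "n = d * d'" "content_free n s'" "of_nat d * s' \<in> ?J" "\<forall>r\<in>?J. of_nat d dvd r"
    using content by blast
  have e: "unit_vec x \<in> ?W" unfolding slice_def using submod_0[OF V]
    by (intro CollectI bexI[of _ "\<lambda>i. 0"]) (auto simp: unit_vec_def)
  have gen: "\<exists>r. (\<lambda>i. 1 * w i - r * unit_vec x i) \<in> ?V" if w: "w \<in> ?W" for w
  proof -
    obtain v where v: "v \<in> V" "\<forall>i. i \<notin> insert x Z \<longrightarrow> w i = v i" using w by (auto simp: slice_def)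
    then show ?thesis by (intro exI[of _ "w x - v x"]) (auto simp: slice_def unit_vec_def intro!: bexI[of _ v])
  qed
  have "extends ?V ?W (s' * 1)"
    by (rule extends_step[OF sV sW sub(2) e d(1) _ _ gen]) (use d nV sub in auto)
  then have "extends V ?W (s * s')" using extends_trans[OF s(2) _ sub(1)] by simp
  then show ?case using content_free_mult[OF primes s(1) d(2)] by blast
qed

lemma extends_UNIV:
  assumes "submod V" "\<And>v. (\<lambda>i. of_nat n * v i) \<in> V" "finite Z" "\<And>v. (\<And>i. i \<in> Z \<Longrightarrow> v i = 0) \<Longrightarrow> v \<in> V"
  obtains s where "content_free n s" "extends V UNIV s"
proof -
  have "slice V Z = UNIV"
  proof (intro equalityI subset_UNIV subsetI)
    fix v :: "'a \<Rightarrow> 'u"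
    show "v \<in> slice V Z" unfolding slice_def
      by (intro CollectI bexI[of _ "\<lambda>i. if i \<in> Z then 0 else v i"] assms(4)) auto
  qed
  then show ?thesis using extends_slice[OF assms(1-3)] that by auto
qed

end

section \<open>Ideals of integer polynomials in two variables modulo a prime\<close>

lemma of_nat_dvd_poly_iff: "(of_nat q :: 'a::idom poly) dvd f \<longleftrightarrow> (\<forall>i. coeff f i \<in> {c. of_nat q dvd c})"
  by (simp add: of_nat_poly const_poly_dvd_iff)

text \<open>Modulo \<open>q\<close>, every ideal of \<open>\<int>[x][y]\<close> becomes principal after inverting a single polynomial in
  \<open>x\<close>: an element \<open>h\<close> with leading coefficient of least degree in \<open>x\<close> reduces everything to bounded
  degree in \<open>y\<close>, where pseudo-division by an element \<open>g\<close> of least degree in \<open>y\<close> takes over.\<close>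

lemma ideal_principal_up_to_constants:
  fixes I :: "int poly poly set"
  assumes q: "prime (q::nat)" and I: "is_ideal I" and u0: "u0 \<in> I" "\<not> of_nat q dvd u0"
  obtains g c where "g \<in> I" "\<not> of_nat q dvd g" "\<not> of_nat q dvd c"
    "\<forall>u\<in>I. \<exists>a. of_nat q dvd [:c:] * u - a * g"
proof -
  \<comment> \<open>With \<open>p\<close> for the coefficients in \<open>y\<close> and
    \<open>p'\<close> for those in \<open>x\<close>, \<open>deg_mod p\<close> is the degree in
    \<open>y\<close> and \<open>deg_mod p'\<close> the degree in \<open>x\<close> over the field
    with \<open>q\<close> elements.\<close>
  define p where "p = {c :: int poly. of_nat q dvd c}"
  define p' where "p' = {z :: int. of_nat q dvd z}"
  have pe: "prime_elem (of_nat q :: int)" "prime_elem (of_nat q :: int poly)"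
    using q primes_stay_prime_int primes_stay_prime_poly[OF primes_stay_prime_int]
    by (auto simp: primes_stay_prime_def)
  have pp: "is_prime p" "is_prime p'" unfolding p_def p'_def using pe by (auto intro: is_prime_prime_elem)
  note Ip = is_prime_ideal[OF pp(1)] and Ip' = is_prime_ideal[OF pp(2)]
  have dvd: "of_nat q dvd (u :: int poly poly) \<longleftrightarrow> (\<forall>i. coeff u i \<in> p)" for u
    unfolding p_def by (rule of_nat_dvd_poly_iff)
  have dvd': "c \<in> p \<longleftrightarrow> (\<forall>i. coeff c i \<in> p')" for c
    unfolding p_def p'_def mem_Collect_eq[of c] by (rule of_nat_dvd_poly_iff)
  obtain j0 where j0: "coeff u0 j0 \<notin> p" using u0(2) dvd by blast
  obtain g e where g: "g \<in> I" "deg_mod p g e"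
    and gmin: "\<forall>f\<in>I. (\<forall>i\<ge>e. coeff f i \<in> p) \<longrightarrow> (\<forall>i. coeff f i \<in> p)"
    by (rule deg_mod_minimal[OF Ip u0(1) j0])
  \<comment> \<open>The minimum is taken over leading coefficients of elements of every degree in
    \<open>y\<close>, not only of the least one, so that the leading coefficient of any element can
    be reduced against that of \<open>h\<close>.\<close>
  let ?M = "\<lambda>m. \<exists>h\<in>I. \<exists>k. deg_mod p h k \<and> deg_mod p' (coeff h k) m"
  have ex_m: "\<exists>m. deg_mod p' c m" if "c \<notin> p" for c
    using that dvd' deg_mod_exists[OF Ip'] by metis
  have "\<exists>m. ?M m" using g ex_m[of "coeff g e"] by (auto simp: deg_mod_def)
  then have "?M (LEAST m. ?M m)" by (rule LeastI_ex)
  then obtain h k where h: "h \<in> I" "deg_mod p h k" "deg_mod p' (coeff h k) (LEAST m. ?M m)" by blast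
  define m where "m = (LEAST m. ?M m)"
  have mmin: "m \<le> l" if "f \<in> I" "deg_mod p f j" "deg_mod p' (coeff f j) l" for f j l
    unfolding m_def using that by (intro Least_le) blast
  define \<gamma> where "\<gamma> = coeff h k"
  have \<gamma>: "deg_mod p' \<gamma> m" using h(3) by (simp add: \<gamma>_def m_def)
  have "\<not> int q dvd coeff \<gamma> m" using \<gamma> by (simp add: deg_mod_def p'_def)
  then have "coprime (coeff \<gamma> m) (int q)" using q by (simp add: prime_imp_coprime coprime_commute)
  then obtain z y where zy: "z * coeff \<gamma> m + y * int q = 1" by (metis coprime_iff_gcd_eq_1 bezout_int)
  have reduce: "\<exists>b v. v \<in> I \<and> (\<forall>i\<ge>k. coeff v i \<in> p) \<and> u = b * h + v"
    if "u \<in> I" "\<forall>i\<ge>K. coeff u i \<in> p" for u K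
    using that
  proof (induction K arbitrary: u)
    case 0
    then show ?case by (intro exI[of _ 0] exI[of _ u]) auto
  next
    case (Suc K)
    show ?case
    proof (cases "K < k")
      case True
      then show ?thesis using Suc.prems by (intro exI[of _ 0] exI[of _ u]) auto
    next
      case False
      define \<beta> where "\<beta> = coeff u K"
      have "\<forall>i\<ge>Suc (degree \<beta>). coeff \<beta> i \<in> p'" by (auto simp: coeff_eq_0 p'_def)
      then obtain Q r where Qr: "smult (coeff \<gamma> m ^ Suc (degree \<beta>)) \<beta> = Q * \<gamma> + r" "\<forall>i\<ge>m. coeff r i \<in> p'"
        using pseudo_division_mod[OF Ip' is_subring_UNIV, of \<gamma> m \<beta> "Suc (degree \<beta>)"] \<gamma>
        by (auto simp: polys_over_def deg_mod_def)
      let ?N = "Suc (degree \<beta>)"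
      \<comment> \<open>Since \<open>z\<close> inverts the leading coefficient of
        \<open>\<gamma>\<close> modulo \<open>q\<close>, the factor introduced by pseudo-division
        can be undone: over the field with \<open>q\<close> elements this is honest division of
        \<open>\<beta>\<close> by \<open>\<gamma>\<close>.\<close>
      define Q' r' where "Q' = smult (z ^ ?N) Q" and "r' = smult (z ^ ?N) r"
      have "of_nat q dvd smult (1 - (z * coeff \<gamma> m) ^ ?N) \<beta>"
      proof -
        have "1 - z * coeff \<gamma> m dvd 1 ^ ?N - (z * coeff \<gamma> m) ^ ?N" by (rule dvdI[OF power_diff_sumr2])
        moreover have "1 - z * coeff \<gamma> m = y * int q" using zy by simp
        ultimately have "int q dvd 1 - (z * coeff \<gamma> m) ^ ?N" by (metis dvd_mult_right power_one)
        then show ?thesis by (simp add: of_nat_poly const_poly_dvd_iff)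
      qed
      moreover have "smult (1 - (z * coeff \<gamma> m) ^ ?N) \<beta> = \<beta> - smult (z ^ ?N) (smult (coeff \<gamma> m ^ ?N) \<beta>)"
        by (simp only: smult_diff_left smult_smult power_mult_distrib smult_1_left)
      ultimately have \<beta>: "\<beta> - (Q' * \<gamma> + r') \<in> p" unfolding Qr(1) p_def Q'_def r'_def by (simp add: smult_add_right)
      define u' where "u' = u - monom Q' (K - k) * h"
      have u': "u' \<in> I" unfolding u'_def by (intro is_ideal_diff[OF I] is_ideal_mult[OF I] Suc.prems(1) h(1))
      have above: "coeff u' i \<in> p" if i: "i > K" for i
      proof -
        have "coeff u i \<in> p" "coeff h (i - (K - k)) \<in> p" using Suc.prems(2) i h(2) False by (auto simp: deg_mod_def)
        then show ?thesis unfolding u'_def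
          by (auto simp: coeff_monom_mult intro!: is_ideal_diff[OF Ip] is_ideal_mult[OF Ip] is_ideal_0[OF Ip])
      qed
      have at: "coeff u' K = \<beta> - Q' * \<gamma>" using False by (auto simp: u'_def coeff_monom_mult \<beta>_def \<gamma>_def)
      \<comment> \<open>Otherwise \<open>u'\<close> would be an element of \<open>I\<close> whose
        leading coefficient in \<open>y\<close> agrees modulo \<open>q\<close> with
        \<open>r'\<close>, of degree below \<open>m\<close> in \<open>x\<close>, against the choice
        of \<open>m\<close>.\<close>
      have r: "coeff u' K \<in> p"
      proof (rule ccontr)
        assume n: "coeff u' K \<notin> p"
        then have d: "deg_mod p u' K" using above by (auto simp: deg_mod_def)
        obtain l where l: "deg_mod p' (coeff u' K) l" using ex_m[OF n] by blast
        have "m \<le> l" by (rule mmin[OF u' d l])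
        have "coeff u' K - r' \<in> p" using \<beta> by (simp add: at algebra_simps)
        then have "coeff (coeff u' K - r') l \<in> p'" using dvd' by blast
        moreover have "coeff r' l \<in> p'" using Qr(2) \<open>m \<le> l\<close> by (simp add: r'_def is_ideal_mult[OF Ip'])
        ultimately have "coeff (coeff u' K) l \<in> p'" using is_ideal_diff_cancel[OF Ip'] by simp
        then show False using l by (simp add: deg_mod_def)
      qed
      have "\<forall>i\<ge>K. coeff u' i \<in> p" using above r by (metis order_le_less)
      from Suc.IH[OF u' this] obtain b v where "v \<in> I" "\<forall>i\<ge>k. coeff v i \<in> p" "u' = b * h + v" by blast
      then show ?thesis unfolding u'_def
        by (intro exI[of _ "b + monom Q' (K - k)"] exI[of _ v]) (auto simp: algebra_simps)
    qed
  qed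
  define c0 where "c0 = coeff g e"
  have c0: "c0 \<notin> p" using g by (simp add: c0_def deg_mod_def)
  have divide: "\<exists>a. of_nat q dvd [:c0 ^ K:] * v - a * g" if v: "v \<in> I" "\<forall>i\<ge>K. coeff v i \<in> p" for v K
  proof -
    obtain Q r where Qr: "smult (c0 ^ K) v = Q * g + r" "\<forall>i\<ge>e. coeff r i \<in> p"
      using pseudo_division_mod[OF Ip is_subring_UNIV, of g e v K] g(2) v(2)
      by (auto simp: polys_over_def deg_mod_def c0_def)
    have "r = [:c0 ^ K:] * v - Q * g" using Qr(1) by simp
    moreover from this have "r \<in> I" by (auto intro!: is_ideal_diff[OF I] is_ideal_mult[OF I] v g is_ideal_uminus[OF I] simp del: mult_pCons_left)
    then have "of_nat q dvd r" using gmin Qr(2) dvd by blast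
    ultimately show ?thesis by metis
  qed
  show ?thesis
  \<comment> \<open>Only after reduction by \<open>h\<close> is the degree in \<open>y\<close>
    bounded uniformly, so that one power of \<open>c0\<close> serves all of \<open>I\<close>. The
    remainder has degree below \<open>k\<close>, but \<open>h\<close> itself has degree
    \<open>k\<close>, which accounts for \<open>Suc k\<close>.\<close>
  proof (rule that[of g "c0 ^ Suc k"])
    show "g \<in> I" by (rule g(1))
    show "\<not> of_nat q dvd g" using g(2) dvd by (auto simp: deg_mod_def)
    show "\<not> of_nat q dvd c0 ^ Suc k" using c0 is_prime_power[OF pp(1), of c0 "Suc k"] by (auto simp: p_def)
    show "\<forall>u\<in>I. \<exists>a. of_nat q dvd [:c0 ^ Suc k:] * u - a * g"
    proof
    fix u assume u: "u \<in> I"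
    have "\<forall>i\<ge>Suc (degree u). coeff u i \<in> p" by (auto simp: coeff_eq_0 p_def)
    from reduce[OF u this] obtain b v where v: "v \<in> I" "\<forall>i\<ge>k. coeff v i \<in> p" "u = b * h + v" by blast
    have v': "\<forall>i\<ge>Suc k. coeff v i \<in> p" using v(2) by auto
    have h': "\<forall>i\<ge>Suc k. coeff h i \<in> p" using h(2) by (auto simp: deg_mod_def)
    obtain a1 where a1: "of_nat q dvd [:c0 ^ Suc k:] * h - a1 * g" using divide[OF h(1) h'] by blast
    obtain a2 where a2: "of_nat q dvd [:c0 ^ Suc k:] * v - a2 * g" using divide[OF v(1) v'] by blast
    have alg: "C * (b * h + v) - (b * a1 + a2) * g = b * (C * h - a1 * g) + (C * v - a2 * g)" for C :: "int poly poly"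
      by (simp add: algebra_simps)
    have "of_nat q dvd [:c0 ^ Suc k:] * u - (b * a1 + a2) * g"
      unfolding v(3) alg by (rule dvd_add[OF dvd_mult[OF a1] a2])
    then show "\<exists>a. of_nat q dvd [:c0 ^ Suc k:] * u - a * g" by blast
    qed
  qed
qed

text \<open>A polynomial prime to \<open>q\<close> may still be divisible by other prime factors of
  \<open>n\<close>. Adding \<open>q\<close> times a monomial above its degree leaves its class
  modulo \<open>q\<close> unchanged and creates a coefficient \<open>q\<close>, which no other prime
  divides.\<close>

lemma content_free_lift:
  assumes q: "prime (q::nat)" and c: "\<not> of_nat q dvd (c :: int poly)"
  obtains c' where "content_free n c'" "of_nat q dvd c' - c"
proof -
  define c' where "c' = c + of_nat q * monom 1 (Suc (degree c))"
  have "of_nat q dvd c' - c" by (simp add: c'_def)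
  moreover have "content_free n c'"
    unfolding content_free_def
  proof (intro allI impI notI)
    fix r :: nat assume r: "prime r" "r dvd n" "of_nat r dvd c'"
    show False
    proof (cases "r = q")
      case True
      then show ?thesis using r(3) c \<open>of_nat q dvd c' - c\<close> by (metis dvd_diff diff_diff_eq2 add_diff_cancel_left')
    next
      case False
      have "of_nat r dvd coeff c' (Suc (degree c))" using r(3) by (simp add: of_nat_poly const_poly_dvd_iff)
      then have "int r dvd int q" by (simp add: c'_def of_nat_poly coeff_eq_0)
      then show ?thesis using False r(1) q by (simp add: primes_dvd_imp_eq)
    qed
  qed
  ultimately show ?thesis using that by blast
qed

section \<open>Submodules cut out by linear congruences\<close>

definition dot :: "'i set \<Rightarrow> ('i \<Rightarrow> 'u::comm_ring_1) \<Rightarrow> ('i \<Rightarrow> 'u) \<Rightarrow> 'u" where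
  "dot A v h = (\<Sum>i\<in>A. v i * h i)"

definition perp :: "nat \<Rightarrow> 'i set \<Rightarrow> ('i \<Rightarrow> 'u::comm_ring_1) set \<Rightarrow> ('i \<Rightarrow> 'u) set" where
  "perp n A H = {v. \<forall>h\<in>H. of_nat n dvd dot A v h}"

lemma dot_commute: "dot A v h = dot A h v"
  by (simp add: dot_def mult.commute)

lemma dot_add_left: "dot A (\<lambda>i. v i + w i) h = dot A v h + dot A w h"
  and dot_mult_left: "dot A (\<lambda>i. u * v i) h = u * dot A v h"
  and dot_diff_left: "dot A (\<lambda>i. v i - w i) h = dot A v h - dot A w h"
  and dot_0_left: "dot A (\<lambda>i. 0) h = 0"
  by (simp_all add: dot_def sum.distrib sum_distrib_left algebra_simps sum_subtractf)

lemma submod_perp: "submod (perp n A H)"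
  by (auto simp: submod_def perp_def dot_add_left dot_mult_left dot_0_left)

lemma n_multiple_mem_perp: "(\<lambda>i. of_nat n * v i) \<in> perp n A H"
  by (auto simp: perp_def dot_mult_left)

context mod_functionals begin

text \<open>Echelon form, up to the content-free factor \<open>s\<close>.\<close>

lemma submod_echelon:
  fixes H :: "('i \<Rightarrow> 'u) set"
  assumes H: "submod H" and nH: "\<And>v. (\<lambda>i. of_nat n * v i) \<in> H" and A: "finite A" and B: "B \<subseteq> A"
  shows "\<exists>\<eta> s. content_free n s \<and> (\<forall>j\<in>B. \<eta> j \<in> H) \<and>
    (\<forall>h\<in>H. (\<forall>i\<in>A - B. h i = 0) \<longrightarrow> (\<exists>c. \<forall>i\<in>A. s * h i = (\<Sum>j\<in>B. c j * \<eta> j i)))"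
  using finite_subset[OF B A] B
proof (induction B)
  case empty
  show ?case by (intro exI[of _ "\<lambda>j i. 0"] exI[of _ 1]) (auto simp: content_free_1[OF primes])
next
  case (insert x B)
  from insert obtain \<eta> s where s: "content_free n s" and \<eta>: "\<forall>j\<in>B. \<eta> j \<in> H"
    and gen: "\<And>h. h \<in> H \<Longrightarrow> \<forall>i\<in>A - B. h i = 0 \<Longrightarrow> \<exists>c. \<forall>i\<in>A. s * h i = (\<Sum>j\<in>B. c j * \<eta> j i)" by auto
  let ?Hx = "{h \<in> H. \<forall>i\<in>A - insert x B. h i = 0}"
  let ?J = "(\<lambda>h. h x) ` ?Hx"
  have J: "is_ideal ?J"
  proof (rule is_idealI)
    show "0 \<in> ?J" using submod_0[OF H] by (intro image_eqI[of _ _ "\<lambda>i. 0"]) auto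
  next
    fix a b assume "a \<in> ?J" "b \<in> ?J"
    then obtain h k where *: "h \<in> ?Hx" "k \<in> ?Hx" "a = h x" "b = k x" by blast
    then have "(\<lambda>i. h i + k i) \<in> ?Hx" using submod_add[OF H] by auto
    then show "a + b \<in> ?J" using * by (intro image_eqI[of _ _ "\<lambda>i. h i + k i"]) simp_all
  next
    fix u a assume "a \<in> ?J"
    then obtain h where *: "h \<in> ?Hx" "a = h x" by blast
    then have "(\<lambda>i. u * h i) \<in> ?Hx" using submod_mult[OF H] by auto
    then show "u * a \<in> ?J" using * by (intro image_eqI[of _ _ "\<lambda>i. u * h i"]) simp_all
  qed
  have nJ: "of_nat n \<in> ?J"
    using nH[of "unit_vec x"] by (intro image_eqI[of _ _ "\<lambda>i. of_nat n * unit_vec x i"]) (auto simp: unit_vec_def)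
  obtain d d' t where d: "n = d * d'" "content_free n t" "of_nat d * t \<in> ?J" "\<forall>r\<in>?J. of_nat d dvd r"
    using content[OF J nJ] by (elim exE conjE) (rule that)
  from d(3) obtain k where k: "of_nat d * t = k x" "k \<in> ?Hx" by (rule imageE)
  have "\<exists>c. \<forall>i\<in>A. (s * t) * h i = (\<Sum>j\<in>insert x B. c j * (\<eta>(x := k)) j i)" if h: "h \<in> ?Hx" for h
  proof -
    have "h x \<in> ?J" using h by (rule imageI)
    then have "of_nat d dvd h x" using d(4) by (rule bspec[rotated])
    then obtain b where b: "h x = of_nat d * b" by (rule dvdE)
    \<comment> \<open>From \<open>h x = d * b\<close> and \<open>k x = d * t\<close> the coordinate
      \<open>x\<close> cancels, and the induction hypothesis applies to the difference.\<close>
    have "(\<lambda>i. t * h i - b * k i) \<in> H"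
      using h k by (intro submod_diff[OF H] submod_mult[OF H]) auto
    moreover have "\<forall>i\<in>A - B. t * h i - b * k i = 0"
    proof
      fix i assume "i \<in> A - B"
      then show "t * h i - b * k i = 0" using h k(2) by (cases "i = x") (auto simp: b k(1)[symmetric])
    qed
    ultimately obtain c where c: "\<forall>i\<in>A. s * (t * h i - b * k i) = (\<Sum>j\<in>B. c j * \<eta> j i)" using gen by blast
    have "(\<Sum>j\<in>insert x B. (c(x := s * b)) j * (\<eta>(x := k)) j i) = s * b * k i + (\<Sum>j\<in>B. c j * \<eta> j i)" for i
      using insert.hyps by (auto intro!: sum.cong)
    then have "\<forall>i\<in>A. (s * t) * h i = (\<Sum>j\<in>insert x B. (c(x := s * b)) j * (\<eta>(x := k)) j i)"
      using c by (auto simp: algebra_simps)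
    then show ?thesis by blast
  qed
  then have "\<forall>h\<in>H. (\<forall>i\<in>A - insert x B. h i = 0) \<longrightarrow>
      (\<exists>c. \<forall>i\<in>A. (s * t) * h i = (\<Sum>j\<in>insert x B. c j * (\<eta>(x := k)) j i))" by simp
  moreover have "\<forall>j\<in>insert x B. (\<eta>(x := k)) j \<in> H" using \<eta> k by auto
  ultimately show ?case using content_free_mult[OF primes s d(2)]
    by (intro exI[of _ "\<eta>(x := k)"] exI[of _ "s * t"] conjI)
qed

lemma perp_finite:
  fixes H :: "('i \<Rightarrow> 'u) set"
  assumes H: "submod H" and nH: "\<And>v. (\<lambda>i. of_nat n * v i) \<in> H" and A: "finite A"
  obtains \<eta> where "perp n A H = {v. \<forall>j\<in>A. of_nat n dvd dot A v (\<eta> j)}"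
proof -
  obtain \<eta> s where s: "content_free n s" and \<eta>: "\<forall>j\<in>A. \<eta> j \<in> H"
    and gen: "\<And>h. h \<in> H \<Longrightarrow> \<exists>c. \<forall>i\<in>A. s * h i = (\<Sum>j\<in>A. c j * \<eta> j i)"
    using submod_echelon[OF H nH A order_refl] by auto
  have "of_nat n dvd dot A v h" if v: "\<forall>j\<in>A. of_nat n dvd dot A v (\<eta> j)" and h: "h \<in> H" for v h
  proof -
    obtain c where c: "\<forall>i\<in>A. s * h i = (\<Sum>j\<in>A. c j * \<eta> j i)" using gen[OF h] by blast
    have "s * dot A v h = (\<Sum>i\<in>A. v i * (s * h i))" by (simp add: dot_def sum_distrib_left mult_ac)
    also have "\<dots> = (\<Sum>i\<in>A. \<Sum>j\<in>A. c j * (v i * \<eta> j i))" using c by (simp add: sum_distrib_left mult_ac)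
    also have "\<dots> = (\<Sum>j\<in>A. c j * dot A v (\<eta> j))" by (subst sum.swap) (simp add: dot_def sum_distrib_left)
    also have "of_nat n dvd \<dots>" using v by (intro dvd_sum dvd_mult) auto
    finally show ?thesis by (rule content_free_cancel[OF primes n_pos s])
  qed
  then have "perp n A H = {v. \<forall>j\<in>A. of_nat n dvd dot A v (\<eta> j)}" using \<eta> by (auto simp: perp_def)
  then show ?thesis by (rule that)
qed

end

locale mod_functionals_2 = mod_functionals n \<theta>
  for n and \<theta> :: "int poly poly \<Rightarrow> 'n::comm_ring_1"
begin

text \<open>On \<open>W C\<close> the products with \<open>\<eta> x\<close> are divisible by
  \<open>m\<close>, and the new condition is that the quotients be divisible by \<open>q\<close>.
  These quotients form an ideal, generated modulo \<open>q\<close> by a single \<open>g\<close>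
  after multiplication by some \<open>c\<close> in \<open>x\<close> alone. A vector \<open>e\<close>
  with quotient \<open>g\<close> therefore generates \<open>W C\<close> over the smaller module up
  to this \<open>c\<close>, which is the situation of \<open>extends_step\<close>.\<close>

lemma extends_layer:
  fixes A :: "'i set" and \<eta> :: "'j \<Rightarrow> 'i \<Rightarrow> int poly poly"
  assumes q: "prime q" and nm: "n = q * m * l" and x: "x \<in> B"
  defines "W \<equiv> \<lambda>C. {v. (\<forall>j\<in>B. of_nat m dvd dot A v (\<eta> j)) \<and> (\<forall>j\<in>C. of_nat (q * m) dvd dot A v (\<eta> j))}"
  obtains c where "content_free n c" "extends (W (insert x C)) (W C) [:c:]"
proof -
  have sW: "submod (W C)" for C
    by (auto simp: submod_def W_def dot_add_left dot_mult_left dot_0_left)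
  have nW: "(\<lambda>i. of_nat n * v i) \<in> W C" for v C
    by (auto simp: W_def dot_mult_left nm mult.commute mult.left_commute)
  have sub: "W (insert x C) \<subseteq> W C" by (auto simp: W_def)
  have m0: "m > 0" "q > 0" using n_pos nm by auto
  then have om: "(of_nat m :: int poly poly) \<noteq> 0" by simp
  \<comment> \<open>The values at \<open>\<eta> x\<close>, divided by the factor \<open>m\<close>
    that membership in \<open>W C\<close> guarantees because \<open>x\<close> belongs to
    \<open>B\<close>.\<close>
  define I where "I = {u. \<exists>v\<in>W C. dot A v (\<eta> x) = of_nat m * u}"
  have I: "is_ideal I"
  proof (rule is_idealI)
    show "0 \<in> I" unfolding I_def using submod_0[OF sW] by (auto simp: dot_0_left intro!: bexI[of _ "\<lambda>i. 0"])
  next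
    fix a b assume "a \<in> I" "b \<in> I"
    then obtain v w where "v \<in> W C" "w \<in> W C" "dot A v (\<eta> x) = of_nat m * a" "dot A w (\<eta> x) = of_nat m * b"
      unfolding I_def by blast
    then show "a + b \<in> I" unfolding I_def using submod_add[OF sW]
      by (intro CollectI bexI[of _ "\<lambda>i. v i + w i"]) (auto simp: dot_add_left algebra_simps)
  next
    fix u a assume "a \<in> I"
    then obtain v where "v \<in> W C" "dot A v (\<eta> x) = of_nat m * a" unfolding I_def by blast
    then show "u * a \<in> I" unfolding I_def using submod_mult[OF sW]
      by (intro CollectI bexI[of _ "\<lambda>i. u * v i"]) (auto simp: dot_mult_left algebra_simps)
  qed
  have mem: "w \<in> W (insert x C) \<longleftrightarrow> of_nat (q * m) dvd dot A w (\<eta> x)" if "w \<in> W C" for w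
    using that by (auto simp: W_def)
  show ?thesis
  proof (cases "\<exists>u\<in>I. \<not> of_nat q dvd u")
    case False
    have "W C \<subseteq> W (insert x C)"
    proof
      fix v assume v: "v \<in> W C"
      then obtain u where u: "dot A v (\<eta> x) = of_nat m * u" using x by (auto simp: W_def dvd_def)
      then have "of_nat q dvd u" using False v by (auto simp: I_def)
      then have "of_nat (q * m) dvd dot A v (\<eta> x)" unfolding u by (simp add: mult_dvd_mono mult.commute)
      then show "v \<in> W (insert x C)" using mem[OF v] by blast
    qed
    then have "W (insert x C) = W C" using sub by blast
    then have "extends (W (insert x C)) (W C) [:1:]" using extends_refl by (simp add: one_pCons[symmetric])
    then show ?thesis
      using that[of 1] content_free_1[OF primes_stay_prime_poly[OF primes_stay_prime_int]] by blast
  next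
    case True
    then obtain u0 where u0: "u0 \<in> I" "\<not> of_nat q dvd u0" by blast
    obtain g c where g: "g \<in> I" "\<not> of_nat q dvd g" and c: "\<not> of_nat q dvd c"
      and gc: "\<forall>u\<in>I. \<exists>a. of_nat q dvd [:c:] * u - a * g"
      by (rule ideal_principal_up_to_constants[OF q I u0])
    obtain c' where c': "content_free n c'" "of_nat q dvd c' - c" by (rule content_free_lift[OF q c])
    have cc: "of_nat q dvd [:c' - c:]" using c'(2) by (simp add: of_nat_poly)
    obtain e where e: "e \<in> W C" "dot A e (\<eta> x) = of_nat m * g" using g(1) unfolding I_def by blast
    have "extends (W (insert x C)) (W C) (1 * [:c':])"
    proof (rule extends_step[OF sW sW sub e(1), of q "m * l"])
      show "n = q * (m * l)" using nm by simp
      have "(\<lambda>i. of_nat q * e i) \<in> W C" by (rule submod_mult[OF sW e(1)])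
      then show "(\<lambda>i. of_nat q * 1 * e i) \<in> W (insert x C)" using mem by (simp add: dot_mult_left e(2) mult_dvd_mono)
    next
      \<comment> \<open>As \<open>q\<close> is prime and does not divide \<open>g\<close>, the
        scalars carrying \<open>e\<close> into the smaller module are exactly the multiples of
        \<open>q\<close>; so the first multiplier in \<open>extends_step\<close> is \<open>1\<close>
        and only \<open>c'\<close> remains.\<close>
      fix r assume "(\<lambda>i. r * e i) \<in> W (insert x C)"
      then have "of_nat (q * m) dvd r * (of_nat m * g)" by (simp add: W_def dot_mult_left e(2)[symmetric])
      then have "of_nat m * of_nat q dvd of_nat m * (r * g)" by (simp add: mult_ac)
      then have "of_nat q dvd r * g" using om by simp
      then show "of_nat q dvd r" using g(2) primes q by (auto simp: primes_stay_prime_def prime_elem_dvd_mult_iff)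
    next
      fix w assume w: "w \<in> W C"
      then obtain u where u: "dot A w (\<eta> x) = of_nat m * u" using x by (auto simp: W_def dvd_def)
      then obtain a where a: "of_nat q dvd [:c:] * u - a * g" using gc w by (auto simp: I_def)
      have "[:c':] * u - a * g = [:c' - c:] * u + ([:c:] * u - a * g)"
        by (simp add: smult_diff_left)
      then have "of_nat q dvd [:c':] * u - a * g" using a cc by (metis dvd_add dvd_mult2)
      then have "of_nat (q * m) dvd of_nat m * ([:c':] * u - a * g)" by (simp add: mult_dvd_mono mult.commute[of "of_nat q"] del: mult_pCons_left)
      also have "\<dots> = dot A (\<lambda>i. [:c':] * w i - a * e i) (\<eta> x)"
        unfolding dot_diff_left dot_mult_left u e(2) by (simp add: algebra_simps del: mult_pCons_left)
      finally have "of_nat (q * m) dvd dot A (\<lambda>i. [:c':] * w i - a * e i) (\<eta> x)" .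
      moreover have "(\<lambda>i. [:c':] * w i - a * e i) \<in> W C"
        by (intro submod_diff[OF sW] submod_mult[OF sW] w e(1))
      ultimately show "\<exists>r. (\<lambda>i. [:c':] * w i - r * e i) \<in> W (insert x C)" using mem by blast
    qed (rule nW)
    then show ?thesis using that[OF c'(1)] by simp
  qed
qed

text \<open>The solution sets modulo the divisors of \<open>n\<close> are climbed from
  \<open>n\<close> down to \<open>1\<close>, where the congruences are void. Each step removes one
  prime factor, one congruence at a time, and the product of the multipliers is again a content-free
  polynomial in \<open>x\<close>.\<close>

lemma extends_perp_UNIV:
  fixes A :: "'i set"
  assumes A: "finite A" and H: "submod H" and nH: "\<And>v. (\<lambda>i. of_nat n * v i) \<in> H"
  obtains c where "content_free n c" "extends (perp n A H) UNIV [:c:]"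
proof -
  obtain \<eta> where \<eta>: "perp n A H = {v. \<forall>j\<in>A. of_nat n dvd dot A v (\<eta> j)}" by (rule perp_finite[OF H nH A])
  define V where "V m = {v. \<forall>j\<in>A. of_nat m dvd dot A v (\<eta> j)}" for m
  note PI = primes_stay_prime_poly[OF primes_stay_prime_int]
  have layer: "\<exists>c. content_free n c \<and> extends (V (q * m)) (V m) [:c:]" if q: "prime q" and nm: "n = q * m * l" for q m l
  proof -
    define W where "W C = {v. (\<forall>j\<in>A. of_nat m dvd dot A v (\<eta> j)) \<and> (\<forall>j\<in>C. of_nat (q * m) dvd dot A v (\<eta> j))}" for C
    have "\<exists>c. content_free n c \<and> extends (W C) (W {}) [:c:]" if "C \<subseteq> A" for C
      using finite_subset[OF that A] that
    proof (induction C)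
      case empty
      have "extends (W {}) (W {}) [:1:]" using extends_refl by (simp add: one_pCons[symmetric])
      then show ?case using content_free_1[OF PI] by blast
    next
      case (insert x C)
      then obtain c where c: "content_free n c" "extends (W C) (W {}) [:c:]" by auto
      obtain c' where c': "content_free n c'" "extends (W (insert x C)) (W C) [:c':]"
        using extends_layer[OF q nm, of x A A \<eta> C] insert.prems unfolding W_def by blast
      have "W (insert x C) \<subseteq> W C" by (auto simp: W_def)
      from extends_trans[OF c'(2) c(2) this] have "extends (W (insert x C)) (W {}) [:c' * c:]" by (simp add: mult.commute)
      then show ?case using content_free_mult[OF PI c'(1) c(1)] by blast
    qed
    moreover have "W A = V (q * m)"
      unfolding W_def V_def by (auto intro: dvd_mult_right)
    moreover have "W {} = V m" by (simp add: W_def V_def)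
    ultimately show ?thesis by (metis order_refl)
  qed
  have "\<exists>c. content_free n c \<and> extends (V m) UNIV [:c:]" if "m dvd n" for m
    using that
  proof (induction m rule: less_induct)
    case (less m)
    show ?case
    proof (cases "m = 1")
      case True
      then have "V m = UNIV" by (simp add: V_def)
      then have "extends (V m) UNIV [:1:]" using extends_refl by (simp add: one_pCons[symmetric])
      then show ?thesis using content_free_1[OF PI] by blast
    next
      case False
      then obtain q where q: "prime q" "q dvd m" using prime_factor_nat by blast
      then obtain k where k: "m = q * k" by (auto simp: dvd_def)
      obtain l where l: "n = q * k * l" using less.prems k by (auto simp: dvd_def)
      have "k < m" using n_pos prime_gt_1_nat[OF q(1)] l k by auto
      moreover have "k dvd n" using l by simp
      ultimately obtain c where c: "content_free n c" "extends (V k) UNIV [:c:]" using less.IH by blast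
      obtain c' where c': "content_free n c'" "extends (V m) (V k) [:c':]" using layer[OF q(1) l] k by blast
      have "V m \<subseteq> V k" unfolding V_def k by (auto intro: dvd_mult_right)
      from extends_trans[OF c'(2) c(2) this] have "extends (V m) UNIV [:c' * c:]" by (simp add: mult.commute)
      then show ?thesis using content_free_mult[OF PI c'(1) c(1)] by blast
    qed
  qed
  from this[of n] obtain c where "content_free n c" "extends (V n) UNIV [:c:]" by auto
  then show ?thesis using that \<eta> by (simp add: V_def)
qed

end

section \<open>Group rings over \<open>\<int>/n\<close>\<close>

lemma ZMod_hom: "ZMod k \<in> ring_hom \<Z> (ZFact k)"
proof -
  interpret ideal "Idl\<^bsub>\<Z>\<^esub> {k}" \<Z> by (rule int.genideal_ideal) simp
  have "ZMod k = (+>\<^bsub>\<Z>\<^esub>) (Idl\<^bsub>\<Z>\<^esub> {k})" by (rule ext) (simp add: ZMod_def)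
  then show ?thesis using rcos_ring_hom by (simp add: ZFact_def)
qed

lemma ZMod_add: "ZMod k (a + b) = ZMod k a \<oplus>\<^bsub>ZFact k\<^esub> ZMod k b"
  and ZMod_mult: "ZMod k (a * b) = ZMod k a \<otimes>\<^bsub>ZFact k\<^esub> ZMod k b"
  and ZMod_1: "ZMod k 1 = \<one>\<^bsub>ZFact k\<^esub>"
  and ZMod_closed: "ZMod k a \<in> carrier (ZFact k)"
  using ring_hom_add[OF ZMod_hom] ring_hom_mult[OF ZMod_hom] ring_hom_one[OF ZMod_hom]
    ring_hom_closed[OF ZMod_hom] by simp_all

lemma ZMod_0: "ZMod k 0 = \<zero>\<^bsub>ZFact k\<^esub>"
  using ring_hom_zero[OF ZMod_hom] ZFact_is_cring[of k] by (simp add: cring_def int.ring_axioms)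

lemma ZFact_carrier: "carrier (ZFact k) = range (ZMod k)"
  by (auto simp: ZFact_def FactRing_def A_RCOSETS_def RCOSETS_def ZMod_def a_r_coset_def)

lemma ZMod_eq_iff: "ZMod k a = ZMod k b \<longleftrightarrow> k dvd a - b"
  by (simp add: ZMod_eq_mod mod_eq_dvd_iff)

lemma ZMod_eq_0_iff: "ZMod k a = \<zero>\<^bsub>ZFact k\<^esub> \<longleftrightarrow> k dvd a"
  using ZMod_eq_iff[of k a 0] by (simp add: ZMod_0)

lemma ZMod_minus: "ZMod k (- a) = \<ominus>\<^bsub>ZFact k\<^esub> ZMod k a"
proof -
  interpret K: cring "ZFact k" by (rule ZFact_is_cring)
  have "ZMod k (- a) \<oplus>\<^bsub>ZFact k\<^esub> ZMod k a = \<zero>\<^bsub>ZFact k\<^esub>" by (simp flip: ZMod_add ZMod_0)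
  then show ?thesis using ZMod_closed[of k] K.minus_equality by metis
qed

lemma ZMod_sum: "(\<Oplus>\<^bsub>ZFact k\<^esub>x\<in>A. ZMod k (f x)) = ZMod k (\<Sum>x\<in>A. f x)"
proof -
  interpret K: cring "ZFact k" by (rule ZFact_is_cring)
  show ?thesis
    by (induction A rule: infinite_finite_induct) (auto simp: ZMod_0 ZMod_add ZMod_closed)
qed

lemma finite_ZFact: "k > 0 \<Longrightarrow> finite (carrier (ZFact k))"
proof -
  assume k: "k > 0"
  have "carrier (ZFact k) \<subseteq> ZMod k ` {0..<k}"
  proof
    fix x assume "x \<in> carrier (ZFact k)"
    then obtain a where "x = ZMod k a" by (auto simp: ZFact_carrier)
    then show "x \<in> ZMod k ` {0..<k}" using k by (auto simp: ZMod_mod[of k a])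
  qed
  then show ?thesis by (rule finite_subset) simp
qed

text \<open>The class of zero is represented by \<open>0\<close> itself, so that lifting a finitely
  supported function coefficientwise keeps its support finite.\<close>

definition ZRep :: "int \<Rightarrow> int set \<Rightarrow> int" where
  "ZRep k x = (if x = \<zero>\<^bsub>ZFact k\<^esub> then 0 else SOME a. ZMod k a = x)"

lemma ZMod_ZRep: "x \<in> carrier (ZFact k) \<Longrightarrow> ZMod k (ZRep k x) = x"
proof -
  assume "x \<in> carrier (ZFact k)"
  then have "\<exists>a. ZMod k a = x" by (auto simp: ZFact_carrier)
  then have "ZMod k (SOME a. ZMod k a = x) = x" by (rule someI_ex)
  then show ?thesis by (simp add: ZRep_def ZMod_0)
qed

lemma ZRep_0: "ZRep k \<zero>\<^bsub>ZFact k\<^esub> = 0"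
  by (simp add: ZRep_def)

section \<open>Integral group rings and their maps to group rings over residues\<close>

definition pairing :: "('e \<Rightarrow> int) \<Rightarrow> ('e \<Rightarrow>\<^sub>0 int) \<Rightarrow> int" where
  "pairing \<phi> u = (\<Sum>a\<in>Poly_Mapping.keys u. Poly_Mapping.lookup u a * \<phi> a)"

lemma pairing_superset:
  assumes "finite A" "Poly_Mapping.keys u \<subseteq> A"
  shows "pairing \<phi> u = (\<Sum>a\<in>A. Poly_Mapping.lookup u a * \<phi> a)"
  unfolding pairing_def by (rule sum.mono_neutral_left) (use assms in \<open>auto simp: in_keys_iff\<close>)

lemma pairing_diff: "pairing \<phi> (u - v) = pairing \<phi> u - pairing \<phi> v"
proof -
  let ?A = "Poly_Mapping.keys u \<union> Poly_Mapping.keys v"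
  have "Poly_Mapping.keys (u - v) \<subseteq> ?A" by (rule keys_diff)
  then have "pairing \<phi> (u - v) = (\<Sum>a\<in>?A. Poly_Mapping.lookup (u - v) a * \<phi> a)" by (intro pairing_superset) auto
  also have "\<dots> = (\<Sum>a\<in>?A. Poly_Mapping.lookup u a * \<phi> a) - (\<Sum>a\<in>?A. Poly_Mapping.lookup v a * \<phi> a)"
    by (simp add: lookup_minus left_diff_distrib sum_subtractf)
  also have "\<dots> = pairing \<phi> u - pairing \<phi> v"
    by (subst (1 2) pairing_superset[of ?A]) auto
  finally show ?thesis .
qed

lemma pairing_0: "pairing \<phi> 0 = 0"
  and pairing_frag_of: "pairing \<phi> (frag_of a) = \<phi> a"
  by (simp_all add: pairing_def)

text \<open>Only the additive map induced by \<open>\<mu>\<close> on formal sums: the type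
  \<open>'l\<close> carries no group structure, so its formal sums have no product. Multiplicativity
  reappears in coefficient form in \<open>lookup_push_mult\<close>.\<close>

definition push :: "('e \<Rightarrow> 'l) \<Rightarrow> ('e \<Rightarrow>\<^sub>0 int) \<Rightarrow> 'l \<Rightarrow>\<^sub>0 int" where
  "push \<mu> = frag_extend (frag_of \<circ> \<mu>)"

lemma push_0: "push \<mu> 0 = 0"
  and push_diff: "push \<mu> (u - v) = push \<mu> u - push \<mu> v"
  and push_add: "push \<mu> (u + v) = push \<mu> u + push \<mu> v"
  and push_cmul: "push \<mu> (frag_cmul k u) = frag_cmul k (push \<mu> u)"
  and push_frag_of: "push \<mu> (frag_of a) = frag_of (\<mu> a)"
  and push_sum: "finite A \<Longrightarrow> push \<mu> (\<Sum>x\<in>A. f x) = (\<Sum>x\<in>A. push \<mu> (f x))"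
  by (simp_all add: push_def frag_extend_diff frag_extend_add frag_extend_cmul frag_extend_sum comp_def)

lemma keys_push: "Poly_Mapping.keys (push \<mu> u) \<subseteq> range \<mu>"
  using keys_frag_extend[of "frag_of \<circ> \<mu>" u] by (auto simp: push_def)

lemma pairing_push: "pairing \<phi> (push \<mu> u) = pairing (\<lambda>a. \<phi> (\<mu> a)) u"
  using subset_UNIV
  by (induction u rule: frag_induction)
    (auto simp: push_diff push_0 push_frag_of pairing_diff pairing_0 pairing_frag_of)

lemma lookup_frag_of_mult:
  fixes v :: "'e::ab_group_add \<Rightarrow>\<^sub>0 int"
  shows "Poly_Mapping.lookup (frag_of a * v) b = Poly_Mapping.lookup v (b - a)"
  using subset_UNIV
proof (induction v rule: frag_induction)
  case (one c)
  then show ?case by (auto simp: mult_single algebra_simps)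
qed (auto simp: right_diff_distrib lookup_minus)

lemma lookup_mult_pairing:
  fixes v :: "'e::ab_group_add \<Rightarrow>\<^sub>0 int"
  shows "Poly_Mapping.lookup (u * v) b = pairing (\<lambda>a. Poly_Mapping.lookup v (b - a)) u"
  using subset_UNIV
  by (induction u rule: frag_induction)
    (auto simp: left_diff_distrib lookup_minus pairing_diff pairing_0 pairing_frag_of lookup_frag_of_mult)

definition exponent_map :: "('l, 'm) monoid_scheme \<Rightarrow> ('e::comm_monoid_add \<Rightarrow> 'l) \<Rightarrow> bool" where
  "exponent_map G \<mu> \<longleftrightarrow> (\<forall>a. \<mu> a \<in> carrier G) \<and> \<mu> 0 = \<one>\<^bsub>G\<^esub> \<and> (\<forall>a b. \<mu> (a + b) = \<mu> a \<otimes>\<^bsub>G\<^esub> \<mu> b)"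

locale zn_group_ring = G: comm_group G for G :: "('l, 'm) monoid_scheme" +
  fixes n :: nat
  assumes n_gt_0: "n > 0"
begin

abbreviation "K \<equiv> ZFact (int n)"
abbreviation "R \<equiv> group_ring K G"
abbreviation "cls \<equiv> ZMod (int n)"
abbreviation "rep \<equiv> ZRep (int n)"

text \<open>The ring homomorphism from the integral group ring on the exponents, followed by
  reduction modulo \<open>n\<close>. It lets results on ring types act on the carrier-based ring
  \<open>R\<close>.\<close>

definition gmap :: "('e::comm_monoid_add \<Rightarrow> 'l) \<Rightarrow> ('e \<Rightarrow>\<^sub>0 int) \<Rightarrow> 'l \<Rightarrow> int set" where
  "gmap \<mu> u = (\<lambda>g\<in>carrier G. cls (Poly_Mapping.lookup (push \<mu> u) g))"

lemma K_cring: "cring K"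
  by (rule ZFact_is_cring)

lemma R_sel:
  "carrier R = finsupp_funs G K"
  "monoid.mult R r s = (\<lambda>g\<in>carrier G. \<Oplus>\<^bsub>K\<^esub>h\<in>gsupp G K r. r h \<otimes>\<^bsub>K\<^esub> s (inv\<^bsub>G\<^esub> h \<otimes>\<^bsub>G\<^esub> g))"
  "\<one>\<^bsub>R\<^esub> = gmonom G K \<one>\<^bsub>K\<^esub> \<one>\<^bsub>G\<^esub>"
  "\<zero>\<^bsub>R\<^esub> = (\<lambda>g\<in>carrier G. \<zero>\<^bsub>K\<^esub>)"
  "r \<oplus>\<^bsub>R\<^esub> s = (\<lambda>g\<in>carrier G. r g \<oplus>\<^bsub>K\<^esub> s g)"
  by (simp_all add: group_ring_def)

lemma gmap_closed: "gmap \<mu> u \<in> carrier R"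
proof -
  let ?w = "push \<mu> u"
  have "gsupp G K (gmap \<mu> u) \<subseteq> Poly_Mapping.keys ?w"
    by (auto simp: gsupp_def gmap_def in_keys_iff ZMod_0)
  then have "finite (gsupp G K (gmap \<mu> u))" by (rule finite_subset) simp
  then show ?thesis by (auto simp: R_sel finsupp_funs_def gmap_def ZMod_closed)
qed

lemma gmap_add: "gmap \<mu> (u + v) = gmap \<mu> u \<oplus>\<^bsub>R\<^esub> gmap \<mu> v"
  unfolding gmap_def R_sel by (rule restrict_ext) (simp add: push_add lookup_add ZMod_add)

lemma gmap_0: "gmap \<mu> 0 = \<zero>\<^bsub>R\<^esub>"
  unfolding gmap_def R_sel by (rule restrict_ext) (simp add: push_0 ZMod_0)

lemma gmap_frag_of: "gmap \<mu> (frag_of a) = gmonom G K \<one>\<^bsub>K\<^esub> (\<mu> a)"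
  unfolding gmap_def gmonom_def by (rule restrict_ext) (simp add: push_frag_of ZMod_0 ZMod_1)

lemma gmap_1: "exponent_map G \<mu> \<Longrightarrow> gmap \<mu> 1 = \<one>\<^bsub>R\<^esub>"
  using gmap_frag_of[of \<mu> 0] by (simp add: exponent_map_def R_sel single_one)

text \<open>Convolution computed on integer lifts. Only a pointwise lift \<open>s'\<close> of the
  second factor enters, so the formula also serves for lifted values of functionals.\<close>

lemma gmap_mult_apply:
  assumes \<mu>: "exponent_map G \<mu>" and s: "\<And>g. g \<in> carrier G \<Longrightarrow> cls (s' g) = s g" and g: "g \<in> carrier G"
  shows "(gmap \<mu> u \<otimes>\<^bsub>R\<^esub> s) g = cls (pairing (\<lambda>a. s' (inv\<^bsub>G\<^esub> (\<mu> a) \<otimes>\<^bsub>G\<^esub> g)) u)"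
proof -
  interpret K: cring K by (rule K_cring)
  let ?w = "push \<mu> u"
  let ?S = "gsupp G K (gmap \<mu> u)"
  have sub: "?S \<subseteq> Poly_Mapping.keys ?w" by (auto simp: gsupp_def gmap_def in_keys_iff ZMod_0)
  have wG: "Poly_Mapping.keys ?w \<subseteq> carrier G" using keys_push[of \<mu> u] \<mu> by (auto simp: exponent_map_def)
  have "(gmap \<mu> u \<otimes>\<^bsub>R\<^esub> s) g = (\<Oplus>\<^bsub>K\<^esub>h\<in>?S. gmap \<mu> u h \<otimes>\<^bsub>K\<^esub> s (inv\<^bsub>G\<^esub> h \<otimes>\<^bsub>G\<^esub> g))"
    using g by (simp add: R_sel)
  also have "\<dots> = (\<Oplus>\<^bsub>K\<^esub>h\<in>?S. cls (Poly_Mapping.lookup ?w h * s' (inv\<^bsub>G\<^esub> h \<otimes>\<^bsub>G\<^esub> g)))"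
  proof (rule K.finsum_cong')
    fix h assume h: "h \<in> ?S"
    then have "h \<in> carrier G" by (auto simp: gsupp_def)
    then show "gmap \<mu> u h \<otimes>\<^bsub>K\<^esub> s (inv\<^bsub>G\<^esub> h \<otimes>\<^bsub>G\<^esub> g) = cls (Poly_Mapping.lookup ?w h * s' (inv\<^bsub>G\<^esub> h \<otimes>\<^bsub>G\<^esub> g))"
      using g s by (simp add: gmap_def ZMod_mult)
  qed (auto simp: ZMod_closed)
  also have "\<dots> = cls (\<Sum>h\<in>?S. Poly_Mapping.lookup ?w h * s' (inv\<^bsub>G\<^esub> h \<otimes>\<^bsub>G\<^esub> g))"
    by (rule ZMod_sum)
  also have "\<dots> = cls (\<Sum>h\<in>Poly_Mapping.keys ?w. Poly_Mapping.lookup ?w h * s' (inv\<^bsub>G\<^esub> h \<otimes>\<^bsub>G\<^esub> g))"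
  proof -
    \<comment> \<open>A key whose coefficient is a multiple of \<open>n\<close> drops out of the
      support of \<open>gmap \<mu> u\<close>, but then its summand vanishes modulo \<open>n\<close>
      as well.\<close>
    have "int n dvd (\<Sum>h\<in>Poly_Mapping.keys ?w - ?S. Poly_Mapping.lookup ?w h * s' (inv\<^bsub>G\<^esub> h \<otimes>\<^bsub>G\<^esub> g))"
    proof (intro dvd_sum dvd_mult2)
      fix h assume "h \<in> Poly_Mapping.keys ?w - ?S"
      then show "int n dvd Poly_Mapping.lookup ?w h" using wG by (auto simp: gsupp_def gmap_def ZMod_eq_0_iff)
    qed
    then show ?thesis unfolding ZMod_eq_iff
      by (subst sum.subset_diff[OF sub]) (simp_all add: algebra_simps)
  qed
  also have "\<dots> = cls (pairing (\<lambda>h. s' (inv\<^bsub>G\<^esub> h \<otimes>\<^bsub>G\<^esub> g)) ?w)" by (simp add: pairing_def)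
  also have "\<dots> = cls (pairing (\<lambda>a. s' (inv\<^bsub>G\<^esub> (\<mu> a) \<otimes>\<^bsub>G\<^esub> g)) u)"
    by (simp only: pairing_push)
  finally show ?thesis .
qed

lemma lookup_push_mult:
  assumes \<mu>: "exponent_map G \<mu>" and g: "g \<in> carrier G"
  shows "Poly_Mapping.lookup (push \<mu> (u * v)) g
    = pairing (\<lambda>a. Poly_Mapping.lookup (push \<mu> v) (inv\<^bsub>G\<^esub> (\<mu> a) \<otimes>\<^bsub>G\<^esub> g)) u"
  using subset_UNIV
proof (induction u rule: frag_induction)
  case (one a)
  have "Poly_Mapping.lookup (push \<mu> (frag_of a * v)) g
    = Poly_Mapping.lookup (push \<mu> v) (inv\<^bsub>G\<^esub> (\<mu> a) \<otimes>\<^bsub>G\<^esub> g)"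
    using subset_UNIV
  proof (induction v rule: frag_induction)
    case (one b)
    have "g = \<mu> a \<otimes>\<^bsub>G\<^esub> \<mu> b \<longleftrightarrow> inv\<^bsub>G\<^esub> (\<mu> a) \<otimes>\<^bsub>G\<^esub> g = \<mu> b"
      using \<mu> g by (metis exponent_map_def G.inv_solve_left)
    then show ?case using \<mu> by (auto simp: mult_single exponent_map_def push_frag_of)
  qed (auto simp: right_diff_distrib push_diff push_0 lookup_minus)
  then show ?case by (simp add: pairing_frag_of)
qed (auto simp: left_diff_distrib push_diff push_0 lookup_minus pairing_diff pairing_0)

lemma gmap_mult:
  assumes \<mu>: "exponent_map G \<mu>"
  shows "gmap \<mu> (u * v) = gmap \<mu> u \<otimes>\<^bsub>R\<^esub> gmap \<mu> v"
proof (rule ext)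
  fix g
  show "gmap \<mu> (u * v) g = (gmap \<mu> u \<otimes>\<^bsub>R\<^esub> gmap \<mu> v) g"
  proof (cases "g \<in> carrier G")
    case True
    have "(gmap \<mu> u \<otimes>\<^bsub>R\<^esub> gmap \<mu> v) g
      = cls (pairing (\<lambda>a. Poly_Mapping.lookup (push \<mu> v) (inv\<^bsub>G\<^esub> (\<mu> a) \<otimes>\<^bsub>G\<^esub> g)) u)"
      by (rule gmap_mult_apply[OF \<mu> _ True, where s' = "Poly_Mapping.lookup (push \<mu> v)"]) (simp add: gmap_def)
    moreover have "gmap \<mu> (u * v) g = cls (Poly_Mapping.lookup (push \<mu> (u * v)) g)"
      using True by (simp add: gmap_def)
    ultimately show ?thesis unfolding lookup_push_mult[OF \<mu> True] by simp
  next
    case False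
    then show ?thesis by (simp add: gmap_def R_sel)
  qed
qed

text \<open>The carrier-based group is presented as a quotient of an additive group that is a type:
  the free abelian group on all of \<open>'l\<close>, with elements outside the carrier sent to the
  identity.\<close>

lemma total_exponent_map:
  obtains \<mu> :: "('l \<Rightarrow>\<^sub>0 int) \<Rightarrow> 'l" where "exponent_map G \<mu>" "\<forall>g\<in>carrier G. \<mu> (frag_of g) = g"
proof -
  let ?f = "\<lambda>g. if g \<in> carrier G then g else \<one>\<^bsub>G\<^esub>"
  obtain h where h: "h \<in> hom (free_Abelian_group (UNIV :: 'l set)) G" "\<And>x. h (frag_of x) = ?f x"
    using G.free_Abelian_group_universal[of ?f UNIV] by auto
  have F: "group (free_Abelian_group (UNIV :: 'l set))" by simp
  have "h 0 = \<one>\<^bsub>G\<^esub>" using hom_one[OF h(1) F G.is_group] by simp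
  moreover have "h a \<in> carrier G" "h (a + b) = h a \<otimes>\<^bsub>G\<^esub> h b" for a b
    using h(1) hom_mult[OF h(1), of a b] by (auto simp: hom_def)
  ultimately show ?thesis using that[of h] h(2) by (auto simp: exponent_map_def)
qed

lemma gmap_surj:
  assumes \<mu>: "exponent_map G \<mu>" "\<forall>g\<in>carrier G. \<mu> (e g) = g"
  shows "carrier R = range (gmap \<mu>)"
proof
  show "range (gmap \<mu>) \<subseteq> carrier R" using gmap_closed by auto
  show "carrier R \<subseteq> range (gmap \<mu>)"
  proof
    fix r assume r: "r \<in> carrier R"
    then have fin: "finite (gsupp G K r)" and ext: "r \<in> carrier G \<rightarrow>\<^sub>E carrier K"
      by (auto simp: R_sel finsupp_funs_def)
    let ?S = "gsupp G K r"
    define u where "u = (\<Sum>h\<in>?S. frag_cmul (rep (r h)) (frag_of (e h)))"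
    have push: "push \<mu> u = (\<Sum>h\<in>?S. frag_cmul (rep (r h)) (frag_of h))"
      unfolding u_def push_sum[OF fin]
      by (rule sum.cong) (auto simp: push_cmul push_frag_of gsupp_def \<mu>)
    have "gmap \<mu> u g = r g" for g
    proof (cases "g \<in> carrier G")
      case True
      have "Poly_Mapping.lookup (push \<mu> u) g = (\<Sum>h\<in>?S. if h = g then rep (r h) else 0)"
        unfolding push lookup_sum by (rule sum.cong) auto
      also have "\<dots> = (if g \<in> ?S then rep (r g) else 0)" using fin by simp
      also have "cls \<dots> = r g"
      proof (cases "r g = \<zero>\<^bsub>K\<^esub>")
        case False
        have "r g \<in> carrier K" using ext True by blast
        then show ?thesis using False True by (simp add: gsupp_def ZMod_ZRep)
      qed (simp add: gsupp_def ZMod_0)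
      finally show ?thesis using True by (simp add: gmap_def)
    next
      case False
      then show ?thesis by (simp add: gmap_def PiE_arb[OF ext])
    qed
    then have "gmap \<mu> u = r" by (rule HOL.ext)
    then show "r \<in> range (gmap \<mu>)" by (rule range_eqI[OF sym])
  qed
qed

lemma gmap_ring_surjection:
  assumes "exponent_map G \<mu>" "\<forall>g\<in>carrier G. \<mu> (e g) = g"
  shows "ring_surjection (gmap \<mu>) R"
  by standard (simp_all add: gmap_surj[OF assms] gmap_add gmap_mult[OF assms(1)] gmap_0 gmap_1[OF assms(1)])

lemma R_cring: "cring R"
proof -
  obtain \<mu> :: "('l \<Rightarrow>\<^sub>0 int) \<Rightarrow> 'l" where \<mu>: "exponent_map G \<mu>" "\<forall>g\<in>carrier G. \<mu> (frag_of g) = g"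
    by (rule total_exponent_map)
  show ?thesis by (rule ring_surjection.is_cring[OF gmap_ring_surjection[OF \<mu>]])
qed

lemma gmonom_closed: "gmonom G K \<one>\<^bsub>K\<^esub> g \<in> carrier R"
proof -
  interpret K: cring K by (rule K_cring)
  have "gsupp G K (gmonom G K \<one>\<^bsub>K\<^esub> g) \<subseteq> {g}" by (auto simp: gsupp_def gmonom_def)
  then have "finite (gsupp G K (gmonom G K \<one>\<^bsub>K\<^esub> g))" by (rule finite_subset) simp
  then show ?thesis by (auto simp: R_sel finsupp_funs_def gmonom_def)
qed

lemma R_apply_closed: "r \<in> carrier R \<Longrightarrow> g \<in> carrier G \<Longrightarrow> r g \<in> carrier K"
  by (auto simp: R_sel finsupp_funs_def)

lemma gmonom_mult_apply:
  assumes s: "\<And>g. g \<in> carrier G \<Longrightarrow> s g \<in> carrier K" and h: "h \<in> carrier G" and g: "g \<in> carrier G"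
  shows "(gmonom G K \<one>\<^bsub>K\<^esub> h \<otimes>\<^bsub>R\<^esub> s) g = s (inv\<^bsub>G\<^esub> h \<otimes>\<^bsub>G\<^esub> g)"
proof -
  obtain \<mu> :: "('l \<Rightarrow>\<^sub>0 int) \<Rightarrow> 'l" where \<mu>: "exponent_map G \<mu>" "\<forall>g\<in>carrier G. \<mu> (frag_of g) = g"
    by (rule total_exponent_map)
  have "(gmap \<mu> (frag_of (frag_of h)) \<otimes>\<^bsub>R\<^esub> s) g
    = cls (pairing (\<lambda>a. rep (s (inv\<^bsub>G\<^esub> (\<mu> a) \<otimes>\<^bsub>G\<^esub> g))) (frag_of (frag_of h)))"
    by (rule gmap_mult_apply[OF \<mu>(1) _ g, where s' = "\<lambda>g. rep (s g)"]) (simp add: ZMod_ZRep s)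
  then show ?thesis using g h by (simp add: gmap_frag_of pairing_frag_of \<mu>(2) ZMod_ZRep s)
qed

end

section \<open>The excitation module\<close>

sublocale stabilizer_code \<subseteq> zn_group_ring \<Lambda> n
  by unfold_locales (rule n_pos)

context stabilizer_code
begin

abbreviation "P \<equiv> group_module K \<Lambda> P\<^sub>0"
abbreviation "form \<equiv> form_ext K \<Lambda> P\<^sub>0 \<omega>\<^sub>0"
abbreviation "D \<equiv> pauli_dual n \<Lambda> P\<^sub>0 L"
abbreviation "Q \<equiv> excitations n \<Lambda> P\<^sub>0 \<omega>\<^sub>0 L"

definition shift :: "'l \<Rightarrow> ('l \<Rightarrow> 'a) \<Rightarrow> 'l \<Rightarrow> 'a" where
  "shift h p = (\<lambda>g\<in>carrier \<Lambda>. p (inv\<^bsub>\<Lambda>\<^esub> h \<otimes>\<^bsub>\<Lambda>\<^esub> g))"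

definition locals :: "(('l \<Rightarrow> 'p) \<Rightarrow> 'l \<Rightarrow> int set) set" where
  "locals = (\<lambda>p. \<lambda>m\<in>L. form m p) ` carrier P"

lemma P_sel:
  "carrier P = finsupp_funs \<Lambda> P\<^sub>0"
  "\<zero>\<^bsub>P\<^esub> = (\<lambda>g\<in>carrier \<Lambda>. \<zero>\<^bsub>P\<^sub>0\<^esub>)"
  "p \<oplus>\<^bsub>P\<^esub> q = (\<lambda>g\<in>carrier \<Lambda>. p g \<oplus>\<^bsub>P\<^sub>0\<^esub> q g)"
  "r \<odot>\<^bsub>P\<^esub> p = (\<lambda>g\<in>carrier \<Lambda>. \<Oplus>\<^bsub>P\<^sub>0\<^esub>h\<in>gsupp \<Lambda> K r. r h \<odot>\<^bsub>P\<^sub>0\<^esub> p (inv\<^bsub>\<Lambda>\<^esub> h \<otimes>\<^bsub>\<Lambda>\<^esub> g))"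
  by (simp_all add: group_module_def)

lemma P_closed_iff: "p \<in> carrier P \<longleftrightarrow> p \<in> carrier \<Lambda> \<rightarrow>\<^sub>E carrier P\<^sub>0 \<and> finite (gsupp \<Lambda> P\<^sub>0 p)"
  by (simp add: P_sel finsupp_funs_def)

lemma P_apply: "p \<in> carrier P \<Longrightarrow> g \<in> carrier \<Lambda> \<Longrightarrow> p g \<in> carrier P\<^sub>0"
  by (auto simp: P_closed_iff)

lemma P_eqI: "p \<in> carrier P \<Longrightarrow> q \<in> carrier P \<Longrightarrow> (\<And>g. g \<in> carrier \<Lambda> \<Longrightarrow> p g = q g) \<Longrightarrow> p = q"
  unfolding P_closed_iff by (blast intro: PiE_ext)

lemma P_finite: "p \<in> carrier P \<Longrightarrow> finite (gsupp \<Lambda> P\<^sub>0 p)"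
  by (simp add: P_closed_iff)

lemma P_closedI:
  assumes "\<And>g. g \<in> carrier \<Lambda> \<Longrightarrow> p g \<in> carrier P\<^sub>0" "finite A"
    "\<And>g. g \<in> carrier \<Lambda> \<Longrightarrow> g \<notin> A \<Longrightarrow> p g = \<zero>\<^bsub>P\<^sub>0\<^esub>"
  shows "(\<lambda>g\<in>carrier \<Lambda>. p g) \<in> carrier P"
proof -
  have "gsupp \<Lambda> P\<^sub>0 (\<lambda>g\<in>carrier \<Lambda>. p g) \<subseteq> A" using assms(3) by (auto simp: gsupp_def)
  then show ?thesis using assms by (auto simp: P_closed_iff intro: finite_subset)
qed

lemma P_0_closed: "\<zero>\<^bsub>P\<^esub> \<in> carrier P"
  unfolding P_sel(2) by (rule P_closedI[of _ "{}"]) auto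

lemma P_add_closed:
  assumes "p \<in> carrier P" "q \<in> carrier P" shows "p \<oplus>\<^bsub>P\<^esub> q \<in> carrier P"
  unfolding P_sel(3)
proof (rule P_closedI[of _ "gsupp \<Lambda> P\<^sub>0 p \<union> gsupp \<Lambda> P\<^sub>0 q"])
  fix g assume "g \<in> carrier \<Lambda>"
  then show "p g \<oplus>\<^bsub>P\<^sub>0\<^esub> q g \<in> carrier P\<^sub>0" using assms by (simp add: P_apply)
  assume "g \<notin> gsupp \<Lambda> P\<^sub>0 p \<union> gsupp \<Lambda> P\<^sub>0 q"
  then show "p g \<oplus>\<^bsub>P\<^sub>0\<^esub> q g = \<zero>\<^bsub>P\<^sub>0\<^esub>" using \<open>g \<in> carrier \<Lambda>\<close> by (simp add: gsupp_def)
qed (simp add: assms P_finite)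

lemma P_abelian_group: "abelian_group P"
proof (rule abelian_groupI)
  fix p q r assume p: "p \<in> carrier P" and q: "q \<in> carrier P"
  show "p \<oplus>\<^bsub>P\<^esub> q = q \<oplus>\<^bsub>P\<^esub> p"
    by (rule P_eqI[OF P_add_closed[OF p q] P_add_closed[OF q p]]) (simp add: P_sel P_apply[OF p] P_apply[OF q] P\<^sub>0.a_comm)
  assume r: "r \<in> carrier P"
  show "(p \<oplus>\<^bsub>P\<^esub> q) \<oplus>\<^bsub>P\<^esub> r = p \<oplus>\<^bsub>P\<^esub> (q \<oplus>\<^bsub>P\<^esub> r)"
    by (rule P_eqI[OF P_add_closed[OF P_add_closed[OF p q] r] P_add_closed[OF p P_add_closed[OF q r]]])
      (simp add: P_sel P_apply[OF p] P_apply[OF q] P_apply[OF r] P\<^sub>0.a_assoc)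
next
  fix p assume p: "p \<in> carrier P"
  show "\<zero>\<^bsub>P\<^esub> \<oplus>\<^bsub>P\<^esub> p = p"
    by (rule P_eqI[OF P_add_closed[OF P_0_closed p] p]) (simp add: P_sel P_apply[OF p])
  let ?m = "\<lambda>g\<in>carrier \<Lambda>. \<ominus>\<^bsub>P\<^sub>0\<^esub> p g"
  have m: "?m \<in> carrier P"
    by (rule P_closedI[OF _ P_finite[OF p]]) (use p in \<open>auto simp: P_apply gsupp_def\<close>)
  have "?m \<oplus>\<^bsub>P\<^esub> p = \<zero>\<^bsub>P\<^esub>"
    by (rule P_eqI[OF P_add_closed[OF m p] P_0_closed]) (simp add: P_sel P_apply[OF p] P\<^sub>0.l_neg)
  then show "\<exists>y\<in>carrier P. y \<oplus>\<^bsub>P\<^esub> p = \<zero>\<^bsub>P\<^esub>" using m by blast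
qed (auto simp: P_0_closed P_add_closed)

lemma P_minus_apply:
  assumes p: "p \<in> carrier P" and g: "g \<in> carrier \<Lambda>"
  shows "(\<ominus>\<^bsub>P\<^esub> p) g = \<ominus>\<^bsub>P\<^sub>0\<^esub> p g"
proof -
  interpret P: abelian_group P by (rule P_abelian_group)
  have "(\<ominus>\<^bsub>P\<^esub> p \<oplus>\<^bsub>P\<^esub> p) g = \<zero>\<^bsub>P\<^esub> g" using p by (simp add: P.l_neg)
  then have "(\<ominus>\<^bsub>P\<^esub> p) g \<oplus>\<^bsub>P\<^sub>0\<^esub> p g = \<zero>\<^bsub>P\<^sub>0\<^esub>" using g by (simp add: P_sel)
  moreover have "(\<ominus>\<^bsub>P\<^esub> p) g \<in> carrier P\<^sub>0" by (rule P_apply[OF P.a_inv_closed[OF p] g])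
  ultimately show ?thesis using P\<^sub>0.minus_equality[OF _ P_apply[OF p g]] by simp
qed

text \<open>For \<open>n = 1\<close> a monomial of \<open>R\<close> has empty support, so its action
  on \<open>P\<close> is an empty sum; this covers that case in \<open>gmonom_smult\<close>.\<close>

lemma one_smult_eq_0:
  assumes "a \<in> carrier P\<^sub>0" "\<one>\<^bsub>K\<^esub> = \<zero>\<^bsub>K\<^esub>" shows "a = \<zero>\<^bsub>P\<^sub>0\<^esub>"
  using P\<^sub>0.smult_one[OF assms(1)] P\<^sub>0.smult_l_null[OF assms(1)] assms(2) by simp

lemma shift_closed:
  assumes p: "p \<in> carrier P" and h: "h \<in> carrier \<Lambda>"
  shows "shift h p \<in> carrier P"
  unfolding shift_def
proof (rule P_closedI[of _ "(\<lambda>g. h \<otimes>\<^bsub>\<Lambda>\<^esub> g) ` gsupp \<Lambda> P\<^sub>0 p"])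
  fix g assume g: "g \<in> carrier \<Lambda>"
  then show "p (inv\<^bsub>\<Lambda>\<^esub> h \<otimes>\<^bsub>\<Lambda>\<^esub> g) \<in> carrier P\<^sub>0" using h p by (simp add: P_apply)
  assume "g \<notin> (\<lambda>g. h \<otimes>\<^bsub>\<Lambda>\<^esub> g) ` gsupp \<Lambda> P\<^sub>0 p"
  moreover have "g = h \<otimes>\<^bsub>\<Lambda>\<^esub> (inv\<^bsub>\<Lambda>\<^esub> h \<otimes>\<^bsub>\<Lambda>\<^esub> g)" using g h by (simp add: \<Lambda>.m_assoc[symmetric])
  ultimately have "inv\<^bsub>\<Lambda>\<^esub> h \<otimes>\<^bsub>\<Lambda>\<^esub> g \<notin> gsupp \<Lambda> P\<^sub>0 p" by blast
  then show "p (inv\<^bsub>\<Lambda>\<^esub> h \<otimes>\<^bsub>\<Lambda>\<^esub> g) = \<zero>\<^bsub>P\<^sub>0\<^esub>" using g h by (simp add: gsupp_def)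
qed (simp add: P_finite p)

lemma gmonom_smult:
  assumes p: "p \<in> carrier P" and h: "h \<in> carrier \<Lambda>"
  shows "gmonom \<Lambda> K \<one>\<^bsub>K\<^esub> h \<odot>\<^bsub>P\<^esub> p = shift h p"
  unfolding shift_def P_sel
proof (rule restrict_ext)
  fix g assume g: "g \<in> carrier \<Lambda>"
  let ?m = "gmonom \<Lambda> K \<one>\<^bsub>K\<^esub> h"
  have pg: "p (inv\<^bsub>\<Lambda>\<^esub> h \<otimes>\<^bsub>\<Lambda>\<^esub> g) \<in> carrier P\<^sub>0" using g h p by (simp add: P_apply)
  show "(\<Oplus>\<^bsub>P\<^sub>0\<^esub>k\<in>gsupp \<Lambda> K ?m. ?m k \<odot>\<^bsub>P\<^sub>0\<^esub> p (inv\<^bsub>\<Lambda>\<^esub> k \<otimes>\<^bsub>\<Lambda>\<^esub> g)) = p (inv\<^bsub>\<Lambda>\<^esub> h \<otimes>\<^bsub>\<Lambda>\<^esub> g)"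
  proof (cases "\<one>\<^bsub>K\<^esub> = \<zero>\<^bsub>K\<^esub>")
    case True
    then have "gsupp \<Lambda> K ?m = {}" by (auto simp: gsupp_def gmonom_def)
    then show ?thesis using one_smult_eq_0[OF pg True] by simp
  next
    case False
    then have "gsupp \<Lambda> K ?m = {h}" using h by (auto simp: gsupp_def gmonom_def)
    then show ?thesis using h pg by (simp add: gmonom_def P\<^sub>0.finsum_insert)
  qed
qed

lemma L_subset: "L \<subseteq> carrier P"
  and L_0: "\<zero>\<^bsub>P\<^esub> \<in> L"
  and L_add: "p \<in> L \<Longrightarrow> q \<in> L \<Longrightarrow> p \<oplus>\<^bsub>P\<^esub> q \<in> L"
  and L_minus: "p \<in> L \<Longrightarrow> \<ominus>\<^bsub>P\<^esub> p \<in> L"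
proof -
  interpret L: submodule L R P by (rule submodule_L)
  show "L \<subseteq> carrier P" using L.subset by simp
  show "\<zero>\<^bsub>P\<^esub> \<in> L" using L.one_closed by simp
  show "p \<in> L \<Longrightarrow> q \<in> L \<Longrightarrow> p \<oplus>\<^bsub>P\<^esub> q \<in> L" using L.m_closed by simp
  show "p \<in> L \<Longrightarrow> \<ominus>\<^bsub>P\<^esub> p \<in> L" using L.m_inv_closed by (simp add: a_inv_def)
qed

lemma L_shift: "p \<in> L \<Longrightarrow> h \<in> carrier \<Lambda> \<Longrightarrow> shift h p \<in> L"
  using submodule.smult_closed[OF submodule_L gmonom_closed, of p h] L_subset gmonom_smult by (metis subsetD)

lemma form_0_left: "b \<in> carrier P\<^sub>0 \<Longrightarrow> \<omega>\<^sub>0 \<zero>\<^bsub>P\<^sub>0\<^esub> b = \<zero>\<^bsub>K\<^esub>"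
proof -
  assume b: "b \<in> carrier P\<^sub>0"
  have "\<omega>\<^sub>0 (\<zero>\<^bsub>K\<^esub> \<odot>\<^bsub>P\<^sub>0\<^esub> \<zero>\<^bsub>P\<^sub>0\<^esub>) b = \<zero>\<^bsub>K\<^esub> \<otimes>\<^bsub>K\<^esub> \<omega>\<^sub>0 \<zero>\<^bsub>P\<^sub>0\<^esub> b"
    by (rule form_smult_left) (auto simp: b)
  then show ?thesis using b by (simp add: form_closed)
qed

lemma form_skew:
  assumes a: "a \<in> carrier P\<^sub>0" and b: "b \<in> carrier P\<^sub>0"
  shows "\<omega>\<^sub>0 a b = \<ominus>\<^bsub>K\<^esub> \<omega>\<^sub>0 b a"
proof -
  have "\<omega>\<^sub>0 (a \<oplus>\<^bsub>P\<^sub>0\<^esub> b) (a \<oplus>\<^bsub>P\<^sub>0\<^esub> b) = \<omega>\<^sub>0 a b \<oplus>\<^bsub>K\<^esub> \<omega>\<^sub>0 b a"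
    using a b by (simp add: form_add_left form_add_right form_alternating[OF a] form_alternating[OF b] form_closed P\<^sub>0.R.a_comm)
  moreover have "\<omega>\<^sub>0 (a \<oplus>\<^bsub>P\<^sub>0\<^esub> b) (a \<oplus>\<^bsub>P\<^sub>0\<^esub> b) = \<zero>\<^bsub>K\<^esub>"
    by (rule form_alternating) (simp add: a b)
  ultimately have "\<omega>\<^sub>0 a b \<oplus>\<^bsub>K\<^esub> \<omega>\<^sub>0 b a = \<zero>\<^bsub>K\<^esub>" by simp
  then show ?thesis using a b by (metis P\<^sub>0.R.minus_equality form_closed P\<^sub>0.R.minus_minus)
qed

definition \<omega>z :: "'p \<Rightarrow> 'p \<Rightarrow> int" where
  "\<omega>z a b = rep (\<omega>\<^sub>0 a b)"

lemma cls_\<omega>z: "a \<in> carrier P\<^sub>0 \<Longrightarrow> b \<in> carrier P\<^sub>0 \<Longrightarrow> cls (\<omega>z a b) = \<omega>\<^sub>0 a b"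
  by (simp add: \<omega>z_def ZMod_ZRep form_closed)

text \<open>The summation range may be any finite set containing the support of \<open>p\<close>.
  This flexibility allows substitutions under the sum and the comparison of forms whose arguments
  have different supports.\<close>

lemma form_apply:
  assumes p: "p \<in> carrier P" and q: "q \<in> carrier P" and \<nu>: "\<nu> \<in> carrier \<Lambda>"
    and A: "finite A" "gsupp \<Lambda> P\<^sub>0 p \<subseteq> A" "A \<subseteq> carrier \<Lambda>"
  shows "form p q \<nu> = cls (\<Sum>\<kappa>\<in>A. \<omega>z (p \<kappa>) (q (\<kappa> \<otimes>\<^bsub>\<Lambda>\<^esub> \<nu>)))"
proof -
  have "form p q \<nu> = (\<Oplus>\<^bsub>K\<^esub>\<kappa>\<in>gsupp \<Lambda> P\<^sub>0 p. \<omega>\<^sub>0 (p \<kappa>) (q (\<kappa> \<otimes>\<^bsub>\<Lambda>\<^esub> \<nu>)))"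
    using \<nu> by (simp add: form_ext_def)
  also have "\<dots> = (\<Oplus>\<^bsub>K\<^esub>\<kappa>\<in>A. \<omega>\<^sub>0 (p \<kappa>) (q (\<kappa> \<otimes>\<^bsub>\<Lambda>\<^esub> \<nu>)))"
    unfolding finsum_def
  proof (rule comm_monoid.finprod_mono_neutral_cong_left[OF abelian_monoid.a_comm_monoid[OF abelian_group.axioms(1)[OF ring.axioms(1)[OF cring.axioms(1)[OF K_cring]]]] A(1,2)])
    show "\<omega>\<^sub>0 (p \<kappa>) (q (\<kappa> \<otimes>\<^bsub>\<Lambda>\<^esub> \<nu>)) = \<one>\<^bsub>add_monoid K\<^esub>" if "\<kappa> \<in> A - gsupp \<Lambda> P\<^sub>0 p" for \<kappa>
    proof -
      have "\<kappa> \<in> carrier \<Lambda>" "p \<kappa> = \<zero>\<^bsub>P\<^sub>0\<^esub>" using that A(3) by (auto simp: gsupp_def)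
      then show ?thesis using \<nu> by (simp add: form_0_left P_apply[OF q])
    qed
    show "(\<lambda>\<kappa>. \<omega>\<^sub>0 (p \<kappa>) (q (\<kappa> \<otimes>\<^bsub>\<Lambda>\<^esub> \<nu>))) \<in> A \<rightarrow> carrier (add_monoid K)"
    proof (rule Pi_I)
      fix \<kappa> assume "\<kappa> \<in> A"
      then have "\<kappa> \<in> carrier \<Lambda>" using A(3) by blast
      then show "\<omega>\<^sub>0 (p \<kappa>) (q (\<kappa> \<otimes>\<^bsub>\<Lambda>\<^esub> \<nu>)) \<in> carrier (add_monoid K)"
        using \<nu> by (simp add: form_closed P_apply[OF p] P_apply[OF q])
    qed
  qed simp
  also have "\<dots> = (\<Oplus>\<^bsub>K\<^esub>\<kappa>\<in>A. cls (\<omega>z (p \<kappa>) (q (\<kappa> \<otimes>\<^bsub>\<Lambda>\<^esub> \<nu>))))"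
    by (rule P\<^sub>0.R.finsum_cong') (use A(3) \<nu> in \<open>auto simp: cls_\<omega>z ZMod_closed P_apply[OF p] P_apply[OF q] subset_iff\<close>)
  finally show ?thesis by (simp add: ZMod_sum)
qed

lemma form_R_closed:
  assumes p: "p \<in> carrier P" and q: "q \<in> carrier P"
  shows "form p q \<in> carrier R"
proof -
  have sub: "gsupp \<Lambda> P\<^sub>0 p \<subseteq> carrier \<Lambda>" by (auto simp: gsupp_def)
  note fa = form_apply[OF p q _ P_finite[OF p] order_refl sub]
  let ?S = "\<Union>\<kappa>\<in>gsupp \<Lambda> P\<^sub>0 p. (\<lambda>\<mu>. inv\<^bsub>\<Lambda>\<^esub> \<kappa> \<otimes>\<^bsub>\<Lambda>\<^esub> \<mu>) ` gsupp \<Lambda> P\<^sub>0 q"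
  have fin: "finite ?S" using P_finite p q by auto
  have "gsupp \<Lambda> K (form p q) \<subseteq> ?S"
  proof
    fix \<nu> assume \<nu>: "\<nu> \<in> gsupp \<Lambda> K (form p q)"
    then have \<nu>G: "\<nu> \<in> carrier \<Lambda>" by (simp add: gsupp_def)
    show "\<nu> \<in> ?S"
    proof (rule ccontr)
      assume no: "\<nu> \<notin> ?S"
      have "int n dvd \<omega>z (p \<kappa>) (q (\<kappa> \<otimes>\<^bsub>\<Lambda>\<^esub> \<nu>))" if \<kappa>: "\<kappa> \<in> gsupp \<Lambda> P\<^sub>0 p" for \<kappa>
      proof -
        have \<kappa>G: "\<kappa> \<in> carrier \<Lambda>" using \<kappa> sub by blast
        have "\<nu> = inv\<^bsub>\<Lambda>\<^esub> \<kappa> \<otimes>\<^bsub>\<Lambda>\<^esub> (\<kappa> \<otimes>\<^bsub>\<Lambda>\<^esub> \<nu>)" using \<kappa>G \<nu>G by (simp add: \<Lambda>.m_assoc[symmetric])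
        then have "\<kappa> \<otimes>\<^bsub>\<Lambda>\<^esub> \<nu> \<notin> gsupp \<Lambda> P\<^sub>0 q" using no \<kappa> by blast
        then have "q (\<kappa> \<otimes>\<^bsub>\<Lambda>\<^esub> \<nu>) = \<zero>\<^bsub>P\<^sub>0\<^esub>" using \<kappa>G \<nu>G by (simp add: gsupp_def)
        moreover have pk: "p \<kappa> \<in> carrier P\<^sub>0" by (rule P_apply[OF p \<kappa>G])
        have "\<omega>\<^sub>0 (p \<kappa>) \<zero>\<^bsub>P\<^sub>0\<^esub> = \<zero>\<^bsub>K\<^esub>" using form_skew[OF pk P\<^sub>0.zero_closed] form_0_left[OF pk] by simp
        ultimately have "cls (\<omega>z (p \<kappa>) (q (\<kappa> \<otimes>\<^bsub>\<Lambda>\<^esub> \<nu>))) = \<zero>\<^bsub>K\<^esub>" using pk by (simp add: cls_\<omega>z)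
        then show ?thesis by (simp add: ZMod_eq_0_iff)
      qed
      then have "form p q \<nu> = \<zero>\<^bsub>K\<^esub>" unfolding fa[OF \<nu>G] ZMod_eq_0_iff by (intro dvd_sum)
      then show False using \<nu> by (simp add: gsupp_def)
    qed
  qed
  then have "finite (gsupp \<Lambda> K (form p q))" using fin by (rule finite_subset)
  moreover have "form p q \<in> carrier \<Lambda> \<rightarrow>\<^sub>E carrier K"
  proof (rule PiE_I)
    show "form p q g \<in> carrier K" if "g \<in> carrier \<Lambda>" for g using fa[OF that] by (simp add: ZMod_closed)
    show "form p q g = undefined" if "g \<notin> carrier \<Lambda>" for g using that by (simp add: form_ext_def)
  qed
  ultimately show ?thesis by (simp add: R_sel finsupp_funs_def)
qed

lemma R_eqI: "r \<in> carrier R \<Longrightarrow> s \<in> carrier R \<Longrightarrow> (\<And>g. g \<in> carrier \<Lambda> \<Longrightarrow> r g = s g) \<Longrightarrow> r = s"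
  by (auto simp: R_sel finsupp_funs_def intro: PiE_ext)

lemma form_ext_add_right:
  assumes m: "m \<in> carrier P" and p: "p \<in> carrier P" and q: "q \<in> carrier P"
  shows "form m (p \<oplus>\<^bsub>P\<^esub> q) = form m p \<oplus>\<^bsub>R\<^esub> form m q"
proof (rule R_eqI)
  interpret R: cring R by (rule R_cring)
  show "form m (p \<oplus>\<^bsub>P\<^esub> q) \<in> carrier R" "form m p \<oplus>\<^bsub>R\<^esub> form m q \<in> carrier R"
    using m p q by (simp_all add: form_R_closed P_add_closed)
  fix g assume g: "g \<in> carrier \<Lambda>"
  have sub: "gsupp \<Lambda> P\<^sub>0 m \<subseteq> carrier \<Lambda>" by (auto simp: gsupp_def)
  note fa = form_apply[OF m _ g P_finite[OF m] order_refl sub]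
  let ?S = "gsupp \<Lambda> P\<^sub>0 m"
  have "int n dvd \<omega>z (m \<kappa>) ((p \<oplus>\<^bsub>P\<^esub> q) (\<kappa> \<otimes>\<^bsub>\<Lambda>\<^esub> g)) -
      (\<omega>z (m \<kappa>) (p (\<kappa> \<otimes>\<^bsub>\<Lambda>\<^esub> g)) + \<omega>z (m \<kappa>) (q (\<kappa> \<otimes>\<^bsub>\<Lambda>\<^esub> g)))" if "\<kappa> \<in> ?S" for \<kappa>
  proof -
    have k: "\<kappa> \<in> carrier \<Lambda>" using that sub by blast
    then have c: "m \<kappa> \<in> carrier P\<^sub>0" "p (\<kappa> \<otimes>\<^bsub>\<Lambda>\<^esub> g) \<in> carrier P\<^sub>0" "q (\<kappa> \<otimes>\<^bsub>\<Lambda>\<^esub> g) \<in> carrier P\<^sub>0"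
      using g by (simp_all add: P_apply m p q)
    show ?thesis unfolding ZMod_eq_iff[symmetric] ZMod_add
      using c k g by (simp add: cls_\<omega>z P_sel form_add_right)
  qed
  then have "int n dvd (\<Sum>\<kappa>\<in>?S. \<omega>z (m \<kappa>) ((p \<oplus>\<^bsub>P\<^esub> q) (\<kappa> \<otimes>\<^bsub>\<Lambda>\<^esub> g)) -
      (\<omega>z (m \<kappa>) (p (\<kappa> \<otimes>\<^bsub>\<Lambda>\<^esub> g)) + \<omega>z (m \<kappa>) (q (\<kappa> \<otimes>\<^bsub>\<Lambda>\<^esub> g))))" by (rule dvd_sum)
  then have "cls (\<Sum>\<kappa>\<in>?S. \<omega>z (m \<kappa>) ((p \<oplus>\<^bsub>P\<^esub> q) (\<kappa> \<otimes>\<^bsub>\<Lambda>\<^esub> g)))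
    = cls ((\<Sum>\<kappa>\<in>?S. \<omega>z (m \<kappa>) (p (\<kappa> \<otimes>\<^bsub>\<Lambda>\<^esub> g))) + (\<Sum>\<kappa>\<in>?S. \<omega>z (m \<kappa>) (q (\<kappa> \<otimes>\<^bsub>\<Lambda>\<^esub> g))))"
    unfolding ZMod_eq_iff by (simp add: sum_subtractf sum.distrib)
  then show "form m (p \<oplus>\<^bsub>P\<^esub> q) g = (form m p \<oplus>\<^bsub>R\<^esub> form m q) g"
    unfolding ZMod_add fa[OF P_add_closed[OF p q], symmetric] fa[OF p, symmetric] fa[OF q, symmetric]
    using g by (simp add: R_sel)
qed

lemma form_ext_shift_right:
  assumes m: "m \<in> carrier P" and p: "p \<in> carrier P" and h: "h \<in> carrier \<Lambda>"
  shows "form m (shift h p) = gmonom \<Lambda> K \<one>\<^bsub>K\<^esub> h \<otimes>\<^bsub>R\<^esub> form m p"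
proof (rule R_eqI)
  interpret R: cring R by (rule R_cring)
  show "form m (shift h p) \<in> carrier R" "gmonom \<Lambda> K \<one>\<^bsub>K\<^esub> h \<otimes>\<^bsub>R\<^esub> form m p \<in> carrier R"
    using m p h by (simp_all add: form_R_closed shift_closed gmonom_closed)
  fix g assume g: "g \<in> carrier \<Lambda>"
  have sub: "gsupp \<Lambda> P\<^sub>0 m \<subseteq> carrier \<Lambda>" by (auto simp: gsupp_def)
  have gh: "inv\<^bsub>\<Lambda>\<^esub> h \<otimes>\<^bsub>\<Lambda>\<^esub> g \<in> carrier \<Lambda>" using g h by simp
  have "\<omega>z (m \<kappa>) (shift h p (\<kappa> \<otimes>\<^bsub>\<Lambda>\<^esub> g)) = \<omega>z (m \<kappa>) (p (\<kappa> \<otimes>\<^bsub>\<Lambda>\<^esub> (inv\<^bsub>\<Lambda>\<^esub> h \<otimes>\<^bsub>\<Lambda>\<^esub> g)))"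
    if "\<kappa> \<in> gsupp \<Lambda> P\<^sub>0 m" for \<kappa>
  proof -
    have "\<kappa> \<in> carrier \<Lambda>" using that sub by blast
    then show ?thesis using g h by (simp add: shift_def \<Lambda>.m_lcomm)
  qed
  then have "form m (shift h p) g = form m p (inv\<^bsub>\<Lambda>\<^esub> h \<otimes>\<^bsub>\<Lambda>\<^esub> g)"
    unfolding form_apply[OF m shift_closed[OF p h] g P_finite[OF m] order_refl sub]
      form_apply[OF m p gh P_finite[OF m] order_refl sub]
    by (metis (no_types, lifting) sum.cong)
  then show "form m (shift h p) g = (gmonom \<Lambda> K \<one>\<^bsub>K\<^esub> h \<otimes>\<^bsub>R\<^esub> form m p) g"
    using gmonom_mult_apply[OF R_apply_closed[OF form_R_closed[OF m p]] h g] by simp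
qed

lemma D_sel:
  "f \<in> carrier D \<longleftrightarrow> f \<in> L \<rightarrow>\<^sub>E carrier R \<and> (\<forall>x\<in>L. \<forall>y\<in>L. f (x \<oplus>\<^bsub>P\<^esub> y) = f x \<oplus>\<^bsub>R\<^esub> f y) \<and>
    (\<forall>r\<in>carrier R. \<forall>x\<in>L. f (antipode \<Lambda> r \<odot>\<^bsub>P\<^esub> x) = r \<otimes>\<^bsub>R\<^esub> f x)"
  "f \<oplus>\<^bsub>D\<^esub> g = (\<lambda>x\<in>L. f x \<oplus>\<^bsub>R\<^esub> g x)"
  "r \<odot>\<^bsub>D\<^esub> f = (\<lambda>x\<in>L. r \<otimes>\<^bsub>R\<^esub> f x)"
  by (simp_all add: pauli_dual_def hom_module_def twist_module_def regular_module_def)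

lemma D_apply: "f \<in> carrier D \<Longrightarrow> x \<in> L \<Longrightarrow> f x \<in> carrier R"
  by (auto simp: D_sel)

text \<open>Functionals are antilinear, so translating the argument by \<open>h\<close> multiplies
  the value by the monomial of \<open>inv h\<close>. Consequently the coefficients at one site,
  taken at all translates of \<open>x\<close>, determine \<open>f x\<close>.\<close>

lemma D_shift:
  assumes f: "f \<in> carrier D" and x: "x \<in> L" and h: "h \<in> carrier \<Lambda>" and g: "g \<in> carrier \<Lambda>"
  shows "f (shift h x) g = f x (h \<otimes>\<^bsub>\<Lambda>\<^esub> g)"
proof -
  let ?m = "gmonom \<Lambda> K \<one>\<^bsub>K\<^esub>"
  have "antipode \<Lambda> (?m (inv\<^bsub>\<Lambda>\<^esub> h)) = ?m h"
    unfolding antipode_def gmonom_def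
    by (rule restrict_ext) (use h in \<open>auto dest: inj_onD[OF \<Lambda>.inv_inj]\<close>)
  moreover have "f (antipode \<Lambda> (?m (inv\<^bsub>\<Lambda>\<^esub> h)) \<odot>\<^bsub>P\<^esub> x) = ?m (inv\<^bsub>\<Lambda>\<^esub> h) \<otimes>\<^bsub>R\<^esub> f x"
    using f x gmonom_closed[of "inv\<^bsub>\<Lambda>\<^esub> h"] unfolding D_sel(1) by blast
  moreover have "x \<in> carrier P" using x L_subset by blast
  ultimately have "f (shift h x) = ?m (inv\<^bsub>\<Lambda>\<^esub> h) \<otimes>\<^bsub>R\<^esub> f x" using h by (simp add: gmonom_smult)
  then show ?thesis
    using gmonom_mult_apply[OF R_apply_closed[OF D_apply[OF f x]] \<Lambda>.inv_closed[OF h] g] h by simp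
qed

lemma locals_mem: "p \<in> carrier P \<Longrightarrow> (\<lambda>m\<in>L. form m p) \<in> locals"
  by (simp add: locals_def)

lemma locals_0: "(\<lambda>m\<in>L. \<zero>\<^bsub>R\<^esub>) \<in> locals"
proof -
  interpret R: cring R by (rule R_cring)
  interpret P: abelian_group P by (rule P_abelian_group)
  have "form m \<zero>\<^bsub>P\<^esub> = \<zero>\<^bsub>R\<^esub>" if "m \<in> L" for m
  proof -
    have m: "m \<in> carrier P" using that L_subset by blast
    have "form m \<zero>\<^bsub>P\<^esub> = form m \<zero>\<^bsub>P\<^esub> \<oplus>\<^bsub>R\<^esub> form m \<zero>\<^bsub>P\<^esub>"
      using form_ext_add_right[OF m P_0_closed P_0_closed] by simp
    then show ?thesis using form_R_closed[OF m P_0_closed] by (metis R.add.l_cancel_one')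
  qed
  then have "(\<lambda>m\<in>L. \<zero>\<^bsub>R\<^esub>) = (\<lambda>m\<in>L. form m \<zero>\<^bsub>P\<^esub>)" by (intro restrict_ext) simp
  then show ?thesis by (simp only: locals_mem[OF P_0_closed])
qed

lemma locals_add:
  assumes "a \<in> locals" "b \<in> locals"
  shows "(\<lambda>m\<in>L. a m \<oplus>\<^bsub>R\<^esub> b m) \<in> locals"
proof -
  obtain p q where *: "p \<in> carrier P" "a = (\<lambda>m\<in>L. form m p)" "q \<in> carrier P" "b = (\<lambda>m\<in>L. form m q)"
    using assms unfolding locals_def by blast
  have "(\<lambda>m\<in>L. a m \<oplus>\<^bsub>R\<^esub> b m) = (\<lambda>m\<in>L. form m (p \<oplus>\<^bsub>P\<^esub> q))"
    unfolding * using L_subset by (intro restrict_ext) (simp add: form_ext_add_right[OF _ *(1,3)] subset_iff)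
  then show ?thesis by (simp only: locals_mem[OF P_add_closed[OF *(1,3)]])
qed

lemma locals_apply: "a \<in> locals \<Longrightarrow> m \<in> L \<Longrightarrow> a m \<in> carrier R"
  using L_subset form_R_closed by (auto simp: locals_def)

lemma locals_ext: "a \<in> locals \<Longrightarrow> (\<lambda>m\<in>L. a m) = a"
  by (auto simp: locals_def)

lemma locals_uminus:
  assumes "a \<in> locals"
  shows "(\<lambda>m\<in>L. \<ominus>\<^bsub>R\<^esub> a m) \<in> locals"
proof -
  interpret R: cring R by (rule R_cring)
  interpret P: abelian_group P by (rule P_abelian_group)
  obtain p where p: "p \<in> carrier P" "a = (\<lambda>m\<in>L. form m p)" using assms unfolding locals_def by blast
  obtain z where z: "z \<in> carrier P" "(\<lambda>m\<in>L. \<zero>\<^bsub>R\<^esub>) = (\<lambda>m\<in>L. form m z)" using locals_0 unfolding locals_def by blast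
  have "form m (\<ominus>\<^bsub>P\<^esub> p \<oplus>\<^bsub>P\<^esub> z) = \<ominus>\<^bsub>R\<^esub> a m" if "m \<in> L" for m
  proof -
    have m: "m \<in> carrier P" using that L_subset by blast
    have z0: "form m z = \<zero>\<^bsub>R\<^esub>" using fun_cong[OF z(2), of m] that by simp
    have "form m (\<ominus>\<^bsub>P\<^esub> p \<oplus>\<^bsub>P\<^esub> z) \<oplus>\<^bsub>R\<^esub> form m p = form m z"
      using p z m by (simp add: form_ext_add_right[symmetric] P.a_assoc P.a_comm[of z p] P.r_neg1)
    then have "\<ominus>\<^bsub>R\<^esub> form m p = form m (\<ominus>\<^bsub>P\<^esub> p \<oplus>\<^bsub>P\<^esub> z)"
      using p z m z0 by (intro R.minus_equality) (simp_all add: form_R_closed)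
    then show ?thesis using p that by simp
  qed
  then have "(\<lambda>m\<in>L. \<ominus>\<^bsub>R\<^esub> a m) = (\<lambda>m\<in>L. form m (\<ominus>\<^bsub>P\<^esub> p \<oplus>\<^bsub>P\<^esub> z))" by (intro restrict_ext) simp
  moreover have "\<ominus>\<^bsub>P\<^esub> p \<oplus>\<^bsub>P\<^esub> z \<in> carrier P" using p z by simp
  ultimately show ?thesis by (simp only: locals_mem)
qed

lemma locals_smult:
  assumes r: "r \<in> carrier R" and a: "a \<in> locals"
  shows "(\<lambda>m\<in>L. r \<otimes>\<^bsub>R\<^esub> a m) \<in> locals"
proof -
  interpret R: cring R by (rule R_cring)
  obtain \<mu> :: "('l \<Rightarrow>\<^sub>0 int) \<Rightarrow> 'l" where \<mu>: "exponent_map \<Lambda> \<mu>" "\<forall>g\<in>carrier \<Lambda>. \<mu> (frag_of g) = g"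
    by (rule total_exponent_map)
  interpret \<mu>: ring_surjection "gmap \<mu>" R by (rule gmap_ring_surjection[OF \<mu>])
  obtain u where u: "r = gmap \<mu> u" using r gmap_surj[OF \<mu>] by blast
  have "(\<lambda>m\<in>L. gmap \<mu> u \<otimes>\<^bsub>R\<^esub> a m) \<in> locals"
    using subset_UNIV
  proof (induction u rule: frag_induction)
    case zero
    have "(\<lambda>m\<in>L. gmap \<mu> 0 \<otimes>\<^bsub>R\<^esub> a m) = (\<lambda>m\<in>L. \<zero>\<^bsub>R\<^esub>)"
      by (rule restrict_ext) (simp add: gmap_0 locals_apply[OF a])
    then show ?case by (simp only: locals_0)
  next
    case (one x)
    obtain p where p: "p \<in> carrier P" "a = (\<lambda>m\<in>L. form m p)" using a unfolding locals_def by blast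
    have x: "\<mu> x \<in> carrier \<Lambda>" using \<mu>(1) by (simp add: exponent_map_def)
    have "(\<lambda>m\<in>L. gmap \<mu> (frag_of x) \<otimes>\<^bsub>R\<^esub> a m) = (\<lambda>m\<in>L. form m (shift (\<mu> x) p))"
      by (rule restrict_ext) (use L_subset in \<open>simp add: gmap_frag_of p(2) form_ext_shift_right[OF _ p(1) x] subset_iff\<close>)
    then show ?case by (simp only: locals_mem[OF shift_closed[OF p(1) x]])
  next
    case (diff u v)
    have "(\<lambda>m\<in>L. gmap \<mu> (u - v) \<otimes>\<^bsub>R\<^esub> a m)
      = (\<lambda>m\<in>L. (\<lambda>m\<in>L. gmap \<mu> u \<otimes>\<^bsub>R\<^esub> a m) m \<oplus>\<^bsub>R\<^esub> (\<lambda>m\<in>L. \<ominus>\<^bsub>R\<^esub> (\<lambda>m\<in>L. gmap \<mu> v \<otimes>\<^bsub>R\<^esub> a m) m) m)"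
      by (rule restrict_ext)
        (simp add: \<mu>.map_minus gmap_closed locals_apply[OF a] R.minus_eq R.l_distr R.l_minus)
    then show ?case by (simp only: locals_add[OF diff(1) locals_uminus[OF diff(2)]])
  qed
  then show ?thesis by (simp add: u)
qed

end

section \<open>Finite index in finitely generated abelian groups\<close>

lemma (in comm_group) finprod_mem_subgroup:
  assumes H: "subgroup H G"
  shows "(\<And>x. x \<in> A \<Longrightarrow> f x \<in> H) \<Longrightarrow> finprod G f A \<in> H"
proof (induction A rule: infinite_finite_induct)
  case (insert x A)
  then have "f \<in> A \<rightarrow> carrier G" "f x \<in> carrier G" using subgroup.subset[OF H] by auto
  then show ?case using insert subgroup.m_closed[OF H] by simp
qed (auto simp: subgroup.one_closed[OF H] finprod_infinite)

text \<open>Every element is a product of powers of the generators, and modulo the subgroup each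
  exponent matters only modulo the order \<open>N s\<close> of its generator. Finitely many reduced
  exponent vectors therefore reach all cosets.\<close>

lemma (in comm_group) finite_index_if_torsion:
  assumes fg: "fin_gen_group G" and \<Gamma>: "subgroup \<Gamma> G"
    and tors: "\<And>g. g \<in> carrier G \<Longrightarrow> \<exists>N>0. g [^] (N::nat) \<in> \<Gamma>"
  shows "finite (rcosets \<Gamma>)"
proof -
  interpret \<Gamma>: subgroup \<Gamma> G by (rule \<Gamma>)
  obtain S where S: "finite S" "S \<subseteq> carrier G" "generate G S = carrier G" using fg unfolding fin_gen_group_def by blast
  have "\<forall>g\<in>S. \<exists>N>0. g [^] (N::nat) \<in> \<Gamma>" using tors S(2) by blast
  then obtain N :: "'a \<Rightarrow> nat" where N: "\<forall>g\<in>S. N g > 0 \<and> g [^] N g \<in> \<Gamma>" by metis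
  define F where "F c = (\<Otimes>s\<in>S. s [^] (c s :: int))" for c
  have cl: "(\<lambda>s. s [^] (c s :: int)) \<in> S \<rightarrow> carrier G" for c using S(2) by auto
  have F: "F c \<in> carrier G" for c unfolding F_def using cl by (rule finprod_closed)
  have F_add: "F (\<lambda>s. c s + d s) = F c \<otimes> F d" for c d
  proof -
    have "F (\<lambda>s. c s + d s) = (\<Otimes>s\<in>S. s [^] c s \<otimes> s [^] d s)"
      unfolding F_def by (rule finprod_cong') (use S(2) in \<open>auto simp: int_pow_mult subset_iff\<close>)
    then show ?thesis unfolding F_def using finprod_multf[OF cl cl] by simp
  qed
  have F_one: "F (\<lambda>s. if s = x then k else 0) = x [^] k" if "x \<in> S" for x k
  proof -
    have "F (\<lambda>s. if s = x then k else 0) = (\<Otimes>s\<in>S. if x = s then s [^] k else \<one>)"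
      unfolding F_def by (rule finprod_cong') (use S(2) in \<open>auto\<close>)
    also have "\<dots> = x [^] k" by (rule finprod_singleton) (use S that in auto)
    finally show ?thesis .
  qed
  have ex: "\<exists>c. g = F c" if "g \<in> carrier G" for g
    using that unfolding S(3)[symmetric]
  proof (induction g rule: generate.induct)
    case one
    have "F (\<lambda>s. 0) = \<one>" unfolding F_def by (rule finprod_one_eqI) simp
    then show ?case by metis
  next
    case (incl h)
    then show ?case using F_one[of h 1] S(2) by (metis int_pow_1 subsetD)
  next
    case (inv h)
    then show ?case using F_one[of h "-1"] S(2) by (metis int_pow_neg int_pow_1 subsetD)
  next
    case (eng h1 h2)
    then show ?case using F_add by metis
  qed
  let ?E = "(\<lambda>c. \<Gamma> #> F c) ` (S \<rightarrow>\<^sub>E (\<Union>s\<in>S. {0..<int (N s)}))"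
  have "rcosets \<Gamma> \<subseteq> ?E"
  proof
    fix A assume "A \<in> rcosets \<Gamma>"
    then obtain g where g: "g \<in> carrier G" "A = \<Gamma> #> g" by (auto simp: RCOSETS_def)
    then obtain c where c: "g = F c" using ex by blast
    define d where "d = (\<lambda>s\<in>S. c s mod int (N s))"
    \<comment> \<open>The part of the exponents divisible by \<open>N s\<close>; the corresponding
      product lies in the subgroup, leaving the remainders \<open>d\<close> to represent the
      coset.\<close>
    define e where "e s = int (N s) * (c s div int (N s))" for s
    have "F c = F (\<lambda>s. e s + d s)"
      unfolding F_def by (rule finprod_cong') (use S(2) in \<open>auto simp: d_def e_def\<close>)
    then have split: "F c = F e \<otimes> F d" by (simp add: F_add)
    have "F e \<in> \<Gamma>"
      unfolding F_def
    proof (rule finprod_mem_subgroup[OF \<Gamma>])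
      fix s assume s: "s \<in> S"
      have "s [^] e s = (s [^] N s) [^] (c s div int (N s))"
        using s S(2) by (simp add: e_def int_pow_pow[symmetric] int_pow_int subset_iff)
      moreover have "s [^] N s \<in> \<Gamma>" using N s by blast
      ultimately show "s [^] e s \<in> \<Gamma>" using subgroup_int_pow_closed[OF \<Gamma>] by simp
    qed
    then have "\<Gamma> #> F c = \<Gamma> #> F d"
      unfolding split using coset_mult_assoc[OF \<Gamma>.subset F F] coset_join2[OF F \<Gamma>] by metis
    moreover have "d \<in> S \<rightarrow>\<^sub>E (\<Union>s\<in>S. {0..<int (N s)})"
    proof (rule PiE_I)
      fix s assume s: "s \<in> S"
      then have "N s > 0" using N by blast
      then have "d s \<in> {0..<int (N s)}" using s by (simp add: d_def)
      then show "d s \<in> (\<Union>s\<in>S. {0..<int (N s)})" using s by blast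
    qed (simp add: d_def)
    ultimately show "A \<in> ?E" using g c by blast
  qed
  moreover have "finite ?E" using S(1) by (intro finite_imageI finite_PiE) auto
  ultimately show ?thesis by (rule finite_subset)
qed

text \<open>Two powers of \<open>g\<close> fall into the same coset, and their quotient is a
  positive power in the subgroup.\<close>

lemma (in comm_group) torsion_if_finite_index:
  assumes \<Gamma>: "subgroup \<Gamma> G" and fin: "finite (rcosets \<Gamma>)" and g: "g \<in> carrier G"
  obtains N :: nat where "N > 0" "g [^] N \<in> \<Gamma>"
proof -
  interpret \<Gamma>: subgroup \<Gamma> G by (rule \<Gamma>)
  have "range (\<lambda>k::nat. \<Gamma> #> g [^] k) \<subseteq> rcosets \<Gamma>" using g by (auto simp: RCOSETS_def)
  then have "finite (range (\<lambda>k::nat. \<Gamma> #> g [^] k))" using fin by (rule finite_subset)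
  then have "\<not> inj (\<lambda>k::nat. \<Gamma> #> g [^] k)" using finite_imageD infinite_UNIV_nat by blast
  then obtain i j :: nat where ij: "i < j" "\<Gamma> #> g [^] i = \<Gamma> #> g [^] j"
    unfolding inj_def by (metis linorder_neqE_nat)
  have "g [^] j \<in> \<Gamma> #> g [^] i" using ij g rcos_self[OF nat_pow_closed[OF g] \<Gamma>, of j] by simp
  then obtain h where h: "h \<in> \<Gamma>" "g [^] j = h \<otimes> g [^] i" by (auto simp: r_coset_def)
  have "g [^] (j - i) \<otimes> g [^] i = h \<otimes> g [^] i" using ij(1) g h(2) by (simp add: nat_pow_mult)
  then have "g [^] (j - i) = h" using g h(1) \<Gamma>.subset by (simp add: subset_iff)
  then show ?thesis using that[of "j - i"] ij(1) h(1) by simp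
qed

section \<open>The annihilator of the excitations and the mobile directions\<close>

context stabilizer_code
begin

definition Ann :: "('l \<Rightarrow> int set) set" where
  "Ann = annihilator R Q"

lemma Q_sel:
  "carrier Q = {locals +>\<^bsub>D\<^esub> f | f. f \<in> carrier D}"
  "\<zero>\<^bsub>Q\<^esub> = locals"
  "r \<odot>\<^bsub>Q\<^esub> A = (\<Union>x\<in>A. locals +>\<^bsub>D\<^esub> (r \<odot>\<^bsub>D\<^esub> x))"
  by (auto simp: excitations_def quot_module_def locals_def A_RCOSETS_def RCOSETS_def a_r_coset_def)

lemma coset_iff: "y \<in> locals +>\<^bsub>D\<^esub> x \<longleftrightarrow> (\<exists>\<nu>\<in>locals. y = \<nu> \<oplus>\<^bsub>D\<^esub> x)"
  by (auto simp: a_r_coset_def r_coset_def)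

lemma coset_locals:
  assumes x: "x \<in> locals" shows "locals +>\<^bsub>D\<^esub> x = locals"
proof
  interpret R: cring R by (rule R_cring)
  show "locals +>\<^bsub>D\<^esub> x \<subseteq> locals" using x by (auto simp: coset_iff D_sel locals_add)
  show "locals \<subseteq> locals +>\<^bsub>D\<^esub> x"
  proof
    fix y assume y: "y \<in> locals"
    let ?z = "\<lambda>m\<in>L. y m \<oplus>\<^bsub>R\<^esub> (\<lambda>m\<in>L. \<ominus>\<^bsub>R\<^esub> x m) m"
    have "?z \<oplus>\<^bsub>D\<^esub> x = (\<lambda>m\<in>L. y m)"
      unfolding D_sel(2) by (rule restrict_ext) (simp add: R.a_assoc R.l_neg locals_apply[OF x] locals_apply[OF y])
    then have "y = ?z \<oplus>\<^bsub>D\<^esub> x" using locals_ext[OF y] by simp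
    moreover have "?z \<in> locals" by (rule locals_add[OF y locals_uminus[OF x]])
    ultimately show "y \<in> locals +>\<^bsub>D\<^esub> x" unfolding coset_iff by blast
  qed
qed

text \<open>The scalar action on a coset is a union over its representatives, each a local
  functional plus \<open>f\<close>. The union collapses to \<open>locals\<close> because
  \<open>locals\<close> is closed under addition and scalars and contains the image of
  \<open>f\<close>.\<close>

lemma Ann_iff: "r \<in> Ann \<longleftrightarrow> r \<in> carrier R \<and> (\<forall>f\<in>carrier D. r \<odot>\<^bsub>D\<^esub> f \<in> locals)"
proof -
  interpret R: cring R by (rule R_cring)
  have "(\<forall>e\<in>carrier Q. r \<odot>\<^bsub>Q\<^esub> e = \<zero>\<^bsub>Q\<^esub>) \<longleftrightarrow> (\<forall>f\<in>carrier D. r \<odot>\<^bsub>D\<^esub> f \<in> locals)" if r: "r \<in> carrier R"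
  proof (intro iffI ballI)
    fix f assume kill: "\<forall>e\<in>carrier Q. r \<odot>\<^bsub>Q\<^esub> e = \<zero>\<^bsub>Q\<^esub>" and f: "f \<in> carrier D"
    let ?e = "locals +>\<^bsub>D\<^esub> f"
    have "?e \<in> carrier Q" unfolding Q_sel(1) using f by blast
    then have e: "(\<Union>x\<in>?e. locals +>\<^bsub>D\<^esub> (r \<odot>\<^bsub>D\<^esub> x)) = locals" using kill unfolding Q_sel(2,3) by blast
    have z: "(\<lambda>m\<in>L. \<zero>\<^bsub>R\<^esub>) \<oplus>\<^bsub>D\<^esub> g = g" if "g \<in> L \<rightarrow>\<^sub>E carrier R" for g
    proof -
      have "(\<lambda>m\<in>L. \<zero>\<^bsub>R\<^esub>) \<oplus>\<^bsub>D\<^esub> g = (\<lambda>m\<in>L. g m)" unfolding D_sel(2)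
        by (rule restrict_ext) (simp add: PiE_mem[OF that])
      then show ?thesis using that by simp
    qed
    have "f \<in> L \<rightarrow>\<^sub>E carrier R" using f unfolding D_sel(1) by blast
    from z[OF this] have "f \<in> ?e" unfolding coset_iff using locals_0 by metis
    moreover have "r \<odot>\<^bsub>D\<^esub> f \<in> L \<rightarrow>\<^sub>E carrier R" using D_apply[OF f] r by (auto simp: D_sel)
    then have "r \<odot>\<^bsub>D\<^esub> f \<in> locals +>\<^bsub>D\<^esub> (r \<odot>\<^bsub>D\<^esub> f)" unfolding coset_iff using locals_0 z by metis
    ultimately show "r \<odot>\<^bsub>D\<^esub> f \<in> locals" using e by blast
  next
    fix e assume loc: "\<forall>f\<in>carrier D. r \<odot>\<^bsub>D\<^esub> f \<in> locals" and "e \<in> carrier Q"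
    then obtain f where f: "f \<in> carrier D" "e = locals +>\<^bsub>D\<^esub> f" unfolding Q_sel(1) by blast
    have "r \<odot>\<^bsub>D\<^esub> x \<in> locals" if x: "x \<in> e" for x
    proof -
      obtain \<nu> where \<nu>: "\<nu> \<in> locals" "x = \<nu> \<oplus>\<^bsub>D\<^esub> f" using x f by (auto simp: coset_iff)
      have "r \<odot>\<^bsub>D\<^esub> x = (\<lambda>m\<in>L. (\<lambda>m\<in>L. r \<otimes>\<^bsub>R\<^esub> \<nu> m) m \<oplus>\<^bsub>R\<^esub> (r \<odot>\<^bsub>D\<^esub> f) m)"
        unfolding D_sel(3)
        by (rule restrict_ext) (simp add: \<nu>(2) D_sel(2,3) R.r_distr r locals_apply[OF \<nu>(1)] D_apply[OF f(1)])
      then show ?thesis using locals_add[OF locals_smult[OF r \<nu>(1)]] loc f(1) by simp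
    qed
    then have "locals +>\<^bsub>D\<^esub> (r \<odot>\<^bsub>D\<^esub> x) = locals" if "x \<in> e" for x using coset_locals that by blast
    moreover have "e \<noteq> {}" using f locals_0 by (auto simp: a_r_coset_def r_coset_def)
    ultimately show "r \<odot>\<^bsub>Q\<^esub> e = \<zero>\<^bsub>Q\<^esub>" unfolding Q_sel(2,3) by auto
  qed
  then show ?thesis by (auto simp: Ann_def annihilator_def)
qed

lemma Ann_ideal: "ideal Ann R"
proof -
  interpret R: cring R by (rule R_cring)
  have zero: "\<zero>\<^bsub>R\<^esub> \<in> Ann"
  proof -
    have "\<zero>\<^bsub>R\<^esub> \<odot>\<^bsub>D\<^esub> f = (\<lambda>m\<in>L. \<zero>\<^bsub>R\<^esub>)" if "f \<in> carrier D" for f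
      unfolding D_sel(3) by (rule restrict_ext) (simp add: D_apply[OF that])
    then show ?thesis by (simp add: Ann_iff locals_0)
  qed
  have add: "r \<oplus>\<^bsub>R\<^esub> s \<in> Ann" if "r \<in> Ann" "s \<in> Ann" for r s
  proof -
    have "(r \<oplus>\<^bsub>R\<^esub> s) \<odot>\<^bsub>D\<^esub> f = (\<lambda>m\<in>L. (r \<odot>\<^bsub>D\<^esub> f) m \<oplus>\<^bsub>R\<^esub> (s \<odot>\<^bsub>D\<^esub> f) m)" if "f \<in> carrier D" for f
      unfolding D_sel(3) using \<open>r \<in> Ann\<close> \<open>s \<in> Ann\<close>
      by (intro restrict_ext) (simp add: D_apply[OF that] R.l_distr Ann_iff)
    then show ?thesis using that by (simp add: Ann_iff locals_add)
  qed
  have mult: "r \<otimes>\<^bsub>R\<^esub> s \<in> Ann" if r: "r \<in> carrier R" and s: "s \<in> Ann" for r s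
  proof -
    have "(r \<otimes>\<^bsub>R\<^esub> s) \<odot>\<^bsub>D\<^esub> f = (\<lambda>m\<in>L. r \<otimes>\<^bsub>R\<^esub> (s \<odot>\<^bsub>D\<^esub> f) m)" if "f \<in> carrier D" for f
      unfolding D_sel(3) using r s
      by (intro restrict_ext) (simp add: D_apply[OF that] R.m_assoc Ann_iff)
    then show ?thesis using r s by (simp add: Ann_iff locals_smult)
  qed
  show ?thesis
  proof (rule idealI)
    show "ring R" by (rule R.ring_axioms)
    show "subgroup Ann (add_monoid R)"
    proof (unfold_locales, goal_cases)
      case 1 then show ?case by (auto simp: Ann_iff)
    next
      case (2 r s) then show ?case using add by simp
    next
      case 3 then show ?case using zero by simp
    next
      case (4 r)
      then have "r \<in> carrier R" by (simp add: Ann_iff)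
      then have "\<ominus>\<^bsub>R\<^esub> r = \<ominus>\<^bsub>R\<^esub> \<one>\<^bsub>R\<^esub> \<otimes>\<^bsub>R\<^esub> r" by (simp add: R.l_minus)
      then show ?case using mult[of "\<ominus>\<^bsub>R\<^esub> \<one>\<^bsub>R\<^esub>" r] 4 unfolding a_inv_def[symmetric] by simp
    qed
    fix r s assume rs: "r \<in> Ann" "s \<in> carrier R"
    then show "s \<otimes>\<^bsub>R\<^esub> r \<in> Ann" by (simp add: mult)
    then show "r \<otimes>\<^bsub>R\<^esub> s \<in> Ann" using rs by (simp add: R.m_comm Ann_iff)
  qed
qed

lemma vimage_Ann_ideal:
  assumes \<mu>: "exponent_map \<Lambda> \<mu>"
  shows "is_ideal {u. gmap \<mu> u \<in> Ann}"
proof -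
  interpret I: ideal Ann R by (rule Ann_ideal)
  show ?thesis
    by (rule is_idealI) (auto simp: gmap_0 gmap_add gmap_mult[OF \<mu>] gmap_closed intro: I.I_l_closed)
qed

lemma gmap_n: "gmap \<mu> (of_nat n * u) = \<zero>\<^bsub>R\<^esub>"
proof -
  have "of_nat k * u = frag_cmul (int k) u" for k
    by (induction k) (simp_all add: distrib_right frag_cmul_distrib)
  then show ?thesis
    unfolding gmap_def R_sel by (intro restrict_ext) (simp add: push_cmul ZMod_eq_0_iff)
qed

lemma of_nat_n_vimage_Ann: "of_nat n \<in> {u. gmap \<mu> u \<in> Ann}"
proof -
  interpret I: ideal Ann R by (rule Ann_ideal)
  show ?thesis using gmap_n[of \<mu> 1] by simp
qed

lemma gmap_diff:
  assumes \<mu>: "exponent_map \<Lambda> \<mu>"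
  shows "gmap \<mu> (u - v) = gmap \<mu> u \<ominus>\<^bsub>R\<^esub> gmap \<mu> v"
proof -
  interpret R: cring R by (rule R_cring)
  have "gmap \<mu> (u - v) \<oplus>\<^bsub>R\<^esub> gmap \<mu> v = gmap \<mu> u" by (simp flip: gmap_add)
  then show ?thesis using gmap_closed[of \<mu>] by (metis R.minus_eq R.a_assoc R.r_neg R.r_zero R.a_inv_closed)
qed

lemma frag_of_power: "frag_of (a::'e::comm_monoid_add) ^ N = frag_of (((+) a ^^ N) 0)"
  by (induction N) (simp_all add: mult_single single_one)

lemma exponent_map_power:
  "exponent_map \<Lambda> \<mu> \<Longrightarrow> \<mu> (((+) a ^^ N) 0) = \<mu> a [^]\<^bsub>\<Lambda>\<^esub> N"
  by (induction N) (auto simp: exponent_map_def \<Lambda>.m_comm \<Lambda>.nat_pow_Suc)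

abbreviation mobile_along :: "'l \<Rightarrow> bool" where
  "mobile_along g \<equiv> gmonom \<Lambda> K \<one>\<^bsub>K\<^esub> g \<ominus>\<^bsub>R\<^esub> \<one>\<^bsub>R\<^esub> \<in> Ann"

lemma mobile_along_iff:
  assumes "exponent_map \<Lambda> \<mu>"
  shows "mobile_along (\<mu> a) \<longleftrightarrow> frag_of a - 1 \<in> {u. gmap \<mu> u \<in> Ann}"
  by (simp add: gmap_diff[OF assms] gmap_frag_of gmap_1[OF assms])

lemma mobile_along_power_iff:
  assumes "exponent_map \<Lambda> \<mu>"
  shows "mobile_along (\<mu> a [^]\<^bsub>\<Lambda>\<^esub> N) \<longleftrightarrow> frag_of a ^ N - 1 \<in> {u. gmap \<mu> u \<in> Ann}"
  using mobile_along_iff[OF assms, of "((+) a ^^ N) 0"]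
  by (simp add: frag_of_power exponent_map_power[OF assms])

lemma mobile_subgroup: "subgroup {g \<in> carrier \<Lambda>. mobile_along g} \<Lambda>"
proof -
  obtain \<mu> :: "('l \<Rightarrow>\<^sub>0 int) \<Rightarrow> 'l" where \<mu>: "exponent_map \<Lambda> \<mu>" "\<forall>g\<in>carrier \<Lambda>. \<mu> (frag_of g) = g"
    by (rule total_exponent_map)
  let ?I = "{u. gmap \<mu> u \<in> Ann}"
  note I = vimage_Ann_ideal[OF \<mu>(1)]
  have m: "mobile_along g \<longleftrightarrow> frag_of (frag_of g) - 1 \<in> ?I" if "g \<in> carrier \<Lambda>" for g
    using mobile_along_iff[OF \<mu>(1), of "frag_of g"] \<mu>(2) that by simp
  have mult: "mobile_along (g \<otimes>\<^bsub>\<Lambda>\<^esub> h)"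
    if "g \<in> carrier \<Lambda>" "h \<in> carrier \<Lambda>" "mobile_along g" "mobile_along h" for g h
  proof -
    let ?x = "frag_of (frag_of g)" and ?y = "frag_of (frag_of h)"
    have "\<mu> (frag_of g + frag_of h) = g \<otimes>\<^bsub>\<Lambda>\<^esub> h" using \<mu> that by (simp add: exponent_map_def)
    then have "mobile_along (g \<otimes>\<^bsub>\<Lambda>\<^esub> h) \<longleftrightarrow> ?x * ?y - 1 \<in> ?I"
      using mobile_along_iff[OF \<mu>(1), of "frag_of g + frag_of h"] by (simp add: mult_single)
    moreover have "?x * ?y - 1 = ?y * (?x - 1) + (?y - 1)" by (simp add: algebra_simps)
    moreover have "?y * (?x - 1) + (?y - 1) \<in> ?I"
      by (rule is_ideal_add[OF I is_ideal_mult[OF I]]) (use that m in blast)+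
    ultimately show ?thesis by simp
  qed
  have inv: "mobile_along (inv\<^bsub>\<Lambda>\<^esub> g)" if "g \<in> carrier \<Lambda>" "mobile_along g" for g
  proof -
    let ?x = "frag_of (frag_of g)" and ?y = "frag_of (frag_of (inv\<^bsub>\<Lambda>\<^esub> g))"
    interpret R: cring R by (rule R_cring)
    \<comment> \<open>In the free abelian group the two generators are not inverse to each other;
      only their images in the lattice are, so \<open>?x * ?y - 1\<close> is nonzero but maps to
      zero.\<close>
    have "\<mu> (frag_of g + frag_of (inv\<^bsub>\<Lambda>\<^esub> g)) = \<one>\<^bsub>\<Lambda>\<^esub>" using \<mu> that by (simp add: exponent_map_def)
    then have "gmap \<mu> (?x * ?y) = \<one>\<^bsub>R\<^esub>" by (simp add: mult_single gmap_frag_of R_sel)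
    then have "gmap \<mu> (?x * ?y - 1) = \<zero>\<^bsub>R\<^esub>"
      by (simp add: gmap_diff[OF \<mu>(1)] gmap_1[OF \<mu>(1)] R.minus_eq R.r_neg)
    then have "?x * ?y - 1 \<in> ?I" using additive_subgroup.zero_closed[OF ideal.axioms(1)[OF Ann_ideal]] by simp
    moreover have "?y * (?x - 1) \<in> ?I" using is_ideal_mult[OF I] m that by blast
    ultimately have "(?x * ?y - 1) - ?y * (?x - 1) \<in> ?I" by (rule is_ideal_diff[OF I])
    then show ?thesis using m[of "inv\<^bsub>\<Lambda>\<^esub> g"] that by (simp add: algebra_simps)
  qed
  have one: "mobile_along \<one>\<^bsub>\<Lambda>\<^esub>"
    using mobile_along_iff[OF \<mu>(1), of 0] \<mu>(1) is_ideal_0[OF I] by (simp add: exponent_map_def single_one)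
  show ?thesis
    by (rule \<Lambda>.subgroupI) (use mult inv one in auto)
qed

lemma all_mobile_iff_Ann:
  "all_mobile n \<Lambda> P\<^sub>0 \<omega>\<^sub>0 L \<longleftrightarrow> (\<exists>\<Gamma>. finite_index \<Gamma> \<Lambda> \<and> (\<forall>g\<in>\<Gamma>. mobile_along g))"
proof -
  interpret R: cring R by (rule R_cring)
  have "gmonom \<Lambda> K \<one>\<^bsub>K\<^esub> g \<ominus>\<^bsub>R\<^esub> \<one>\<^bsub>R\<^esub> \<in> carrier R" for g using gmonom_closed by simp
  then show ?thesis by (simp add: all_mobile_def Let_def Ann_def annihilator_def)
qed

text \<open>The mobile directions form a subgroup, and in a finitely generated abelian group a
  subgroup has finite index exactly if it contains a positive power of every element. This turns
  mobility into a condition on one element at a time.\<close>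

lemma all_mobile_iff_torsion:
  "all_mobile n \<Lambda> P\<^sub>0 \<omega>\<^sub>0 L \<longleftrightarrow> (\<forall>g\<in>carrier \<Lambda>. \<exists>N>0. mobile_along (g [^]\<^bsub>\<Lambda>\<^esub> (N::nat)))"
proof
  assume "all_mobile n \<Lambda> P\<^sub>0 \<omega>\<^sub>0 L"
  then obtain \<Gamma> where \<Gamma>: "subgroup \<Gamma> \<Lambda>" "finite (rcosets\<^bsub>\<Lambda>\<^esub> \<Gamma>)" "\<forall>g\<in>\<Gamma>. mobile_along g"
    unfolding all_mobile_iff_Ann finite_index_def by blast
  show "\<forall>g\<in>carrier \<Lambda>. \<exists>N>0. mobile_along (g [^]\<^bsub>\<Lambda>\<^esub> (N::nat))"
    using \<Lambda>.torsion_if_finite_index[OF \<Gamma>(1,2)] \<Gamma>(3) by metis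
next
  assume tors: "\<forall>g\<in>carrier \<Lambda>. \<exists>N>0. mobile_along (g [^]\<^bsub>\<Lambda>\<^esub> (N::nat))"
  let ?\<Gamma> = "{g \<in> carrier \<Lambda>. mobile_along g}"
  have "finite (rcosets\<^bsub>\<Lambda>\<^esub> ?\<Gamma>)"
    by (rule \<Lambda>.finite_index_if_torsion[OF fin_gen_lattice mobile_subgroup]) (use tors in auto)
  then show "all_mobile n \<Lambda> P\<^sub>0 \<omega>\<^sub>0 L"
    unfolding all_mobile_iff_Ann finite_index_def using mobile_subgroup by blast
qed

text \<open>The free abelian group on the type \<open>'l\<close> may have infinitely many
  generators, but monomials with the same image in the lattice agree modulo the kernel of
  \<open>gmap\<close>. Hence the monomials of finitely many group generators and of their inverses
  suffice.\<close>

lemma adjoin_list_generators: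
  assumes \<mu>: "exponent_map \<Lambda> \<mu>" "\<forall>g\<in>carrier \<Lambda>. \<mu> (frag_of g) = g"
  obtains bs where "\<forall>u. \<exists>y\<in>adjoin_list bs. u - y \<in> {u. gmap \<mu> u \<in> Ann}"
proof -
  let ?I = "{u. gmap \<mu> u \<in> Ann}"
  note I = vimage_Ann_ideal[OF \<mu>(1)]
  interpret R: cring R by (rule R_cring)
  obtain S where S: "finite S" "S \<subseteq> carrier \<Lambda>" "generate \<Lambda> S = carrier \<Lambda>"
    using fin_gen_lattice unfolding fin_gen_group_def by blast
  obtain xs where xs: "set xs = S" using finite_list[OF S(1)] by blast
  define bs where "bs = map (\<lambda>g. frag_of (frag_of g)) xs @ map (\<lambda>g. frag_of (frag_of (inv\<^bsub>\<Lambda>\<^esub> g))) xs"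
  let ?B = "adjoin_list bs"
  note B = is_subring_adjoin_list[of bs]
  have bsB: "frag_of (frag_of g) \<in> ?B" "frag_of (frag_of (inv\<^bsub>\<Lambda>\<^esub> g)) \<in> ?B" if "g \<in> S" for g
    using set_subset_adjoin_list[of bs] xs that by (auto simp: bs_def)
  have mon: "\<exists>a. frag_of a \<in> ?B \<and> \<mu> a = g" if "g \<in> carrier \<Lambda>" for g
    using that unfolding S(3)[symmetric]
  proof (induction g rule: generate.induct)
    case one
    show ?case using is_subring_1[OF B] \<mu>(1) by (intro exI[of _ 0]) (simp add: single_one exponent_map_def)
  next
    case (incl h)
    then show ?case using bsB(1) S(2) \<mu>(2) by (intro exI[of _ "frag_of h"]) auto
  next
    case (inv h)
    then have "h \<in> carrier \<Lambda>" using S(2) by blast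
    then show ?case using bsB(2)[OF inv] \<mu>(2) by (intro exI[of _ "frag_of (inv\<^bsub>\<Lambda>\<^esub> h)"]) simp
  next
    case (eng h1 h2)
    then obtain a b where "frag_of a \<in> ?B" "\<mu> a = h1" "frag_of b \<in> ?B" "\<mu> b = h2" by blast
    then show ?case using is_subring_mult[OF B, of "frag_of a" "frag_of b"] \<mu>(1)
      by (intro exI[of _ "a + b"]) (simp add: mult_single exponent_map_def)
  qed
  have "\<exists>y\<in>?B. u - y \<in> ?I" for u
    using subset_UNIV
  proof (induction u rule: frag_induction)
    case zero
    show ?case using is_subring_0[OF B] is_ideal_0[OF I] by (intro bexI[of _ 0]) auto
  next
    case (one a)
    have "\<mu> a \<in> carrier \<Lambda>" using \<mu>(1) by (simp add: exponent_map_def)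
    then obtain b where b: "frag_of b \<in> ?B" "\<mu> b = \<mu> a" using mon by blast
    have "gmap \<mu> (frag_of a - frag_of b) = gmap \<mu> 0"
      by (simp add: gmap_diff[OF \<mu>(1)] gmap_frag_of b(2) gmap_0 R.minus_eq R.r_neg gmonom_closed)
    then have "frag_of a - frag_of b \<in> ?I" using is_ideal_0[OF I] by simp
    then show ?case using b(1) by blast
  next
    case (diff u v)
    then obtain x y where *: "x \<in> ?B" "y \<in> ?B" "u - x \<in> ?I" "v - y \<in> ?I" by blast
    have "(u - v) - (x - y) = (u - x) - (v - y)" by simp
    then have "(u - v) - (x - y) \<in> ?I" using is_ideal_diff[OF I *(3,4)] by metis
    then show ?case using is_subring_diff[OF B *(1,2)] by blast
  qed
  then show ?thesis by (intro that[of bs] allI)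
qed

text \<open>Modulo the annihilator every monomial from \<open>\<Gamma>\<close> equals
  \<open>1\<close>, so all monomials of a coset coincide and one representative per coset
  spans.\<close>

lemma finite_spanning:
  assumes \<mu>: "exponent_map \<Lambda> \<mu>" "\<forall>g\<in>carrier \<Lambda>. \<mu> (frag_of g) = g"
    and \<Gamma>: "subgroup \<Gamma> \<Lambda>" "finite (rcosets\<^bsub>\<Lambda>\<^esub> \<Gamma>)" "\<forall>g\<in>\<Gamma>. mobile_along g"
  obtains Y where "finite Y" "\<forall>u. \<exists>c. u - (\<Sum>y\<in>Y. of_int (c y) * y) \<in> {u. gmap \<mu> u \<in> Ann}"
proof -
  let ?I = "{u. gmap \<mu> u \<in> Ann}"
  note I = vimage_Ann_ideal[OF \<mu>(1)]
  interpret R: cring R by (rule R_cring)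
  interpret \<Gamma>: subgroup \<Gamma> \<Lambda> by (rule \<Gamma>(1))
  define r where "r A = (SOME g. g \<in> A)" for A :: "'l set"
  define Y where "Y = (\<lambda>A. frag_of (frag_of (r A))) ` (rcosets\<^bsub>\<Lambda>\<^esub> \<Gamma>)"
  have Y: "finite Y" using \<Gamma>(2) by (simp add: Y_def)
  have "\<exists>c. u - (\<Sum>y\<in>Y. of_int (c y) * y) \<in> ?I" for u
    using subset_UNIV
  proof (induction u rule: frag_induction)
    case zero
    show ?case using is_ideal_0[OF I] by (intro exI[of _ "\<lambda>y. 0"]) simp
  next
    case (one a)
    have g: "\<mu> a \<in> carrier \<Lambda>" using \<mu>(1) by (simp add: exponent_map_def)
    let ?A = "\<Gamma> #>\<^bsub>\<Lambda>\<^esub> \<mu> a"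
    have A: "?A \<in> rcosets\<^bsub>\<Lambda>\<^esub> \<Gamma>" using g by (auto simp: RCOSETS_def)
    have "\<mu> a \<in> ?A" by (rule \<Lambda>.rcos_self[OF g \<Gamma>(1)])
    then have "r ?A \<in> ?A" unfolding r_def by (rule someI)
    then obtain \<gamma> where \<gamma>: "\<gamma> \<in> \<Gamma>" "r ?A = \<gamma> \<otimes>\<^bsub>\<Lambda>\<^esub> \<mu> a" by (auto simp: r_coset_def)
    have \<gamma>G: "\<gamma> \<in> carrier \<Lambda>" using \<gamma>(1) \<Gamma>.subset by blast
    let ?y = "frag_of (frag_of (r ?A))"
    have yY: "?y \<in> Y" using A by (auto simp: Y_def)
    have "gmap \<mu> ?y = gmap \<mu> (frag_of (frag_of \<gamma>) * frag_of a)"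
      using \<mu> \<gamma>G g by (simp add: mult_single gmap_frag_of exponent_map_def \<gamma>(2))
    then have "gmap \<mu> (frag_of a - ?y) = gmap \<mu> (- (frag_of a * (frag_of (frag_of \<gamma>) - 1)))"
      by (simp add: gmap_diff[OF \<mu>(1)] algebra_simps)
    moreover have "frag_of (frag_of \<gamma>) - 1 \<in> ?I"
      using mobile_along_iff[OF \<mu>(1), of "frag_of \<gamma>"] \<mu>(2) \<gamma>G \<Gamma>(3) \<gamma>(1) by simp
    then have "- (frag_of a * (frag_of (frag_of \<gamma>) - 1)) \<in> ?I" by (intro is_ideal_uminus[OF I] is_ideal_mult[OF I])
    ultimately have "frag_of a - ?y \<in> ?I" by simp
    moreover have "(\<Sum>y\<in>Y. of_int (if y = ?y then 1 else 0) * y) = (\<Sum>y\<in>Y. if y = ?y then y else 0)"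
      by (rule sum.cong) auto
    then have "(\<Sum>y\<in>Y. of_int (if y = ?y then 1 else 0) * y) = ?y" using Y yY by simp
    ultimately show ?case by (intro exI[of _ "\<lambda>y. if y = ?y then 1 else 0"]) simp
  next
    case (diff u v)
    then obtain c d where *: "u - (\<Sum>y\<in>Y. of_int (c y) * y) \<in> ?I" "v - (\<Sum>y\<in>Y. of_int (d y) * y) \<in> ?I" by blast
    have "u - v - (\<Sum>y\<in>Y. of_int (c y - d y) * y)
      = (u - (\<Sum>y\<in>Y. of_int (c y) * y)) - (v - (\<Sum>y\<in>Y. of_int (d y) * y))"
      by (simp add: left_diff_distrib sum_subtractf)
    then have "u - v - (\<Sum>y\<in>Y. of_int (c y - d y) * y) \<in> ?I" using is_ideal_diff[OF I *] by metis
    then show ?case by (rule exI[of _ "\<lambda>y. c y - d y"])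
  qed
  then show ?thesis by (intro that[OF Y] allI)
qed

text \<open>The map \<open>\<psi>\<close> presents the ring defining the dimension as the quotient
  of an integral group ring by the preimage \<open>I\<close> of the annihilator. Dimension at most
  zero and mobility thereby become statements on \<open>I\<close>: no prime chain above it, and
  torsion of all monomials modulo it.\<close>

theorem all_mobile_iff_dim: "all_mobile n \<Lambda> P\<^sub>0 \<omega>\<^sub>0 L \<longleftrightarrow> module_dim R Q \<le> 0"
proof -
  obtain \<mu> :: "('l \<Rightarrow>\<^sub>0 int) \<Rightarrow> 'l" where \<mu>: "exponent_map \<Lambda> \<mu>" "\<forall>g\<in>carrier \<Lambda>. \<mu> (frag_of g) = g"
    by (rule total_exponent_map)
  define I where "I = {u. gmap \<mu> u \<in> Ann}"
  have I: "is_ideal I" and nI: "of_nat n \<in> I"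
    unfolding I_def by (rule vimage_Ann_ideal[OF \<mu>(1)], rule of_nat_n_vimage_Ann)
  interpret A: ideal Ann R by (rule Ann_ideal)
  interpret R: cring R by (rule R_cring)
  interpret T: cring "R Quot Ann" by (rule A.quotient_is_cring[OF R_cring])
  define \<psi> where "\<psi> u = Ann +>\<^bsub>R\<^esub> gmap \<mu> u" for u
  have hom: "(+>\<^bsub>R\<^esub>) Ann \<in> ring_hom R (R Quot Ann)" by (rule A.rcos_ring_hom)
  have "carrier (R Quot Ann) = (\<lambda>x. Ann +>\<^bsub>R\<^esub> x) ` carrier R"
    by (auto simp: FactRing_def A_RCOSETS_def RCOSETS_def a_r_coset_def)
  then have surj: "carrier (R Quot Ann) = range \<psi>" unfolding \<psi>_def gmap_surj[OF \<mu>] by auto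
  interpret \<psi>: ring_surjection \<psi> "R Quot Ann"
  proof
    show "carrier (R Quot Ann) = range \<psi>" by (rule surj)
    show "\<psi> (x + y) = \<psi> x \<oplus>\<^bsub>R Quot Ann\<^esub> \<psi> y" "\<psi> (x * y) = \<psi> x \<otimes>\<^bsub>R Quot Ann\<^esub> \<psi> y" for x y
      unfolding \<psi>_def gmap_add gmap_mult[OF \<mu>(1)]
      by (rule ring_hom_add[OF hom gmap_closed gmap_closed], rule ring_hom_mult[OF hom gmap_closed gmap_closed])
    show "\<psi> 0 = \<zero>\<^bsub>R Quot Ann\<^esub>" unfolding \<psi>_def gmap_0
      using ring_hom_zero[OF hom cring.axioms(1)[OF R_cring] cring.axioms(1)[OF T.is_cring]] .
    show "\<psi> 1 = \<one>\<^bsub>R Quot Ann\<^esub>" unfolding \<psi>_def gmap_1[OF \<mu>(1)] by (rule ring_hom_one[OF hom])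
  qed
  have "\<psi> u = \<zero>\<^bsub>R Quot Ann\<^esub> \<longleftrightarrow> u \<in> I" for u
  proof -
    have "\<zero>\<^bsub>R Quot Ann\<^esub> = Ann" by (simp add: FactRing_def)
    moreover have "Ann +>\<^bsub>R\<^esub> gmap \<mu> u = Ann \<longleftrightarrow> gmap \<mu> u \<in> Ann"
      using A.a_rcos_const A.a_rcos_self[OF gmap_closed[of \<mu> u]] by metis
    ultimately show ?thesis by (simp add: \<psi>_def I_def)
  qed
  then have ker: "{u. \<psi> u = \<zero>\<^bsub>R Quot Ann\<^esub>} = I" by auto
  have dim: "module_dim R Q \<le> 0 \<longleftrightarrow> (\<forall>p p'. is_prime p \<longrightarrow> is_prime p' \<longrightarrow> I \<subseteq> p \<longrightarrow> \<not> p \<subset> p')"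
    unfolding module_dim_def Ann_def[symmetric] \<psi>.krull_dim_le_0_iff ker by (rule refl)
  show ?thesis
  proof
    assume "all_mobile n \<Lambda> P\<^sub>0 \<omega>\<^sub>0 L"
    then obtain \<Gamma> where \<Gamma>: "subgroup \<Gamma> \<Lambda>" "finite (rcosets\<^bsub>\<Lambda>\<^esub> \<Gamma>)" "\<forall>g\<in>\<Gamma>. mobile_along g"
      unfolding all_mobile_iff_Ann finite_index_def by blast
    obtain Y where Y: "finite Y" "\<forall>u. \<exists>c. u - (\<Sum>y\<in>Y. of_int (c y) * y) \<in> I"
      unfolding I_def by (rule finite_spanning[OF \<mu> \<Gamma>])
    show "module_dim R Q \<le> 0"
      unfolding dim using no_prime_chain_if_finite[OF I nI n_pos Y(1) spec[OF Y(2)]] by blast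
  next
    assume "module_dim R Q \<le> 0"
    then have no: "\<And>p p'. is_prime p \<Longrightarrow> is_prime p' \<Longrightarrow> I \<subseteq> p \<Longrightarrow> p \<subset> p' \<Longrightarrow> False" unfolding dim by blast
    obtain bs where bs: "\<forall>u. \<exists>y\<in>adjoin_list bs. u - y \<in> I"
      unfolding I_def by (rule adjoin_list_generators[OF \<mu>])
    show "all_mobile n \<Lambda> P\<^sub>0 \<omega>\<^sub>0 L"
      unfolding all_mobile_iff_torsion
    proof
      fix g assume g: "g \<in> carrier \<Lambda>"
      let ?t = "frag_of (frag_of g)"
      have t: "?t * frag_of (- frag_of g) - 1 \<in> I" by (simp add: mult_single single_one is_ideal_0[OF I])
      obtain N where "N > 0" "?t ^ N - 1 \<in> I"
        by (rule torsion_if_primes_maximal[OF I nI n_pos spec[OF bs] _ t]) (erule (3) no)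
      then show "\<exists>N>0. mobile_along (g [^]\<^bsub>\<Lambda>\<^esub> (N::nat))"
        using mobile_along_power_iff[OF \<mu>(1), of "frag_of g"] \<mu>(2) g unfolding I_def by auto
    qed
  qed
qed

end

section \<open>Duality for the finite module \<open>P\<^sub>0\<close>\<close>

definition zchar :: "nat \<Rightarrow> int set \<Rightarrow> complex" where
  "zchar n x = cis (2 * pi * real_of_int (ZRep (int n) x) / real n)"

lemma cis_eq_1_iff: "cis (2 * pi * real_of_int z / real n) = 1 \<longleftrightarrow> int n dvd z" if "n > 0"
proof
  assume "cis (2 * pi * real_of_int z / real n) = 1"
  then have "cos (2 * pi * real_of_int z / real n) = 1" by (metis cis.sel(1) one_complex.sel(1))
  then obtain k :: int where "2 * pi * real_of_int z / real n = real_of_int k * 2 * pi"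
    unfolding cos_one_2pi_int by blast
  then have "real_of_int z = real_of_int k * real n" using that by (simp add: field_simps)
  then have "z = k * int n" by (metis of_int_eq_iff of_int_mult of_int_of_nat_eq)
  then show "int n dvd z" by simp
next
  assume "int n dvd z"
  then obtain k where "z = int n * k" by (auto simp: dvd_def)
  then have "2 * pi * real_of_int z / real n = 2 * pi * real_of_int k" using that by simp
  then show "cis (2 * pi * real_of_int z / real n) = 1" by (simp add: cis_multiple_2pi)
qed

lemma zchar_ZMod: "n > 0 \<Longrightarrow> zchar n (ZMod (int n) z) = cis (2 * pi * real_of_int z / real n)"
proof -
  assume n: "n > 0"
  let ?r = "ZRep (int n) (ZMod (int n) z)"
  have "ZMod (int n) ?r = ZMod (int n) z" by (rule ZMod_ZRep[OF ZMod_closed])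
  then have "int n dvd ?r - z" by (simp add: ZMod_eq_iff)
  then have "cis (2 * pi * real_of_int (?r - z) / real n) = 1" using cis_eq_1_iff[OF n] by blast
  moreover have "zchar n (ZMod (int n) z) = cis (2 * pi * real_of_int (?r - z) / real n) * cis (2 * pi * real_of_int z / real n)"
    by (simp add: zchar_def cis_mult add_divide_distrib[symmetric] distrib_left[symmetric])
  ultimately show ?thesis by simp
qed

lemma zchar_add:
  "n > 0 \<Longrightarrow> x \<in> carrier (ZFact (int n)) \<Longrightarrow> y \<in> carrier (ZFact (int n)) \<Longrightarrow>
    zchar n (x \<oplus>\<^bsub>ZFact (int n)\<^esub> y) = zchar n x * zchar n y"
  by (auto simp: ZFact_carrier ZMod_add[symmetric] zchar_ZMod cis_mult add_divide_distrib distrib_left)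

lemma zchar_eq_1_iff:
  assumes "n > 0" "x \<in> carrier (ZFact (int n))"
  shows "zchar n x = 1 \<longleftrightarrow> x = \<zero>\<^bsub>ZFact (int n)\<^esub>"
proof -
  obtain z where "x = ZMod (int n) z" using assms(2) by (auto simp: ZFact_carrier)
  then show ?thesis using assms(1) by (simp add: zchar_ZMod cis_eq_1_iff ZMod_eq_0_iff)
qed

text \<open>Permuting the summands by \<open>s\<close> multiplies the sum by
  \<open>zchar n x0\<close>, which differs from \<open>1\<close>.\<close>

lemma sum_zchar_eq_0:
  assumes "n > 0" and bij: "bij_betw s A A" and x0: "x0 \<in> carrier (ZFact (int n))" "x0 \<noteq> \<zero>\<^bsub>ZFact (int n)\<^esub>"
    and f: "\<And>a. a \<in> A \<Longrightarrow> f a \<in> carrier (ZFact (int n))" "\<And>a. a \<in> A \<Longrightarrow> f (s a) = f a \<oplus>\<^bsub>ZFact (int n)\<^esub> x0"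
  shows "(\<Sum>a\<in>A. zchar n (f a)) = 0"
proof -
  have "(\<Sum>a\<in>A. zchar n (f a)) = (\<Sum>a\<in>A. zchar n (f (s a)))"
    using sum.reindex_bij_betw[OF bij, of "\<lambda>a. zchar n (f a)"] by simp
  also have "\<dots> = (\<Sum>a\<in>A. zchar n (f a) * zchar n x0)"
    by (rule sum.cong) (simp_all add: f zchar_add x0 assms(1))
  also have "\<dots> = (\<Sum>a\<in>A. zchar n (f a)) * zchar n x0" by (rule sum_distrib_right[symmetric])
  finally have "(\<Sum>a\<in>A. zchar n (f a)) * (zchar n x0 - 1) = 0" by (simp add: algebra_simps)
  moreover have "zchar n x0 \<noteq> 1" using zchar_eq_1_iff[OF assms(1) x0(1)] x0(2) by simp
  ultimately show ?thesis by simp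
qed

context stabilizer_code
begin

lemma finite_P0: "finite (carrier P\<^sub>0)"
proof -
  obtain S where S: "finite S" "S \<subseteq> carrier P\<^sub>0"
    and gen: "\<And>N. submodule N K P\<^sub>0 \<Longrightarrow> S \<subseteq> N \<Longrightarrow> N = carrier P\<^sub>0"
    using fin_gen_P0 unfolding fin_gen_module_def by blast
  define F where "F c = (\<Oplus>\<^bsub>P\<^sub>0\<^esub>s\<in>S. cls (c s) \<odot>\<^bsub>P\<^sub>0\<^esub> s)" for c
  have cl: "(\<lambda>s. cls (c s) \<odot>\<^bsub>P\<^sub>0\<^esub> s) \<in> S \<rightarrow> carrier P\<^sub>0" for c using S(2) by (auto simp: ZMod_closed)
  have F: "F c \<in> carrier P\<^sub>0" for c unfolding F_def using cl by (rule P\<^sub>0.M.finsum_closed)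
  have F_add: "F (\<lambda>s. c s + d s) = F c \<oplus>\<^bsub>P\<^sub>0\<^esub> F d" for c d
  proof -
    have "F (\<lambda>s. c s + d s) = (\<Oplus>\<^bsub>P\<^sub>0\<^esub>s\<in>S. cls (c s) \<odot>\<^bsub>P\<^sub>0\<^esub> s \<oplus>\<^bsub>P\<^sub>0\<^esub> cls (d s) \<odot>\<^bsub>P\<^sub>0\<^esub> s)"
      unfolding F_def
      by (rule P\<^sub>0.M.finsum_cong') (use S(2) in \<open>auto simp: ZMod_add ZMod_closed P\<^sub>0.smult_l_distr subset_iff\<close>)
    then show ?thesis unfolding F_def using P\<^sub>0.M.finsum_addf[OF cl cl] by simp
  qed
  have F_mult: "F (\<lambda>s. z * c s) = cls z \<odot>\<^bsub>P\<^sub>0\<^esub> F c" for z c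
  proof -
    have "F (\<lambda>s. z * c s) = (\<Oplus>\<^bsub>P\<^sub>0\<^esub>s\<in>S. cls z \<odot>\<^bsub>P\<^sub>0\<^esub> (cls (c s) \<odot>\<^bsub>P\<^sub>0\<^esub> s))"
      unfolding F_def
      by (rule P\<^sub>0.M.finsum_cong') (use S(2) in \<open>auto simp: ZMod_mult ZMod_closed P\<^sub>0.smult_assoc1 subset_iff\<close>)
    then show ?thesis unfolding F_def using P\<^sub>0.finsum_smult_ldistr[OF S(1) ZMod_closed cl] by simp
  qed
  have F_0: "F (\<lambda>s. 0) = \<zero>\<^bsub>P\<^sub>0\<^esub>"
    unfolding F_def by (rule P\<^sub>0.M.add.finprod_one_eqI) (use S(2) in \<open>auto simp: ZMod_0 subset_iff\<close>)
  have "submodule (range F) K P\<^sub>0"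
  proof (rule P\<^sub>0.submoduleI)
    show "range F \<subseteq> carrier P\<^sub>0" using F by blast
    show "\<zero>\<^bsub>P\<^sub>0\<^esub> \<in> range F" using F_0 by (metis rangeI)
    fix a assume "a \<in> range F"
    then obtain c where c: "a = F c" by blast
    have "F (\<lambda>s. (-1) * c s) \<oplus>\<^bsub>P\<^sub>0\<^esub> F c = \<zero>\<^bsub>P\<^sub>0\<^esub>" using F_add[of "\<lambda>s. (-1) * c s" c] F_0 by simp
    then have "\<ominus>\<^bsub>P\<^sub>0\<^esub> a = F (\<lambda>s. (-1) * c s)" using P\<^sub>0.minus_equality F c by metis
    then show "\<ominus>\<^bsub>P\<^sub>0\<^esub> a \<in> range F" by blast
    fix b assume "b \<in> range F"
    then obtain d where "b = F d" by blast
    then show "a \<oplus>\<^bsub>P\<^sub>0\<^esub> b \<in> range F" using F_add[of c d] c by (metis rangeI)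
  next
    fix k x assume "k \<in> carrier K" "x \<in> range F"
    then obtain z c where "k = cls z" "x = F c" by (auto simp: ZFact_carrier)
    then show "k \<odot>\<^bsub>P\<^sub>0\<^esub> x \<in> range F" using F_mult[of z c] by (metis rangeI)
  qed
  moreover have "S \<subseteq> range F"
  proof
    fix x assume x: "x \<in> S"
    have "F (\<lambda>s. if s = x then 1 else 0) = (\<Oplus>\<^bsub>P\<^sub>0\<^esub>s\<in>S. if x = s then s else \<zero>\<^bsub>P\<^sub>0\<^esub>)"
      unfolding F_def
      by (rule P\<^sub>0.M.finsum_cong') (use S(2) in \<open>auto simp: ZMod_0 ZMod_1 subset_iff\<close>)
    also have "\<dots> = x" by (rule P\<^sub>0.M.add.finprod_singleton) (use S x in auto)
    finally show "x \<in> range F" by (metis rangeI)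
  qed
  ultimately have E: "carrier P\<^sub>0 = range F" using gen by blast
  have "range F \<subseteq> F ` (S \<rightarrow>\<^sub>E {0..<int n})"
  proof
    fix a assume "a \<in> range F"
    then obtain c where c: "a = F c" by blast
    let ?d = "\<lambda>s\<in>S. c s mod int n"
    have "F c = F ?d" unfolding F_def
      by (rule P\<^sub>0.M.finsum_cong') (use S(2) in \<open>auto simp: ZMod_closed ZMod_mod[of "int n" "c _"] subset_iff\<close>)
    moreover have "?d \<in> S \<rightarrow>\<^sub>E {0..<int n}" using n_pos by auto
    ultimately show "a \<in> F ` (S \<rightarrow>\<^sub>E {0..<int n})" using c by blast
  qed
  moreover have "finite (F ` (S \<rightarrow>\<^sub>E {0..<int n}))" using S(1) by (intro finite_imageI finite_PiE) auto
  ultimately show ?thesis unfolding E by (rule finite_subset)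
qed

text \<open>Counting characters by orthogonality bounds the number of additive maps \<open>P\<^sub>0 \<rightarrow> \<int>/n\<close> by the
  order of \<open>P\<^sub>0\<close>; as \<open>\<omega>\<^sub>0\<close> provides that many, it provides them all.\<close>

lemma form_represents:
  assumes \<chi>: "\<And>b. b \<in> carrier P\<^sub>0 \<Longrightarrow> \<chi> b \<in> carrier K"
    and add: "\<And>a b. a \<in> carrier P\<^sub>0 \<Longrightarrow> b \<in> carrier P\<^sub>0 \<Longrightarrow> \<chi> (a \<oplus>\<^bsub>P\<^sub>0\<^esub> b) = \<chi> a \<oplus>\<^bsub>K\<^esub> \<chi> b"
  obtains a where "a \<in> carrier P\<^sub>0" "\<forall>b\<in>carrier P\<^sub>0. \<omega>\<^sub>0 b a = \<chi> b"
proof -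
  let ?A = "carrier P\<^sub>0"
  note n = n_pos and fA = finite_P0
  define H where "H = {\<chi> \<in> ?A \<rightarrow>\<^sub>E carrier K. \<forall>a\<in>?A. \<forall>b\<in>?A. \<chi> (a \<oplus>\<^bsub>P\<^sub>0\<^esub> b) = \<chi> a \<oplus>\<^bsub>K\<^esub> \<chi> b}"
  have fH: "finite H" unfolding H_def using finite_PiE[OF fA, of "\<lambda>_. carrier K"] finite_ZFact[of "int n"] n by simp
  define z where "z = (\<lambda>a\<in>?A. \<zero>\<^bsub>K\<^esub>)"
  have zH: "z \<in> H" by (simp add: H_def z_def)
  have Hc: "\<eta> a \<in> carrier K" if "\<eta> \<in> H" "a \<in> ?A" for \<eta> a using that by (auto simp: H_def)
  have col: "(\<Sum>a\<in>?A. zchar n (\<eta> a)) = (if \<eta> = z then of_nat (card ?A) else 0)" if \<eta>: "\<eta> \<in> H" for \<eta>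
  proof (cases "\<eta> = z")
    case True
    have "zchar n \<zero>\<^bsub>K\<^esub> = 1" using zchar_eq_1_iff[OF n] by simp
    then show ?thesis using True by (simp add: z_def)
  next
    case False
    have "\<exists>a0\<in>?A. \<eta> a0 \<noteq> \<zero>\<^bsub>K\<^esub>"
    proof (rule ccontr)
      assume "\<not> ?thesis"
      then have "\<eta> = z" using \<eta> zH unfolding H_def by (intro PiE_ext[of _ ?A "\<lambda>_. carrier K"]) (auto simp: z_def)
      then show False using False by blast
    qed
    then obtain a0 where a0: "a0 \<in> ?A" "\<eta> a0 \<noteq> \<zero>\<^bsub>K\<^esub>" by blast
    have "(\<Sum>a\<in>?A. zchar n (\<eta> a)) = 0"
    proof (rule sum_zchar_eq_0[OF n])
      show "bij_betw (\<lambda>a. a \<oplus>\<^bsub>P\<^sub>0\<^esub> a0) ?A ?A"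
        by (rule bij_betw_byWitness[where f' = "\<lambda>a. a \<oplus>\<^bsub>P\<^sub>0\<^esub> \<ominus>\<^bsub>P\<^sub>0\<^esub> a0"])
          (use a0 in \<open>auto simp: P\<^sub>0.M.a_assoc P\<^sub>0.M.r_neg P\<^sub>0.M.l_neg\<close>)
    qed (use a0 \<eta> in \<open>auto simp: Hc H_def\<close>)
    then show ?thesis using False by simp
  qed
  have row: "(\<Sum>\<eta>\<in>H. zchar n (\<eta> a)) = (if \<forall>\<eta>\<in>H. \<eta> a = \<zero>\<^bsub>K\<^esub> then of_nat (card H) else 0)" if a: "a \<in> ?A" for a
  proof (cases "\<forall>\<eta>\<in>H. \<eta> a = \<zero>\<^bsub>K\<^esub>")
    case True
    have "zchar n \<zero>\<^bsub>K\<^esub> = 1" using zchar_eq_1_iff[OF n] by simp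
    then have "(\<Sum>\<eta>\<in>H. zchar n (\<eta> a)) = (\<Sum>\<eta>\<in>H. 1)" using True by (intro sum.cong) auto
    then show ?thesis using True by simp
  next
    case False
    then obtain \<eta>0 where \<eta>0: "\<eta>0 \<in> H" "\<eta>0 a \<noteq> \<zero>\<^bsub>K\<^esub>" by blast
    let ?s = "\<lambda>\<eta>. \<lambda>b\<in>?A. \<eta> b \<oplus>\<^bsub>K\<^esub> \<eta>0 b" and ?t = "\<lambda>\<eta>. \<lambda>b\<in>?A. \<eta> b \<oplus>\<^bsub>K\<^esub> \<ominus>\<^bsub>K\<^esub> \<eta>0 b"
    have ext: "(\<lambda>b\<in>?A. \<eta> b) = \<eta>" if "\<eta> \<in> H" for \<eta>
      by (rule PiE_restrict[of _ _ "\<lambda>_. carrier K"]) (use that in \<open>simp add: H_def\<close>)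
    have sH: "?s \<eta> \<in> H" if \<eta>: "\<eta> \<in> H" for \<eta>
      using \<eta> \<eta>0(1) Hc unfolding H_def by (auto simp: P\<^sub>0.R.add.m_ac)
    have tH: "?t \<eta> \<in> H" if \<eta>: "\<eta> \<in> H" for \<eta>
      using \<eta> \<eta>0(1) Hc unfolding H_def by (auto simp: P\<^sub>0.R.add.m_ac P\<^sub>0.R.minus_add)
    have st: "?s (?t \<eta>) = \<eta>" if \<eta>: "\<eta> \<in> H" for \<eta>
    proof -
      have "?s (?t \<eta>) = (\<lambda>b\<in>?A. \<eta> b)"
        by (rule restrict_ext) (simp add: Hc[OF \<eta>] Hc[OF \<eta>0(1)] P\<^sub>0.R.add.m_assoc P\<^sub>0.R.l_neg)
      then show ?thesis using ext[OF \<eta>] by simp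
    qed
    have ts: "?t (?s \<eta>) = \<eta>" if \<eta>: "\<eta> \<in> H" for \<eta>
    proof -
      have "?t (?s \<eta>) = (\<lambda>b\<in>?A. \<eta> b)"
        by (rule restrict_ext) (simp add: Hc[OF \<eta>] Hc[OF \<eta>0(1)] P\<^sub>0.R.add.m_assoc P\<^sub>0.R.r_neg)
      then show ?thesis using ext[OF \<eta>] by simp
    qed
    have "(\<Sum>\<eta>\<in>H. zchar n (\<eta> a)) = 0"
    proof (rule sum_zchar_eq_0[OF n])
      show "bij_betw ?s H H"
        by (rule bij_betw_byWitness[where f' = ?t]) (use sH tH st ts in blast)+
    qed (use \<eta>0 a Hc in auto)
    then show ?thesis using False by auto
  qed
  define m where "m = card {a \<in> ?A. \<forall>\<eta>\<in>H. \<eta> a = \<zero>\<^bsub>K\<^esub>}"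
  \<comment> \<open>Double counting of the character table. Summed over \<open>?A\<close> first,
    only the zero map contributes; summed over \<open>H\<close> first, only the \<open>m\<close>
    common zeros of all maps do. As zero is a common zero, \<open>m\<close> is positive and
    \<open>H\<close> has at most as many elements as \<open>?A\<close>.\<close>
  have "(of_nat (card ?A) :: complex) = (\<Sum>\<eta>\<in>H. \<Sum>a\<in>?A. zchar n (\<eta> a))"
    using zH fH by (simp add: col)
  also have "\<dots> = (\<Sum>a\<in>?A. \<Sum>\<eta>\<in>H. zchar n (\<eta> a))" by (rule sum.swap)
  also have "\<dots> = (\<Sum>a\<in>?A. if \<forall>\<eta>\<in>H. \<eta> a = \<zero>\<^bsub>K\<^esub> then of_nat (card H) else 0)"
    by (rule sum.cong) (simp_all only: row)
  also have "\<dots> = of_nat (m * card H)"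
    unfolding m_def by (subst sum.inter_filter[OF fA, symmetric]) simp
  finally have card: "card ?A = m * card H" by (simp only: of_nat_eq_iff)
  have H0: "\<eta> \<zero>\<^bsub>P\<^sub>0\<^esub> = \<zero>\<^bsub>K\<^esub>" if "\<eta> \<in> H" for \<eta>
  proof -
    have "\<eta> (\<zero>\<^bsub>P\<^sub>0\<^esub> \<oplus>\<^bsub>P\<^sub>0\<^esub> \<zero>\<^bsub>P\<^sub>0\<^esub>) = \<eta> \<zero>\<^bsub>P\<^sub>0\<^esub> \<oplus>\<^bsub>K\<^esub> \<eta> \<zero>\<^bsub>P\<^sub>0\<^esub>"
      using that P\<^sub>0.M.zero_closed unfolding H_def by blast
    then have "\<eta> \<zero>\<^bsub>P\<^sub>0\<^esub> = \<eta> \<zero>\<^bsub>P\<^sub>0\<^esub> \<oplus>\<^bsub>K\<^esub> \<eta> \<zero>\<^bsub>P\<^sub>0\<^esub>" by simp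
    then show ?thesis using Hc[OF that, of "\<zero>\<^bsub>P\<^sub>0\<^esub>"] by (simp add: P\<^sub>0.R.add.l_cancel_one')
  qed
  have "card {\<zero>\<^bsub>P\<^sub>0\<^esub>} \<le> m" unfolding m_def by (rule card_mono) (use fA H0 in auto)
  then have "card H \<le> card ?A" unfolding card by (cases m) auto
  \<comment> \<open>The maps given by the form. Nondegeneracy makes them pairwise distinct, so their
    number attains the bound.\<close>
  define B where "B = (\<lambda>a. \<lambda>b\<in>?A. \<omega>\<^sub>0 b a) ` ?A"
  have "inj_on (\<lambda>a. \<lambda>b\<in>?A. \<omega>\<^sub>0 b a) ?A"
  proof (rule inj_onI)
    fix a a' assume a: "a \<in> ?A" "a' \<in> ?A" and eq: "(\<lambda>b\<in>?A. \<omega>\<^sub>0 b a) = (\<lambda>b\<in>?A. \<omega>\<^sub>0 b a')"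
    have "\<omega>\<^sub>0 b (a \<oplus>\<^bsub>P\<^sub>0\<^esub> \<ominus>\<^bsub>P\<^sub>0\<^esub> a') = \<zero>\<^bsub>K\<^esub>" if b: "b \<in> ?A" for b
    proof -
      have "\<omega>\<^sub>0 b a = \<omega>\<^sub>0 b a'" using fun_cong[OF eq, of b] b by simp
      then have "\<omega>\<^sub>0 b (a \<oplus>\<^bsub>P\<^sub>0\<^esub> \<ominus>\<^bsub>P\<^sub>0\<^esub> a') = \<omega>\<^sub>0 b (a' \<oplus>\<^bsub>P\<^sub>0\<^esub> \<ominus>\<^bsub>P\<^sub>0\<^esub> a')"
        using a b by (simp only: form_add_right P\<^sub>0.M.a_inv_closed)
      also have "a' \<oplus>\<^bsub>P\<^sub>0\<^esub> \<ominus>\<^bsub>P\<^sub>0\<^esub> a' = \<zero>\<^bsub>P\<^sub>0\<^esub>" using a by (simp add: P\<^sub>0.M.r_neg)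
      finally show ?thesis using form_skew[OF b P\<^sub>0.M.zero_closed] form_0_left[OF b] by simp
    qed
    then have "a \<oplus>\<^bsub>P\<^sub>0\<^esub> \<ominus>\<^bsub>P\<^sub>0\<^esub> a' = \<zero>\<^bsub>P\<^sub>0\<^esub>" using a by (intro form_nondegenerate) auto
    then have "\<ominus>\<^bsub>P\<^sub>0\<^esub> (\<ominus>\<^bsub>P\<^sub>0\<^esub> a') = a" using a by (intro P\<^sub>0.M.minus_equality) auto
    then show "a = a'" using a by simp
  qed
  then have "card B = card ?A" unfolding B_def by (rule card_image)
  moreover have "B \<subseteq> H" unfolding B_def H_def by (auto simp: form_closed form_add_left)
  ultimately have "B = H" using \<open>card H \<le> card ?A\<close> by (intro card_seteq[OF fH]) auto
  moreover have "(\<lambda>b\<in>?A. \<chi> b) \<in> H" unfolding H_def using \<chi> add by auto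
  ultimately obtain a where a: "a \<in> ?A" "(\<lambda>b\<in>?A. \<chi> b) = (\<lambda>b\<in>?A. \<omega>\<^sub>0 b a)" unfolding B_def by blast
  have "\<omega>\<^sub>0 b a = \<chi> b" if "b \<in> ?A" for b using fun_cong[OF a(2), of b] that by simp
  then show ?thesis using that[OF a(1)] by blast
qed

end

text \<open>If \<open>B\<close> is independent of maximal size, adding \<open>g\<close> creates a
  relation, and independence of \<open>B\<close> forces the coefficient of \<open>g\<close> in it to
  be nonzero. So some nonzero power of \<open>g\<close> lies in the span of
  \<open>B\<close>.\<close>

lemma (in comm_group) free_rank_basis:
  assumes rk: "free_rank G = enat d"
  obtains B where "int_independent G B" "card B = d"
    "\<forall>g\<in>carrier G. \<exists>c :: int. \<exists>k :: 'a \<Rightarrow> int. c \<noteq> 0 \<and> g [^] c = (\<Otimes>b\<in>B. b [^] k b)"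
proof -
  let ?S = "{B. int_independent G B}"
  have sup: "(SUP B\<in>?S. enat (card B)) = enat d" using rk by (simp add: free_rank_def)
  have le: "card B \<le> d" if "int_independent G B" for B
    using SUP_upper[of B ?S "\<lambda>B. enat (card B)"] that unfolding sup by simp
  \<comment> \<open>A finite supremum of cardinalities is attained, since otherwise
    \<open>d - 1\<close> would be an upper bound; the empty set takes care of
    \<open>d = 0\<close>.\<close>
  have "\<exists>B. int_independent G B \<and> card B = d"
  proof (rule ccontr)
    assume no: "\<not> ?thesis"
    have emp: "int_independent G {}" by (simp add: int_independent_def)
    then have d: "d > 0" using no by (metis card.empty gr0I)
    have "(SUP B\<in>?S. enat (card B)) \<le> enat (d - 1)"
    proof (rule SUP_least)
      fix B assume "B \<in> ?S"
      then show "enat (card B) \<le> enat (d - 1)" using le no by (fastforce simp: le_less)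
    qed
    then show False unfolding sup using d by simp
  qed
  then obtain B where B: "int_independent G B" "card B = d" by blast
  have fB: "finite B" "B \<subseteq> carrier G" using B(1) by (auto simp: int_independent_def)
  have "\<exists>c :: int. \<exists>k :: 'a \<Rightarrow> int. c \<noteq> 0 \<and> g [^] c = (\<Otimes>b\<in>B. b [^] k b)" if g: "g \<in> carrier G" for g
  proof (cases "g \<in> B")
    case True
    have "(\<Otimes>b\<in>B. b [^] (if b = g then 1 else 0 :: int)) = (\<Otimes>b\<in>B. if g = b then b else \<one>)"
      by (rule finprod_cong') (use fB(2) in auto)
    also have "\<dots> = g" by (rule finprod_singleton) (use fB True in auto)
    finally show ?thesis using g by (intro exI[of _ 1] exI[of _ "\<lambda>b. if b = g then 1 else 0"]) simp
  next
    case False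
    have "\<not> int_independent G (insert g B)" using le[of "insert g B"] False fB(1) B(2) by auto
    then obtain c :: "'a \<Rightarrow> int" where c: "(\<Otimes>b\<in>insert g B. b [^] c b) = \<one>" "\<exists>b\<in>insert g B. c b \<noteq> 0"
      unfolding int_independent_def using fB g by blast
    have cl: "(\<lambda>b. b [^] c b) \<in> B \<rightarrow> carrier G" using fB(2) by auto
    have eq: "g [^] c g \<otimes> (\<Otimes>b\<in>B. b [^] c b) = \<one>"
      using c(1) finprod_insert[OF fB(1) False cl] g by simp
    have "c g \<noteq> 0"
    proof
      assume c0: "c g = 0"
      then have "(\<Otimes>b\<in>B. b [^] c b) = \<one>" using eq finprod_closed[OF cl] by simp
      then have "\<forall>b\<in>B. c b = 0" using B(1) by (auto simp: int_independent_def)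
      then show False using c(2) c0 by auto
    qed
    moreover have "g [^] c g = (\<Otimes>b\<in>B. b [^] (- c b))"
    proof -
      have "(\<Otimes>b\<in>B. b [^] (- c b)) \<otimes> (\<Otimes>b\<in>B. b [^] c b) = (\<Otimes>b\<in>B. b [^] (- c b) \<otimes> b [^] c b)"
        by (rule finprod_multf[symmetric]) (use fB(2) in auto)
      also have "\<dots> = \<one>" by (rule finprod_one_eqI) (use fB(2) in \<open>auto simp: int_pow_mult[symmetric]\<close>)
      finally show ?thesis using eq finprod_closed[OF cl] g
        finprod_closed[of "\<lambda>b. b [^] (- c b)" B] fB(2)
        by (metis (no_types, lifting) Pi_I int_pow_closed right_cancel subsetD)
    qed
    ultimately show ?thesis by (intro exI[of _ "c g"] exI[of _ "\<lambda>b. - c b"]) simp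
  qed
  then show ?thesis using that B by blast
qed

section \<open>Excitations as functionals on a free module\<close>

abbreviation coef :: "('e \<Rightarrow>\<^sub>0 int) \<Rightarrow> 'e \<Rightarrow> int" where
  "coef \<equiv> Poly_Mapping.lookup"

lemma of_nat_mult_frag: "of_nat k * (u :: 'e::comm_monoid_add \<Rightarrow>\<^sub>0 int) = frag_cmul (int k) u"
  by (induction k) (simp_all add: distrib_right frag_cmul_distrib)

lemma of_nat_dvd_frag_iff:
  "of_nat n dvd (u :: 'e::comm_monoid_add \<Rightarrow>\<^sub>0 int) \<longleftrightarrow> (\<forall>a. int n dvd coef u a)"
proof
  assume "of_nat n dvd u"
  then show "\<forall>a. int n dvd coef u a" by (auto simp: dvd_def of_nat_mult_frag)
next
  assume dvd: "\<forall>a. int n dvd coef u a"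
  have "of_nat n dvd frag_cmul (coef u a) (frag_of a)" for a
  proof -
    obtain k where "coef u a = int n * k" using dvd by (auto simp: dvd_def)
    then have "frag_cmul (coef u a) (frag_of a) = of_nat n * frag_cmul k (frag_of a)" by (simp add: of_nat_mult_frag)
    then show ?thesis by simp
  qed
  then have "of_nat n dvd (\<Sum>a\<in>Poly_Mapping.keys u. frag_cmul (coef u a) (frag_of a))" by (intro dvd_sum)
  then show "of_nat n dvd u" using frag_expansion[of u] by (simp add: frag_extend_def)
qed

context stabilizer_code
begin

text \<open>A presentation of \<open>P\<^sub>0\<close> that takes all of its elements as generators,
  since a module over residues modulo a composite \<open>n\<close> need not have a basis. Relations
  among the generators are dealt with when functionals descend.\<close>

definition comb :: "('p \<Rightarrow> int) \<Rightarrow> 'p" where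
  "comb z = (\<Oplus>\<^bsub>P\<^sub>0\<^esub>b\<in>carrier P\<^sub>0. cls (z b) \<odot>\<^bsub>P\<^sub>0\<^esub> b)"

lemma comb_Pi: "(\<lambda>b. cls (z b) \<odot>\<^bsub>P\<^sub>0\<^esub> b) \<in> carrier P\<^sub>0 \<rightarrow> carrier P\<^sub>0"
  by (auto simp: ZMod_closed)

lemma comb_closed: "comb z \<in> carrier P\<^sub>0"
  unfolding comb_def using comb_Pi by (rule P\<^sub>0.M.finsum_closed)

lemma comb_add: "comb (\<lambda>b. z b + w b) = comb z \<oplus>\<^bsub>P\<^sub>0\<^esub> comb w"
proof -
  have "comb (\<lambda>b. z b + w b) = (\<Oplus>\<^bsub>P\<^sub>0\<^esub>b\<in>carrier P\<^sub>0. cls (z b) \<odot>\<^bsub>P\<^sub>0\<^esub> b \<oplus>\<^bsub>P\<^sub>0\<^esub> cls (w b) \<odot>\<^bsub>P\<^sub>0\<^esub> b)"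
    unfolding comb_def by (rule P\<^sub>0.M.finsum_cong') (auto simp: ZMod_add ZMod_closed P\<^sub>0.smult_l_distr)
  then show ?thesis unfolding comb_def using P\<^sub>0.M.finsum_addf[OF comb_Pi comb_Pi] by simp
qed

lemma comb_0:
  assumes "\<And>b. b \<in> carrier P\<^sub>0 \<Longrightarrow> int n dvd z b"
  shows "comb z = \<zero>\<^bsub>P\<^sub>0\<^esub>"
  unfolding comb_def
proof (rule P\<^sub>0.M.add.finprod_one_eqI)
  fix b assume b: "b \<in> carrier P\<^sub>0"
  then have "cls (z b) = \<zero>\<^bsub>K\<^esub>" using assms by (simp add: ZMod_eq_0_iff)
  then show "cls (z b) \<odot>\<^bsub>P\<^sub>0\<^esub> b = \<zero>\<^bsub>P\<^sub>0\<^esub>" using b by simp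
qed

lemma comb_diff: "comb (\<lambda>b. z b - w b) = comb z \<oplus>\<^bsub>P\<^sub>0\<^esub> \<ominus>\<^bsub>P\<^sub>0\<^esub> comb w"
proof -
  have "comb (\<lambda>b. z b - w b) \<oplus>\<^bsub>P\<^sub>0\<^esub> comb w = comb z" using comb_add[of "\<lambda>b. z b - w b" w] by simp
  then have "comb z \<oplus>\<^bsub>P\<^sub>0\<^esub> \<ominus>\<^bsub>P\<^sub>0\<^esub> comb w = comb (\<lambda>b. z b - w b) \<oplus>\<^bsub>P\<^sub>0\<^esub> comb w \<oplus>\<^bsub>P\<^sub>0\<^esub> \<ominus>\<^bsub>P\<^sub>0\<^esub> comb w" by simp
  then show ?thesis by (simp add: comb_closed P\<^sub>0.M.a_assoc P\<^sub>0.M.r_neg)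
qed

lemma comb_single:
  assumes "b \<in> carrier P\<^sub>0" shows "comb (\<lambda>x. if x = b then 1 else 0) = b"
proof -
  have "comb (\<lambda>x. if x = b then 1 else 0) = (\<Oplus>\<^bsub>P\<^sub>0\<^esub>x\<in>carrier P\<^sub>0. if b = x then x else \<zero>\<^bsub>P\<^sub>0\<^esub>)"
    unfolding comb_def by (rule P\<^sub>0.M.finsum_cong') (auto simp: ZMod_0 ZMod_1)
  also have "\<dots> = b" by (rule P\<^sub>0.M.add.finprod_singleton) (use assms finite_P0 in auto)
  finally show ?thesis .
qed

lemma form_comb:
  assumes x: "x \<in> carrier P\<^sub>0"
  shows "\<omega>\<^sub>0 (comb z) x = cls (\<Sum>b\<in>carrier P\<^sub>0. z b * \<omega>z b x)"
proof -
  have "\<omega>\<^sub>0 (\<Oplus>\<^bsub>P\<^sub>0\<^esub>b\<in>B. cls (z b) \<odot>\<^bsub>P\<^sub>0\<^esub> b) x = cls (\<Sum>b\<in>B. z b * \<omega>z b x)" if "B \<subseteq> carrier P\<^sub>0" for B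
    using finite_subset[OF that finite_P0] that
  proof (induction B)
    case empty
    then show ?case by (simp add: form_0_left x ZMod_0)
  next
    case (insert b B)
    have cl: "(\<lambda>b. cls (z b) \<odot>\<^bsub>P\<^sub>0\<^esub> b) \<in> B \<rightarrow> carrier P\<^sub>0" using insert.prems by (auto simp: ZMod_closed)
    have b: "b \<in> carrier P\<^sub>0" using insert.prems by simp
    have "(\<Oplus>\<^bsub>P\<^sub>0\<^esub>b\<in>insert b B. cls (z b) \<odot>\<^bsub>P\<^sub>0\<^esub> b) = cls (z b) \<odot>\<^bsub>P\<^sub>0\<^esub> b \<oplus>\<^bsub>P\<^sub>0\<^esub> (\<Oplus>\<^bsub>P\<^sub>0\<^esub>b\<in>B. cls (z b) \<odot>\<^bsub>P\<^sub>0\<^esub> b)"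
      using insert.hyps cl b by (simp add: ZMod_closed P\<^sub>0.M.finsum_insert)
    moreover have "\<omega>\<^sub>0 (cls (z b) \<odot>\<^bsub>P\<^sub>0\<^esub> b) x = cls (z b * \<omega>z b x)"
      using b x by (simp add: form_smult_left ZMod_closed ZMod_mult cls_\<omega>z)
    ultimately show ?case using insert b x P\<^sub>0.M.finsum_closed[OF cl]
      by (simp add: form_add_left ZMod_closed ZMod_add)
  qed
  from this[OF order_refl] show ?thesis by (simp add: comb_def)
qed

lemma form_ext_shift_left:
  assumes l: "l \<in> carrier P" and p: "p \<in> carrier P" and h: "h \<in> carrier \<Lambda>" and g: "g \<in> carrier \<Lambda>"
  shows "form (shift h l) p g = form l p (h \<otimes>\<^bsub>\<Lambda>\<^esub> g)"
proof -
  let ?S = "gsupp \<Lambda> P\<^sub>0 l"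
  have S: "finite ?S" "?S \<subseteq> carrier \<Lambda>" using P_finite[OF l] by (auto simp: gsupp_def)
  let ?T = "(\<lambda>\<kappa>. h \<otimes>\<^bsub>\<Lambda>\<^esub> \<kappa>) ` ?S"
  have T: "finite ?T" "?T \<subseteq> carrier \<Lambda>" using S h by auto
  have "gsupp \<Lambda> P\<^sub>0 (shift h l) \<subseteq> ?T"
  proof
    fix \<kappa> assume \<kappa>: "\<kappa> \<in> gsupp \<Lambda> P\<^sub>0 (shift h l)"
    then have "\<kappa> \<in> carrier \<Lambda>" by (simp add: gsupp_def)
    moreover from this have "inv\<^bsub>\<Lambda>\<^esub> h \<otimes>\<^bsub>\<Lambda>\<^esub> \<kappa> \<in> ?S" using \<kappa> h by (simp add: gsupp_def shift_def)
    moreover have "\<kappa> = h \<otimes>\<^bsub>\<Lambda>\<^esub> (inv\<^bsub>\<Lambda>\<^esub> h \<otimes>\<^bsub>\<Lambda>\<^esub> \<kappa>)" using calculation h by (simp add: \<Lambda>.m_assoc[symmetric])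
    ultimately show "\<kappa> \<in> ?T" by blast
  qed
  then have "form (shift h l) p g = cls (\<Sum>\<kappa>\<in>?T. \<omega>z (shift h l \<kappa>) (p (\<kappa> \<otimes>\<^bsub>\<Lambda>\<^esub> g)))"
    using form_apply[OF shift_closed[OF l h] p g T(1)] T(2) by simp
  also have "(\<Sum>\<kappa>\<in>?T. \<omega>z (shift h l \<kappa>) (p (\<kappa> \<otimes>\<^bsub>\<Lambda>\<^esub> g)))
    = (\<Sum>\<kappa>\<in>?S. \<omega>z (shift h l (h \<otimes>\<^bsub>\<Lambda>\<^esub> \<kappa>)) (p (h \<otimes>\<^bsub>\<Lambda>\<^esub> \<kappa> \<otimes>\<^bsub>\<Lambda>\<^esub> g)))"
  proof (rule sum.reindex_cong[OF _ refl refl], rule inj_onI)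
    fix x y assume "x \<in> ?S" "y \<in> ?S" "h \<otimes>\<^bsub>\<Lambda>\<^esub> x = h \<otimes>\<^bsub>\<Lambda>\<^esub> y"
    then show "x = y" using S(2) h \<Lambda>.l_cancel by blast
  qed
  also have "\<dots> = (\<Sum>\<kappa>\<in>?S. \<omega>z (l \<kappa>) (p (\<kappa> \<otimes>\<^bsub>\<Lambda>\<^esub> (h \<otimes>\<^bsub>\<Lambda>\<^esub> g))))"
  proof (rule sum.cong[OF refl])
    fix \<kappa> assume "\<kappa> \<in> ?S"
    then have k: "\<kappa> \<in> carrier \<Lambda>" using S by blast
    then have "shift h l (h \<otimes>\<^bsub>\<Lambda>\<^esub> \<kappa>) = l \<kappa>" using h by (simp add: shift_def \<Lambda>.m_assoc[symmetric])
    moreover have "h \<otimes>\<^bsub>\<Lambda>\<^esub> \<kappa> \<otimes>\<^bsub>\<Lambda>\<^esub> g = \<kappa> \<otimes>\<^bsub>\<Lambda>\<^esub> (h \<otimes>\<^bsub>\<Lambda>\<^esub> g)" using k h g by (simp add: \<Lambda>.m_ac)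
    ultimately show "\<omega>z (shift h l (h \<otimes>\<^bsub>\<Lambda>\<^esub> \<kappa>)) (p (h \<otimes>\<^bsub>\<Lambda>\<^esub> \<kappa> \<otimes>\<^bsub>\<Lambda>\<^esub> g)) = \<omega>z (l \<kappa>) (p (\<kappa> \<otimes>\<^bsub>\<Lambda>\<^esub> (h \<otimes>\<^bsub>\<Lambda>\<^esub> g)))" by simp
  qed
  also have "cls \<dots> = form l p (h \<otimes>\<^bsub>\<Lambda>\<^esub> g)"
    using form_apply[OF l p _ S(1) order_refl S(2)] h g by simp
  finally show ?thesis .
qed

lemma form_ext_skew:
  assumes l: "l \<in> carrier P" and p: "p \<in> carrier P" and g: "g \<in> carrier \<Lambda>"
  shows "form l p g = \<ominus>\<^bsub>K\<^esub> form p l (inv\<^bsub>\<Lambda>\<^esub> g)"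
proof -
  \<comment> \<open>Chosen to contain the support of \<open>l\<close> while its translate
    \<open>?T\<close> contains the support of \<open>p\<close>, so that both forms become sums over
    the same sites.\<close>
  let ?S = "gsupp \<Lambda> P\<^sub>0 l \<union> (\<lambda>\<kappa>. \<kappa> \<otimes>\<^bsub>\<Lambda>\<^esub> inv\<^bsub>\<Lambda>\<^esub> g) ` gsupp \<Lambda> P\<^sub>0 p"
  have S: "finite ?S" "?S \<subseteq> carrier \<Lambda>" using P_finite l p g by (auto simp: gsupp_def)
  let ?T = "(\<lambda>\<kappa>. \<kappa> \<otimes>\<^bsub>\<Lambda>\<^esub> g) ` ?S"
  have T: "finite ?T" "?T \<subseteq> carrier \<Lambda>" using S g by auto
  have "gsupp \<Lambda> P\<^sub>0 p \<subseteq> ?T"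
  proof
    fix \<kappa> assume \<kappa>: "\<kappa> \<in> gsupp \<Lambda> P\<^sub>0 p"
    then have "\<kappa> \<in> carrier \<Lambda>" by (simp add: gsupp_def)
    then have "\<kappa> = (\<kappa> \<otimes>\<^bsub>\<Lambda>\<^esub> inv\<^bsub>\<Lambda>\<^esub> g) \<otimes>\<^bsub>\<Lambda>\<^esub> g" using g by (simp add: \<Lambda>.m_assoc)
    then show "\<kappa> \<in> ?T" using \<kappa> by blast
  qed
  then have "form p l (inv\<^bsub>\<Lambda>\<^esub> g) = cls (\<Sum>\<kappa>\<in>?T. \<omega>z (p \<kappa>) (l (\<kappa> \<otimes>\<^bsub>\<Lambda>\<^esub> inv\<^bsub>\<Lambda>\<^esub> g)))"
    using form_apply[OF p l _ T(1)] T(2) g by simp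
  also have "(\<Sum>\<kappa>\<in>?T. \<omega>z (p \<kappa>) (l (\<kappa> \<otimes>\<^bsub>\<Lambda>\<^esub> inv\<^bsub>\<Lambda>\<^esub> g)))
    = (\<Sum>\<kappa>\<in>?S. \<omega>z (p (\<kappa> \<otimes>\<^bsub>\<Lambda>\<^esub> g)) (l (\<kappa> \<otimes>\<^bsub>\<Lambda>\<^esub> g \<otimes>\<^bsub>\<Lambda>\<^esub> inv\<^bsub>\<Lambda>\<^esub> g)))"
  proof (rule sum.reindex_cong[OF _ refl refl], rule inj_onI)
    fix x y assume "x \<in> ?S" "y \<in> ?S" "x \<otimes>\<^bsub>\<Lambda>\<^esub> g = y \<otimes>\<^bsub>\<Lambda>\<^esub> g"
    then show "x = y" using S(2) g \<Lambda>.r_cancel by blast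
  qed
  finally have A: "form p l (inv\<^bsub>\<Lambda>\<^esub> g) = cls (\<Sum>\<kappa>\<in>?S. \<omega>z (p (\<kappa> \<otimes>\<^bsub>\<Lambda>\<^esub> g)) (l (\<kappa> \<otimes>\<^bsub>\<Lambda>\<^esub> g \<otimes>\<^bsub>\<Lambda>\<^esub> inv\<^bsub>\<Lambda>\<^esub> g)))" .
  have B: "form l p g = cls (\<Sum>\<kappa>\<in>?S. \<omega>z (l \<kappa>) (p (\<kappa> \<otimes>\<^bsub>\<Lambda>\<^esub> g)))"
    by (rule form_apply[OF l p g S(1) _ S(2)]) simp
  have "int n dvd (\<Sum>\<kappa>\<in>?S. \<omega>z (l \<kappa>) (p (\<kappa> \<otimes>\<^bsub>\<Lambda>\<^esub> g)) + \<omega>z (p (\<kappa> \<otimes>\<^bsub>\<Lambda>\<^esub> g)) (l (\<kappa> \<otimes>\<^bsub>\<Lambda>\<^esub> g \<otimes>\<^bsub>\<Lambda>\<^esub> inv\<^bsub>\<Lambda>\<^esub> g)))"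
  proof (rule dvd_sum)
    fix \<kappa> assume "\<kappa> \<in> ?S"
    then have k: "\<kappa> \<in> carrier \<Lambda>" using S(2) by blast
    then have "\<kappa> \<otimes>\<^bsub>\<Lambda>\<^esub> g \<otimes>\<^bsub>\<Lambda>\<^esub> inv\<^bsub>\<Lambda>\<^esub> g = \<kappa>" using g by (simp add: \<Lambda>.m_assoc)
    moreover have lk: "l \<kappa> \<in> carrier P\<^sub>0" and pk: "p (\<kappa> \<otimes>\<^bsub>\<Lambda>\<^esub> g) \<in> carrier P\<^sub>0" using k g by (simp_all add: P_apply l p)
    have "cls (\<omega>z (l \<kappa>) (p (\<kappa> \<otimes>\<^bsub>\<Lambda>\<^esub> g)) + \<omega>z (p (\<kappa> \<otimes>\<^bsub>\<Lambda>\<^esub> g)) (l \<kappa>)) = \<zero>\<^bsub>K\<^esub>"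
      unfolding ZMod_add cls_\<omega>z[OF lk pk] cls_\<omega>z[OF pk lk] form_skew[OF lk pk]
      using form_closed[OF pk lk] by (simp add: P\<^sub>0.R.l_neg)
    ultimately show "int n dvd \<omega>z (l \<kappa>) (p (\<kappa> \<otimes>\<^bsub>\<Lambda>\<^esub> g)) + \<omega>z (p (\<kappa> \<otimes>\<^bsub>\<Lambda>\<^esub> g)) (l (\<kappa> \<otimes>\<^bsub>\<Lambda>\<^esub> g \<otimes>\<^bsub>\<Lambda>\<^esub> inv\<^bsub>\<Lambda>\<^esub> g))"
      by (simp add: ZMod_eq_0_iff)
  qed
  then show ?thesis unfolding A B ZMod_minus[symmetric] ZMod_eq_iff by (simp add: sum.distrib)
qed

end

text \<open>The map \<open>\<tau>\<close> embeds the exponents as a subgroup containing a positive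
  power of every lattice element. By \<open>monomials\<close>, finitely many Laurent monomials can
  be moved together into the image of the polynomial ring, and by \<open>reflects\<close> no
  divisibility by \<open>n\<close> is gained on the way.\<close>

locale code_functionals = stabilizer_code n \<Lambda> P\<^sub>0 \<omega>\<^sub>0 L + F: mod_functionals n \<theta>
  for n and \<Lambda> :: "('l, 'm) monoid_scheme" and P\<^sub>0 :: "(int set, 'p, 'q) module_scheme" and \<omega>\<^sub>0 L
    and \<theta> :: "'u::idom \<Rightarrow> ('e::ab_group_add \<Rightarrow>\<^sub>0 int)" +
  fixes \<tau> :: "'e \<Rightarrow> 'l"
  assumes exponents: "exponent_map \<Lambda> \<tau>"
    and independent: "\<tau> a = \<one>\<^bsub>\<Lambda>\<^esub> \<Longrightarrow> a = 0"
    and cofinite: "g \<in> carrier \<Lambda> \<Longrightarrow> \<exists>N>0. \<exists>a. g [^]\<^bsub>\<Lambda>\<^esub> (N::nat) = \<tau> a"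
    and monomials: "finite E \<Longrightarrow> \<exists>c. \<forall>a\<in>E. frag_of (a + c) \<in> range \<theta>"
    and reflects: "of_nat n dvd \<theta> u \<Longrightarrow> of_nat n dvd u"
begin

lemma \<tau>_closed: "\<tau> a \<in> carrier \<Lambda>"
  and \<tau>_0: "\<tau> 0 = \<one>\<^bsub>\<Lambda>\<^esub>"
  and \<tau>_add: "\<tau> (a + b) = \<tau> a \<otimes>\<^bsub>\<Lambda>\<^esub> \<tau> b"
  using exponents by (auto simp: exponent_map_def)

lemma \<tau>_minus: "\<tau> (- a) = inv\<^bsub>\<Lambda>\<^esub> \<tau> a"
proof -
  have "\<tau> (- a) \<otimes>\<^bsub>\<Lambda>\<^esub> \<tau> a = \<one>\<^bsub>\<Lambda>\<^esub>" using \<tau>_add[of "- a" a] by (simp add: \<tau>_0)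
  then show ?thesis using \<tau>_closed by (metis \<Lambda>.inv_equality)
qed

lemma \<tau>_inj: "\<tau> a = \<tau> b \<longleftrightarrow> a = b"
proof
  assume "\<tau> a = \<tau> b"
  then have "\<tau> (a + - b) = \<one>\<^bsub>\<Lambda>\<^esub>" using \<tau>_closed by (simp add: \<tau>_add \<tau>_minus del: add_uminus_conv_diff)
  then have "a + - b = 0" by (rule independent)
  then show "a = b" by simp
qed simp

lemma subgroup_\<tau>: "subgroup (range \<tau>) \<Lambda>"
  by (rule \<Lambda>.subgroupI) (auto simp: \<tau>_closed \<tau>_minus[symmetric] \<tau>_add[symmetric])

text \<open>Every \<open>g\<close> is the product of a coset representative \<open>cr g\<close> and \<open>\<tau> (al g)\<close>.\<close>

definition cr :: "'l \<Rightarrow> 'l" where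
  "cr g = (SOME h. h \<in> range \<tau> #>\<^bsub>\<Lambda>\<^esub> g)"

definition al :: "'l \<Rightarrow> 'e" where
  "al g = (THE a. g = cr g \<otimes>\<^bsub>\<Lambda>\<^esub> \<tau> a)"

lemma cr_mem: "g \<in> carrier \<Lambda> \<Longrightarrow> cr g \<in> range \<tau> #>\<^bsub>\<Lambda>\<^esub> g"
  unfolding cr_def by (rule someI, rule \<Lambda>.rcos_self[OF _ subgroup_\<tau>])

lemma cr_closed: "g \<in> carrier \<Lambda> \<Longrightarrow> cr g \<in> carrier \<Lambda>"
  using cr_mem[of g] by (auto simp: r_coset_def \<tau>_closed)

lemma cr_al: "g \<in> carrier \<Lambda> \<Longrightarrow> g = cr g \<otimes>\<^bsub>\<Lambda>\<^esub> \<tau> (al g)"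
proof -
  assume g: "g \<in> carrier \<Lambda>"
  obtain a where "cr g = \<tau> a \<otimes>\<^bsub>\<Lambda>\<^esub> g" using cr_mem[OF g] by (auto simp: r_coset_def)
  then have "cr g \<otimes>\<^bsub>\<Lambda>\<^esub> \<tau> (- a) = g"
    using g \<tau>_closed[of a] by (simp add: \<tau>_minus \<Lambda>.m_ac)
  then have *: "g = cr g \<otimes>\<^bsub>\<Lambda>\<^esub> \<tau> (- a)" by simp
  have uniq: "b = - a" if "g = cr g \<otimes>\<^bsub>\<Lambda>\<^esub> \<tau> b" for b
  proof -
    have "cr g \<otimes>\<^bsub>\<Lambda>\<^esub> \<tau> b = cr g \<otimes>\<^bsub>\<Lambda>\<^esub> \<tau> (- a)" using * that by simp
    then show ?thesis using cr_closed[OF g] \<tau>_closed by (simp add: \<tau>_inj)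
  qed
  have "al g = - a" unfolding al_def by (rule the_equality) (fact *, rule uniq)
  then show ?thesis using * by simp
qed

lemma al_eqI: "g \<in> carrier \<Lambda> \<Longrightarrow> g = cr g \<otimes>\<^bsub>\<Lambda>\<^esub> \<tau> a \<Longrightarrow> al g = a"
proof -
  assume g: "g \<in> carrier \<Lambda>" and "g = cr g \<otimes>\<^bsub>\<Lambda>\<^esub> \<tau> a"
  then have "cr g \<otimes>\<^bsub>\<Lambda>\<^esub> \<tau> (al g) = cr g \<otimes>\<^bsub>\<Lambda>\<^esub> \<tau> a" using cr_al[OF g] by simp
  then show ?thesis using cr_closed[OF g] \<tau>_closed by (simp add: \<tau>_inj)
qed

lemma cr_shift: "g \<in> carrier \<Lambda> \<Longrightarrow> cr (g \<otimes>\<^bsub>\<Lambda>\<^esub> \<tau> a) = cr g"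
proof -
  assume g: "g \<in> carrier \<Lambda>"
  have "g \<otimes>\<^bsub>\<Lambda>\<^esub> \<tau> a = \<tau> a \<otimes>\<^bsub>\<Lambda>\<^esub> g" using g \<tau>_closed by (simp add: \<Lambda>.m_comm)
  then have "range \<tau> #>\<^bsub>\<Lambda>\<^esub> (g \<otimes>\<^bsub>\<Lambda>\<^esub> \<tau> a) = range \<tau> #>\<^bsub>\<Lambda>\<^esub> g"
    using \<Lambda>.coset_mult_assoc[OF subgroup.subset[OF subgroup_\<tau>] \<tau>_closed g] \<Lambda>.coset_join2[OF \<tau>_closed subgroup_\<tau>]
    by (metis rangeI)
  then show ?thesis by (simp add: cr_def)
qed

lemma al_shift: "g \<in> carrier \<Lambda> \<Longrightarrow> al (g \<otimes>\<^bsub>\<Lambda>\<^esub> \<tau> a) = al g + a"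
proof -
  assume g: "g \<in> carrier \<Lambda>"
  have "g \<otimes>\<^bsub>\<Lambda>\<^esub> \<tau> a = cr g \<otimes>\<^bsub>\<Lambda>\<^esub> \<tau> (al g) \<otimes>\<^bsub>\<Lambda>\<^esub> \<tau> a" using cr_al[OF g] by simp
  also have "\<dots> = cr (g \<otimes>\<^bsub>\<Lambda>\<^esub> \<tau> a) \<otimes>\<^bsub>\<Lambda>\<^esub> \<tau> (al g + a)"
    using cr_closed[OF g] \<tau>_closed by (simp add: cr_shift[OF g] \<tau>_add \<Lambda>.m_assoc)
  finally show ?thesis using g \<tau>_closed by (intro al_eqI) auto
qed

lemma cr_cr: "g \<in> carrier \<Lambda> \<Longrightarrow> cr (cr g) = cr g"
proof -
  assume g: "g \<in> carrier \<Lambda>"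
  have "cr g = cr g \<otimes>\<^bsub>\<Lambda>\<^esub> \<tau> (al g) \<otimes>\<^bsub>\<Lambda>\<^esub> \<tau> (- al g)"
    using cr_closed[OF g] \<tau>_closed by (simp add: \<tau>_minus \<Lambda>.m_assoc)
  then have "cr g = g \<otimes>\<^bsub>\<Lambda>\<^esub> \<tau> (- al g)" using cr_al[OF g] by simp
  then show ?thesis using cr_shift[OF g] by metis
qed

lemma al_cr: "g \<in> carrier \<Lambda> \<Longrightarrow> al (cr g) = 0"
  using cr_closed[of g] by (intro al_eqI) (simp_all add: cr_cr \<tau>_0)

definition C :: "'l set" where
  "C = cr ` carrier \<Lambda>"

lemma finite_C: "finite C"
proof -
  have "finite (rcosets\<^bsub>\<Lambda>\<^esub> (range \<tau>))"
    by (rule \<Lambda>.finite_index_if_torsion[OF fin_gen_lattice subgroup_\<tau>]) (use cofinite in fastforce)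
  moreover have "C \<subseteq> (\<lambda>A. SOME h. h \<in> A) ` (rcosets\<^bsub>\<Lambda>\<^esub> (range \<tau>))"
    by (auto simp: C_def cr_def RCOSETS_def)
  ultimately show ?thesis by (rule finite_surj)
qed

lemma C_facts: "c \<in> C \<Longrightarrow> c \<in> carrier \<Lambda>" "c \<in> C \<Longrightarrow> cr c = c" "c \<in> C \<Longrightarrow> al c = 0"
  by (auto simp: C_def cr_closed cr_cr al_cr)

definition Ix :: "('p \<times> 'l) set" where
  "Ix = carrier P\<^sub>0 \<times> C"

lemma finite_Ix: "finite Ix"
  unfolding Ix_def using finite_P0 finite_C by simp

text \<open>The projection from the free module with basis \<open>Ix\<close> onto \<open>P\<close>; the exponent is negated because
  the dual of \<open>L\<close> is formed with the antipode.\<close>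

definition proj :: "('p \<times> 'l \<Rightarrow> 'e \<Rightarrow>\<^sub>0 int) \<Rightarrow> 'l \<Rightarrow> 'p" where
  "proj v = (\<lambda>g\<in>carrier \<Lambda>. comb (\<lambda>b. coef (v (b, cr g)) (- al g)))"

lemma proj_closed: "proj v \<in> carrier P"
  unfolding proj_def
proof (rule P_closedI)
  let ?A = "(\<lambda>(c, a). c \<otimes>\<^bsub>\<Lambda>\<^esub> \<tau> (- a)) ` (C \<times> (\<Union>i\<in>Ix. Poly_Mapping.keys (v i)))"
  show "finite ?A" using finite_C finite_Ix by auto
  fix g assume g: "g \<in> carrier \<Lambda>" "g \<notin> ?A"
  have "coef (v (b, cr g)) (- al g) = 0" if b: "b \<in> carrier P\<^sub>0" for b
  proof (rule ccontr)
    assume "coef (v (b, cr g)) (- al g) \<noteq> 0"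
    moreover have "(b, cr g) \<in> Ix" using b g by (simp add: Ix_def C_def)
    ultimately have "(cr g, - al g) \<in> C \<times> (\<Union>i\<in>Ix. Poly_Mapping.keys (v i))"
      using g(1) by (auto simp: C_def in_keys_iff)
    then have "(case (cr g, - al g) of (c, a) \<Rightarrow> c \<otimes>\<^bsub>\<Lambda>\<^esub> \<tau> (- a)) \<in> ?A" by (rule imageI)
    then show False using cr_al[OF g(1)] g(2) by simp
  qed
  then show "comb (\<lambda>b. coef (v (b, cr g)) (- al g)) = \<zero>\<^bsub>P\<^sub>0\<^esub>" by (intro comb_0) simp
qed (rule comb_closed)

lemma proj_apply: "g \<in> carrier \<Lambda> \<Longrightarrow> proj v g = comb (\<lambda>b. coef (v (b, cr g)) (- al g))"
  by (simp add: proj_def)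

lemma proj_0: "(\<And>i a. i \<in> Ix \<Longrightarrow> int n dvd coef (v i) a) \<Longrightarrow> proj v = \<zero>\<^bsub>P\<^esub>"
  by (rule P_eqI[OF proj_closed P_0_closed]) (auto simp: proj_apply P_sel Ix_def C_def intro!: comb_0)

lemma proj_add: "proj (\<lambda>i. v i + w i) = proj v \<oplus>\<^bsub>P\<^esub> proj w"
  by (rule P_eqI[OF proj_closed P_add_closed[OF proj_closed proj_closed]])
    (simp add: proj_apply P_sel lookup_add comb_add)

lemma proj_diff: "proj (\<lambda>i. v i - w i) = proj v \<oplus>\<^bsub>P\<^esub> \<ominus>\<^bsub>P\<^esub> proj w"
proof -
  interpret PP: abelian_group P by (rule P_abelian_group)
  show ?thesis
    by (rule P_eqI[OF proj_closed P_add_closed[OF proj_closed PP.a_inv_closed[OF proj_closed]]])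
      (simp add: proj_apply P_sel(3) P_minus_apply[OF proj_closed] lookup_minus comb_diff)
qed

lemma proj_shift: "proj (\<lambda>i. frag_of a * v i) = shift (\<tau> (- a)) (proj v)"
proof (rule P_eqI[OF proj_closed shift_closed[OF proj_closed \<tau>_closed]])
  fix g assume g: "g \<in> carrier \<Lambda>"
  have "inv\<^bsub>\<Lambda>\<^esub> \<tau> (- a) \<otimes>\<^bsub>\<Lambda>\<^esub> g = g \<otimes>\<^bsub>\<Lambda>\<^esub> \<tau> a" using g \<tau>_closed by (simp add: \<tau>_minus \<Lambda>.m_comm)
  then show "proj (\<lambda>i. frag_of a * v i) g = shift (\<tau> (- a)) (proj v) g"
    using g \<tau>_closed by (simp add: shift_def proj_apply lookup_frag_of_mult cr_shift al_shift)
qed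

definition V :: "('p \<times> 'l \<Rightarrow> 'u) set" where
  "V = {v. proj (\<lambda>i. \<theta> (v i)) \<in> L}"

lemma proj_mult_mem:
  assumes v: "proj v \<in> L" shows "proj (\<lambda>i. y * v i) \<in> L"
  using subset_UNIV
proof (induction y rule: frag_induction)
  case zero
  then show ?case using proj_0[of "\<lambda>i. 0 * v i"] L_0 by simp
next
  case (one a)
  then show ?case using L_shift[OF v \<tau>_closed] by (simp add: proj_shift)
next
  case (diff y z)
  have "proj (\<lambda>i. (y - z) * v i) = proj (\<lambda>i. y * v i) \<oplus>\<^bsub>P\<^esub> \<ominus>\<^bsub>P\<^esub> proj (\<lambda>i. z * v i)"
    using proj_diff[of "\<lambda>i. y * v i" "\<lambda>i. z * v i"] by (simp add: left_diff_distrib)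
  then show ?case using L_add[OF diff(1) L_minus[OF diff(2)]] by simp
qed

lemma submod_V: "submod V"
  unfolding submod_def V_def
proof (intro conjI ballI allI CollectI)
  show "proj (\<lambda>i. \<theta> 0) \<in> L" using proj_0[of "\<lambda>i. 0"] L_0 by (simp add: F.hom_0)
next
  fix v w assume "v \<in> {v. proj (\<lambda>i. \<theta> (v i)) \<in> L}" "w \<in> {v. proj (\<lambda>i. \<theta> (v i)) \<in> L}"
  then show "proj (\<lambda>i. \<theta> (v i + w i)) \<in> L"
    using proj_add[of "\<lambda>i. \<theta> (v i)" "\<lambda>i. \<theta> (w i)"] L_add by (simp add: F.hom_add)
next
  fix u v assume "v \<in> {v. proj (\<lambda>i. \<theta> (v i)) \<in> L}"
  then show "proj (\<lambda>i. \<theta> (u * v i)) \<in> L"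
    using proj_mult_mem[of "\<lambda>i. \<theta> (v i)" "\<theta> u"] by (simp add: F.hom_mult)
qed

lemma proj_n: "proj (\<lambda>i. \<theta> (of_nat n * v i)) = \<zero>\<^bsub>P\<^esub>"
  by (rule proj_0) (simp add: F.hom_mult F.hom_of_nat of_nat_mult_frag)

lemma n_multiple_mem_V: "(\<lambda>i. of_nat n * v i) \<in> V"
  using proj_n[of v] L_0 by (simp add: V_def)

lemma off_Ix_mem_V: "(\<And>i. i \<in> Ix \<Longrightarrow> v i = 0) \<Longrightarrow> v \<in> V"
  using proj_0[of "\<lambda>i. \<theta> (v i)"] L_0 by (simp add: V_def F.hom_0)

end

context code_functionals
begin

text \<open>Only the coefficients on the subgroup \<open>range \<tau>\<close> are kept, lifted to
  integers. For values of a functional on \<open>L\<close> nothing is lost: by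
  \<open>D_shift\<close> the other coefficients are found at translates of the argument.\<close>

definition coset_restr :: "('l \<Rightarrow> int set) \<Rightarrow> 'e \<Rightarrow>\<^sub>0 int" where
  "coset_restr r = Abs_poly_mapping (\<lambda>a. rep (r (\<tau> a)))"

lemma lookup_coset_restr:
  assumes "r \<in> carrier R" shows "coef (coset_restr r) a = rep (r (\<tau> a))"
proof -
  have inj: "inj \<tau>" by (rule injI) (simp add: \<tau>_inj)
  have "{a. rep (r (\<tau> a)) \<noteq> 0} \<subseteq> \<tau> -` gsupp \<Lambda> K r"
    by (auto simp: gsupp_def \<tau>_closed ZRep_0)
  moreover have "finite (\<tau> -` gsupp \<Lambda> K r)"
    by (rule finite_vimageI[OF _ inj]) (use assms in \<open>simp add: R_sel finsupp_funs_def\<close>)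
  ultimately have "finite {a. rep (r (\<tau> a)) \<noteq> 0}" by (rule finite_subset)
  then show ?thesis unfolding coset_restr_def by (simp add: lookup_Abs_poly_mapping)
qed

lemma coset_restr_add:
  assumes r: "r \<in> carrier R" and s: "s \<in> carrier R"
  shows "of_nat n dvd coset_restr (r \<oplus>\<^bsub>R\<^esub> s) - (coset_restr r + coset_restr s)"
  unfolding of_nat_dvd_frag_iff
proof
  fix a
  interpret R: cring R by (rule R_cring)
  have rs: "r \<oplus>\<^bsub>R\<^esub> s \<in> carrier R" using r s by simp
  have "cls (rep ((r \<oplus>\<^bsub>R\<^esub> s) (\<tau> a))) = cls (rep (r (\<tau> a)) + rep (s (\<tau> a)))"
    unfolding ZMod_add
    by (simp only: ZMod_ZRep R_apply_closed[OF r \<tau>_closed] R_apply_closed[OF s \<tau>_closed] R_apply_closed[OF rs \<tau>_closed])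
      (simp add: R_sel \<tau>_closed)
  then show "int n dvd coef (coset_restr (r \<oplus>\<^bsub>R\<^esub> s) - (coset_restr r + coset_restr s)) a"
    unfolding ZMod_eq_iff by (simp add: lookup_minus lookup_add lookup_coset_restr r s rs)
qed

context
  fixes f assumes f: "f \<in> carrier D"
begin

lemma functional_add:
  "l \<in> L \<Longrightarrow> l' \<in> L \<Longrightarrow>
    of_nat n dvd coset_restr (f (l \<oplus>\<^bsub>P\<^esub> l')) - (coset_restr (f l) + coset_restr (f l'))"
  using coset_restr_add[OF D_apply[OF f] D_apply[OF f]] f by (simp add: D_sel(1))

lemma functional_0: "of_nat n dvd coset_restr (f \<zero>\<^bsub>P\<^esub>)"
proof -
  interpret P: abelian_group P by (rule P_abelian_group)
  have "of_nat n dvd - (coset_restr (f \<zero>\<^bsub>P\<^esub>))"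
    using functional_add[OF L_0 L_0] by simp
  then show ?thesis by (simp only: dvd_minus_iff)
qed

lemma functional_mult:
  assumes w: "proj w \<in> L"
  shows "of_nat n dvd coset_restr (f (proj (\<lambda>i. y * w i))) - y * coset_restr (f (proj w))"
  using subset_UNIV
proof (induction y rule: frag_induction)
  case zero
  have "proj (\<lambda>i. 0 * w i) = \<zero>\<^bsub>P\<^esub>" by (rule proj_0) simp
  then show ?case using functional_0 by simp
next
  case (one a)
  have "coset_restr (f (proj (\<lambda>i. frag_of a * w i))) = frag_of a * coset_restr (f (proj w))"
  proof (rule poly_mapping_eqI)
    fix b
    have "\<tau> (- a) \<otimes>\<^bsub>\<Lambda>\<^esub> \<tau> b = \<tau> (b - a)" by (simp flip: \<tau>_add)
    then have "f (shift (\<tau> (- a)) (proj w)) (\<tau> b) = f (proj w) (\<tau> (b - a))"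
      using D_shift[OF f w \<tau>_closed \<tau>_closed] by simp
    then show "coef (coset_restr (f (proj (\<lambda>i. frag_of a * w i)))) b = coef (frag_of a * coset_restr (f (proj w))) b"
      unfolding proj_shift lookup_frag_of_mult
      by (simp add: lookup_coset_restr D_apply[OF f] w L_shift[OF w \<tau>_closed])
  qed
  then show ?case by simp
next
  case (diff y z)
  have "proj (\<lambda>i. y * w i) = proj (\<lambda>i. (y - z) * w i) \<oplus>\<^bsub>P\<^esub> proj (\<lambda>i. z * w i)"
    by (simp add: left_diff_distrib flip: proj_add)
  then have *: "of_nat n dvd coset_restr (f (proj (\<lambda>i. y * w i)))
      - (coset_restr (f (proj (\<lambda>i. (y - z) * w i))) + coset_restr (f (proj (\<lambda>i. z * w i))))"
    using functional_add[OF proj_mult_mem[OF w] proj_mult_mem[OF w]] by simp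
  let ?r = "coset_restr (f (proj w))"
  have alg: "d - (y - z) * r = (a - y * r) - (b - z * r) - (a - (d + b))" for a b d r :: "'e \<Rightarrow>\<^sub>0 int"
    by (simp add: algebra_simps)
  show ?case
    unfolding alg[of _ ?r "coset_restr (f (proj (\<lambda>i. y * w i)))" "coset_restr (f (proj (\<lambda>i. z * w i)))"]
    by (intro dvd_diff diff *)
qed

text \<open>The pullback of \<open>f\<close> to the free module. It is linear although
  \<open>f\<close> is antilinear, because \<open>proj\<close> negates exponents; the lifts of
  coefficients to integers are additive only modulo \<open>n\<close>, which \<open>nlin\<close>
  allows.\<close>

lemma functional_nlin: "F.nlin V (\<lambda>v. coset_restr (f (proj (\<lambda>i. \<theta> (v i)))))"
  unfolding F.nlin_def
proof (intro conjI ballI allI)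
  fix v w assume "v \<in> V" "w \<in> V"
  then show "of_nat n dvd coset_restr (f (proj (\<lambda>i. \<theta> (v i + w i))))
      - (coset_restr (f (proj (\<lambda>i. \<theta> (v i)))) + coset_restr (f (proj (\<lambda>i. \<theta> (w i)))))"
    using functional_add[of "proj (\<lambda>i. \<theta> (v i))" "proj (\<lambda>i. \<theta> (w i))"]
    by (simp add: V_def F.hom_add proj_add)
next
  fix u v assume "v \<in> V"
  then show "of_nat n dvd coset_restr (f (proj (\<lambda>i. \<theta> (u * v i)))) - \<theta> u * coset_restr (f (proj (\<lambda>i. \<theta> (v i))))"
    using functional_mult[of "\<lambda>i. \<theta> (v i)" "\<theta> u"] by (simp add: V_def F.hom_mult)
next
  fix v show "of_nat n dvd coset_restr (f (proj (\<lambda>i. \<theta> (of_nat n * v i))))"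
    unfolding proj_n by (rule functional_0)
qed

end

lemma nlin_sum:
  assumes G: "F.nlin UNIV G" and G0: "of_nat n dvd G (\<lambda>i. 0)" and "finite A"
  shows "of_nat n dvd G (\<lambda>i. \<Sum>j\<in>A. c j * unit_vec j i) - (\<Sum>j\<in>A. \<theta> (c j) * G (unit_vec j))"
  using \<open>finite A\<close>
proof (induction A)
  case empty
  then show ?case using G0 by simp
next
  case (insert x A)
  let ?s = "\<lambda>i. \<Sum>j\<in>A. c j * unit_vec j i"
  have 1: "of_nat n dvd G (\<lambda>i. c x * unit_vec x i + ?s i) - (G (\<lambda>i. c x * unit_vec x i) + G ?s)"
    by (rule F.nlin_add[OF G]) simp_all
  have 2: "of_nat n dvd G (\<lambda>i. c x * unit_vec x i) - \<theta> (c x) * G (unit_vec x)"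
    by (rule F.nlin_mult[OF G]) simp
  have e1: "(\<lambda>i. \<Sum>j\<in>insert x A. c j * unit_vec j i) = (\<lambda>i. c x * unit_vec x i + ?s i)" using insert by simp
  have e2: "(\<Sum>j\<in>insert x A. \<theta> (c j) * G (unit_vec j)) = \<theta> (c x) * G (unit_vec x) + (\<Sum>j\<in>A. \<theta> (c j) * G (unit_vec j))"
    using insert by simp
  have e3: "G (\<lambda>i. c x * unit_vec x i + ?s i) - (\<theta> (c x) * G (unit_vec x) + (\<Sum>j\<in>A. \<theta> (c j) * G (unit_vec j)))
    = (G (\<lambda>i. c x * unit_vec x i + ?s i) - (G (\<lambda>i. c x * unit_vec x i) + G ?s))
      + (G (\<lambda>i. c x * unit_vec x i) - \<theta> (c x) * G (unit_vec x)) + (G ?s - (\<Sum>j\<in>A. \<theta> (c j) * G (unit_vec j)))"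
    by simp
  show ?case unfolding e1 e2 e3 by (rule dvd_add[OF dvd_add[OF 1 2] insert.IH])
qed

lemma proj_unit_vec:
  assumes b: "b \<in> carrier P\<^sub>0" and c: "c \<in> C"
  shows "proj (\<lambda>i. \<theta> (unit_vec (b, c) i)) = gmonom \<Lambda> P\<^sub>0 b c"
  unfolding proj_def gmonom_def
proof (rule restrict_ext)
  fix g assume g: "g \<in> carrier \<Lambda>"
  have iff: "cr g = c \<and> al g = 0 \<longleftrightarrow> g = c"
    using C_facts[OF c] cr_al[OF g] by (auto simp: \<tau>_0)
  have one: "coef 1 a = (if a = 0 then 1 else 0)" for a :: 'e by (simp add: lookup_one)
  show "comb (\<lambda>x. coef (\<theta> (unit_vec (b, c) (x, cr g))) (- al g)) = (if g = c then b else \<zero>\<^bsub>P\<^sub>0\<^esub>)"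
  proof (cases "g = c")
    case True
    then have "(\<lambda>x. coef (\<theta> (unit_vec (b, c) (x, cr g))) (- al g)) = (\<lambda>x. if x = b then 1 else 0)"
      using iff by (auto simp: unit_vec_def F.hom_1 F.hom_0 one)
    then show ?thesis using comb_single[OF b] True by simp
  next
    case False
    have "comb (\<lambda>x. coef (\<theta> (unit_vec (b, c) (x, cr g))) (- al g)) = \<zero>\<^bsub>P\<^sub>0\<^esub>"
      by (rule comb_0) (use False iff in \<open>auto simp: unit_vec_def F.hom_1 F.hom_0 one\<close>)
    then show ?thesis using False by simp
  qed
qed

text \<open>A site \<open>\<kappa>\<close> contributes one monomial with coefficient
  \<open>1\<close> to the generator indexed by its own value \<open>l \<kappa>\<close> and its coset
  representative. This is available because every element of \<open>P\<^sub>0\<close> is a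
  generator.\<close>

lemma proj_surj:
  assumes l: "l \<in> carrier P"
  shows "proj (\<lambda>(b, c). \<Sum>\<kappa> | \<kappa> \<in> gsupp \<Lambda> P\<^sub>0 l \<and> cr \<kappa> = c \<and> l \<kappa> = b. frag_of (- al \<kappa>)) = l"
proof (rule P_eqI[OF proj_closed l])
  fix g assume g: "g \<in> carrier \<Lambda>"
  define S where "S = gsupp \<Lambda> P\<^sub>0 l"
  have fin: "finite S" and SG: "S \<subseteq> carrier \<Lambda>" using P_finite[OF l] by (auto simp: S_def gsupp_def)
  have "coef (\<Sum>\<kappa> | \<kappa> \<in> S \<and> cr \<kappa> = cr g \<and> l \<kappa> = b. frag_of (- al \<kappa>)) (- al g)
    = (if g \<in> S \<and> b = l g then 1 else 0)" for b
  proof -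
    have "(\<Sum>\<kappa> | \<kappa> \<in> S \<and> cr \<kappa> = cr g \<and> l \<kappa> = b. coef (frag_of (- al \<kappa>)) (- al g))
      = (\<Sum>\<kappa> | \<kappa> \<in> S \<and> cr \<kappa> = cr g \<and> l \<kappa> = b. if \<kappa> = g then 1 else 0)"
    proof (rule sum.cong[OF refl])
      fix \<kappa> assume "\<kappa> \<in> {\<kappa>. \<kappa> \<in> S \<and> cr \<kappa> = cr g \<and> l \<kappa> = b}"
      then have "\<kappa> \<in> carrier \<Lambda>" "cr \<kappa> = cr g" using SG by auto
      then have "al \<kappa> = al g \<longleftrightarrow> \<kappa> = g" using cr_al[of \<kappa>] cr_al[OF g] by metis
      then show "coef (frag_of (- al \<kappa>)) (- al g) = (if \<kappa> = g then 1 else 0)" by auto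
    qed
    also have "\<dots> = (if g \<in> S \<and> b = l g then 1 else 0)" using fin by auto
    finally show ?thesis by (simp add: lookup_sum)
  qed
  then have eq: "proj (\<lambda>(b, c). \<Sum>\<kappa> | \<kappa> \<in> S \<and> cr \<kappa> = c \<and> l \<kappa> = b. frag_of (- al \<kappa>)) g
    = comb (\<lambda>b. if g \<in> S \<and> b = l g then 1 else 0)"
    using g by (simp add: proj_apply)
  show "proj (\<lambda>(b, c). \<Sum>\<kappa> | \<kappa> \<in> gsupp \<Lambda> P\<^sub>0 l \<and> cr \<kappa> = c \<and> l \<kappa> = b. frag_of (- al \<kappa>)) g = l g"
  proof (cases "g \<in> S")
    case True
    then show ?thesis unfolding S_def[symmetric] eq using comb_single[OF P_apply[OF l g]] by simp
  next
    case False
    then have "comb (\<lambda>b. if g \<in> S \<and> b = l g then 1 else 0) = \<zero>\<^bsub>P\<^sub>0\<^esub>" by (intro comb_0) simp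
    then show ?thesis unfolding S_def[symmetric] eq using False g by (simp add: S_def gsupp_def)
  qed
qed

text \<open>The preimage of \<open>l\<close> has Laurent monomials as entries. Multiplying by a
  common monomial makes them polynomial, at the price of translating \<open>l\<close>.\<close>

lemma shift_in_range_proj:
  assumes l: "l \<in> carrier P"
  obtains v \<beta> where "proj (\<lambda>i. \<theta> (v i)) = shift (\<tau> (- \<beta>)) l"
proof -
  define S where "S = gsupp \<Lambda> P\<^sub>0 l"
  have fin: "finite S" using P_finite[OF l] by (simp add: S_def)
  obtain \<beta> where \<beta>: "\<forall>a\<in>(\<lambda>\<kappa>. - al \<kappa>) ` S. frag_of (a + \<beta>) \<in> range \<theta>" using monomials[of "(\<lambda>\<kappa>. - al \<kappa>) ` S"] fin by blast
  then have "\<forall>\<kappa>\<in>S. \<exists>u. \<theta> u = frag_of (- al \<kappa> + \<beta>)" by (metis imageE imageI)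
  then obtain u where u: "\<And>\<kappa>. \<kappa> \<in> S \<Longrightarrow> \<theta> (u \<kappa>) = frag_of (- al \<kappa> + \<beta>)" by metis
  have hom_sum: "\<theta> (sum u A) = (\<Sum>\<kappa>\<in>A. \<theta> (u \<kappa>))" for A
    by (induction A rule: infinite_finite_induct) (simp_all add: F.hom_0 F.hom_add)
  define v where "v = (\<lambda>(b, c). \<Sum>\<kappa> | \<kappa> \<in> S \<and> cr \<kappa> = c \<and> l \<kappa> = b. u \<kappa>)"
  define w where "w = (\<lambda>(b, c). \<Sum>\<kappa> | \<kappa> \<in> S \<and> cr \<kappa> = c \<and> l \<kappa> = b. (frag_of (- al \<kappa>) :: 'e \<Rightarrow>\<^sub>0 int))"
  have "\<theta> (v i) = frag_of \<beta> * w i" for i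
    by (cases i) (auto simp: v_def w_def hom_sum u sum_distrib_left mult_single add.commute intro!: sum.cong)
  then have "proj (\<lambda>i. \<theta> (v i)) = shift (\<tau> (- \<beta>)) (proj w)" by (simp add: proj_shift)
  moreover have "proj w = l" unfolding w_def S_def by (rule proj_surj[OF l])
  ultimately show ?thesis using that[of v \<beta>] by simp
qed

text \<open>The sites of \<open>proj v\<close> are \<open>c\<close> times
  \<open>\<tau> (- a)\<close>, so the coefficient of the form at \<open>\<tau> \<beta>\<close>
  collects products of exponents \<open>a\<close> and \<open>\<beta> - a\<close>, which is the
  convolution in \<open>dot\<close>. The entries of \<open>h\<close> are integer lifts of the
  pairings of the generators with \<open>p\<close>.\<close>

lemma form_proj:
  assumes p: "p \<in> carrier P"
    and h: "\<And>b \<kappa>. b \<in> carrier P\<^sub>0 \<Longrightarrow> \<kappa> \<in> carrier \<Lambda> \<Longrightarrow> cls (coef (h (b, cr \<kappa>)) (al \<kappa>)) = \<omega>\<^sub>0 b (p \<kappa>)"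
  shows "form (proj v) p (\<tau> \<beta>) = cls (coef (dot Ix v h) \<beta>)"
proof -
  define A where "A = (\<Union>i\<in>Ix. Poly_Mapping.keys (v i))"
  have fA: "finite A" unfolding A_def using finite_Ix by simp
  define \<kappa> where "\<kappa> x = (case x of (c, a) \<Rightarrow> c \<otimes>\<^bsub>\<Lambda>\<^esub> \<tau> (- a))" for x
  have cr\<kappa>: "cr (\<kappa> (c, a)) = c" and al\<kappa>: "al (\<kappa> (c, a)) = - a" and \<kappa>G: "\<kappa> (c, a) \<in> carrier \<Lambda>" if "c \<in> C" for c a
    using C_facts[OF that] \<tau>_closed cr_shift[of c "- a"] al_shift[of c "- a"] by (simp_all add: \<kappa>_def)
  have inj: "inj_on \<kappa> (C \<times> A)"
  proof (rule inj_onI)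
    fix x y assume "x \<in> C \<times> A" "y \<in> C \<times> A" "\<kappa> x = \<kappa> y"
    then show "x = y" using cr\<kappa> al\<kappa> by (metis SigmaE minus_minus)
  qed
  have supp: "gsupp \<Lambda> P\<^sub>0 (proj v) \<subseteq> \<kappa> ` (C \<times> A)"
  proof
    fix g assume "g \<in> gsupp \<Lambda> P\<^sub>0 (proj v)"
    then have g: "g \<in> carrier \<Lambda>" and ne: "comb (\<lambda>b. coef (v (b, cr g)) (- al g)) \<noteq> \<zero>\<^bsub>P\<^sub>0\<^esub>"
      by (auto simp: gsupp_def proj_apply)
    obtain b where b: "b \<in> carrier P\<^sub>0" "\<not> int n dvd coef (v (b, cr g)) (- al g)"
      using ne comb_0[of "\<lambda>b. coef (v (b, cr g)) (- al g)"] by auto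
    have "cr g \<in> C" using g by (simp add: C_def)
    moreover have "- al g \<in> A"
    proof -
      have "(b, cr g) \<in> Ix" using b(1) \<open>cr g \<in> C\<close> by (simp add: Ix_def)
      moreover have "- al g \<in> Poly_Mapping.keys (v (b, cr g))" using b(2) by (metis dvd_0_right in_keys_iff)
      ultimately show ?thesis unfolding A_def by blast
    qed
    moreover have "g = \<kappa> (cr g, - al g)" using cr_al[OF g] by (simp add: \<kappa>_def)
    ultimately show "g \<in> \<kappa> ` (C \<times> A)" by blast
  qed
  have "form (proj v) p (\<tau> \<beta>) = cls (\<Sum>k\<in>\<kappa> ` (C \<times> A). \<omega>z (proj v k) (p (k \<otimes>\<^bsub>\<Lambda>\<^esub> \<tau> \<beta>)))"
    by (rule form_apply[OF proj_closed p \<tau>_closed _ supp]) (use finite_C fA \<kappa>G in auto)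
  also have "\<dots> = cls (\<Sum>x\<in>C \<times> A. \<omega>z (proj v (\<kappa> x)) (p (\<kappa> x \<otimes>\<^bsub>\<Lambda>\<^esub> \<tau> \<beta>)))"
    by (simp add: sum.reindex[OF inj])
  also have "\<dots> = cls (\<Sum>x\<in>C \<times> A. \<Sum>b\<in>carrier P\<^sub>0. coef (v (b, fst x)) (snd x) * coef (h (b, fst x)) (\<beta> - snd x))"
    unfolding ZMod_eq_iff sum_subtractf[symmetric]
  proof (rule dvd_sum)
    fix x assume "x \<in> C \<times> A"
    then obtain c a where x: "x = (c, a)" and c: "c \<in> C" by blast
    let ?k = "\<kappa> (c, a) \<otimes>\<^bsub>\<Lambda>\<^esub> \<tau> \<beta>"
    have k: "?k \<in> carrier \<Lambda>" "cr ?k = c" "al ?k = \<beta> - a"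
      using \<kappa>G[OF c] \<tau>_closed cr_shift[OF \<kappa>G[OF c]] al_shift[OF \<kappa>G[OF c]] cr\<kappa>[OF c] al\<kappa>[OF c] by simp_all
    have pk: "p ?k \<in> carrier P\<^sub>0" by (rule P_apply[OF p k(1)])
    have "cls (\<omega>z (proj v (\<kappa> x)) (p (\<kappa> x \<otimes>\<^bsub>\<Lambda>\<^esub> \<tau> \<beta>))) = \<omega>\<^sub>0 (comb (\<lambda>b. coef (v (b, c)) a)) (p ?k)"
      unfolding x by (simp add: cls_\<omega>z P_apply[OF proj_closed] \<kappa>G[OF c] pk) (simp add: proj_apply \<kappa>G[OF c] cr\<kappa>[OF c] al\<kappa>[OF c])
    also have "\<dots> = cls (\<Sum>b\<in>carrier P\<^sub>0. coef (v (b, c)) a * \<omega>z b (p ?k))" by (rule form_comb[OF pk])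
    also have "\<dots> = cls (\<Sum>b\<in>carrier P\<^sub>0. coef (v (b, c)) a * coef (h (b, c)) (\<beta> - a))"
      unfolding ZMod_eq_iff sum_subtractf[symmetric]
    proof (rule dvd_sum)
      fix b assume b: "b \<in> carrier P\<^sub>0"
      have "cls (\<omega>z b (p ?k)) = cls (coef (h (b, c)) (\<beta> - a))"
        using h[OF b k(1)] k(2,3) cls_\<omega>z[OF b pk] by simp
      then have "int n dvd \<omega>z b (p ?k) - coef (h (b, c)) (\<beta> - a)" by (simp only: ZMod_eq_iff)
      then show "int n dvd coef (v (b, c)) a * \<omega>z b (p ?k) - coef (v (b, c)) a * coef (h (b, c)) (\<beta> - a)"
        by (simp add: right_diff_distrib[symmetric])
    qed
    finally show "int n dvd \<omega>z (proj v (\<kappa> x)) (p (\<kappa> x \<otimes>\<^bsub>\<Lambda>\<^esub> \<tau> \<beta>))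
        - (\<Sum>b\<in>carrier P\<^sub>0. coef (v (b, fst x)) (snd x) * coef (h (b, fst x)) (\<beta> - snd x))"
      unfolding ZMod_eq_iff x by simp
  qed
  also have "(\<Sum>x\<in>C \<times> A. \<Sum>b\<in>carrier P\<^sub>0. coef (v (b, fst x)) (snd x) * coef (h (b, fst x)) (\<beta> - snd x))
    = (\<Sum>b\<in>carrier P\<^sub>0. \<Sum>c\<in>C. \<Sum>a\<in>A. coef (v (b, c)) a * coef (h (b, c)) (\<beta> - a))"
    by (subst sum.swap, rule sum.cong[OF refl]) (simp add: sum.cartesian_product case_prod_unfold)
  also have "\<dots> = (\<Sum>i\<in>Ix. \<Sum>a\<in>A. coef (v i) a * coef (h i) (\<beta> - a))"
    using sum.cartesian_product[of "\<lambda>b c. \<Sum>a\<in>A. coef (v (b, c)) a * coef (h (b, c)) (\<beta> - a)" C "carrier P\<^sub>0"]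
    by (simp add: Ix_def case_prod_unfold)
  also have "\<dots> = coef (dot Ix v h) \<beta>"
    unfolding dot_def lookup_sum
  proof (rule sum.cong[OF refl])
    fix i assume "i \<in> Ix"
    then have "Poly_Mapping.keys (v i) \<subseteq> A" by (auto simp: A_def)
    then show "(\<Sum>a\<in>A. coef (v i) a * coef (h i) (\<beta> - a)) = coef (v i * h i) \<beta>"
      unfolding lookup_mult_pairing by (rule pairing_superset[OF fA, symmetric])
  qed
  finally show ?thesis .
qed

text \<open>For a functional \<open>f\<close> on \<open>L\<close>, the extension of \<open>s\<close>
  times its pullback is a functional on the whole free module, hence determined modulo
  \<open>n\<close> by its values \<open>y\<close> on unit vectors. It kills the kernel of
  \<open>proj\<close>, so \<open>y\<close> is additive in the generator, and
  \<open>form_represents\<close> turns its coefficients into the sites of some \<open>p\<close> in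
  \<open>P\<close>. Then \<open>s\<close> times \<open>f\<close> is the form against
  \<open>p\<close>.\<close>

lemma gmap_mem_Ann_if_extends:
  assumes ext: "F.extends V UNIV s"
  shows "gmap \<tau> (\<theta> s) \<in> Ann"
  unfolding Ann_iff
proof (intro conjI ballI gmap_closed)
  fix f assume f: "f \<in> carrier D"
  define F0 where "F0 v = coset_restr (f (proj (\<lambda>i. \<theta> (v i))))" for v
  have "F.nlin V F0" unfolding F0_def by (rule functional_nlin[OF f])
  then obtain G where G: "F.nlin UNIV G" and GV: "\<forall>v\<in>V. of_nat n dvd G v - \<theta> s * F0 v"
    using ext unfolding F.extends_def by blast
  \<comment> \<open>A vector with zero projection belongs to \<open>V\<close>, where
    \<open>G\<close> is \<open>s\<close> times the lift of the value of \<open>f\<close> at zero. So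
    \<open>G\<close> descends to \<open>P\<close> modulo \<open>n\<close>.\<close>
  have G_null: "of_nat n dvd G v" if "proj (\<lambda>i. \<theta> (v i)) = \<zero>\<^bsub>P\<^esub>" for v
  proof -
    have "v \<in> V" using that L_0 by (simp add: V_def)
    moreover have "of_nat n dvd \<theta> s * F0 v" unfolding F0_def that by (rule dvd_mult[OF functional_0[OF f]])
    ultimately show ?thesis using GV dvd_diff_left_iff by blast
  qed
  define y where "y i = G (unit_vec i)" for i
  have G_dot: "of_nat n dvd G v - dot Ix (\<lambda>i. \<theta> (v i)) y" for v
  proof -
    \<comment> \<open>\<open>?w\<close> keeps the coordinates in \<open>Ix\<close>; the rest
      \<open>?d\<close> is invisible to \<open>proj\<close> and is killed by
      \<open>G\<close>.\<close>
    let ?w = "\<lambda>i. \<Sum>j\<in>Ix. v j * unit_vec j i" and ?d = "\<lambda>i. v i - (\<Sum>j\<in>Ix. v j * unit_vec j i)"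
    have w: "?w i = (if i \<in> Ix then v i else 0)" for i
      using finite_Ix by (simp add: unit_vec_def if_distrib[of "(*) _"] cong: if_cong)
    have "proj (\<lambda>i. \<theta> (?d i)) = \<zero>\<^bsub>P\<^esub>" by (rule proj_0) (simp add: w F.hom_0)
    then have 1: "of_nat n dvd G ?d" by (rule G_null)
    have "of_nat n dvd G (\<lambda>i. ?d i + ?w i) - (G ?d + G ?w)" by (rule F.nlin_add[OF G]) simp_all
    then have 2: "of_nat n dvd G v - (G ?d + G ?w)" by simp
    have "proj (\<lambda>i. \<theta> ((\<lambda>i. 0) i)) = \<zero>\<^bsub>P\<^esub>" by (rule proj_0) (simp add: F.hom_0)
    then have "of_nat n dvd G (\<lambda>i. 0)" by (rule G_null)
    then have 3: "of_nat n dvd G ?w - dot Ix (\<lambda>i. \<theta> (v i)) y"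
      unfolding dot_def y_def by (rule nlin_sum[OF G _ finite_Ix])
    have eq: "G v - dot Ix (\<lambda>i. \<theta> (v i)) y = (G v - (G ?d + G ?w)) + G ?d + (G ?w - dot Ix (\<lambda>i. \<theta> (v i)) y)" by simp
    show ?thesis unfolding eq by (rule dvd_add[OF dvd_add[OF 2 1] 3])
  qed
  \<comment> \<open>The difference between the unit vector of a sum and the sum of the unit vectors
    projects to zero; these are the relations among the generators of
    \<open>P\<^sub>0\<close>.\<close>
  have y_add: "of_nat n dvd y (a \<oplus>\<^bsub>P\<^sub>0\<^esub> b, c) - (y (a, c) + y (b, c))"
    if a: "a \<in> carrier P\<^sub>0" and b: "b \<in> carrier P\<^sub>0" and c: "c \<in> C" for a b c
  proof -
    have cG: "c \<in> carrier \<Lambda>" by (rule C_facts(1)[OF c])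
    let ?u = "unit_vec (a \<oplus>\<^bsub>P\<^sub>0\<^esub> b, c)" and ?w = "\<lambda>i. unit_vec (a, c) i + unit_vec (b, c) i"
    interpret PP: abelian_group P by (rule P_abelian_group)
    have mono: "gmonom \<Lambda> P\<^sub>0 x c \<in> carrier P" if "x \<in> carrier P\<^sub>0" for x
      unfolding gmonom_def by (rule P_closedI[of _ "{c}"]) (use that in auto)
    have sum: "gmonom \<Lambda> P\<^sub>0 (a \<oplus>\<^bsub>P\<^sub>0\<^esub> b) c = gmonom \<Lambda> P\<^sub>0 a c \<oplus>\<^bsub>P\<^esub> gmonom \<Lambda> P\<^sub>0 b c"
      unfolding P_sel(3) gmonom_def by (rule restrict_ext) simp
    have "proj (\<lambda>i. \<theta> (?u i - ?w i)) = proj (\<lambda>i. \<theta> (?u i)) \<oplus>\<^bsub>P\<^esub> \<ominus>\<^bsub>P\<^esub> (proj (\<lambda>i. \<theta> (unit_vec (a, c) i)) \<oplus>\<^bsub>P\<^esub> proj (\<lambda>i. \<theta> (unit_vec (b, c) i)))"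
      by (simp add: F.hom_diff F.hom_add proj_diff proj_add)
    also have "\<dots> = \<zero>\<^bsub>P\<^esub>"
      using a b c mono by (simp add: proj_unit_vec sum PP.r_neg)
    finally have 1: "of_nat n dvd G (\<lambda>i. ?u i - ?w i)" by (rule G_null)
    have "of_nat n dvd G (\<lambda>i. (?u i - ?w i) + ?w i) - (G (\<lambda>i. ?u i - ?w i) + G ?w)" by (rule F.nlin_add[OF G]) simp_all
    then have 2: "of_nat n dvd G ?u - (G (\<lambda>i. ?u i - ?w i) + G ?w)" by simp
    have 3: "of_nat n dvd G ?w - (y (a, c) + y (b, c))" unfolding y_def by (rule F.nlin_add[OF G]) simp_all
    have eq: "y (a \<oplus>\<^bsub>P\<^sub>0\<^esub> b, c) - (y (a, c) + y (b, c))
      = (G ?u - (G (\<lambda>i. ?u i - ?w i) + G ?w)) + G (\<lambda>i. ?u i - ?w i) + (G ?w - (y (a, c) + y (b, c)))"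
      by (simp add: y_def)
    show ?thesis unfolding eq by (rule dvd_add[OF dvd_add[OF 2 1] 3])
  qed
  \<comment> \<open>For a fixed site the coefficient of \<open>y\<close> at exponent
    \<open>al \<kappa>\<close> is an additive map from \<open>P\<^sub>0\<close> to residues, so the
    perfect pairing represents it.\<close>
  have "\<exists>a\<in>carrier P\<^sub>0. \<forall>b\<in>carrier P\<^sub>0. \<omega>\<^sub>0 b a = cls (coef (y (b, cr \<kappa>)) (al \<kappa>))" if \<kappa>: "\<kappa> \<in> carrier \<Lambda>" for \<kappa>
  proof -
    have c: "cr \<kappa> \<in> C" using \<kappa> by (simp add: C_def)
    have "cls (coef (y (a \<oplus>\<^bsub>P\<^sub>0\<^esub> b, cr \<kappa>)) (al \<kappa>)) = cls (coef (y (a, cr \<kappa>)) (al \<kappa>)) \<oplus>\<^bsub>K\<^esub> cls (coef (y (b, cr \<kappa>)) (al \<kappa>))"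
      if "a \<in> carrier P\<^sub>0" "b \<in> carrier P\<^sub>0" for a b
      using y_add[OF that c] unfolding of_nat_dvd_frag_iff ZMod_add[symmetric] ZMod_eq_iff
      by (simp add: lookup_minus lookup_add)
    then show ?thesis using form_represents[of "\<lambda>b. cls (coef (y (b, cr \<kappa>)) (al \<kappa>))"] ZMod_closed by metis
  qed
  then obtain p0 where p0: "\<And>\<kappa>. \<kappa> \<in> carrier \<Lambda> \<Longrightarrow> p0 \<kappa> \<in> carrier P\<^sub>0"
      "\<And>b \<kappa>. \<kappa> \<in> carrier \<Lambda> \<Longrightarrow> b \<in> carrier P\<^sub>0 \<Longrightarrow> \<omega>\<^sub>0 b (p0 \<kappa>) = cls (coef (y (b, cr \<kappa>)) (al \<kappa>))"
    by metis
  define p where "p = (\<lambda>\<kappa>\<in>carrier \<Lambda>. p0 \<kappa>)"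
  \<comment> \<open>Away from the finitely many exponents occurring in \<open>y\<close> the
    represented map is zero, and nondegeneracy makes the representing element zero.\<close>
  have p: "p \<in> carrier P"
    unfolding p_def
  proof (rule P_closedI[of _ "(\<lambda>(c, a). c \<otimes>\<^bsub>\<Lambda>\<^esub> \<tau> a) ` (C \<times> (\<Union>i\<in>Ix. Poly_Mapping.keys (y i)))"])
    show "finite ((\<lambda>(c, a). c \<otimes>\<^bsub>\<Lambda>\<^esub> \<tau> a) ` (C \<times> (\<Union>i\<in>Ix. Poly_Mapping.keys (y i))))" using finite_C finite_Ix by simp
    fix g assume g: "g \<in> carrier \<Lambda>" and out: "g \<notin> (\<lambda>(c, a). c \<otimes>\<^bsub>\<Lambda>\<^esub> \<tau> a) ` (C \<times> (\<Union>i\<in>Ix. Poly_Mapping.keys (y i)))"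
    have c: "cr g \<in> C" using g by (simp add: C_def)
    have "\<omega>\<^sub>0 b (p0 g) = \<zero>\<^bsub>K\<^esub>" if b: "b \<in> carrier P\<^sub>0" for b
    proof -
      have "al g \<notin> Poly_Mapping.keys (y (b, cr g))"
      proof
        assume "al g \<in> Poly_Mapping.keys (y (b, cr g))"
        then have "(cr g, al g) \<in> C \<times> (\<Union>i\<in>Ix. Poly_Mapping.keys (y i))" using b c by (auto simp: Ix_def)
        from imageI[OF this, of "\<lambda>(c, a). c \<otimes>\<^bsub>\<Lambda>\<^esub> \<tau> a"] show False using out cr_al[OF g] by simp
      qed
      then show ?thesis using p0(2)[OF g b] by (simp add: in_keys_iff ZMod_0)
    qed
    then show "p0 g = \<zero>\<^bsub>P\<^sub>0\<^esub>" using form_nondegenerate[OF p0(1)[OF g]] by blast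
  qed (rule p0(1))
  have h: "cls (coef (y (b, cr \<kappa>)) (al \<kappa>)) = \<omega>\<^sub>0 b (p \<kappa>)" if "b \<in> carrier P\<^sub>0" "\<kappa> \<in> carrier \<Lambda>" for b \<kappa>
    using p0(2)[OF that(2,1)] that by (simp add: p_def)
  \<comment> \<open>An arbitrary site \<open>\<nu>\<close> is brought to the identity by translating
    \<open>l\<close>. A further translation by \<open>\<tau> (- \<beta>)\<close> gives a preimage
    with polynomial entries, and the coefficient is then read at
    \<open>\<tau> \<beta>\<close>.\<close>
  have "(gmap \<tau> (\<theta> s) \<otimes>\<^bsub>R\<^esub> f l) \<nu> = form l p \<nu>" if l: "l \<in> L" and \<nu>: "\<nu> \<in> carrier \<Lambda>" for l \<nu>
  proof -
    have lP: "l \<in> carrier P" using l L_subset by blast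
    have l1: "shift \<nu> l \<in> L" "shift \<nu> l \<in> carrier P" using L_shift[OF l \<nu>] L_subset by auto
    obtain v \<beta> where v: "proj (\<lambda>i. \<theta> (v i)) = shift (\<tau> (- \<beta>)) (shift \<nu> l)" by (rule shift_in_range_proj[OF l1(2)])
    have "\<tau> (- \<beta>) \<otimes>\<^bsub>\<Lambda>\<^esub> \<tau> \<beta> = \<one>\<^bsub>\<Lambda>\<^esub>" by (simp add: \<tau>_0 flip: \<tau>_add)
    then have "form l p \<nu> = form (proj (\<lambda>i. \<theta> (v i))) p (\<tau> \<beta>)"
      unfolding v form_ext_shift_left[OF l1(2) p \<tau>_closed \<tau>_closed]
      using form_ext_shift_left[OF lP p \<nu> \<Lambda>.one_closed] \<nu> by simp
    also have "\<dots> = cls (coef (dot Ix (\<lambda>i. \<theta> (v i)) y) \<beta>)" by (rule form_proj[OF p h])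
    also have "\<dots> = cls (coef (\<theta> s * F0 v) \<beta>)"
    proof -
      have "v \<in> V" using L_shift[OF l1(1) \<tau>_closed] v by (simp add: V_def)
      then have "of_nat n dvd (G v - \<theta> s * F0 v) - (G v - dot Ix (\<lambda>i. \<theta> (v i)) y)"
        using dvd_diff[OF bspec[OF GV] G_dot] by blast
      then have "of_nat n dvd dot Ix (\<lambda>i. \<theta> (v i)) y - \<theta> s * F0 v" by simp
      then show ?thesis unfolding of_nat_dvd_frag_iff ZMod_eq_iff by (simp add: lookup_minus)
    qed
    also have "coef (\<theta> s * F0 v) \<beta> = pairing (\<lambda>a. rep (f l (inv\<^bsub>\<Lambda>\<^esub> (\<tau> a) \<otimes>\<^bsub>\<Lambda>\<^esub> \<nu>))) (\<theta> s)"
    proof -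
      have "coef (F0 v) (\<beta> - a) = rep (f l (inv\<^bsub>\<Lambda>\<^esub> (\<tau> a) \<otimes>\<^bsub>\<Lambda>\<^esub> \<nu>))" for a
      proof -
        have "coef (F0 v) (\<beta> - a) = rep (f (shift (\<tau> (- \<beta>)) (shift \<nu> l)) (\<tau> (\<beta> - a)))"
          unfolding F0_def v by (rule lookup_coset_restr[OF D_apply[OF f L_shift[OF l1(1) \<tau>_closed]]])
        also have "f (shift (\<tau> (- \<beta>)) (shift \<nu> l)) (\<tau> (\<beta> - a)) = f (shift \<nu> l) (\<tau> (- \<beta>) \<otimes>\<^bsub>\<Lambda>\<^esub> \<tau> (\<beta> - a))"
          by (rule D_shift[OF f l1(1) \<tau>_closed \<tau>_closed])
        also have "\<tau> (- \<beta>) \<otimes>\<^bsub>\<Lambda>\<^esub> \<tau> (\<beta> - a) = inv\<^bsub>\<Lambda>\<^esub> (\<tau> a)" by (simp add: \<tau>_minus[symmetric] \<tau>_add[symmetric])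
        also have "f (shift \<nu> l) (inv\<^bsub>\<Lambda>\<^esub> (\<tau> a)) = f l (inv\<^bsub>\<Lambda>\<^esub> (\<tau> a) \<otimes>\<^bsub>\<Lambda>\<^esub> \<nu>)"
          using D_shift[OF f l \<nu>, of "inv\<^bsub>\<Lambda>\<^esub> (\<tau> a)"] \<tau>_closed \<nu> by (simp add: \<Lambda>.m_comm)
        finally show ?thesis .
      qed
      then show ?thesis unfolding lookup_mult_pairing by simp
    qed
    also have "cls (pairing (\<lambda>a. rep (f l (inv\<^bsub>\<Lambda>\<^esub> (\<tau> a) \<otimes>\<^bsub>\<Lambda>\<^esub> \<nu>))) (\<theta> s)) = (gmap \<tau> (\<theta> s) \<otimes>\<^bsub>R\<^esub> f l) \<nu>"
      by (rule gmap_mult_apply[OF exponents _ \<nu>, where s' = "\<lambda>g. rep (f l g)", symmetric])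
        (rule ZMod_ZRep[OF R_apply_closed[OF D_apply[OF f l]]])
    finally show ?thesis by simp
  qed
  moreover have "gmap \<tau> (\<theta> s) \<otimes>\<^bsub>R\<^esub> f l \<in> carrier R" "form l p \<in> carrier R" if "l \<in> L" for l
  proof -
    interpret R: cring R by (rule R_cring)
    show "gmap \<tau> (\<theta> s) \<otimes>\<^bsub>R\<^esub> f l \<in> carrier R" by (rule R.m_closed[OF gmap_closed D_apply[OF f that]])
    show "form l p \<in> carrier R" using that L_subset p by (intro form_R_closed) auto
  qed
  ultimately have "gmap \<tau> (\<theta> s) \<odot>\<^bsub>D\<^esub> f = (\<lambda>l\<in>L. form l p)"
    unfolding D_sel(3) by (intro restrict_ext R_eqI) auto
  then show "gmap \<tau> (\<theta> s) \<odot>\<^bsub>D\<^esub> f \<in> locals" by (simp only: locals_mem[OF p])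
qed

end

text \<open>The residue characteristic of a prime above the annihilator divides \<open>n\<close>,
  and being content-free keeps \<open>s\<close> nonzero modulo it. The monomial of \<open>e\<close>
  is a unit, hence outside the prime, and \<open>power_torsion_of_root\<close> applies.\<close>

lemma (in stabilizer_code) mobile_along_if_poly:
  fixes \<tau> :: "'e::ab_group_add \<Rightarrow> 'l" and s :: "int poly"
  assumes \<tau>: "exponent_map \<Lambda> \<tau>" and s: "content_free n s"
    and ann: "gmap \<tau> (poly (map_poly of_int s) (frag_of e)) \<in> Ann"
  shows "\<exists>N>0. mobile_along (\<tau> e [^]\<^bsub>\<Lambda>\<^esub> (N::nat))"
proof -
  let ?I = "{u. gmap \<tau> u \<in> Ann}" and ?t = "frag_of e :: 'e \<Rightarrow>\<^sub>0 int"
  have I: "is_ideal ?I" and nI: "of_nat n \<in> ?I" by (rule vimage_Ann_ideal[OF \<tau>], rule of_nat_n_vimage_Ann)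
  have "\<exists>N>0. ?t ^ N - 1 \<in> p" if p: "is_prime p" and Ip: "?I \<subseteq> p" for p
  proof -
    have "of_nat n \<in> p" using nI Ip by blast
    then obtain q where q: "prime q" "q dvd n" "\<And>z. of_int z \<in> p \<longleftrightarrow> int q dvd z"
      using is_prime_nat[OF p _ n_pos] by metis
    have "\<not> of_nat q dvd s" using s q unfolding content_free_def by blast
    then have 1: "\<exists>i. \<not> int q dvd coeff s i" by (simp add: of_nat_poly const_poly_dvd_iff)
    have 2: "poly (map_poly of_int s) ?t \<in> p" using ann Ip by blast
    have 3: "?t \<notin> p"
    proof
      assume "?t \<in> p"
      then have "frag_of (- e) * ?t \<in> p" by (rule is_ideal_mult[OF is_prime_ideal[OF p]])
      then show False using is_prime_1[OF p] by (simp add: mult_single single_one)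
    qed
    from power_torsion_of_root[OF p q(1) q(3) 1 2 3] show ?thesis by metis
  qed
  then obtain N where N: "N > 0" "?t ^ N - 1 \<in> ?I" by (rule torsion_of_prime_torsion[OF I nI n_pos])
  then show ?thesis using mobile_along_power_iff[OF \<tau>, of e N] by blast
qed

section \<open>Evaluating polynomials at monomials\<close>

definition map_eval :: "('a::comm_ring_1 \<Rightarrow> 'b::comm_ring_1) \<Rightarrow> 'b \<Rightarrow> 'a poly \<Rightarrow> 'b" where
  "map_eval h b f = poly (map_poly h f) b"

context
  fixes h :: "'a::comm_ring_1 \<Rightarrow> 'b::comm_ring_1"
  assumes h_add: "\<And>x y. h (x + y) = h x + h y" and h_mult: "\<And>x y. h (x * y) = h x * h y" and h_1: "h 1 = 1"
begin

lemma map_eval_h_0: "h 0 = 0"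
  using h_add[of 0 0] by simp

lemma map_eval_0: "map_eval h b 0 = 0"
  by (simp add: map_eval_def)

lemma map_eval_pCons: "map_eval h b (pCons a f) = h a + b * map_eval h b f"
  by (simp add: map_eval_def map_poly_pCons map_eval_h_0)

lemma map_eval_1: "map_eval h b 1 = 1"
  unfolding one_pCons by (simp add: map_eval_pCons map_eval_0 h_1)

lemma map_eval_add: "map_eval h b (f + g) = map_eval h b f + map_eval h b g"
  by (induction f g rule: poly_induct2) (simp_all add: map_eval_pCons map_eval_0 h_add algebra_simps)

lemma map_eval_smult: "map_eval h b (smult a f) = h a * map_eval h b f"
  by (induction f) (simp_all add: map_eval_pCons map_eval_0 h_mult algebra_simps)

lemma map_eval_mult: "map_eval h b (f * g) = map_eval h b f * map_eval h b g"
  by (induction f) (simp_all add: map_eval_pCons map_eval_0 map_eval_add map_eval_smult map_eval_h_0 algebra_simps)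

end

lemma of_int_add': "(of_int (x + y) :: 'b::comm_ring_1) = of_int x + of_int y"
  and of_int_mult': "(of_int (x * y) :: 'b::comm_ring_1) = of_int x * of_int y"
  and of_int_1': "(of_int 1 :: 'b::comm_ring_1) = 1"
  by simp_all

lemmas int_eval_hom = map_eval_add[of of_int, OF of_int_add' of_int_mult' of_int_1']
  map_eval_mult[of of_int, OF of_int_add' of_int_mult' of_int_1']
  map_eval_1[of of_int, OF of_int_add' of_int_mult' of_int_1']

lemmas int_eval_pCons = map_eval_pCons[of of_int, OF of_int_add' of_int_mult' of_int_1']

lemma lookup_of_int: "coef (of_int z :: 'e::comm_monoid_add \<Rightarrow>\<^sub>0 int) a = (if a = 0 then z else 0)"
proof -
  have nat: "coef (of_nat m :: 'e \<Rightarrow>\<^sub>0 int) a = (if a = 0 then int m else 0)" for m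
    by (induction m) (auto simp: lookup_add lookup_one)
  show ?thesis by (cases z rule: int_cases2) (simp_all add: nat lookup_uminus)
qed

lemma frag_torsion_free:
  fixes y :: "'e::comm_monoid_add \<Rightarrow>\<^sub>0 int"
  assumes "m > 0" "of_nat m * y = 0" shows "y = 0"
proof (rule poly_mapping_eqI)
  fix a
  have "int m * coef y a = coef (of_nat m * y) a" by (simp add: of_nat_mult_frag)
  then show "coef y a = coef 0 a" using assms by simp
qed

abbreviation eval1 :: "int poly \<Rightarrow> int \<Rightarrow>\<^sub>0 int" where
  "eval1 \<equiv> map_eval of_int (frag_of 1)"

abbreviation eval21 :: "int poly \<Rightarrow> int \<times> int \<Rightarrow>\<^sub>0 int" where
  "eval21 \<equiv> map_eval of_int (frag_of (1, 0))"

text \<open>The outer variable is \<open>y\<close>, so the polynomials in \<open>x\<close> alone are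
  the constants \<open>[:c:]\<close>, the shape in which \<open>extends_perp_UNIV\<close> delivers
  its multiplier.\<close>

abbreviation eval2 :: "int poly poly \<Rightarrow> int \<times> int \<Rightarrow>\<^sub>0 int" where
  "eval2 \<equiv> map_eval eval21 (frag_of (0, 1))"

lemmas eval2_hom = map_eval_add[of eval21, OF int_eval_hom] map_eval_mult[of eval21, OF int_eval_hom]
  map_eval_1[of eval21, OF int_eval_hom]

lemma lookup_eval1: "coef (eval1 s) k = (if k < 0 then 0 else coeff s (nat k))"
proof (induction s arbitrary: k)
  case 0
  then show ?case by (simp add: map_eval_def)
next
  case (pCons a s)
  have "nat k = Suc (nat (k - 1))" if "k > 0" using that by simp
  then show ?case
    by (auto simp: int_eval_pCons lookup_add lookup_of_int lookup_frag_of_mult pCons.IH coeff_pCons split: nat.splits)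
qed

lemma lookup_eval21: "coef (eval21 s) (i, j) = (if i < 0 \<or> j \<noteq> 0 then 0 else coeff s (nat i))"
proof (induction s arbitrary: i j)
  case 0
  then show ?case by (simp add: map_eval_def)
next
  case (pCons a s)
  have "nat i = Suc (nat (i - 1))" if "i > 0" using that by simp
  then show ?case
    by (auto simp: int_eval_pCons lookup_add lookup_of_int lookup_frag_of_mult pCons.IH coeff_pCons zero_prod_def split: nat.splits)
qed

lemma lookup_eval2: "coef (eval2 s) (i, j) = (if i < 0 \<or> j < 0 then 0 else coeff (coeff s (nat j)) (nat i))"
proof (induction s arbitrary: i j)
  case 0
  then show ?case by (simp add: map_eval_def)
next
  case (pCons a s)
  have "nat j = Suc (nat (j - 1))" if "j > 0" using that by simp
  then show ?case
    by (auto simp: map_eval_pCons[of eval21, OF int_eval_hom] lookup_add lookup_eval21 lookup_frag_of_mult pCons.IH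
        coeff_pCons split: nat.splits)
qed

lemma mod_functionals_eval1: "n > 0 \<Longrightarrow> mod_functionals n eval1"
proof
  fix J :: "int poly set" assume "n > 0" "is_ideal J" "of_nat n \<in> J"
  then show "\<exists>d d' s. n = d * d' \<and> content_free n s \<and> of_nat d * s \<in> J \<and> (\<forall>r\<in>J. of_nat d dvd r)"
    using ideal_content[OF primes_stay_prime_int, of J n] by metis
qed (auto simp: int_eval_hom primes_stay_prime_poly[OF primes_stay_prime_int] intro: frag_torsion_free)

lemma mod_functionals_2_eval2: "n > 0 \<Longrightarrow> mod_functionals_2 n eval2"
proof
  fix J :: "int poly poly set" assume "n > 0" "is_ideal J" "of_nat n \<in> J"
  then show "\<exists>d d' s. n = d * d' \<and> content_free n s \<and> of_nat d * s \<in> J \<and> (\<forall>r\<in>J. of_nat d dvd r)"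
    using ideal_content[OF primes_stay_prime_poly[OF primes_stay_prime_int], of J n] by metis
qed (auto simp: eval2_hom primes_stay_prime_poly[OF primes_stay_prime_poly[OF primes_stay_prime_int]] intro: frag_torsion_free)

lemma eval1_reflects: "of_nat n dvd eval1 s \<Longrightarrow> of_nat n dvd s"
  unfolding of_nat_dvd_frag_iff of_nat_dvd_poly_iff
proof
  fix i assume "\<forall>a. int n dvd coef (eval1 s) a"
  then show "coeff s i \<in> {c. of_nat n dvd c}" using lookup_eval1[of s "int i"] by (metis mem_Collect_eq nat_int of_nat_less_0_iff)
qed

lemma eval2_reflects: "of_nat n dvd eval2 s \<Longrightarrow> of_nat n dvd s"
proof -
  assume "of_nat n dvd eval2 s"
  then have "int n dvd coef (eval2 s) (int i, int j)" for i j unfolding of_nat_dvd_frag_iff by blast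
  then have "of_nat n dvd coeff (coeff s j) i" for i j by (simp add: lookup_eval2)
  then have "of_nat n dvd coeff s j" for j unfolding of_nat_dvd_poly_iff by simp
  then show ?thesis unfolding of_nat_dvd_poly_iff[of n s] by simp
qed

lemma eval1_monom: "k \<ge> 0 \<Longrightarrow> frag_of k \<in> range eval1"
proof (rule range_eqI)
  assume "k \<ge> 0"
  then show "frag_of k = eval1 (monom 1 (nat k))" by (intro poly_mapping_eqI) (auto simp: lookup_eval1)
qed

lemma eval2_monom: "i \<ge> 0 \<Longrightarrow> j \<ge> 0 \<Longrightarrow> frag_of (i, j) \<in> range eval2"
proof (rule range_eqI)
  assume ij: "i \<ge> 0" "j \<ge> 0"
  have "coef (frag_of (i, j)) (k, l) = coef (eval2 (monom (monom 1 (nat i)) (nat j))) (k, l)" for k l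
    using ij by (auto simp: lookup_eval2)
  then show "frag_of (i, j) = eval2 (monom (monom 1 (nat i)) (nat j))"
    by (intro poly_mapping_eqI) (metis surj_pair)
qed

lemma eval1_monomials: "finite E \<Longrightarrow> \<exists>c. \<forall>a\<in>E. frag_of (a + c) \<in> range eval1"
proof -
  assume E: "finite E"
  have "frag_of (a + (\<Sum>x\<in>E. \<bar>x\<bar>)) \<in> range eval1" if "a \<in> E" for a
  proof (rule eval1_monom)
    have "\<bar>a\<bar> \<le> (\<Sum>x\<in>E. \<bar>x\<bar>)" using member_le_sum[OF that, of "\<lambda>x. \<bar>x\<bar>"] E by simp
    then show "0 \<le> a + (\<Sum>x\<in>E. \<bar>x\<bar>)" by linarith
  qed
  then show ?thesis by blast
qed

lemma eval2_monomials: "finite E \<Longrightarrow> \<exists>c. \<forall>a\<in>E. frag_of (a + c) \<in> range eval2"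
proof -
  assume E: "finite E"
  let ?c = "(\<Sum>x\<in>E. \<bar>fst x\<bar>, \<Sum>x\<in>E. \<bar>snd x\<bar>)"
  have "frag_of (a + ?c) \<in> range eval2" if "a \<in> E" for a
  proof -
    have "\<bar>fst a\<bar> \<le> (\<Sum>x\<in>E. \<bar>fst x\<bar>)" "\<bar>snd a\<bar> \<le> (\<Sum>x\<in>E. \<bar>snd x\<bar>)"
      using member_le_sum[OF that, of "\<lambda>x. \<bar>fst x\<bar>"] member_le_sum[OF that, of "\<lambda>x. \<bar>snd x\<bar>"] E by simp_all
    then have "frag_of (fst a + (\<Sum>x\<in>E. \<bar>fst x\<bar>), snd a + (\<Sum>x\<in>E. \<bar>snd x\<bar>)) \<in> range eval2"
      by (intro eval2_monom) linarith+
    then show ?thesis by (cases a) simp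
  qed
  then show ?thesis by blast
qed

section \<open>Saturated codes\<close>

context code_functionals
begin

lemma range_\<theta>_if_keys: "(\<And>a. a \<in> Poly_Mapping.keys y \<Longrightarrow> frag_of a \<in> range \<theta>) \<Longrightarrow> y \<in> range \<theta>"
proof -
  assume "\<And>a. a \<in> Poly_Mapping.keys y \<Longrightarrow> frag_of a \<in> range \<theta>"
  then have "Poly_Mapping.keys y \<subseteq> {a. frag_of a \<in> range \<theta>}" by blast
  then show ?thesis
  proof (induction y rule: frag_induction)
    case zero
    show ?case using F.hom_0 by (metis rangeI)
  next
    case (diff a b)
    then obtain u v where "a = \<theta> u" "b = \<theta> v" by blast
    then have "a - b = \<theta> (u - v)" by (simp add: F.hom_diff)
    then show ?case by blast
  qed simp
qed

lemma form_ext_shift_right_apply: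
  assumes "l \<in> carrier P" "m \<in> carrier P" "h \<in> carrier \<Lambda>" "g \<in> carrier \<Lambda>"
  shows "form l (shift h m) g = form l m (inv\<^bsub>\<Lambda>\<^esub> h \<otimes>\<^bsub>\<Lambda>\<^esub> g)"
  using gmonom_mult_apply[OF R_apply_closed[OF form_R_closed[OF assms(1,2)]] assms(3,4)] assms
  by (simp add: form_ext_shift_right)

lemma orth_iff:
  "m \<in> orth n \<Lambda> P\<^sub>0 \<omega>\<^sub>0 N \<longleftrightarrow> m \<in> carrier P \<and> (\<forall>l\<in>N. form l m = \<zero>\<^bsub>R\<^esub>)"
  by (simp add: orth_def)

lemma form_eq_0_iff:
  assumes "l \<in> carrier P" "m \<in> carrier P"
  shows "form l m = \<zero>\<^bsub>R\<^esub> \<longleftrightarrow> (\<forall>g\<in>carrier \<Lambda>. form l m g = \<zero>\<^bsub>K\<^esub>)"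
proof -
  interpret R: cring R by (rule R_cring)
  show ?thesis
  proof
    assume "\<forall>g\<in>carrier \<Lambda>. form l m g = \<zero>\<^bsub>K\<^esub>"
    then show "form l m = \<zero>\<^bsub>R\<^esub>"
      by (intro R_eqI form_R_closed assms R.zero_closed) (simp add: R_sel)
  qed (simp add: R_sel)
qed

text \<open>The elements orthogonal to \<open>L\<close> reappear as vectors \<open>h\<close> in the
  orthogonal of \<open>V\<close>: the entries of \<open>h\<close> lift the pairings of the
  generators with \<open>m\<close>. The exponent \<open>\<beta>\<close> records the translation
  needed to make these entries polynomial.\<close>

lemma orth_L_functional:
  assumes m: "m \<in> orth n \<Lambda> P\<^sub>0 \<omega>\<^sub>0 L"
  obtains h \<beta> where "h \<in> perp n Ix V"
    "\<And>v. form (proj (\<lambda>i. \<theta> (v i))) m \<one>\<^bsub>\<Lambda>\<^esub> = cls (coef (\<theta> (dot Ix v h)) \<beta>)"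
proof -
  have mP: "m \<in> carrier P" and mL: "\<And>l. l \<in> L \<Longrightarrow> form l m = \<zero>\<^bsub>R\<^esub>" using m by (auto simp: orth_iff)
  let ?E = "al ` gsupp \<Lambda> P\<^sub>0 m"
  obtain \<beta> where \<beta>: "\<forall>a\<in>?E. frag_of (a + \<beta>) \<in> range \<theta>" using monomials[of ?E] P_finite[OF mP] by blast
  \<comment> \<open>Translation by \<open>\<tau> \<beta>\<close> adds \<open>\<beta>\<close> to
    every exponent in the support of \<open>m\<close>, after which all occurring monomials lie in
    the image of \<open>\<theta>\<close>.\<close>
  define m' where "m' = shift (\<tau> \<beta>) m"
  have m'P: "m' \<in> carrier P" unfolding m'_def by (rule shift_closed[OF mP \<tau>_closed])
  have form_m': "form l m' g = form l m (inv\<^bsub>\<Lambda>\<^esub> (\<tau> \<beta>) \<otimes>\<^bsub>\<Lambda>\<^esub> g)" if "l \<in> carrier P" "g \<in> carrier \<Lambda>" for l g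
    unfolding m'_def by (rule form_ext_shift_right_apply[OF that(1) mP \<tau>_closed that(2)])
  define y where "y = (\<lambda>(b, c). Abs_poly_mapping (\<lambda>a. rep (\<omega>\<^sub>0 b (m' (c \<otimes>\<^bsub>\<Lambda>\<^esub> \<tau> a)))))"
  have nz: "a - \<beta> \<in> ?E" if b: "b \<in> carrier P\<^sub>0" and c: "c \<in> C" and ne: "rep (\<omega>\<^sub>0 b (m' (c \<otimes>\<^bsub>\<Lambda>\<^esub> \<tau> a))) \<noteq> 0" for a b c
  proof -
    have cG: "c \<in> carrier \<Lambda>" by (rule C_facts(1)[OF c])
    have "inv\<^bsub>\<Lambda>\<^esub> (\<tau> \<beta>) \<otimes>\<^bsub>\<Lambda>\<^esub> \<tau> a = \<tau> (a - \<beta>)" by (simp flip: \<tau>_minus \<tau>_add)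
    then have "inv\<^bsub>\<Lambda>\<^esub> (\<tau> \<beta>) \<otimes>\<^bsub>\<Lambda>\<^esub> (c \<otimes>\<^bsub>\<Lambda>\<^esub> \<tau> a) = c \<otimes>\<^bsub>\<Lambda>\<^esub> \<tau> (a - \<beta>)"
      using \<Lambda>.m_lcomm[OF \<Lambda>.inv_closed[OF \<tau>_closed] cG \<tau>_closed] by simp
    then have eq: "m' (c \<otimes>\<^bsub>\<Lambda>\<^esub> \<tau> a) = m (c \<otimes>\<^bsub>\<Lambda>\<^esub> \<tau> (a - \<beta>))"
      unfolding m'_def shift_def using cG \<tau>_closed by simp
    have "\<omega>\<^sub>0 b \<zero>\<^bsub>P\<^sub>0\<^esub> = \<zero>\<^bsub>K\<^esub>" using form_skew[OF b P\<^sub>0.zero_closed] form_0_left[OF b] by simp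
    then have "m (c \<otimes>\<^bsub>\<Lambda>\<^esub> \<tau> (a - \<beta>)) \<noteq> \<zero>\<^bsub>P\<^sub>0\<^esub>" using ne unfolding eq by (auto simp: ZRep_0)
    then have "c \<otimes>\<^bsub>\<Lambda>\<^esub> \<tau> (a - \<beta>) \<in> gsupp \<Lambda> P\<^sub>0 m" using cG \<tau>_closed by (simp add: gsupp_def)
    then have "al (c \<otimes>\<^bsub>\<Lambda>\<^esub> \<tau> (a - \<beta>)) \<in> ?E" by (rule imageI)
    then show ?thesis using al_shift[OF cG, of "a - \<beta>"] C_facts(3)[OF c] by simp
  qed
  have coef_y: "coef (y (b, c)) a = rep (\<omega>\<^sub>0 b (m' (c \<otimes>\<^bsub>\<Lambda>\<^esub> \<tau> a)))" if "b \<in> carrier P\<^sub>0" "c \<in> C" for a b c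
  proof -
    have "{a. rep (\<omega>\<^sub>0 b (m' (c \<otimes>\<^bsub>\<Lambda>\<^esub> \<tau> a))) \<noteq> 0} \<subseteq> (\<lambda>e. e + \<beta>) ` ?E"
    proof
      fix a assume "a \<in> {a. rep (\<omega>\<^sub>0 b (m' (c \<otimes>\<^bsub>\<Lambda>\<^esub> \<tau> a))) \<noteq> 0}"
      then have "a - \<beta> \<in> ?E" using nz[OF that] by blast
      from imageI[OF this, of "\<lambda>e. e + \<beta>"] show "a \<in> (\<lambda>e. e + \<beta>) ` ?E" by simp
    qed
    then have "finite {a. rep (\<omega>\<^sub>0 b (m' (c \<otimes>\<^bsub>\<Lambda>\<^esub> \<tau> a))) \<noteq> 0}"
      using P_finite[OF mP] by (meson finite_imageI finite_subset)
    then show ?thesis unfolding y_def by (simp add: lookup_Abs_poly_mapping)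
  qed
  have "\<exists>u. \<theta> u = y i" if i: "i \<in> Ix" for i
  proof -
    obtain b c where bc: "i = (b, c)" "b \<in> carrier P\<^sub>0" "c \<in> C" using i by (auto simp: Ix_def)
    have "y i \<in> range \<theta>"
    proof (rule range_\<theta>_if_keys)
      fix a assume "a \<in> Poly_Mapping.keys (y i)"
      then have "a - \<beta> \<in> ?E" using nz[OF bc(2,3)] coef_y[OF bc(2,3)] by (simp add: in_keys_iff bc(1))
      then have "frag_of (a - \<beta> + \<beta>) \<in> range \<theta>" using \<beta> by blast
      then show "frag_of a \<in> range \<theta>" by simp
    qed
    then show ?thesis by auto
  qed
  then obtain h where h: "\<And>i. i \<in> Ix \<Longrightarrow> \<theta> (h i) = y i" by metis
  have \<theta>_sum: "\<theta> (sum u A) = (\<Sum>i\<in>A. \<theta> (u i))" for u :: "'p \<times> 'l \<Rightarrow> 'u" and A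
    by (induction A rule: infinite_finite_induct) (simp_all add: F.hom_0 F.hom_add)
  have \<theta>_dot: "dot Ix (\<lambda>i. \<theta> (v i)) y = \<theta> (dot Ix v h)" for v
    unfolding dot_def \<theta>_sum by (rule sum.cong) (simp_all add: F.hom_mult h)
  have yh: "cls (coef (y (b, cr \<kappa>)) (al \<kappa>)) = \<omega>\<^sub>0 b (m' \<kappa>)" if b: "b \<in> carrier P\<^sub>0" and \<kappa>: "\<kappa> \<in> carrier \<Lambda>" for b \<kappa>
  proof -
    have "cr \<kappa> \<in> C" using \<kappa> by (simp add: C_def)
    then have "coef (y (b, cr \<kappa>)) (al \<kappa>) = rep (\<omega>\<^sub>0 b (m' \<kappa>))" using coef_y[OF b] cr_al[OF \<kappa>] by simp
    then show ?thesis by (simp add: ZMod_ZRep form_closed b P_apply[OF m'P \<kappa>])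
  qed
  have form_dot: "form (proj (\<lambda>i. \<theta> (v i))) m' (\<tau> a) = cls (coef (\<theta> (dot Ix v h)) a)" for v a
    using form_proj[OF m'P yh, of "\<lambda>i. \<theta> (v i)" a] by (simp only: \<theta>_dot)
  have "h \<in> perp n Ix V"
    unfolding perp_def
  proof (intro CollectI ballI)
    fix v assume "v \<in> V"
    then have l: "proj (\<lambda>i. \<theta> (v i)) \<in> L" by (simp add: V_def)
    have "int n dvd coef (\<theta> (dot Ix v h)) a" for a
    proof -
      have "form (proj (\<lambda>i. \<theta> (v i))) m (inv\<^bsub>\<Lambda>\<^esub> (\<tau> \<beta>) \<otimes>\<^bsub>\<Lambda>\<^esub> \<tau> a) = \<zero>\<^bsub>K\<^esub>"
        using mL[OF l] \<tau>_closed by (simp add: R_sel)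
      then have "form (proj (\<lambda>i. \<theta> (v i))) m' (\<tau> a) = \<zero>\<^bsub>K\<^esub>" using form_m'[OF proj_closed \<tau>_closed] by simp
      then show ?thesis unfolding form_dot ZMod_eq_0_iff .
    qed
    then have "of_nat n dvd \<theta> (dot Ix v h)" unfolding of_nat_dvd_frag_iff by blast
    then show "of_nat n dvd dot Ix h v" unfolding dot_commute[of Ix h v] by (rule reflects)
  qed
  moreover have "form (proj (\<lambda>i. \<theta> (v i))) m \<one>\<^bsub>\<Lambda>\<^esub> = cls (coef (\<theta> (dot Ix v h)) \<beta>)" for v
    using form_m'[OF proj_closed \<tau>_closed[of \<beta>], of "\<lambda>i. \<theta> (v i)"] \<tau>_closed[of \<beta>] unfolding form_dot by simp
  ultimately show ?thesis by (rule that)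
qed

text \<open>Saturation transported to the free module. A vector of the double orthogonal has a
  projection orthogonal to everything orthogonal to \<open>L\<close>, by
  \<open>orth_L_functional\<close>, so this projection lies in \<open>L\<close>. The two orthogonals
  put their arguments on opposite sides of the form, which \<open>form_ext_skew\<close>
  reconciles.\<close>

lemma perp_perp_V:
  assumes sat: "saturated n \<Lambda> P\<^sub>0 \<omega>\<^sub>0 L"
  shows "perp n Ix (perp n Ix V) = V"
proof
  show "V \<subseteq> perp n Ix (perp n Ix V)"
  proof
    fix v assume v: "v \<in> V"
    have "of_nat n dvd dot Ix v h" if "h \<in> perp n Ix V" for h
      using that v unfolding perp_def dot_commute[of Ix v h] by blast
    then show "v \<in> perp n Ix (perp n Ix V)" unfolding perp_def[of n Ix "perp n Ix V"] by blast
  qed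
  show "perp n Ix (perp n Ix V) \<subseteq> V"
  proof
    fix w assume w: "w \<in> perp n Ix (perp n Ix V)"
    let ?l = "proj (\<lambda>i. \<theta> (w i))"
    have "form m ?l = \<zero>\<^bsub>R\<^esub>" if m: "m \<in> orth n \<Lambda> P\<^sub>0 \<omega>\<^sub>0 L" for m
    proof -
      have mP: "m \<in> carrier P" using m by (simp add: orth_iff)
      have "form ?l m g = \<zero>\<^bsub>K\<^esub>" if g: "g \<in> carrier \<Lambda>" for g
      proof -
        \<comment> \<open>\<open>orth_L_functional\<close> reads the form at the identity only;
          translating \<open>m\<close> moves the coefficient at \<open>g\<close> there and keeps it
          orthogonal to \<open>L\<close>.\<close>
        let ?m = "shift (inv\<^bsub>\<Lambda>\<^esub> g) m"
        have "?m \<in> orth n \<Lambda> P\<^sub>0 \<omega>\<^sub>0 L"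
          unfolding orth_iff
        proof (intro conjI ballI)
          show mc: "?m \<in> carrier P" using shift_closed[OF mP] g by simp
          fix l assume l: "l \<in> L"
          then have lP: "l \<in> carrier P" using L_subset by blast
          have "form l m = \<zero>\<^bsub>R\<^esub>" using m l by (simp add: orth_iff)
          then show "form l ?m = \<zero>\<^bsub>R\<^esub>"
            unfolding form_eq_0_iff[OF lP mc] using form_ext_shift_right_apply[OF lP mP \<Lambda>.inv_closed[OF g]] g by (simp add: R_sel)
        qed
        then obtain h \<beta> where h: "h \<in> perp n Ix V"
            "form ?l ?m \<one>\<^bsub>\<Lambda>\<^esub> = cls (coef (\<theta> (dot Ix w h)) \<beta>)"
          by (rule orth_L_functional) blast
        have "of_nat n dvd dot Ix w h" using w h(1) unfolding perp_def[of n Ix "perp n Ix V"] by blast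
        then have "of_nat n dvd \<theta> (dot Ix w h)" by (metis F.hom_mult F.hom_of_nat dvd_def)
        then have "form ?l ?m \<one>\<^bsub>\<Lambda>\<^esub> = \<zero>\<^bsub>K\<^esub>" unfolding h(2) ZMod_eq_0_iff of_nat_dvd_frag_iff by blast
        then show ?thesis using form_ext_shift_right_apply[OF proj_closed mP \<Lambda>.inv_closed[OF g] \<Lambda>.one_closed] g by simp
      qed
      then show ?thesis
        unfolding form_eq_0_iff[OF mP proj_closed] using form_ext_skew[OF mP proj_closed] by simp
    qed
    then have "?l \<in> orth n \<Lambda> P\<^sub>0 \<omega>\<^sub>0 (orth n \<Lambda> P\<^sub>0 \<omega>\<^sub>0 L)" unfolding orth_iff[of ?l] using proj_closed by blast
    then show "w \<in> V" using sat by (simp add: saturated_def V_def)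
  qed
qed

end

section \<open>Lattices of rank one and two\<close>

lemma (in comm_group) subgroup_power_combination:
  assumes \<Gamma>: "subgroup \<Gamma> G" and x: "x \<in> carrier G" "x [^] (M::nat) \<in> \<Gamma>"
    and y: "y \<in> carrier G" "y [^] (M'::nat) \<in> \<Gamma>"
  shows "(x [^] (i::int) \<otimes> y [^] (j::int)) [^] (M * M') \<in> \<Gamma>"
proof -
  interpret \<Gamma>: subgroup \<Gamma> G by (rule \<Gamma>)
  have closed: "z [^] (k::int) \<in> \<Gamma>" if "z \<in> \<Gamma>" for z k
    using subgroup_int_pow_closed[OF \<Gamma> that] .
  have "(x [^] i \<otimes> y [^] j) [^] int (M * M') = (x [^] i) [^] int (M * M') \<otimes> (y [^] j) [^] int (M * M')"
    using x y by (simp add: int_pow_distrib)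
  also have "(x [^] i) [^] int (M * M') = (x [^] int M) [^] (i * int M')"
    using x by (simp add: int_pow_pow mult_ac)
  also have "(y [^] j) [^] int (M * M') = (y [^] int M') [^] (j * int M)"
    using y by (simp add: int_pow_pow mult_ac)
  finally have "(x [^] i \<otimes> y [^] j) [^] int (M * M') = (x [^] int M) [^] (i * int M') \<otimes> (y [^] int M') [^] (j * int M)" .
  moreover have "(x [^] int M) [^] (i * int M') \<otimes> (y [^] int M') [^] (j * int M) \<in> \<Gamma>"
    using closed x y by (simp add: int_pow_int)
  ultimately show ?thesis by (simp only: int_pow_int)
qed

lemma (in comm_group) exponent_map_powers:
  assumes "x \<in> carrier G" "y \<in> carrier G"
  shows "exponent_map G (\<lambda>(i, j). x [^] (i::int) \<otimes> y [^] (j::int))"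
    and "exponent_map G (\<lambda>i::int. x [^] i)"
  using assms by (auto simp: exponent_map_def int_pow_mult zero_prod_def m_ac)

lemma (in comm_group) nat_power_combination:
  assumes g: "g \<in> carrier G" and x: "x \<in> carrier G" "y \<in> carrier G"
    and c: "c \<noteq> (0::int)" "g [^] c = x [^] (i::int) \<otimes> y [^] (j::int)"
  shows "\<exists>N>0. \<exists>i j. g [^] (N::nat) = x [^] (i::int) \<otimes> y [^] (j::int)"
proof -
  have "int (nat \<bar>c\<bar>) = c * sgn c" by (simp flip: abs_sgn)
  then have "g [^] nat \<bar>c\<bar> = g [^] (c * sgn c)" by (simp only: int_pow_int[symmetric])
  also have "\<dots> = (g [^] c) [^] sgn c" using g by (simp add: int_pow_pow)
  also have "\<dots> = x [^] (i * sgn c) \<otimes> y [^] (j * sgn c)" using x by (simp add: c(2) int_pow_distrib int_pow_pow)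
  finally show ?thesis using c(1) by (intro exI[of _ "nat \<bar>c\<bar>"]) auto
qed

context stabilizer_code
begin

text \<open>If \<open>M\<close> and \<open>M'\<close> are mobile exponents of \<open>t\<close> and
  \<open>u\<close>, then \<open>M * M'\<close> is one for every product of their powers. Rank one is
  included by taking the identity for \<open>u\<close>.\<close>

lemma all_mobile_if_spanned:
  assumes t: "t \<in> carrier \<Lambda>" "M > 0" "mobile_along (t [^]\<^bsub>\<Lambda>\<^esub> (M::nat))"
    and u: "u \<in> carrier \<Lambda>" "M' > 0" "mobile_along (u [^]\<^bsub>\<Lambda>\<^esub> (M'::nat))"
    and span: "\<And>g. g \<in> carrier \<Lambda> \<Longrightarrow>
      \<exists>N>0. \<exists>i j. g [^]\<^bsub>\<Lambda>\<^esub> (N::nat) = t [^]\<^bsub>\<Lambda>\<^esub> (i::int) \<otimes>\<^bsub>\<Lambda>\<^esub> u [^]\<^bsub>\<Lambda>\<^esub> (j::int)"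
  shows "all_mobile n \<Lambda> P\<^sub>0 \<omega>\<^sub>0 L"
  unfolding all_mobile_iff_torsion
proof
  fix g assume g: "g \<in> carrier \<Lambda>"
  obtain N i j where N: "N > 0" "g [^]\<^bsub>\<Lambda>\<^esub> (N::nat) = t [^]\<^bsub>\<Lambda>\<^esub> (i::int) \<otimes>\<^bsub>\<Lambda>\<^esub> u [^]\<^bsub>\<Lambda>\<^esub> (j::int)"
    using span[OF g] by blast
  have "g [^]\<^bsub>\<Lambda>\<^esub> (N * (M * M')) = (t [^]\<^bsub>\<Lambda>\<^esub> i \<otimes>\<^bsub>\<Lambda>\<^esub> u [^]\<^bsub>\<Lambda>\<^esub> j) [^]\<^bsub>\<Lambda>\<^esub> (M * M')"
    using g by (simp add: \<Lambda>.nat_pow_pow[symmetric] N(2))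
  also have "\<dots> \<in> {g \<in> carrier \<Lambda>. mobile_along g}"
    by (rule \<Lambda>.subgroup_power_combination[OF mobile_subgroup]) (use t u in auto)
  finally show "\<exists>N>0. mobile_along (g [^]\<^bsub>\<Lambda>\<^esub> (N::nat))"
    using N(1) t(2) u(2) by (intro exI[of _ "N * (M * M')"]) simp
qed

text \<open>With a single generator \<open>t\<close> the multiplier from freeing coordinates is
  already a polynomial in \<open>t\<close> alone.\<close>

lemma all_mobile_rank_1:
  assumes rk: "free_rank \<Lambda> = 1"
  shows "all_mobile n \<Lambda> P\<^sub>0 \<omega>\<^sub>0 L"
proof -
  have "free_rank \<Lambda> = enat 1" using rk by (simp add: one_enat_def)
  then obtain B where B: "int_independent \<Lambda> B" "card B = 1"
      "\<forall>g\<in>carrier \<Lambda>. \<exists>c :: int. \<exists>k :: 'l \<Rightarrow> int. c \<noteq> 0 \<and> g [^]\<^bsub>\<Lambda>\<^esub> c = (\<Otimes>\<^bsub>\<Lambda>\<^esub>b\<in>B. b [^]\<^bsub>\<Lambda>\<^esub> k b)"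
    by (rule \<Lambda>.free_rank_basis)
  obtain t where Bt: "B = {t}" using B(2) by (rule card_1_singletonE)
  have t: "t \<in> carrier \<Lambda>" using B(1) by (simp add: int_independent_def Bt)
  have prod: "(\<Otimes>\<^bsub>\<Lambda>\<^esub>b\<in>B. b [^]\<^bsub>\<Lambda>\<^esub> k b) = t [^]\<^bsub>\<Lambda>\<^esub> k t" for k :: "'l \<Rightarrow> int"
    unfolding Bt using t by (simp add: \<Lambda>.finprod_insert)
  have span: "\<exists>N>0. \<exists>i j. g [^]\<^bsub>\<Lambda>\<^esub> (N::nat) = t [^]\<^bsub>\<Lambda>\<^esub> (i::int) \<otimes>\<^bsub>\<Lambda>\<^esub> \<one>\<^bsub>\<Lambda>\<^esub> [^]\<^bsub>\<Lambda>\<^esub> (j::int)"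
    if g: "g \<in> carrier \<Lambda>" for g
  proof -
    obtain c :: int and k :: "'l \<Rightarrow> int" where c: "c \<noteq> 0" "g [^]\<^bsub>\<Lambda>\<^esub> c = t [^]\<^bsub>\<Lambda>\<^esub> k t"
      using B(3) g unfolding prod by blast
    have "g [^]\<^bsub>\<Lambda>\<^esub> c = t [^]\<^bsub>\<Lambda>\<^esub> k t \<otimes>\<^bsub>\<Lambda>\<^esub> \<one>\<^bsub>\<Lambda>\<^esub> [^]\<^bsub>\<Lambda>\<^esub> (0::int)" using c(2) t by simp
    from \<Lambda>.nat_power_combination[OF g t \<Lambda>.one_closed c(1) this] show ?thesis .
  qed
  let ?\<tau> = "\<lambda>i::int. t [^]\<^bsub>\<Lambda>\<^esub> i"
  have \<tau>: "exponent_map \<Lambda> ?\<tau>" by (rule \<Lambda>.exponent_map_powers(2)[OF t t])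
  interpret F: mod_functionals n eval1 by (rule mod_functionals_eval1[OF n_pos])
  interpret CF: code_functionals n \<Lambda> P\<^sub>0 \<omega>\<^sub>0 L eval1 ?\<tau>
  proof (intro code_functionals.intro code_functionals_axioms.intro)
    show "stabilizer_code n \<Lambda> P\<^sub>0 \<omega>\<^sub>0 L" by (rule stabilizer_code_axioms)
    show "mod_functionals n eval1" by (rule F.mod_functionals_axioms)
    show "exponent_map \<Lambda> ?\<tau>" by (rule \<tau>)
    show "a = 0" if "t [^]\<^bsub>\<Lambda>\<^esub> a = \<one>\<^bsub>\<Lambda>\<^esub>" for a :: int
      using B(1) that prod[of "\<lambda>_. a"] unfolding int_independent_def by (auto simp: Bt)
    show "\<exists>N>0. \<exists>a::int. g [^]\<^bsub>\<Lambda>\<^esub> (N::nat) = t [^]\<^bsub>\<Lambda>\<^esub> a" if "g \<in> carrier \<Lambda>" for g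
      using span[OF that] t by simp
    show "\<exists>c. \<forall>a\<in>E. frag_of (a + c) \<in> range eval1" if "finite E" for E by (rule eval1_monomials[OF that])
    show "of_nat n dvd u" if "of_nat n dvd eval1 u" for u by (rule eval1_reflects[OF that])
  qed
  obtain s where s: "content_free n s" "F.extends CF.V UNIV s"
    by (rule F.extends_UNIV[OF CF.submod_V CF.n_multiple_mem_V CF.finite_Ix CF.off_Ix_mem_V])
  have "gmap ?\<tau> (eval1 s) \<in> Ann" by (rule CF.gmap_mem_Ann_if_extends[OF s(2)])
  then have "\<exists>N>0. mobile_along ((t [^]\<^bsub>\<Lambda>\<^esub> (1::int)) [^]\<^bsub>\<Lambda>\<^esub> (N::nat))"
    unfolding map_eval_def by (rule mobile_along_if_poly[OF \<tau> s(1)])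
  then obtain N where N: "N > 0" "mobile_along (t [^]\<^bsub>\<Lambda>\<^esub> (N::nat))" using t by auto
  have one: "mobile_along (\<one>\<^bsub>\<Lambda>\<^esub> [^]\<^bsub>\<Lambda>\<^esub> (1::nat))" using subgroup.one_closed[OF mobile_subgroup] by simp
  show ?thesis by (rule all_mobile_if_spanned[OF t N \<Lambda>.one_closed zero_less_one one span])
qed

text \<open>By \<open>perp_perp_V\<close> the module \<open>V\<close> is itself an orthogonal, hence
  a solution set of congruences, so the multiplier can be taken constant in the outer variable
  \<open>u\<close>. It is then a content-free polynomial in \<open>t\<close> that annihilates the
  excitations.\<close>

lemma mobile_along_rank_2:
  assumes sat: "saturated n \<Lambda> P\<^sub>0 \<omega>\<^sub>0 L" and t: "t \<in> carrier \<Lambda>" and u: "u \<in> carrier \<Lambda>"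
    and indep: "\<And>(i::int) (j::int). t [^]\<^bsub>\<Lambda>\<^esub> i \<otimes>\<^bsub>\<Lambda>\<^esub> u [^]\<^bsub>\<Lambda>\<^esub> j = \<one>\<^bsub>\<Lambda>\<^esub> \<Longrightarrow> i = 0 \<and> j = 0"
    and span: "\<And>g. g \<in> carrier \<Lambda> \<Longrightarrow>
      \<exists>N>0. \<exists>i j. g [^]\<^bsub>\<Lambda>\<^esub> (N::nat) = t [^]\<^bsub>\<Lambda>\<^esub> (i::int) \<otimes>\<^bsub>\<Lambda>\<^esub> u [^]\<^bsub>\<Lambda>\<^esub> (j::int)"
  obtains N where "N > 0" "mobile_along (t [^]\<^bsub>\<Lambda>\<^esub> (N::nat))"
proof -
  define \<tau> where "\<tau> = (\<lambda>(i::int, j::int). t [^]\<^bsub>\<Lambda>\<^esub> i \<otimes>\<^bsub>\<Lambda>\<^esub> u [^]\<^bsub>\<Lambda>\<^esub> j)"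
  have \<tau>: "exponent_map \<Lambda> \<tau>" unfolding \<tau>_def by (rule \<Lambda>.exponent_map_powers(1)[OF t u])
  interpret F: mod_functionals_2 n eval2 by (rule mod_functionals_2_eval2[OF n_pos])
  interpret CF: code_functionals n \<Lambda> P\<^sub>0 \<omega>\<^sub>0 L eval2 \<tau>
  proof (intro code_functionals.intro code_functionals_axioms.intro)
    show "stabilizer_code n \<Lambda> P\<^sub>0 \<omega>\<^sub>0 L" by (rule stabilizer_code_axioms)
    show "mod_functionals n eval2" by (rule F.mod_functionals_axioms)
    show "exponent_map \<Lambda> \<tau>" by (rule \<tau>)
    show "a = 0" if "\<tau> a = \<one>\<^bsub>\<Lambda>\<^esub>" for a :: "int \<times> int"
      using that indep[of "fst a" "snd a"] by (simp add: \<tau>_def case_prod_unfold zero_prod_def prod_eq_iff)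
    show "\<exists>N>0. \<exists>a. g [^]\<^bsub>\<Lambda>\<^esub> (N::nat) = \<tau> a" if "g \<in> carrier \<Lambda>" for g
    proof -
      have "\<exists>N>0. \<exists>i j. g [^]\<^bsub>\<Lambda>\<^esub> (N::nat) = \<tau> (i, j)" unfolding \<tau>_def prod.case by (rule span[OF that])
      then show ?thesis by blast
    qed
    show "\<exists>c. \<forall>a\<in>E. frag_of (a + c) \<in> range eval2" if "finite E" for E by (rule eval2_monomials[OF that])
    show "of_nat n dvd u" if "of_nat n dvd eval2 u" for u by (rule eval2_reflects[OF that])
  qed
  obtain c where c: "content_free n c" "F.extends (perp n CF.Ix (perp n CF.Ix CF.V)) UNIV [:c:]"
    by (rule F.extends_perp_UNIV[OF CF.finite_Ix submod_perp n_multiple_mem_perp])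
  have "gmap \<tau> (eval2 [:c:]) \<in> Ann"
    by (rule CF.gmap_mem_Ann_if_extends) (use c(2) in \<open>simp only: CF.perp_perp_V[OF sat]\<close>)
  moreover have "eval2 [:c:] = eval21 c"
    by (simp add: map_eval_pCons[of eval21, OF int_eval_hom] map_eval_def[of _ _ 0])
  ultimately have "gmap \<tau> (poly (map_poly of_int c) (frag_of (1, 0))) \<in> Ann" by (simp add: map_eval_def)
  then have "\<exists>N>0. mobile_along (\<tau> (1, 0) [^]\<^bsub>\<Lambda>\<^esub> (N::nat))" by (rule mobile_along_if_poly[OF \<tau> c(1)])
  then show ?thesis using that t by (auto simp: \<tau>_def)
qed

lemma all_mobile_rank_2:
  assumes sat: "saturated n \<Lambda> P\<^sub>0 \<omega>\<^sub>0 L" and rk: "free_rank \<Lambda> = 2"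
  shows "all_mobile n \<Lambda> P\<^sub>0 \<omega>\<^sub>0 L"
proof -
  have "free_rank \<Lambda> = enat 2" using rk by (simp add: numeral_eq_enat)
  then obtain B where B: "int_independent \<Lambda> B" "card B = 2"
      "\<forall>g\<in>carrier \<Lambda>. \<exists>c :: int. \<exists>k :: 'l \<Rightarrow> int. c \<noteq> 0 \<and> g [^]\<^bsub>\<Lambda>\<^esub> c = (\<Otimes>\<^bsub>\<Lambda>\<^esub>b\<in>B. b [^]\<^bsub>\<Lambda>\<^esub> k b)"
    by (rule \<Lambda>.free_rank_basis)
  obtain t u where Btu: "B = {t, u}" "t \<noteq> u" using B(2) by (auto simp: card_2_iff)
  have t: "t \<in> carrier \<Lambda>" and u: "u \<in> carrier \<Lambda>" using B(1) by (simp_all add: int_independent_def Btu)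
  have prod: "(\<Otimes>\<^bsub>\<Lambda>\<^esub>b\<in>B. b [^]\<^bsub>\<Lambda>\<^esub> k b) = t [^]\<^bsub>\<Lambda>\<^esub> k t \<otimes>\<^bsub>\<Lambda>\<^esub> u [^]\<^bsub>\<Lambda>\<^esub> k u" for k :: "'l \<Rightarrow> int"
    unfolding Btu(1) using t u Btu(2) by (simp add: \<Lambda>.finprod_insert)
  have span: "\<exists>N>0. \<exists>i j. g [^]\<^bsub>\<Lambda>\<^esub> (N::nat) = t [^]\<^bsub>\<Lambda>\<^esub> (i::int) \<otimes>\<^bsub>\<Lambda>\<^esub> u [^]\<^bsub>\<Lambda>\<^esub> (j::int)"
    if g: "g \<in> carrier \<Lambda>" for g
  proof -
    obtain c :: int and k :: "'l \<Rightarrow> int" where "c \<noteq> 0" "g [^]\<^bsub>\<Lambda>\<^esub> c = t [^]\<^bsub>\<Lambda>\<^esub> k t \<otimes>\<^bsub>\<Lambda>\<^esub> u [^]\<^bsub>\<Lambda>\<^esub> k u"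
      using B(3) g unfolding prod by blast
    then show ?thesis by (rule \<Lambda>.nat_power_combination[OF g t u])
  qed
  have indep: "i = 0 \<and> j = 0" if "t [^]\<^bsub>\<Lambda>\<^esub> i \<otimes>\<^bsub>\<Lambda>\<^esub> u [^]\<^bsub>\<Lambda>\<^esub> j = \<one>\<^bsub>\<Lambda>\<^esub>" for i j :: int
  proof -
    define k where "k b = (if b = t then i else j)" for b
    have "(\<Otimes>\<^bsub>\<Lambda>\<^esub>b\<in>B. b [^]\<^bsub>\<Lambda>\<^esub> k b) = \<one>\<^bsub>\<Lambda>\<^esub>" unfolding prod using that Btu(2) by (simp add: k_def)
    then have "\<forall>b\<in>B. k b = 0" using B(1) unfolding int_independent_def by blast
    then show ?thesis using Btu by (simp add: k_def)
  qed
  obtain M where M: "M > 0" "mobile_along (t [^]\<^bsub>\<Lambda>\<^esub> (M::nat))"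
    by (rule mobile_along_rank_2[OF sat t u indep span])
  have swap: "t [^]\<^bsub>\<Lambda>\<^esub> i \<otimes>\<^bsub>\<Lambda>\<^esub> u [^]\<^bsub>\<Lambda>\<^esub> j = u [^]\<^bsub>\<Lambda>\<^esub> j \<otimes>\<^bsub>\<Lambda>\<^esub> t [^]\<^bsub>\<Lambda>\<^esub> i" for i j :: int
    using t u by (simp add: \<Lambda>.m_comm)
  \<comment> \<open>The same argument with \<open>u\<close> as the inner variable; the hypotheses on
    \<open>t\<close> and \<open>u\<close> are symmetric up to commutation.\<close>
  obtain M' where M': "M' > 0" "mobile_along (u [^]\<^bsub>\<Lambda>\<^esub> (M'::nat))"
  proof (rule mobile_along_rank_2[OF sat u t])
    show "i = 0 \<and> j = 0" if "u [^]\<^bsub>\<Lambda>\<^esub> i \<otimes>\<^bsub>\<Lambda>\<^esub> t [^]\<^bsub>\<Lambda>\<^esub> j = \<one>\<^bsub>\<Lambda>\<^esub>" for i j :: int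
      using indep[of j i] that swap by simp
    show "\<exists>N>0. \<exists>i j. g [^]\<^bsub>\<Lambda>\<^esub> (N::nat) = u [^]\<^bsub>\<Lambda>\<^esub> (i::int) \<otimes>\<^bsub>\<Lambda>\<^esub> t [^]\<^bsub>\<Lambda>\<^esub> (j::int)"
      if "g \<in> carrier \<Lambda>" for g
      using span[OF that] unfolding swap by blast
  qed
  show ?thesis by (rule all_mobile_if_spanned[OF t M u M' span])
qed

end

theorem corollary37:
  fixes n :: nat
    and \<Lambda> :: "('l, 'm) monoid_scheme"
    and P\<^sub>0 :: "(int set, 'p, 'q) module_scheme"
    and \<omega>\<^sub>0 :: "'p \<Rightarrow> 'p \<Rightarrow> int set"
    and L :: "('l \<Rightarrow> 'p) set"
  assumes "stabilizer_code n \<Lambda> P\<^sub>0 \<omega>\<^sub>0 L"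
  shows "(all_mobile n \<Lambda> P\<^sub>0 \<omega>\<^sub>0 L \<longleftrightarrow>
            module_dim (pauli_ring n \<Lambda>) (excitations n \<Lambda> P\<^sub>0 \<omega>\<^sub>0 L) \<le> 0) \<and>
         (free_rank \<Lambda> = 1 \<longrightarrow> all_mobile n \<Lambda> P\<^sub>0 \<omega>\<^sub>0 L) \<and>
         (saturated n \<Lambda> P\<^sub>0 \<omega>\<^sub>0 L \<and> free_rank \<Lambda> = 2 \<longrightarrow> all_mobile n \<Lambda> P\<^sub>0 \<omega>\<^sub>0 L)"
proof -
  interpret stabilizer_code n \<Lambda> P\<^sub>0 \<omega>\<^sub>0 L by (rule assms)
  show ?thesis using all_mobile_iff_dim all_mobile_rank_1 all_mobile_rank_2 by blast
qed

end
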